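(* Let $(\mathbf d_n)_{n\in\mathbb N}$ be a sequence of bi-degree sequences $\mathbf d_n=((d_1^-,d_1^+),\dots,(d_n^-,d_n^+))$ for which there exist constants $\eta,C_0>0$ and $K\ge 2$ such that for all $n$: $\min_{v\in[n]}d_v^+\ge 2$; $\max_{v\in[n]}d_v^+\le K$; $\sum_{v\in[n]}(d_v^-)^{2+\eta}\le C_0n$. Let $\Delta^-=\max_{v\in[n]}d_v^-$, let $\pi$ be the stationary distribution of the simple random walk on the directed configuration model $G_n$ with bi-degree sequence $\mathbf d_n$, and let $\pi_{\max}=\max_{v\in[n]}\pi(v)$. Then: (i) There exists an absolute constant $C>0$ such that, with high probability, $\pi_{\max}\le C\log(n)\,\dfrac{\Delta^-}{m}$. (ii) If $\Delta^-\to\infty$ as $n\to\infty$, then for every $\varepsilon>0$, with high probability, $\pi_{\max}\ge(1-\varepsilon)\dfrac{\Delta^-}{m}$.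
   Context: Directed configuration model: given a bi-degree sequence of nonnegative integers with $m:=\sum_{v\in[n]}d_v^+=\sum_{v\in[n]}d_v^-$, attach $d_v^-$ heads and $d_v^+$ tails to each vertex $v\in[n]$, match the $m$ tails to the $m$ heads by a uniformly random bijection, and add a directed edge $(u,v)$ for each tail of $u$ matched to a head of $v$; the result is the random directed multigraph $G=G_n$. The simple random walk has transition matrix $P(y,x)=m(y,x)/d_y^+$, with $m(y,x)$ the multiplicity of the edge $(y,x)$. "With high probability" means with probability tending to $1$ as $n\to\infty$. With high probability $P$ has a unique stationary distribution, denoted $\pi$ (on the complementary event $\pi$ is any stationary distribution). *)

theory Defs
  imports "HOL-Probability.Probability"
begin

text \<open>The vertex set is \<open>[n] = {1..n}\<close>; a bi-degree sequence of length \<open>n\<close> is given by the in-degrees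
  \<open>din v\<close> and the out-degrees \<open>dout v\<close> of the vertices \<open>v \<in> {1..n}\<close> (values elsewhere are ignored).\<close>

definition bidegree_sequence :: "nat \<Rightarrow> (nat \<Rightarrow> nat) \<Rightarrow> (nat \<Rightarrow> nat) \<Rightarrow> bool" where
  "bidegree_sequence n din dout \<longleftrightarrow> (\<Sum>v\<in>{1..n}. dout v) = (\<Sum>v\<in>{1..n}. din v)"

definition num_edges :: "nat \<Rightarrow> (nat \<Rightarrow> nat) \<Rightarrow> nat" where
  "num_edges n dout = (\<Sum>v\<in>{1..n}. dout v)"

definition max_degree :: "nat \<Rightarrow> (nat \<Rightarrow> nat) \<Rightarrow> nat" where
  "max_degree n deg = Max (deg ` {1..n})"

text \<open>\<open>(v, i)\<close> is the \<open>i\<close>-th half-edge attached to \<open>v\<close>; tails are obtained with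
  \<open>deg = dout\<close>, heads with \<open>deg = din\<close>.\<close>

definition half_edges :: "nat \<Rightarrow> (nat \<Rightarrow> nat) \<Rightarrow> (nat \<times> nat) set" where
  "half_edges n deg = (SIGMA v:{1..n}. {..<deg v})"

text \<open>Extensional functions (\<open>PiE\<close>) are used so that every bijection is represented exactly once.\<close>

definition matchings :: "nat \<Rightarrow> (nat \<Rightarrow> nat) \<Rightarrow> (nat \<Rightarrow> nat) \<Rightarrow> (nat \<times> nat \<Rightarrow> nat \<times> nat) set" where
  "matchings n din dout =
     {\<sigma> \<in> half_edges n dout \<rightarrow>\<^sub>E half_edges n din. bij_betw \<sigma> (half_edges n dout) (half_edges n din)}"

text \<open>A directed multigraph on \<open>{1..n}\<close> is represented by its multiset of edges.\<close>

type_synonym multidigraph = "(nat \<times> nat) multiset"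

definition graph_of_matching ::
    "nat \<Rightarrow> (nat \<Rightarrow> nat) \<Rightarrow> (nat \<times> nat \<Rightarrow> nat \<times> nat) \<Rightarrow> multidigraph" where
  "graph_of_matching n dout \<sigma> = image_mset (\<lambda>e. (fst e, fst (\<sigma> e))) (mset_set (half_edges n dout))"

definition dcm :: "nat \<Rightarrow> (nat \<Rightarrow> nat) \<Rightarrow> (nat \<Rightarrow> nat) \<Rightarrow> multidigraph pmf" where
  "dcm n din dout = map_pmf (graph_of_matching n dout) (pmf_of_set (matchings n din dout))"

definition transition :: "(nat \<Rightarrow> nat) \<Rightarrow> multidigraph \<Rightarrow> nat \<Rightarrow> nat \<Rightarrow> real" where
  "transition dout G y x = real (count G (y, x)) / real (dout y)"

definition stationary :: "nat \<Rightarrow> (nat \<Rightarrow> nat) \<Rightarrow> multidigraph \<Rightarrow> nat pmf \<Rightarrow> bool" where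
  "stationary n dout G p \<longleftrightarrow>
     set_pmf p \<subseteq> {1..n} \<and>
     (\<forall>x\<in>{1..n}. (\<Sum>y\<in>{1..n}. pmf p y * transition dout G y x) = pmf p x)"

definition max_mass :: "nat \<Rightarrow> nat pmf \<Rightarrow> real" where
  "max_mass n p = Max (pmf p ` {1..n})"

text \<open>From here on, \<open>din n v\<close> and \<open>dout n v\<close> are the degrees in the \<open>n\<close>-th bi-degree sequence.\<close>

definition degree_assumption ::
    "real \<Rightarrow> real \<Rightarrow> real \<Rightarrow> (nat \<Rightarrow> nat \<Rightarrow> nat) \<Rightarrow> (nat \<Rightarrow> nat \<Rightarrow> nat) \<Rightarrow> bool" where
  "degree_assumption \<eta> C\<^sub>0 K din dout \<longleftrightarrow>
     (\<forall>n\<ge>1. bidegree_sequence n (din n) (dout n) \<and>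
        (\<forall>v\<in>{1..n}. 2 \<le> dout n v) \<and>
        (\<forall>v\<in>{1..n}. real (dout n v) \<le> K) \<and>
        (\<Sum>v\<in>{1..n}. real (din n v) powr (2 + \<eta>)) \<le> C\<^sub>0 * real n)"

text \<open>\<open>\<pi> n G\<close> is a stationary distribution for every possible outcome \<open>G\<close> of the model: it is the
  stationary distribution when that is unique, and an arbitrary one otherwise.\<close>

definition stationary_choice ::
    "(nat \<Rightarrow> nat \<Rightarrow> nat) \<Rightarrow> (nat \<Rightarrow> nat \<Rightarrow> nat) \<Rightarrow> (nat \<Rightarrow> multidigraph \<Rightarrow> nat pmf) \<Rightarrow> bool" where
  "stationary_choice din dout \<pi> \<longleftrightarrow>
     (\<forall>n\<ge>1. \<forall>G\<in>set_pmf (dcm n (din n) (dout n)). stationary n (dout n) G (\<pi> n G))"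

definition whp ::
    "(nat \<Rightarrow> nat \<Rightarrow> nat) \<Rightarrow> (nat \<Rightarrow> nat \<Rightarrow> nat) \<Rightarrow> (nat \<Rightarrow> multidigraph \<Rightarrow> bool) \<Rightarrow> bool" where
  "whp din dout E \<longleftrightarrow>
     (\<lambda>n. measure_pmf.prob (dcm n (din n) (dout n)) {G. E n G}) \<longlonglongrightarrow> 1"

end

theory Submission
  imports Defs "HOL-Real_Asymp.Real_Asymp"
begin

text \<open>Fix \<open>v\<close> and write \<open>\<delta> = \<Delta>\<^sup>-/m\<close>, \<open>k\<close> for about \<open>ln n\<close>; polylogarithmic means polynomial in \<open>k\<close>. The moment
  condition gives \<open>(\<Delta>\<^sup>-)\<^sup>2 \<le> n\<close> up to a factor \<open>n\<^bsup>-a\<^esup>\<close> with \<open>a > 0\<close>, so two coincidences among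
  polylogarithmically many revealed edges, of probability about \<open>\<delta>\<^sup>2\<close>, can be afforded at all \<open>n\<close> vertices.

  Upper bound: with high probability every vertex has at most one child from which the walk is likely to
  return, or two walks are likely to stay together. Hence the Green function is at most \<open>4\<close>, and a walk
  leaves any polylogarithmic set of edges quickly. Run \<open>k\<close> walks of polylogarithmic length one after the
  other, revealing the edges they use, and count their visits to \<open>v\<close> after a burn-in period. A new walk
  must leave the revealed edges before it is counted; it then enters each revealed vertex with probability
  at most \<open>\<delta>\<close> per step, and the revealed graph is a forest up to a few edges, so the expected number of
  visits is \<open>O(\<delta>)\<close> per step. This bounds the \<open>k\<close>-th moment by \<open>(C k \<delta> T)\<^bsup>k\<^esup>\<close>, and Markov's
  inequality allows a union bound over all starting points.

  Lower bound: exchanging a uniformly random set \<open>R\<close> of \<open>\<Delta>\<^sup>-\<close> heads with the heads of \<open>v\<close> preserves the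
  law of the matching. After the exchange the walk reaches \<open>v\<close> when the old walk used \<open>R\<close>, unless the old
  walk had used an exchanged head before. The probability \<open>\<psi>\<^sub>R(y)\<close> that the old walk from \<open>y\<close> uses \<open>R\<close>
  at a given time is concentrated around \<open>\<delta>\<close> because \<open>\<Delta>\<^sup>-\<close> is large, and it depends on \<open>y\<close> only by a
  polynomially small relative amount in \<open>L\<^sup>2\<close>: swapping tails shows that the probability that two walks
  meet hardly depends on their starting points. The upper bound on \<open>\<pi>\<close> transfers this \<open>L\<^sup>2\<close> estimate
  to the average under \<open>\<pi>\<close>.\<close>

section \<open>Conditioning on revealed edges\<close>

text \<open>Why about \<open>ln n\<close> walks: the union bound runs over all pairs of a target and
  a starting point, and no moment of bounded order gives a failure probability below
  \<open>n^-2\<close>. The logarithm in the upper bound is the factor \<open>k\<close> of the moment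
  bound, and its origin is a factorial: each walk can profit from every collision left by the
  earlier ones and can add collisions of its own.

  Conditioning on typical behaviour would destroy the uniform law of the unrevealed heads. So only
  the partners of finitely many tails are ever conditioned on, and typical behaviour enters as a
  factor \<open>F\<close> of the integrand. Once some completion of the revealed part is typical,
  the bounds that this implies can be read off from the revealed part alone.

  Out-degree at least 2 acts as a contraction by 1/2, both for two walks staying together and for
  the total weight of paths in a forest.

  In the lower bound the stationary law belongs to the exchanged matching and
  \<open>\<psi>_R\<close> to the old one, so they are dependent. The maximum is all that is used of
  the stationary law; the price is a factor of order \<open>ln n\<close>, which the polynomially
  small \<open>L^2\<close> error pays.\<close>

locale dcm_model =
  fixes n :: nat and din dout :: "nat \<Rightarrow> nat"
  assumes n_pos: "1 \<le> n"
    and bidegree: "bidegree_sequence n din dout"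
    and dout_ge2: "\<And>v. v \<in> {1..n} \<Longrightarrow> 2 \<le> dout v"
begin

definition V :: "nat set" where "V = {1..n}"
abbreviation tails :: "(nat \<times> nat) set" where "tails \<equiv> half_edges n dout"
abbreviation heads :: "(nat \<times> nat) set" where "heads \<equiv> half_edges n din"
abbreviation S :: "(nat \<times> nat \<Rightarrow> nat \<times> nat) set" where "S \<equiv> matchings n din dout"
abbreviation m :: nat where "m \<equiv> num_edges n dout"
abbreviation D :: nat where "D \<equiv> max_degree n din"

lemma finite_V [simp, intro]: "finite V" by (simp add: V_def)

lemma V_dout: "v \<in> V \<Longrightarrow> 2 \<le> dout v"
  using dout_ge2 by (simp add: V_def)

lemma finite_tails [simp, intro]: "finite tails"
  and finite_heads [simp, intro]: "finite heads"
  by (auto simp: half_edges_def)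

lemma card_tails: "card tails = m"
  by (simp add: half_edges_def num_edges_def)

lemma card_heads: "card heads = m"
  using bidegree by (simp add: half_edges_def num_edges_def bidegree_sequence_def)

lemma din_le_D: "v \<in> V \<Longrightarrow> din v \<le> D"
  by (simp add: max_degree_def V_def)

lemma m_ge: "2 * n \<le> m"
proof -
  have "(\<Sum>v\<in>V. 2) \<le> (\<Sum>v\<in>V. dout v)" by (rule sum_mono) (rule V_dout)
  thus ?thesis by (simp add: num_edges_def V_def)
qed

lemma m_pos: "0 < m" using m_ge n_pos by simp

lemma D_pos: "0 < D"
proof (rule ccontr)
  assume "\<not> 0 < D"
  hence "din v = 0" if "v \<in> V" for v using din_le_D[OF that] by simp
  hence "heads = {}" by (auto simp: half_edges_def V_def)
  thus False using card_heads m_pos by simp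
qed

lemma tail_fst: "e \<in> tails \<Longrightarrow> fst e \<in> V"
  and head_fst: "f \<in> heads \<Longrightarrow> fst f \<in> V"
  by (auto simp: half_edges_def V_def)

lemma in_tails: "(x, i) \<in> tails \<longleftrightarrow> x \<in> V \<and> i < dout x"
  by (auto simp: half_edges_def V_def)

lemma finite_S [simp, intro]: "finite S"
proof -
  have "S \<subseteq> tails \<rightarrow>\<^sub>E heads" by (auto simp: matchings_def)
  thus ?thesis by (rule finite_subset) (auto intro: finite_PiE)
qed

lemma S_nonempty: "S \<noteq> {}"
proof -
  obtain g where g: "bij_betw g tails heads"
    using finite_same_card_bij[of tails heads] card_tails card_heads by auto
  have "restrict g tails \<in> S"
    using g by (auto simp: matchings_def bij_betw_restrict_eq dest: bij_betwE)
  thus ?thesis by blast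
qed

lemma S_bij: "\<sigma> \<in> S \<Longrightarrow> bij_betw \<sigma> tails heads"
  by (simp add: matchings_def)

lemma S_heads: "\<sigma> \<in> S \<Longrightarrow> e \<in> tails \<Longrightarrow> \<sigma> e \<in> heads"
  by (rule bij_betw_apply[OF S_bij])

lemma S_undef: "\<sigma> \<in> S \<Longrightarrow> e \<notin> tails \<Longrightarrow> \<sigma> e = undefined"
  unfolding matchings_def by (blast intro: PiE_arb)

lemma S_inj: "\<sigma> \<in> S \<Longrightarrow> inj_on \<sigma> tails"
  using S_bij bij_betw_imp_inj_on by blast

lemma S_fst: "\<sigma> \<in> S \<Longrightarrow> x \<in> V \<Longrightarrow> i < dout x \<Longrightarrow> fst (\<sigma> (x, i)) \<in> V"
  using S_heads head_fst in_tails by blast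

lemma S_eqI: "\<sigma> \<in> S \<Longrightarrow> \<tau> \<in> S \<Longrightarrow> (\<And>e. e \<in> tails \<Longrightarrow> \<sigma> e = \<tau> e) \<Longrightarrow> \<sigma> = \<tau>"
  by (rule HOL.ext) (metis S_undef)

lemma S_post:
  assumes "\<sigma> \<in> S" "bij_betw \<alpha> heads heads"
  shows "restrict (\<alpha> \<circ> \<sigma>) tails \<in> S"
proof -
  have "bij_betw (\<alpha> \<circ> \<sigma>) tails heads" using S_bij[OF assms(1)] assms(2) by (rule bij_betw_trans)
  thus ?thesis by (auto simp: matchings_def bij_betw_restrict_eq dest: bij_betwE)
qed

lemma S_pre:
  assumes "\<sigma> \<in> S" "bij_betw \<alpha> tails tails"
  shows "restrict (\<sigma> \<circ> \<alpha>) tails \<in> S"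
proof -
  have "bij_betw (\<sigma> \<circ> \<alpha>) tails heads" using assms(2) S_bij[OF assms(1)] by (rule bij_betw_trans)
  thus ?thesis by (auto simp: matchings_def bij_betw_restrict_eq dest: bij_betwE)
qed

text \<open>\<open>cexp \<sigma> E\<close> is the expectation over the uniform matching, conditional on the partners that
  \<open>\<sigma>\<close> gives to the tails in \<open>E\<close>.\<close>

definition ext :: "(nat \<times> nat \<Rightarrow> nat \<times> nat) \<Rightarrow> (nat \<times> nat) set \<Rightarrow> (nat \<times> nat \<Rightarrow> nat \<times> nat) set" where
  "ext \<sigma> E = {\<tau> \<in> S. \<forall>e\<in>E. \<tau> e = \<sigma> e}"

definition cexp :: "(nat \<times> nat \<Rightarrow> nat \<times> nat) \<Rightarrow> (nat \<times> nat) set \<Rightarrow>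
    ((nat \<times> nat \<Rightarrow> nat \<times> nat) \<Rightarrow> real) \<Rightarrow> real" where
  "cexp \<sigma> E F = (\<Sum>\<tau>\<in>ext \<sigma> E. F \<tau>) / real (card (ext \<sigma> E))"

lemma ext_subset: "ext \<sigma> E \<subseteq> S" by (auto simp: ext_def)
lemma finite_ext [simp, intro]: "finite (ext \<sigma> E)" using ext_subset finite_S by (rule finite_subset)
lemma ext_self: "\<sigma> \<in> S \<Longrightarrow> \<sigma> \<in> ext \<sigma> E" by (auto simp: ext_def)
lemma ext_in_S: "\<tau> \<in> ext \<sigma> E \<Longrightarrow> \<tau> \<in> S" by (auto simp: ext_def)
lemma ext_agree: "\<tau> \<in> ext \<sigma> E \<Longrightarrow> e \<in> E \<Longrightarrow> \<tau> e = \<sigma> e" by (auto simp: ext_def)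
lemma ext_image: "\<tau> \<in> ext \<sigma> E \<Longrightarrow> \<tau> ` E = \<sigma> ` E" by (auto simp: ext_def image_def)
lemma ext_eq: "\<tau> \<in> ext \<sigma> E \<Longrightarrow> ext \<tau> E = ext \<sigma> E" by (auto simp: ext_def)
lemma ext_empty: "ext \<sigma> {} = S" by (auto simp: ext_def)
lemma ext_trans: "\<tau> \<in> ext \<sigma> E \<Longrightarrow> \<upsilon> \<in> ext \<tau> (insert e E) \<Longrightarrow> \<upsilon> \<in> ext \<sigma> E" by (auto simp: ext_def)

lemma card_ext_pos: "\<sigma> \<in> S \<Longrightarrow> 0 < card (ext \<sigma> E)"
  using ext_self by (auto simp: card_gt_0_iff)

lemma cexp_mono:
  "\<lbrakk>\<And>\<tau>. \<tau> \<in> ext \<sigma> E \<Longrightarrow> F \<tau> \<le> G \<tau>\<rbrakk> \<Longrightarrow> cexp \<sigma> E F \<le> cexp \<sigma> E G"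
  unfolding cexp_def by (intro divide_right_mono sum_mono) auto

lemma cexp_cong:
  "\<lbrakk>\<And>\<tau>. \<tau> \<in> ext \<sigma> E \<Longrightarrow> F \<tau> = G \<tau>\<rbrakk> \<Longrightarrow> cexp \<sigma> E F = cexp \<sigma> E G"
  unfolding cexp_def by (simp cong: sum.cong)

lemma cexp_const: "\<sigma> \<in> S \<Longrightarrow> cexp \<sigma> E (\<lambda>_. c) = c"
  using ext_self[of \<sigma> E] by (auto simp: cexp_def)

lemma cexp_add: "cexp \<sigma> E (\<lambda>\<tau>. F \<tau> + G \<tau>) = cexp \<sigma> E F + cexp \<sigma> E G"
  by (simp add: cexp_def sum.distrib add_divide_distrib)

lemma cexp_mult: "cexp \<sigma> E (\<lambda>\<tau>. c * F \<tau>) = c * cexp \<sigma> E F"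
  by (simp add: cexp_def sum_distrib_left)

lemma cexp_divide: "cexp \<sigma> E (\<lambda>\<tau>. F \<tau> / c) = cexp \<sigma> E F / c"
  by (simp add: cexp_def sum_divide_distrib mult.commute)

lemma cexp_sum: "cexp \<sigma> E (\<lambda>\<tau>. \<Sum>a\<in>A. F a \<tau>) = (\<Sum>a\<in>A. cexp \<sigma> E (F a))"
  unfolding cexp_def by (subst sum.swap) (simp add: sum_divide_distrib)

lemma cexp_le: "\<lbrakk>\<sigma> \<in> S; \<And>\<tau>. \<tau> \<in> ext \<sigma> E \<Longrightarrow> F \<tau> \<le> c\<rbrakk> \<Longrightarrow> cexp \<sigma> E F \<le> c"
  using cexp_mono[of \<sigma> E F "\<lambda>_. c"] cexp_const by simp

text \<open>The blocks \<open>ext \<tau> E'\<close> partition \<open>ext \<sigma> E\<close>. Lying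
  in a common block is symmetric, so after exchanging the sums each value is divided by the size of
  its own block and counted that many times.\<close>

lemma cexp_tower:
  assumes \<sigma>: "\<sigma> \<in> S" and E: "E \<subseteq> E'"
  shows "cexp \<sigma> E F = cexp \<sigma> E (\<lambda>\<tau>. cexp \<tau> E' F)"
proof -
  let ?C = "ext \<sigma> E"
  have sub: "ext \<tau> E' \<subseteq> ?C" if "\<tau> \<in> ?C" for \<tau> using that E by (auto simp: ext_def)
  have sym: "\<upsilon> \<in> ext \<tau> E' \<longleftrightarrow> \<tau> \<in> ext \<upsilon> E'" if "\<tau> \<in> ?C" "\<upsilon> \<in> ?C" for \<tau> \<upsilon>
    using that by (auto simp: ext_def)
  have "(\<Sum>\<tau>\<in>?C. cexp \<tau> E' F)
      = (\<Sum>\<tau>\<in>?C. \<Sum>\<upsilon>\<in>?C. if \<upsilon> \<in> ext \<tau> E' then F \<upsilon> / card (ext \<tau> E') else 0)"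
  proof (rule sum.cong[OF refl])
    fix \<tau> assume "\<tau> \<in> ?C"
    thus "cexp \<tau> E' F = (\<Sum>\<upsilon>\<in>?C. if \<upsilon> \<in> ext \<tau> E' then F \<upsilon> / card (ext \<tau> E') else 0)"
      using sub[of \<tau>] by (simp add: cexp_def sum_divide_distrib sum.inter_restrict[symmetric] Int_absorb1)
  qed
  also have "\<dots> = (\<Sum>\<upsilon>\<in>?C. \<Sum>\<tau>\<in>?C. if \<upsilon> \<in> ext \<tau> E' then F \<upsilon> / card (ext \<tau> E') else 0)"
    by (rule sum.swap)
  also have "\<dots> = (\<Sum>\<upsilon>\<in>?C. \<Sum>\<tau>\<in>?C. if \<tau> \<in> ext \<upsilon> E' then F \<upsilon> / card (ext \<upsilon> E') else 0)"
    by (intro sum.cong refl) (use sym ext_eq in auto)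
  also have "\<dots> = (\<Sum>\<upsilon>\<in>?C. F \<upsilon>)"
  proof (rule sum.cong[OF refl])
    fix \<upsilon> assume \<upsilon>: "\<upsilon> \<in> ?C"
    have "(\<Sum>\<tau>\<in>?C. if \<tau> \<in> ext \<upsilon> E' then F \<upsilon> / card (ext \<upsilon> E') else 0)
        = (\<Sum>\<tau>\<in>ext \<upsilon> E'. F \<upsilon> / card (ext \<upsilon> E'))"
      using sub[OF \<upsilon>] by (simp only: sum.inter_restrict[symmetric] finite_ext Int_absorb1)
    also have "\<dots> = F \<upsilon>" using ext_self[OF ext_in_S[OF \<upsilon>], of E'] by auto
    finally show "(\<Sum>\<tau>\<in>?C. if \<tau> \<in> ext \<upsilon> E' then F \<upsilon> / card (ext \<upsilon> E') else 0) = F \<upsilon>" .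
  qed
  finally show ?thesis by (simp add: cexp_def)
qed

text \<open>Exchanging the two free heads \<open>f\<close> and \<open>g\<close> in the values of a
  matching keeps all revealed partners and is injective. By symmetry all free heads are equally
  likely partners of \<open>e\<close>.\<close>

lemma landing_count:
  assumes \<sigma>: "\<sigma> \<in> S" and E: "E \<subseteq> tails" and e: "e \<in> tails - E"
    and f: "f \<in> heads - \<sigma> ` E" and g: "g \<in> heads - \<sigma> ` E"
  shows "card {\<tau> \<in> ext \<sigma> E. \<tau> e = f} \<le> card {\<tau> \<in> ext \<sigma> E. \<tau> e = g}"
proof (rule card_inj_on_le)
  let ?s = "Transposition.transpose f g"
  let ?h = "\<lambda>\<tau>. restrict (?s \<circ> \<tau>) tails"
  have bij: "bij_betw ?s heads heads" using f g
    by (metis DiffE bij_betw_def inj_on_transpose transpose_image_eq)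
  show "inj_on ?h {\<tau> \<in> ext \<sigma> E. \<tau> e = f}"
  proof (rule inj_onI, rule S_eqI)
    fix \<tau> \<upsilon> d assume a: "\<tau> \<in> {\<tau> \<in> ext \<sigma> E. \<tau> e = f}" "\<upsilon> \<in> {\<tau> \<in> ext \<sigma> E. \<tau> e = f}"
      "?h \<tau> = ?h \<upsilon>" "d \<in> tails"
    from fun_cong[OF a(3), of d] a(4) have "?s (\<tau> d) = ?s (\<upsilon> d)" by simp
    thus "\<tau> d = \<upsilon> d" by (metis transpose_involutory)
  qed (auto simp: ext_def)
  show "?h ` {\<tau> \<in> ext \<sigma> E. \<tau> e = f} \<subseteq> {\<tau> \<in> ext \<sigma> E. \<tau> e = g}"
  proof (rule image_subsetI)
    fix \<tau> assume "\<tau> \<in> {\<tau> \<in> ext \<sigma> E. \<tau> e = f}"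
    hence \<tau>: "\<tau> \<in> ext \<sigma> E" "f = \<tau> e" by auto
    have "?s (\<sigma> d) = \<sigma> d" if "d \<in> E" for d
      using f g that by (intro transpose_apply_other) auto
    hence "\<forall>d\<in>E. ?h \<tau> d = \<sigma> d" using \<tau> E by (auto simp: ext_def subset_iff)
    moreover have "?h \<tau> \<in> S" using S_post[OF _ bij] \<tau> by (auto simp: ext_def)
    ultimately show "?h \<tau> \<in> {\<tau> \<in> ext \<sigma> E. \<tau> e = g}" using e \<tau> by (auto simp: ext_def)
  qed
  show "finite {\<tau> \<in> ext \<sigma> E. \<tau> e = g}" by simp
qed

text \<open>For a free head, the completions split into equally large classes, one for each possible
  partner of \<open>e\<close>; a head that is already matched has probability zero. The bound thus
  holds for every \<open>f\<close>, and later sums may run over all heads.\<close>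

lemma landing:
  assumes \<sigma>: "\<sigma> \<in> S" and E: "E \<subseteq> tails" and e: "e \<in> tails - E"
  shows "cexp \<sigma> E (\<lambda>\<tau>. if \<tau> e = f then 1 else 0) \<le> 1 / (real m - real (card E))"
proof -
  let ?A = "heads - \<sigma> ` E" and ?c = "\<lambda>f. card {\<tau> \<in> ext \<sigma> E. \<tau> e = f}"
  have finE: "finite E" using E finite_tails finite_subset by blast
  have img: "\<sigma> ` E \<subseteq> heads" using \<sigma> E S_heads by blast
  have cE: "card (\<sigma> ` E) = card E" using S_inj[OF \<sigma>] E by (meson card_image inj_on_subset)
  have lt: "card E < m" using e E card_tails psubset_card_mono[of tails E] by auto
  have cA: "real (card ?A) = real m - real (card E)"
    using card_Diff_subset[of "\<sigma> ` E" heads] finE img cE card_heads lt by simp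
  have eq: "cexp \<sigma> E (\<lambda>\<tau>. if \<tau> e = f then 1 else 0) = ?c f / card (ext \<sigma> E)"
    by (simp add: cexp_def sum.inter_filter[symmetric])
  have land: "\<tau> e \<in> ?A" if "\<tau> \<in> ext \<sigma> E" for \<tau>
  proof -
    have \<tau>: "\<tau> \<in> S" using that by (rule ext_in_S)
    have "\<tau> e \<notin> \<tau> ` E" using e E inj_on_image_mem_iff[OF S_inj[OF \<tau>], of e E] by blast
    moreover have "\<tau> e \<in> heads" using S_heads[OF \<tau>] e by blast
    ultimately show ?thesis unfolding ext_image[OF that] by blast
  qed
  show ?thesis
  proof (cases "f \<in> ?A")
    case False
    hence "{\<tau> \<in> ext \<sigma> E. \<tau> e = f} = {}" using land by auto
    thus ?thesis unfolding eq using lt by (simp only: card.empty) simp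
  next
    case True
    have "card (ext \<sigma> E) = (\<Sum>g\<in>?A. ?c g)"
    proof -
      have "ext \<sigma> E = (\<Union>g\<in>?A. {\<tau> \<in> ext \<sigma> E. \<tau> e = g})" using land by auto
      moreover have "card (\<Union>g\<in>?A. {\<tau> \<in> ext \<sigma> E. \<tau> e = g}) = (\<Sum>g\<in>?A. ?c g)"
        by (rule card_UN_disjoint) auto
      ultimately show ?thesis by simp
    qed
    also have "\<dots> \<ge> (\<Sum>g\<in>?A. ?c f)" using landing_count[OF \<sigma> E e True] by (intro sum_mono) auto
    finally have "card ?A * ?c f \<le> card (ext \<sigma> E)" by simp
    hence "real (card ?A) * real (?c f) \<le> real (card (ext \<sigma> E))"
      unfolding of_nat_mult[symmetric] of_nat_le_iff .
    moreover have "0 < real (card ?A)" unfolding cA using lt by simp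
    moreover have "0 < real (card (ext \<sigma> E))" using card_ext_pos[OF \<sigma>, of E] by linarith
    moreover have "c / b \<le> 1 / a" if "a * c \<le> b" "0 < a" "0 < b" for a b c :: real
      using that by (simp add: field_simps)
    ultimately have "?c f / card (ext \<sigma> E) \<le> 1 / real (card ?A)" by blast
    thus ?thesis unfolding eq cA .
  qed
qed

lemma landing_sum:
  assumes \<sigma>: "\<sigma> \<in> S" and E: "E \<subseteq> tails" and e: "e \<in> tails - E"
    and g: "\<And>f. f \<in> heads \<Longrightarrow> 0 \<le> g f"
  shows "cexp \<sigma> E (\<lambda>\<tau>. g (\<tau> e)) \<le> (\<Sum>f\<in>heads. g f) / (real m - real (card E))"
proof -
  have "cexp \<sigma> E (\<lambda>\<tau>. g (\<tau> e)) = cexp \<sigma> E (\<lambda>\<tau>. \<Sum>f\<in>heads. g f * (if \<tau> e = f then 1 else 0))"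
  proof (rule cexp_cong)
    fix \<tau> assume "\<tau> \<in> ext \<sigma> E"
    hence "\<tau> e \<in> heads" using e S_heads ext_in_S by blast
    thus "g (\<tau> e) = (\<Sum>f\<in>heads. g f * (if \<tau> e = f then 1 else 0))"
      by (simp add: mult_ac if_distrib[of "(*) _"] sum.delta' cong: if_cong)
  qed
  also have "\<dots> = (\<Sum>f\<in>heads. g f * cexp \<sigma> E (\<lambda>\<tau>. if \<tau> e = f then 1 else 0))"
    by (simp add: cexp_sum cexp_mult)
  also have "\<dots> \<le> (\<Sum>f\<in>heads. g f * (1 / (real m - real (card E))))"
    using landing[OF \<sigma> E e] g by (intro sum_mono mult_left_mono) auto
  finally show ?thesis by (simp add: sum_divide_distrib)
qed

text \<open>The two tails are revealed one after the other; the single number \<open>s\<close>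
  dominates the revealed tails both times, so that both denominators become \<open>m - s\<close> and
  the double sum keeps its product form.\<close>

lemma landing_pair_sum:
  assumes \<sigma>: "\<sigma> \<in> S" and E: "E \<subseteq> tails" and e: "e \<in> tails - E" and e': "e' \<in> tails - E" "e \<noteq> e'"
    and c: "card E + 1 \<le> s" "s < m"
    and g: "\<And>f f'. f \<in> heads \<Longrightarrow> f' \<in> heads \<Longrightarrow> 0 \<le> g f f'"
  shows "cexp \<sigma> E (\<lambda>\<tau>. g (\<tau> e) (\<tau> e')) \<le> (\<Sum>f\<in>heads. \<Sum>f'\<in>heads. g f f') / (real m - real s)^2"
proof -
  let ?d = "real m - real s"
  have d: "0 < ?d" using c by simp
  have finE: "finite E" using E finite_tails finite_subset by blast
  have "cexp \<sigma> E (\<lambda>\<tau>. g (\<tau> e) (\<tau> e')) = cexp \<sigma> E (\<lambda>\<tau>. cexp \<tau> (insert e E) (\<lambda>\<upsilon>. g (\<upsilon> e) (\<upsilon> e')))"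
    by (rule cexp_tower[OF \<sigma>]) auto
  also have "\<dots> \<le> cexp \<sigma> E (\<lambda>\<tau>. (\<Sum>f'\<in>heads. g (\<tau> e) f') / ?d)"
  proof (rule cexp_mono)
    fix \<tau> assume \<tau>: "\<tau> \<in> ext \<sigma> E"
    hence \<tau>S: "\<tau> \<in> S" by (rule ext_in_S)
    have h: "\<tau> e \<in> heads" using \<tau>S e S_heads by blast
    have "cexp \<tau> (insert e E) (\<lambda>\<upsilon>. g (\<upsilon> e) (\<upsilon> e')) = cexp \<tau> (insert e E) (\<lambda>\<upsilon>. g (\<tau> e) (\<upsilon> e'))"
      by (rule cexp_cong) (auto simp: ext_def)
    also have "\<dots> \<le> (\<Sum>f'\<in>heads. g (\<tau> e) f') / (real m - real (card (insert e E)))"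
      by (rule landing_sum[OF \<tau>S]) (use E e e' g h in auto)
    also have "\<dots> \<le> (\<Sum>f'\<in>heads. g (\<tau> e) f') / ?d"
      using c e finE g h d by (intro divide_left_mono sum_nonneg) (auto simp: mult_pos_pos)
    finally show "cexp \<tau> (insert e E) (\<lambda>\<upsilon>. g (\<upsilon> e) (\<upsilon> e')) \<le> (\<Sum>f'\<in>heads. g (\<tau> e) f') / ?d" .
  qed
  also have "\<dots> \<le> (\<Sum>f\<in>heads. (\<Sum>f'\<in>heads. g f f') / ?d) / (real m - real (card E))"
    by (rule landing_sum[OF \<sigma> E e, where g="\<lambda>f. (\<Sum>f'\<in>heads. g f f') / ?d"])
      (use g d in \<open>auto intro!: divide_nonneg_pos sum_nonneg\<close>)
  also have "\<dots> \<le> (\<Sum>f\<in>heads. (\<Sum>f'\<in>heads. g f f') / ?d) / ?d"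
    using c g d by (intro divide_left_mono sum_nonneg divide_nonneg_pos) (auto simp: mult_pos_pos)
  finally show ?thesis by (simp add: sum_divide_distrib power2_eq_square)
qed

lemma sum_heads: "(\<Sum>f\<in>heads. g (fst f)) = (\<Sum>v\<in>V. real (din v) * g v)"
proof -
  have "(\<Sum>f\<in>heads. g (fst f)) = (\<Sum>v\<in>V. \<Sum>i<din v. g v)"
    unfolding half_edges_def V_def[symmetric] by (subst sum.Sigma) (auto intro: sum.cong)
  thus ?thesis by simp
qed

lemma sum_tails: "(\<Sum>e\<in>tails. g e) = (\<Sum>v\<in>V. \<Sum>i<dout v. g (v, i))"
  unfolding half_edges_def V_def[symmetric] by (subst sum.Sigma) auto

lemma heads_in_set:
  assumes "finite A" shows "(\<Sum>f\<in>heads. if fst f \<in> A then 1 else 0) \<le> real (card A) * real D"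
proof -
  have "(\<Sum>f\<in>heads. if fst f \<in> A then 1 else 0) = (\<Sum>v\<in>V. real (din v) * (if v \<in> A then 1 else 0))"
    by (rule sum_heads)
  also have "\<dots> = (\<Sum>v\<in>V \<inter> A. real (din v))"
    by (simp add: sum.inter_restrict if_distrib cong: if_cong)
  also have "\<dots> \<le> (\<Sum>v\<in>V \<inter> A. real D)" by (rule sum_mono) (use din_le_D in auto)
  also have "\<dots> \<le> real (card A) * real D"
    using assms by (simp add: mult_right_mono card_mono)
  finally show ?thesis .
qed

section \<open>Walks killed outside a set of tails, and the landing of one new tail\<close>

definition step :: "(nat \<times> nat \<Rightarrow> nat \<times> nat) \<Rightarrow> (nat \<times> nat) set \<Rightarrow> (nat \<Rightarrow> real) \<Rightarrow> nat \<Rightarrow> real" where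
  "step \<sigma> E \<phi> x = (\<Sum>i<dout x. if (x, i) \<in> E then \<phi> (fst (\<sigma> (x, i))) else 0) / real (dout x)"

text \<open>\<open>rate s\<close> bounds the probability that a newly revealed tail lands in a set of at most \<open>s + 5\<close>
  vertices when at most \<open>s\<close> tails have been revealed.\<close>

definition rate :: "nat \<Rightarrow> real" where
  "rate s = (real s + 5) * real D / (real m - real s)"

text \<open>The expectation of \<open>F\<close> stays at most \<open>\<beta>\<close> whatever is revealed away from \<open>Z\<close>: a quantity governed by
  walks from \<open>Z\<close> can thus be estimated after other walks have been run.\<close>

definition bounded_off ::
    "((nat \<times> nat \<Rightarrow> nat \<times> nat) \<Rightarrow> real) \<Rightarrow> nat set \<Rightarrow> nat \<Rightarrow> real \<Rightarrow> bool" where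
  "bounded_off F Z r \<beta> \<longleftrightarrow>
     (\<forall>\<sigma>\<in>S. \<forall>E\<subseteq>tails. card E \<le> r \<longrightarrow> fst ` E \<inter> Z = {} \<longrightarrow> cexp \<sigma> E F \<le> \<beta>)"

lemma bounded_offD:
  "\<lbrakk>bounded_off F Z r \<beta>; \<sigma> \<in> S; E \<subseteq> tails; card E \<le> r; fst ` E \<inter> Z = {}\<rbrakk> \<Longrightarrow> cexp \<sigma> E F \<le> \<beta>"
  by (auto simp: bounded_off_def)

lemma bounded_off_one: "bounded_off (\<lambda>_. 1) Z r 1"
  by (auto simp: bounded_off_def cexp_const)

lemma dout_pos: "x \<in> V \<Longrightarrow> 0 < real (dout x)"
  using V_dout[of x] by simp

lemma inverse_dout: "x \<in> V \<Longrightarrow> 1 / real (dout x) \<le> 1 / 2"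
  using V_dout[of x] by (intro divide_left_mono) auto

lemma rate_nonneg: "s < m \<Longrightarrow> 0 \<le> rate s"
  by (simp add: rate_def)

lemma step_mono:
  assumes "\<sigma> \<in> S" "x \<in> V" "\<And>z. z \<in> V \<Longrightarrow> \<phi> z \<le> \<psi> z"
  shows "step \<sigma> E \<phi> x \<le> step \<sigma> E \<psi> x"
  unfolding step_def using assms by (intro divide_right_mono sum_mono) (auto simp: S_fst)

lemma step_nonneg:
  assumes "\<sigma> \<in> S" "x \<in> V" "\<And>z. z \<in> V \<Longrightarrow> 0 \<le> \<phi> z"
  shows "0 \<le> step \<sigma> E \<phi> x"
  unfolding step_def using assms by (intro divide_nonneg_nonneg sum_nonneg) (auto simp: S_fst)

lemma step_mono_set:
  assumes "\<sigma> \<in> S" "x \<in> V" "\<And>z. z \<in> V \<Longrightarrow> 0 \<le> \<phi> z" "E \<subseteq> E'"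
  shows "step \<sigma> E \<phi> x \<le> step \<sigma> E' \<phi> x"
  unfolding step_def using assms by (intro divide_right_mono sum_mono) (auto simp: S_fst)

lemma step_cong:
  assumes "\<sigma> \<in> S" "x \<in> V" "\<And>z. z \<in> V \<Longrightarrow> \<phi> z = \<psi> z"
  shows "step \<sigma> E \<phi> x = step \<sigma> E \<psi> x"
  using assms by (intro antisym step_mono) auto

lemma step_const: "x \<in> V \<Longrightarrow> step \<sigma> UNIV (\<lambda>_. c) x = c"
  using dout_pos[of x] by (simp add: step_def)

lemma step_le_const:
  assumes "\<sigma> \<in> S" "x \<in> V" "\<And>z. z \<in> V \<Longrightarrow> \<phi> z \<le> c" "0 \<le> c"
  shows "step \<sigma> E \<phi> x \<le> c"
proof -
  have "step \<sigma> E \<phi> x \<le> step \<sigma> E (\<lambda>_. c) x" using assms by (intro step_mono) auto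
  also have "\<dots> \<le> step \<sigma> UNIV (\<lambda>_. c) x" using assms by (intro step_mono_set) auto
  finally show ?thesis using step_const[OF assms(2)] by simp
qed

lemma step_add: "step \<sigma> E (\<lambda>z. \<phi> z + \<psi> z) x = step \<sigma> E \<phi> x + step \<sigma> E \<psi> x"
proof -
  have "(if P then a + b else 0) = (if P then a else 0) + (if P then b else (0::real))" for P a b by simp
  thus ?thesis by (simp only: step_def sum.distrib add_divide_distrib)
qed

lemma step_cmult: "step \<sigma> E (\<lambda>z. c * \<phi> z) x = c * step \<sigma> E \<phi> x"
  by (simp add: step_def sum_distrib_left if_distrib cong: if_cong)

lemma step_diff: "step \<sigma> E (\<lambda>z. \<phi> z - \<psi> z) x = step \<sigma> E \<phi> x - step \<sigma> E \<psi> x"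
  using step_add[of \<sigma> E \<phi> "\<lambda>z. (-1) * \<psi> z" x] step_cmult[of \<sigma> E "-1" \<psi> x] by simp

lemma step_sum: "step \<sigma> E (\<lambda>z. \<Sum>a\<in>A. \<phi> a z) x = (\<Sum>a\<in>A. step \<sigma> E (\<phi> a) x)"
proof (cases "finite A")
  case True thus ?thesis
    by (induction A rule: finite_induct) (auto simp: step_add, simp add: step_def)
qed (simp add: step_def cong: if_cong)

lemma cexp_step:
  assumes "x \<in> V" "\<And>i. i < dout x \<Longrightarrow> cexp \<sigma> E (\<lambda>\<tau>. F \<tau> * \<phi> \<tau> (fst (\<tau> (x, i)))) \<le> b"
  shows "cexp \<sigma> E (\<lambda>\<tau>. F \<tau> * step \<tau> UNIV (\<phi> \<tau>) x) \<le> b"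
proof -
  have "cexp \<sigma> E (\<lambda>\<tau>. F \<tau> * step \<tau> UNIV (\<phi> \<tau>) x)
      = (\<Sum>i<dout x. cexp \<sigma> E (\<lambda>\<tau>. F \<tau> * \<phi> \<tau> (fst (\<tau> (x, i))))) / real (dout x)"
    by (simp add: step_def sum_distrib_left cexp_divide cexp_sum)
  also have "\<dots> \<le> (\<Sum>i<dout x. b) / real (dout x)"
    using assms(2) by (intro divide_right_mono sum_mono) auto
  also have "\<dots> = b" using dout_pos[OF assms(1)] by simp
  finally show ?thesis .
qed

text \<open>The basic move of all later inductions: reveal one more tail and pay \<open>b1\<close>
  only if it lands in \<open>A\<close>, whose at most \<open>s + 5\<close> vertices carry at most
  \<open>(s + 5) D\<close> heads.\<close>

lemma reveal:
  assumes \<sigma>: "\<sigma> \<in> S" and E: "E \<subseteq> tails" and e: "e \<in> tails - E" and s: "card E \<le> s" "s < m"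
    and A: "finite A" "card A \<le> s + 5" and b: "0 \<le> b1"
    and H: "\<And>\<tau>. \<tau> \<in> ext \<sigma> E \<Longrightarrow> cexp \<tau> (insert e E) F \<le> b0 + (if fst (\<tau> e) \<in> A then b1 else 0)"
  shows "cexp \<sigma> E F \<le> b0 + b1 * rate s"
proof -
  let ?g = "\<lambda>f. if fst f \<in> A then 1 else (0::real)"
  have "cexp \<sigma> E F = cexp \<sigma> E (\<lambda>\<tau>. cexp \<tau> (insert e E) F)" by (rule cexp_tower[OF \<sigma>]) auto
  also have "\<dots> \<le> cexp \<sigma> E (\<lambda>\<tau>. b0 + b1 * ?g (\<tau> e))"
    by (rule cexp_mono, rule order_trans[OF H]) auto
  also have "\<dots> = b0 + b1 * cexp \<sigma> E (\<lambda>\<tau>. ?g (\<tau> e))"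
    by (simp add: cexp_add cexp_mult cexp_const[OF \<sigma>])
  also have "\<dots> \<le> b0 + b1 * rate s"
  proof -
    have "cexp \<sigma> E (\<lambda>\<tau>. ?g (\<tau> e)) \<le> (\<Sum>f\<in>heads. ?g f) / (real m - real (card E))"
      by (rule landing_sum[OF \<sigma> E e]) auto
    also have "\<dots> \<le> ((real s + 5) * real D) / (real m - real s)"
      using heads_in_set[OF A(1)] A(2) s
      by (intro frac_le order_trans[OF heads_in_set[OF A(1)]] mult_right_mono) auto
    finally show ?thesis using b unfolding rate_def[symmetric] by (simp add: mult_left_mono)
  qed
  finally show ?thesis .
qed

lemma reveal_landing:
  assumes \<sigma>: "\<sigma> \<in> S" and E: "E \<subseteq> tails" and e: "e \<in> tails - E" and s: "card E \<le> s" "s < m"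
    and A: "finite A" "card A \<le> s + 5" and b: "0 \<le> b1"
    and good: "\<And>\<tau>. \<tau> \<in> ext \<sigma> E \<Longrightarrow> fst (\<tau> e) \<in> V \<Longrightarrow> fst (\<tau> e) \<notin> A \<Longrightarrow>
       cexp \<tau> (insert e E) (\<lambda>\<upsilon>. \<psi> \<upsilon> (fst (\<tau> e))) \<le> b0"
    and bad: "\<And>\<tau>. \<tau> \<in> ext \<sigma> E \<Longrightarrow> fst (\<tau> e) \<in> V \<Longrightarrow>
       cexp \<tau> (insert e E) (\<lambda>\<upsilon>. \<psi> \<upsilon> (fst (\<tau> e))) \<le> b0 + b1"
  shows "cexp \<sigma> E (\<lambda>\<upsilon>. \<psi> \<upsilon> (fst (\<upsilon> e))) \<le> b0 + b1 * rate s"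
proof (rule reveal[OF \<sigma> E e s A b])
  fix \<tau> assume \<tau>: "\<tau> \<in> ext \<sigma> E"
  have V: "fst (\<tau> e) \<in> V" using \<tau> e S_heads head_fst ext_in_S by blast
  have "cexp \<tau> (insert e E) (\<lambda>\<upsilon>. \<psi> \<upsilon> (fst (\<upsilon> e))) = cexp \<tau> (insert e E) (\<lambda>\<upsilon>. \<psi> \<upsilon> (fst (\<tau> e)))"
    by (rule cexp_cong) (auto simp: ext_def)
  thus "cexp \<tau> (insert e E) (\<lambda>\<upsilon>. \<psi> \<upsilon> (fst (\<upsilon> e))) \<le> b0 + (if fst (\<tau> e) \<in> A then b1 else 0)"
    using good[OF \<tau> V] bad[OF \<tau> V] by auto
qed

section \<open>Hitting and meeting probabilities from fresh vertices\<close>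

fun hit :: "(nat \<times> nat \<Rightarrow> nat \<times> nat) \<Rightarrow> nat set \<Rightarrow> nat \<Rightarrow> nat \<Rightarrow> real" where
  "hit \<sigma> W 0 x = (if x \<in> W then 1 else 0)"
| "hit \<sigma> W (Suc t) x = (if x \<in> W then 1 else step \<sigma> UNIV (hit \<sigma> W t) x)"

lemma hit_nonneg: "\<sigma> \<in> S \<Longrightarrow> x \<in> V \<Longrightarrow> 0 \<le> hit \<sigma> W t x"
  by (induction t arbitrary: x) (auto intro!: step_nonneg)

lemma hit_le_1: "\<sigma> \<in> S \<Longrightarrow> x \<in> V \<Longrightarrow> hit \<sigma> W t x \<le> 1"
  by (induction t arbitrary: x) (auto intro!: step_le_const)

text \<open>Two independent walks in the same environment, compared at time \<open>t\<close> only;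
  earlier meetings and separations do not matter. With \<open>c = 1\<close> this is the inner
  product of the two \<open>t\<close>-step laws, and for \<open>a = b\<close> a squared
  \<open>L^2\<close> norm.\<close>

fun meet :: "(nat \<times> nat \<Rightarrow> nat \<times> nat) \<Rightarrow> (nat \<Rightarrow> real) \<Rightarrow> nat \<Rightarrow> nat \<Rightarrow> nat \<Rightarrow> real" where
  "meet \<sigma> c 0 a b = (if a = b then c a else 0)"
| "meet \<sigma> c (Suc t) a b = step \<sigma> UNIV (\<lambda>z. step \<sigma> UNIV (\<lambda>z'. meet \<sigma> c t z z') b) a"

lemma meet_nonneg:
  "\<sigma> \<in> S \<Longrightarrow> a \<in> V \<Longrightarrow> b \<in> V \<Longrightarrow> (\<And>x. x \<in> V \<Longrightarrow> 0 \<le> c x) \<Longrightarrow> 0 \<le> meet \<sigma> c t a b"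
  by (induction t arbitrary: a b) (auto intro!: step_nonneg)

lemma meet_le_1:
  "\<sigma> \<in> S \<Longrightarrow> a \<in> V \<Longrightarrow> b \<in> V \<Longrightarrow> (\<And>x. x \<in> V \<Longrightarrow> c x \<le> 1) \<Longrightarrow> meet \<sigma> c t a b \<le> 1"
  by (induction t arbitrary: a b) (auto intro!: step_le_const)

lemma step_commute:
  "step \<sigma> UNIV (\<lambda>z. step \<sigma> UNIV (\<lambda>z'. f z z') b) a = step \<sigma> UNIV (\<lambda>z'. step \<sigma> UNIV (\<lambda>z. f z z') a) b"
  unfolding step_def by (simp add: sum_divide_distrib) (subst sum.swap, simp add: mult.commute)

lemma meet_sym: "meet \<sigma> c t a b = meet \<sigma> c t b a"
proof (induction t arbitrary: a b)
  case (Suc t)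
  have *: "meet \<sigma> c t = (\<lambda>z z'. meet \<sigma> c t z' z)" by (intro HOL.ext) (rule Suc.IH)
  show ?case unfolding meet.simps
    by (subst step_commute, subst (2) *) (rule refl)
qed auto

lemma cexp_le_factor:
  assumes "bounded_off F Z r \<beta>" "\<sigma> \<in> S" "E \<subseteq> tails" "card E \<le> r" "fst ` E \<inter> Z = {}"
    "\<And>\<tau>. \<tau> \<in> S \<Longrightarrow> 0 \<le> F \<tau>" "\<And>\<tau>. \<tau> \<in> S \<Longrightarrow> G \<tau> \<le> 1"
  shows "cexp \<sigma> E (\<lambda>\<tau>. F \<tau> * G \<tau>) \<le> \<beta>"
proof -
  have "cexp \<sigma> E (\<lambda>\<tau>. F \<tau> * G \<tau>) \<le> cexp \<sigma> E F"
    using assms(6,7) ext_in_S by (intro cexp_mono mult_left_le) auto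
  thus ?thesis using bounded_offD[OF assms(1-5)] by simp
qed

lemma card_insert_E:
  "\<lbrakk>E \<subseteq> tails; e \<in> tails - E\<rbrakk> \<Longrightarrow> insert e E \<subseteq> tails \<and> card (insert e E) = Suc (card E)"
  using finite_subset[OF _ finite_tails] by auto

lemma fresh_tail: "\<lbrakk>x \<in> V; x \<notin> fst ` E; i < dout x\<rbrakk> \<Longrightarrow> (x, i) \<in> tails - E"
  using in_tails by (metis DiffI fst_conv imageI)

lemma card_dirty_le:
  assumes "E \<subseteq> tails" "finite Z" shows "card (fst ` E \<union> Z) \<le> card E + card Z" "finite (fst ` E \<union> Z)"
proof -
  have "finite E" using assms finite_subset by blast
  thus "card (fst ` E \<union> Z) \<le> card E + card Z" "finite (fst ` E \<union> Z)"
    using card_Un_le[of "fst ` E" Z] card_image_le[of E fst] assms by auto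
qed

text \<open>While the landings avoid the exposed vertices, \<open>Z\<close>, \<open>W\<close> and
  the current vertex, the walk stands on a fresh vertex. The first exception costs
  \<open>rate s\<close>; from then on the hitting probability is replaced by 1 and only
  \<open>F\<close> is left, whose bound \<open>\<beta>\<close> still applies because nothing at
  \<open>Z\<close> has been revealed. At most four vertices in \<open>Z\<close> and
  \<open>W\<close>, plus the current one, give the 5 in \<open>rate\<close>.\<close>

lemma cexp_hit_le:
  assumes bd: "bounded_off F Z r \<beta>" and F: "\<And>\<tau>. \<tau> \<in> S \<Longrightarrow> 0 \<le> F \<tau>" and \<beta>: "0 \<le> \<beta>"
    and r: "r \<le> s" "s < m" and Z: "finite Z" "finite W" "card Z + card W \<le> 4"
  shows "\<lbrakk>\<sigma> \<in> S; E \<subseteq> tails; card E + t \<le> r; fst ` E \<inter> Z = {}; x \<in> V; x \<notin> fst ` E; x \<notin> Z; x \<notin> W\<rbrakk>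
    \<Longrightarrow> cexp \<sigma> E (\<lambda>\<tau>. F \<tau> * hit \<tau> W t x) \<le> \<beta> * (real t * rate s)"
proof (induction t arbitrary: \<sigma> E x)
  case 0 thus ?case by (simp add: cexp_const)
next
  case (Suc t)
  let ?A = "fst ` E \<union> (insert x (Z \<union> W))"
  have A: "finite ?A" "card ?A \<le> s + 5"
  proof -
    have "card (insert x (Z \<union> W)) \<le> 5"
      using Z card_insert_le_m1[of 5 "Z \<union> W" x] card_Un_le[of Z W] by simp
    thus "finite ?A" "card ?A \<le> s + 5"
      using card_dirty_le[OF Suc.prems(2), of "insert x (Z \<union> W)"] Z Suc.prems(3) r by auto
  qed
  have "cexp \<sigma> E (\<lambda>\<tau>. F \<tau> * hit \<tau> W (Suc t) x) = cexp \<sigma> E (\<lambda>\<tau>. F \<tau> * step \<tau> UNIV (hit \<tau> W t) x)"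
    using Suc.prems by simp
  also have "\<dots> \<le> \<beta> * (real t * rate s) + \<beta> * rate s"
  proof (rule cexp_step[OF Suc.prems(5)])
    fix i assume i: "i < dout x"
    have e: "(x, i) \<in> tails - E" by (rule fresh_tail[OF Suc.prems(5,6) i])
    note ins = card_insert_E[OF Suc.prems(2) e]
    show "cexp \<sigma> E (\<lambda>\<tau>. F \<tau> * hit \<tau> W t (fst (\<tau> (x, i)))) \<le> \<beta> * (real t * rate s) + \<beta> * rate s"
    proof (rule reveal_landing[OF Suc.prems(1,2) e _ r(2) A \<beta>, where \<psi>="\<lambda>\<tau> z. F \<tau> * hit \<tau> W t z"])
      show "card E \<le> s" using Suc.prems r by simp
      fix \<tau> assume \<tau>: "\<tau> \<in> ext \<sigma> E" and V: "fst (\<tau> (x, i)) \<in> V"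
      have \<tau>S: "\<tau> \<in> S" using \<tau> by (rule ext_in_S)
      show "cexp \<tau> (insert (x, i) E) (\<lambda>\<upsilon>. F \<upsilon> * hit \<upsilon> W t (fst (\<tau> (x, i)))) \<le> \<beta> * (real t * rate s)"
        if "fst (\<tau> (x, i)) \<notin> ?A"
        by (rule Suc.IH) (use \<tau>S V that ins Suc.prems in auto)
      have "cexp \<tau> (insert (x, i) E) (\<lambda>\<upsilon>. F \<upsilon> * hit \<upsilon> W t (fst (\<tau> (x, i)))) \<le> \<beta>"
        by (rule cexp_le_factor[OF bd \<tau>S]) (use ins Suc.prems F V hit_le_1 in auto)
      thus "cexp \<tau> (insert (x, i) E) (\<lambda>\<upsilon>. F \<upsilon> * hit \<upsilon> W t (fst (\<tau> (x, i)))) \<le> \<beta> * (real t * rate s) + \<beta>"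
        using \<beta> rate_nonneg[OF r(2)] by (simp add: add_increasing)
    qed
  qed
  finally show ?case by (simp add: algebra_simps)
qed

lemma cexp_step_pair:
  assumes "a \<in> V" "b \<in> V"
  shows "cexp \<sigma> E (\<lambda>\<tau>. F \<tau> * step \<tau> UNIV (\<lambda>z. step \<tau> UNIV (\<lambda>z'. \<phi> \<tau> z z') b) a)
    = (\<Sum>i<dout a. \<Sum>j<dout b. cexp \<sigma> E (\<lambda>\<tau>. F \<tau> * \<phi> \<tau> (fst (\<tau> (a, i))) (fst (\<tau> (b, j)))))
        / (real (dout a) * real (dout b))"
  by (simp add: step_def sum_distrib_left cexp_divide cexp_sum sum_divide_distrib mult_ac)

lemma cexp_step_pair_le:
  assumes "a \<in> V" "b \<in> V"
    and "\<And>i j. i < dout a \<Longrightarrow> j < dout b \<Longrightarrow>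
      cexp \<sigma> E (\<lambda>\<tau>. F \<tau> * \<phi> \<tau> (fst (\<tau> (a, i))) (fst (\<tau> (b, j)))) \<le> c"
  shows "cexp \<sigma> E (\<lambda>\<tau>. F \<tau> * step \<tau> UNIV (\<lambda>z. step \<tau> UNIV (\<lambda>z'. \<phi> \<tau> z z') b) a) \<le> c"
proof -
  have "(\<Sum>i<dout a. \<Sum>j<dout b. cexp \<sigma> E (\<lambda>\<tau>. F \<tau> * \<phi> \<tau> (fst (\<tau> (a, i))) (fst (\<tau> (b, j)))))
    \<le> (\<Sum>i<dout a. \<Sum>j<dout b. c)" using assms(3) by (intro sum_mono) auto
  thus ?thesis unfolding cexp_step_pair[OF assms(1,2)]
    using dout_pos[OF assms(1)] dout_pos[OF assms(2)] by (simp add: divide_simps mult_ac)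
qed

text \<open>Two walks at the same vertex use the same tail with probability at most \<open>1/2\<close>.\<close>

lemma cexp_step_diag_le:
  assumes a: "a \<in> V"
    and same: "\<And>i. i < dout a \<Longrightarrow>
      cexp \<sigma> E (\<lambda>\<tau>. F \<tau> * \<phi> \<tau> (fst (\<tau> (a, i))) (fst (\<tau> (a, i)))) \<le> c1"
    and diff: "\<And>i j. i < dout a \<Longrightarrow> j < dout a \<Longrightarrow> i \<noteq> j \<Longrightarrow>
      cexp \<sigma> E (\<lambda>\<tau>. F \<tau> * \<phi> \<tau> (fst (\<tau> (a, i))) (fst (\<tau> (a, j)))) \<le> c2"
    and c: "c2 \<le> c1"
  shows "cexp \<sigma> E (\<lambda>\<tau>. F \<tau> * step \<tau> UNIV (\<lambda>z. step \<tau> UNIV (\<lambda>z'. \<phi> \<tau> z z') a) a) \<le> (c1 + c2) / 2"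
proof -
  let ?d = "real (dout a)"
  have d: "2 \<le> ?d" using V_dout[OF a] by simp
  have "(\<Sum>i<dout a. \<Sum>j<dout a. cexp \<sigma> E (\<lambda>\<tau>. F \<tau> * \<phi> \<tau> (fst (\<tau> (a, i))) (fst (\<tau> (a, j)))))
    \<le> (\<Sum>i<dout a. \<Sum>j<dout a. c2 + (if i = j then c1 - c2 else 0))"
    using same diff by (intro sum_mono) auto
  also have "\<dots> = ?d * (?d * c2 + (c1 - c2))" by (simp add: sum.distrib)
  finally have "cexp \<sigma> E (\<lambda>\<tau>. F \<tau> * step \<tau> UNIV (\<lambda>z. step \<tau> UNIV (\<lambda>z'. \<phi> \<tau> z z') a) a)
     \<le> ?d * (?d * c2 + (c1 - c2)) / (?d * ?d)"
    unfolding cexp_step_pair[OF a a] by (rule divide_right_mono) simp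
  also have "\<dots> = c2 + (c1 - c2) / ?d" using d by (simp add: field_simps)
  also have "(c1 - c2) / ?d \<le> (c1 - c2) / 2" using c d by (intro divide_left_mono) auto
  hence "c2 + (c1 - c2) / ?d \<le> (c1 + c2) / 2" by (simp add: field_simps)
  finally show ?thesis .
qed

text \<open>\<open>A\<close> has one vertex less than \<open>rate\<close> allows, because the second
  landing must also avoid the vertex of the first.\<close>

lemma reveal_two_landings:
  assumes \<sigma>: "\<sigma> \<in> S" and E: "E \<subseteq> tails" and e: "e \<in> tails - E" "e' \<in> tails - E" "e \<noteq> e'"
    and s: "card E + 2 \<le> r" "r \<le> s" "s < m"
    and A: "finite A" "card A \<le> s + 4"
    and bd: "bounded_off F Z r \<beta>" and F: "\<And>\<tau>. \<tau> \<in> S \<Longrightarrow> 0 \<le> F \<tau>" and \<beta>: "0 \<le> \<beta>"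
    and Z: "fst ` E \<inter> Z = {}" "fst e \<notin> Z" "fst e' \<notin> Z"
    and \<phi>: "\<And>\<tau> z z'. \<tau> \<in> S \<Longrightarrow> z \<in> V \<Longrightarrow> z' \<in> V \<Longrightarrow> \<phi> \<tau> z z' \<le> 1" and b0: "0 \<le> b0"
    and good: "\<And>\<tau> z z'. \<tau> \<in> ext \<sigma> E \<Longrightarrow> z \<in> V \<Longrightarrow> z' \<in> V \<Longrightarrow> z \<noteq> z' \<Longrightarrow> z \<notin> A \<Longrightarrow> z' \<notin> A \<Longrightarrow>
        cexp \<tau> (insert e' (insert e E)) (\<lambda>\<upsilon>. F \<upsilon> * \<phi> \<upsilon> z z') \<le> b0"
  shows "cexp \<sigma> E (\<lambda>\<tau>. F \<tau> * \<phi> \<tau> (fst (\<tau> e)) (fst (\<tau> e'))) \<le> b0 + 2 * \<beta> * rate s"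
proof -
  note ins = card_insert_E[OF E e(1)]
  have e'': "e' \<in> tails - insert e E" using e by auto
  note ins' = card_insert_E[OF conjunct1[OF ins] e'']
  have q: "0 \<le> rate s" using rate_nonneg s by simp
  have "cexp \<sigma> E (\<lambda>\<tau>. F \<tau> * \<phi> \<tau> (fst (\<tau> e)) (fst (\<tau> e'))) \<le> (b0 + \<beta> * rate s) + \<beta> * rate s"
  proof (rule reveal_landing[OF \<sigma> E e(1) _ s(3) A(1) _ \<beta>, where \<psi>="\<lambda>\<tau> z. F \<tau> * \<phi> \<tau> z (fst (\<tau> e'))"])
    show "card E \<le> s" "card A \<le> s + 5" using s A by auto
    fix \<tau> assume \<tau>: "\<tau> \<in> ext \<sigma> E" and z: "fst (\<tau> e) \<in> V"
    have \<tau>S: "\<tau> \<in> S" using \<tau> by (rule ext_in_S)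
    have "cexp \<tau> (insert e E) (\<lambda>\<upsilon>. F \<upsilon> * \<phi> \<upsilon> (fst (\<tau> e)) (fst (\<upsilon> e'))) \<le> \<beta>"
    proof (rule cexp_le_factor[OF bd \<tau>S])
      fix \<upsilon> assume "\<upsilon> \<in> S"
      thus "\<phi> \<upsilon> (fst (\<tau> e)) (fst (\<upsilon> e')) \<le> 1" using \<phi> z e(2) S_heads head_fst by auto
    qed (use ins s Z F in auto)
    thus "cexp \<tau> (insert e E) (\<lambda>\<upsilon>. F \<upsilon> * \<phi> \<upsilon> (fst (\<tau> e)) (fst (\<upsilon> e'))) \<le> b0 + \<beta> * rate s + \<beta>"
      using b0 \<beta> q by (simp add: add_increasing)
    assume zA: "fst (\<tau> e) \<notin> A"
    show "cexp \<tau> (insert e E) (\<lambda>\<upsilon>. F \<upsilon> * \<phi> \<upsilon> (fst (\<tau> e)) (fst (\<upsilon> e'))) \<le> b0 + \<beta> * rate s"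
    proof (rule reveal_landing[OF \<tau>S conjunct1[OF ins] e'' _ s(3) _ _ \<beta>, where A="insert (fst (\<tau> e)) A"
          and \<psi>="\<lambda>\<upsilon> z'. F \<upsilon> * \<phi> \<upsilon> (fst (\<tau> e)) z'"])
      show "card (insert e E) \<le> s" "finite (insert (fst (\<tau> e)) A)" "card (insert (fst (\<tau> e)) A) \<le> s + 5"
        using ins s A card_insert_le_m1[of "s + 5" A "fst (\<tau> e)"] by auto
      fix \<upsilon> assume \<upsilon>: "\<upsilon> \<in> ext \<tau> (insert e E)" and z': "fst (\<upsilon> e') \<in> V"
      have \<upsilon>S: "\<upsilon> \<in> S" using \<upsilon> by (rule ext_in_S)
      have \<upsilon>E: "\<upsilon> \<in> ext \<sigma> E" using \<tau> \<upsilon> by (rule ext_trans)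
      show "cexp \<upsilon> (insert e' (insert e E)) (\<lambda>\<upsilon>'. F \<upsilon>' * \<phi> \<upsilon>' (fst (\<tau> e)) (fst (\<upsilon> e'))) \<le> b0"
        if "fst (\<upsilon> e') \<notin> insert (fst (\<tau> e)) A"
        using that zA z z' by (intro good[OF \<upsilon>E]) auto
      have "cexp \<upsilon> (insert e' (insert e E)) (\<lambda>\<upsilon>'. F \<upsilon>' * \<phi> \<upsilon>' (fst (\<tau> e)) (fst (\<upsilon> e'))) \<le> \<beta>"
        by (rule cexp_le_factor[OF bd \<upsilon>S]) (use ins ins' s Z F \<phi> z z' in auto)
      thus "cexp \<upsilon> (insert e' (insert e E)) (\<lambda>\<upsilon>'. F \<upsilon>' * \<phi> \<upsilon>' (fst (\<tau> e)) (fst (\<upsilon> e'))) \<le> b0 + \<beta>"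
        using b0 by simp
    qed
  qed
  thus ?thesis by simp
qed

text \<open>Walks at distinct fresh vertices can only meet after a landing on an exposed vertex or
  on each other. Walks at a common fresh vertex choose the same tail with probability at most 1/2,
  which accounts for \<open>1 / 2 ^ t\<close>; after different choices they are at distinct fresh
  vertices, up to \<open>rate s\<close> for each landing.\<close>

lemma cexp_meet_le:
  assumes bd: "bounded_off F Z r \<beta>" and F: "\<And>\<tau>. \<tau> \<in> S \<Longrightarrow> 0 \<le> F \<tau>" and \<beta>: "0 \<le> \<beta>"
    and r: "r \<le> s" "s < m" and Z: "finite Z" "card Z \<le> 4"
    and c: "\<And>x. x \<in> V \<Longrightarrow> 0 \<le> c x \<and> c x \<le> 1"
  shows "\<lbrakk>\<sigma> \<in> S; E \<subseteq> tails; card E + 2 * t \<le> r; fst ` E \<inter> Z = {}; a \<in> V; a \<notin> fst ` E; a \<notin> Z;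
      b \<in> V; b \<notin> fst ` E; b \<notin> Z\<rbrakk>
    \<Longrightarrow> cexp \<sigma> E (\<lambda>\<tau>. F \<tau> * meet \<tau> c t a b) \<le> \<beta> * ((if a = b then 1 / 2 ^ t else 0) + 2 * real t * rate s)"
proof (induction t arbitrary: \<sigma> E a b)
  case 0
  have "cexp \<sigma> E (\<lambda>\<tau>. F \<tau> * meet \<tau> c 0 a b) \<le> \<beta>" 
    by (rule cexp_le_factor[OF bd]) (use 0 F c in auto)
  thus ?case by (auto simp: cexp_const[OF \<open>\<sigma> \<in> S\<close>])
next
  case (Suc t)
  let ?q = "rate s"
  have q: "0 \<le> ?q" using rate_nonneg r by simp
  have two: "cexp \<sigma> E (\<lambda>\<tau>. F \<tau> * meet \<tau> c t (fst (\<tau> e)) (fst (\<tau> e'))) \<le> \<beta> * (2 * real t * ?q) + 2 * \<beta> * ?q"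
    if e: "e \<in> tails - E" "e' \<in> tails - E" "e \<noteq> e'" and fe: "fst e \<in> {a, b}" "fst e' \<in> {a, b}" for e e'
  proof (rule reveal_two_landings[OF Suc.prems(1,2) e _ r _ _ bd F \<beta> Suc.prems(4),
        where A="fst ` E \<union> insert a (insert b Z)"])
    have "card (insert a (insert b Z)) \<le> 6"
      using Z card_insert_le_m1[of 6 "insert b Z" a] card_insert_le_m1[of 5 Z b] by simp
    thus "finite (fst ` E \<union> insert a (insert b Z))" "card (fst ` E \<union> insert a (insert b Z)) \<le> s + 4"
      using card_dirty_le[OF Suc.prems(2), of "insert a (insert b Z)"] Z Suc.prems(3) r by auto
    fix \<tau> z z' assume a: "\<tau> \<in> ext \<sigma> E" "z \<in> V" "z' \<in> V" "z \<noteq> z'"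
      "z \<notin> fst ` E \<union> insert a (insert b Z)" "z' \<notin> fst ` E \<union> insert a (insert b Z)"
    note ins = card_insert_E[OF Suc.prems(2) e(1)]
    have e'': "e' \<in> tails - insert e E" using e by auto
    note ins' = card_insert_E[OF conjunct1[OF ins] e'']
    have "cexp \<tau> (insert e' (insert e E)) (\<lambda>\<upsilon>. F \<upsilon> * meet \<upsilon> c t z z') \<le>
        \<beta> * ((if z = z' then 1 / 2 ^ t else 0) + 2 * real t * ?q)"
      by (rule Suc.IH) (use a ext_in_S ins ins' Suc.prems fe in auto)
    thus "cexp \<tau> (insert e' (insert e E)) (\<lambda>\<upsilon>. F \<upsilon> * meet \<upsilon> c t z z') \<le> \<beta> * (2 * real t * ?q)"
      using a by simp
  qed (use Suc.prems fe \<beta> q meet_le_1 c in auto)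
  have tail: "(a, i) \<in> tails - E" if "i < dout a" for i by (rule fresh_tail[OF Suc.prems(5,6) that])
  have tail': "(b, i) \<in> tails - E" if "i < dout b" for i by (rule fresh_tail[OF Suc.prems(8,9) that])
  show ?case
  proof (cases "a = b")
    case False
    have "cexp \<sigma> E (\<lambda>\<tau>. F \<tau> * meet \<tau> c (Suc t) a b) \<le> \<beta> * (2 * real t * ?q) + 2 * \<beta> * ?q"
      unfolding meet.simps
      by (rule cexp_step_pair_le[OF Suc.prems(5,8)]) (use two tail tail' False in auto)
    thus ?thesis using False by (simp add: algebra_simps)
  next
    case True
    \<comment> \<open>The error in \<open>?c1\<close> is rounded up to the one in
      \<open>?c2\<close>; their mean is then exactly the claim for \<open>t + 1\<close>.\<close>
    let ?c1 = "\<beta> * (1 / 2 ^ t + 2 * real t * ?q) + 2 * \<beta> * ?q" and ?c2 = "\<beta> * (2 * real t * ?q) + 2 * \<beta> * ?q"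
    have "cexp \<sigma> E (\<lambda>\<tau>. F \<tau> * meet \<tau> c (Suc t) a a) \<le> (?c1 + ?c2) / 2"
      unfolding meet.simps
    proof (rule cexp_step_diag_le[OF Suc.prems(5)])
      fix i assume i: "i < dout a"
      note ins = card_insert_E[OF Suc.prems(2) tail[OF i]]
      show "cexp \<sigma> E (\<lambda>\<tau>. F \<tau> * meet \<tau> c t (fst (\<tau> (a, i))) (fst (\<tau> (a, i)))) \<le> ?c1"
      proof -
        have "cexp \<sigma> E (\<lambda>\<tau>. F \<tau> * meet \<tau> c t (fst (\<tau> (a, i))) (fst (\<tau> (a, i)))) \<le>
          \<beta> * (1 / 2 ^ t + 2 * real t * ?q) + \<beta> * ?q"
        proof (rule reveal_landing[OF Suc.prems(1,2) tail[OF i] _ r(2) _ _ \<beta>, where A="fst ` E \<union> insert a Z"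
            and \<psi>="\<lambda>\<tau> z. F \<tau> * meet \<tau> c t z z"])
          have "card (insert a Z) \<le> 5" using Z card_insert_le_m1[of 5 Z a] by simp
          thus "finite (fst ` E \<union> insert a Z)" "card (fst ` E \<union> insert a Z) \<le> s + 5" "card E \<le> s"
            using card_dirty_le[OF Suc.prems(2), of "insert a Z"] Z Suc.prems(3) r by auto
          fix \<tau> assume \<tau>: "\<tau> \<in> ext \<sigma> E" and V: "fst (\<tau> (a, i)) \<in> V"
          have \<tau>S: "\<tau> \<in> S" using \<tau> by (rule ext_in_S)
          show "cexp \<tau> (insert (a, i) E) (\<lambda>\<upsilon>. F \<upsilon> * meet \<upsilon> c t (fst (\<tau> (a, i))) (fst (\<tau> (a, i)))) \<le>
             \<beta> * (1 / 2 ^ t + 2 * real t * ?q)" if "fst (\<tau> (a, i)) \<notin> fst ` E \<union> insert a Z"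
          proof -
            have "cexp \<tau> (insert (a, i) E) (\<lambda>\<upsilon>. F \<upsilon> * meet \<upsilon> c t (fst (\<tau> (a, i))) (fst (\<tau> (a, i)))) \<le>
              \<beta> * ((if fst (\<tau> (a, i)) = fst (\<tau> (a, i)) then 1 / 2 ^ t else 0) + 2 * real t * ?q)"
              by (rule Suc.IH) (use \<tau>S V that ins Suc.prems in auto)
            thus ?thesis by simp
          qed
          have "cexp \<tau> (insert (a, i) E) (\<lambda>\<upsilon>. F \<upsilon> * meet \<upsilon> c t (fst (\<tau> (a, i))) (fst (\<tau> (a, i)))) \<le> \<beta>"
            by (rule cexp_le_factor[OF bd \<tau>S]) (use ins Suc.prems F V meet_le_1 c in auto)
          thus "cexp \<tau> (insert (a, i) E) (\<lambda>\<upsilon>. F \<upsilon> * meet \<upsilon> c t (fst (\<tau> (a, i))) (fst (\<tau> (a, i)))) \<le>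
             \<beta> * (1 / 2 ^ t + 2 * real t * ?q) + \<beta>"
            using \<beta> q by (simp add: add_increasing)
        qed
        also have "\<dots> \<le> ?c1" using \<beta> q by simp
        finally show ?thesis .
      qed
    next
      fix i j assume ij: "i < dout a" "j < dout a" "i \<noteq> j"
      show "cexp \<sigma> E (\<lambda>\<tau>. F \<tau> * meet \<tau> c t (fst (\<tau> (a, i))) (fst (\<tau> (a, j)))) \<le> ?c2"
        by (rule two) (use ij tail in auto)
    next
      show "?c2 \<le> ?c1" using \<beta> by (simp add: algebra_simps)
    qed
    also have "\<dots> = \<beta> * (1 / 2 ^ Suc t + 2 * real (Suc t) * ?q)" by (simp add: field_simps)
    finally show ?thesis using True by simp
  qed
qed

text \<open>The square makes the failure probability at one vertex small enough for a union bound over all vertices.\<close>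

lemma two_children:
  assumes \<Phi>: "\<And>\<tau> x. \<tau> \<in> S \<Longrightarrow> x \<in> V \<Longrightarrow> 0 \<le> \<Phi> \<tau> x \<and> \<Phi> \<tau> x \<le> 1"
    and y: "y \<in> V" and ij: "i < dout y" "j < dout y" "i \<noteq> j"
    and s: "2 + 2 * L \<le> s" "s < m" and \<epsilon>: "0 \<le> \<epsilon>"
    and H: "\<And>F Z r \<beta> \<sigma> E x. \<lbrakk>bounded_off F Z r \<beta>; \<And>\<tau>. \<tau> \<in> S \<Longrightarrow> 0 \<le> F \<tau>; 0 \<le> \<beta>; r \<le> s;
        finite Z; card Z \<le> 1; \<sigma> \<in> S; E \<subseteq> tails; card E + L \<le> r; fst ` E \<inter> Z = {};
        x \<in> V; x \<notin> fst ` E; x \<notin> Z; x \<noteq> y\<rbrakk> \<Longrightarrow> cexp \<sigma> E (\<lambda>\<tau>. F \<tau> * \<Phi> \<tau> x) \<le> \<beta> * \<epsilon>"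
    and \<sigma>: "\<sigma> \<in> S"
  shows "cexp \<sigma> {} (\<lambda>\<tau>. \<Phi> \<tau> (fst (\<tau> (y, i))) * \<Phi> \<tau> (fst (\<tau> (y, j)))) \<le> (\<epsilon> + rate s)\<^sup>2"
proof -
  let ?q = "rate s" and ?e = "(y, i)" and ?f = "(y, j)"
  have q: "0 \<le> ?q" using rate_nonneg s by simp
  have e: "?e \<in> tails - {}" "?f \<in> tails - {?e}" using y ij in_tails by auto
  have single: "cexp \<tau> E (\<lambda>\<upsilon>. \<Phi> \<upsilon> x) \<le> \<epsilon>"
    if "\<tau> \<in> S" "E \<subseteq> tails" "card E + L \<le> s" "x \<in> V" "x \<notin> fst ` E" "x \<noteq> y" for \<tau> E x
    using H[OF bounded_off_one[of "{}"], of s \<tau> E x] that by auto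
  have "cexp \<sigma> {} (\<lambda>\<tau>. \<Phi> \<tau> (fst (\<tau> ?e)) * \<Phi> \<tau> (fst (\<tau> ?f))) \<le> (\<epsilon>\<^sup>2 + \<epsilon> * ?q) + (\<epsilon> + ?q) * ?q"
  proof (rule reveal_landing[OF \<sigma> _ e(1) _ s(2), where A="{y}" and \<psi>="\<lambda>\<tau> z. \<Phi> \<tau> z * \<Phi> \<tau> (fst (\<tau> ?f))"])
    fix \<tau> assume "\<tau> \<in> ext \<sigma> {}" and z: "fst (\<tau> ?e) \<in> V"
    hence \<tau>: "\<tau> \<in> S" by (auto dest: ext_in_S)
    let ?z = "fst (\<tau> ?e)"
    have f1: "\<upsilon> \<in> S \<Longrightarrow> fst (\<upsilon> ?f) \<in> V" for \<upsilon> using S_fst y ij by auto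
    have c2: "{?f, ?e} \<subseteq> tails" "card {?f, ?e} = 2" using e ij by auto
    have "cexp \<tau> (insert ?e {}) (\<lambda>\<upsilon>. \<Phi> \<upsilon> ?z * \<Phi> \<upsilon> (fst (\<upsilon> ?f))) \<le>
        cexp \<tau> (insert ?e {}) (\<lambda>\<upsilon>. \<Phi> \<upsilon> (fst (\<upsilon> ?f)))"
      using \<Phi> z f1 ext_in_S by (intro cexp_mono mult_left_le_one_le) auto
    also have "\<dots> \<le> \<epsilon> + 1 * ?q"
    proof (rule reveal_landing[OF \<tau> _ e(2) _ s(2), where A="{y, ?z}" and \<psi>="\<lambda>\<tau> z'. \<Phi> \<tau> z'"])
      fix \<upsilon> assume \<upsilon>: "\<upsilon> \<in> ext \<tau> {?e}" and z': "fst (\<upsilon> ?f) \<in> V"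
      hence \<upsilon>S: "\<upsilon> \<in> S" by (auto dest: ext_in_S)
      show "cexp \<upsilon> {?f, ?e} (\<lambda>\<upsilon>'. \<Phi> \<upsilon>' (fst (\<upsilon> ?f))) \<le> \<epsilon>" if "fst (\<upsilon> ?f) \<notin> {y, ?z}"
        by (rule single) (use c2 \<upsilon>S z' that s in auto)
      have "cexp \<upsilon> {?f, ?e} (\<lambda>\<upsilon>'. \<Phi> \<upsilon>' (fst (\<upsilon> ?f))) \<le> 1"
        by (rule cexp_le[OF \<upsilon>S]) (use \<Phi> z' ext_in_S in auto)
      thus "cexp \<upsilon> {?f, ?e} (\<lambda>\<upsilon>'. \<Phi> \<upsilon>' (fst (\<upsilon> ?f))) \<le> \<epsilon> + 1" using \<epsilon> by simp
    qed (use e s in \<open>auto simp: card_insert_if\<close>)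
    finally have bd: "cexp \<tau> (insert ?e {}) (\<lambda>\<upsilon>. \<Phi> \<upsilon> ?z * \<Phi> \<upsilon> (fst (\<upsilon> ?f))) \<le> \<epsilon> + ?q" by simp
    also have "\<dots> \<le> (\<epsilon>\<^sup>2 + \<epsilon> * ?q) + (\<epsilon> + ?q)" using \<epsilon> q by simp
    finally show "cexp \<tau> (insert ?e {}) (\<lambda>\<upsilon>. \<Phi> \<upsilon> ?z * \<Phi> \<upsilon> (fst (\<upsilon> ?f))) \<le> (\<epsilon>\<^sup>2 + \<epsilon> * ?q) + (\<epsilon> + ?q)" .
    assume zy: "?z \<notin> {y}"
    show "cexp \<tau> (insert ?e {}) (\<lambda>\<upsilon>. \<Phi> \<upsilon> ?z * \<Phi> \<upsilon> (fst (\<upsilon> ?f))) \<le> \<epsilon>\<^sup>2 + \<epsilon> * ?q"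
    proof (rule reveal_landing[OF \<tau> _ e(2) _ s(2), where A="{y, ?z}" and \<psi>="\<lambda>\<tau> z'. \<Phi> \<tau> ?z * \<Phi> \<tau> z'"])
      fix \<upsilon> assume \<upsilon>: "\<upsilon> \<in> ext \<tau> {?e}" and z': "fst (\<upsilon> ?f) \<in> V"
      hence \<upsilon>S: "\<upsilon> \<in> S" by (auto dest: ext_in_S)
      let ?y = "fst (\<upsilon> ?f)"
      show "cexp \<upsilon> {?f, ?e} (\<lambda>\<upsilon>'. \<Phi> \<upsilon>' ?z * \<Phi> \<upsilon>' ?y) \<le> \<epsilon>\<^sup>2" if "?y \<notin> {y, ?z}"
      proof -
        \<comment> \<open>How a product arises without independence: the value at the first child
          becomes the factor \<open>F\<close>, with \<open>Z\<close> consisting of that child, and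
          \<open>H\<close> for the second child multiplies its bound \<open>\<epsilon>\<close> by
          another \<open>\<epsilon>\<close>.\<close>
        have "bounded_off (\<lambda>\<upsilon>'. \<Phi> \<upsilon>' ?z) {?z} (s - L) \<epsilon>"
          unfolding bounded_off_def using single z zy s by fastforce
        hence "cexp \<upsilon> {?f, ?e} (\<lambda>\<upsilon>'. \<Phi> \<upsilon>' ?z * \<Phi> \<upsilon>' ?y) \<le> \<epsilon> * \<epsilon>"
          by (rule H) (use \<Phi> z zy that z' \<upsilon>S c2 s \<epsilon> in auto)
        thus ?thesis by (simp add: power2_eq_square)
      qed
      have "cexp \<upsilon> {?f, ?e} (\<lambda>\<upsilon>'. \<Phi> \<upsilon>' ?z * \<Phi> \<upsilon>' ?y) \<le> cexp \<upsilon> {?f, ?e} (\<lambda>\<upsilon>'. \<Phi> \<upsilon>' ?z)"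
        using \<Phi> z z' ext_in_S by (intro cexp_mono mult_left_le) auto
      also have "\<dots> \<le> \<epsilon>" by (rule single) (use c2 \<upsilon>S z zy s in auto)
      finally show "cexp \<upsilon> {?f, ?e} (\<lambda>\<upsilon>'. \<Phi> \<upsilon>' ?z * \<Phi> \<upsilon>' ?y) \<le> \<epsilon>\<^sup>2 + \<epsilon>" by (simp add: add_increasing)
    qed (use e s \<epsilon> in \<open>auto simp: card_insert_if\<close>)
  qed (use \<epsilon> q s in auto)
  also have "\<dots> = (\<epsilon> + ?q)\<^sup>2" by (simp add: power2_eq_square algebra_simps)
  finally show ?thesis .
qed

section \<open>Moments of the number of visits\<close>

fun visits :: "(nat \<times> nat \<Rightarrow> nat \<times> nat) \<Rightarrow> (nat \<times> nat) set \<Rightarrow> nat \<Rightarrow> nat \<Rightarrow> nat \<Rightarrow> real" where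
  "visits \<sigma> E v 0 x = 0"
| "visits \<sigma> E v (Suc t) x = (if x = v then 1 else 0) + step \<sigma> E (visits \<sigma> E v t) x"

text \<open>\<open>late \<sigma> E v T j\<close> counts the visits to \<open>v\<close> during the last \<open>T\<close> of \<open>j\<close> steps; when \<open>E\<close> is the set of
  exposed tails, it is nonzero for \<open>j > T\<close> only if the walk can stay \<open>j - T\<close> steps inside \<open>E\<close>.\<close>

fun late :: "(nat \<times> nat \<Rightarrow> nat \<times> nat) \<Rightarrow> (nat \<times> nat) set \<Rightarrow> nat \<Rightarrow> nat \<Rightarrow> nat \<Rightarrow> nat \<Rightarrow> real" where
  "late \<sigma> E v T 0 x = 0"
| "late \<sigma> E v T (Suc j) x = (if x = v \<and> Suc j \<le> T then 1 else 0) + step \<sigma> E (late \<sigma> E v T j) x"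

fun stay :: "(nat \<times> nat \<Rightarrow> nat \<times> nat) \<Rightarrow> (nat \<times> nat) set \<Rightarrow> nat \<Rightarrow> nat \<Rightarrow> real" where
  "stay \<sigma> E 0 x = 1"
| "stay \<sigma> E (Suc t) x = step \<sigma> E (stay \<sigma> E t) x"

lemma visits_nonneg: "\<sigma> \<in> S \<Longrightarrow> x \<in> V \<Longrightarrow> 0 \<le> visits \<sigma> E v t x"
  by (induction t arbitrary: x) (auto intro!: add_nonneg_nonneg step_nonneg)

lemma late_nonneg: "\<sigma> \<in> S \<Longrightarrow> x \<in> V \<Longrightarrow> 0 \<le> late \<sigma> E v T j x"
  by (induction j arbitrary: x) (auto intro!: add_nonneg_nonneg step_nonneg)

lemma stay_nonneg: "\<sigma> \<in> S \<Longrightarrow> x \<in> V \<Longrightarrow> 0 \<le> stay \<sigma> E t x"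
  by (induction t arbitrary: x) (auto intro!: step_nonneg)

lemma late_le_visits: "\<sigma> \<in> S \<Longrightarrow> x \<in> V \<Longrightarrow> late \<sigma> E v T j x \<le> visits \<sigma> E v j x"
proof (induction j arbitrary: x)
  case (Suc j)
  have "step \<sigma> E (late \<sigma> E v T j) x \<le> step \<sigma> E (visits \<sigma> E v j) x"
    by (rule step_mono) (use Suc in auto)
  thus ?case by auto
qed auto

lemma visits_mono: "\<sigma> \<in> S \<Longrightarrow> x \<in> V \<Longrightarrow> visits \<sigma> E v t x \<le> visits \<sigma> E v (Suc t) x"
proof (induction t arbitrary: x)
  case 0 thus ?case using visits_nonneg[OF 0, of E v "Suc 0"] by simp
next
  case (Suc t)
  have "step \<sigma> E (visits \<sigma> E v t) x \<le> step \<sigma> E (visits \<sigma> E v (Suc t)) x"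
    by (rule step_mono) (use Suc in auto)
  thus ?case by simp
qed

lemma visits_mono_le: "t \<le> t' \<Longrightarrow> \<sigma> \<in> S \<Longrightarrow> x \<in> V \<Longrightarrow> visits \<sigma> E v t x \<le> visits \<sigma> E v t' x"
  by (rule lift_Suc_mono_le[of "\<lambda>t. visits \<sigma> E v t x"]) (rule visits_mono, assumption+)

lemma visits_mono_set:
  "E \<subseteq> E' \<Longrightarrow> \<sigma> \<in> S \<Longrightarrow> x \<in> V \<Longrightarrow> visits \<sigma> E v t x \<le> visits \<sigma> E' v t x"
proof (induction t arbitrary: x)
  case (Suc t)
  have "step \<sigma> E (visits \<sigma> E v t) x \<le> step \<sigma> E (visits \<sigma> E' v t) x"
    by (rule step_mono) (use Suc in auto)
  also have "\<dots> \<le> step \<sigma> E' (visits \<sigma> E' v t) x"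
    by (rule step_mono_set) (use Suc visits_nonneg in auto)
  finally show ?case by simp
qed auto

lemma step_agree: "(\<And>e. e \<in> E \<Longrightarrow> \<tau> e = \<sigma> e) \<Longrightarrow> step \<tau> E = step \<sigma> E"
  by (intro HOL.ext) (simp add: step_def cong: if_cong)

lemma visits_agree: assumes "\<And>e. e \<in> E \<Longrightarrow> \<tau> e = \<sigma> e" shows "visits \<tau> E v t x = visits \<sigma> E v t x"
proof (induction t arbitrary: x)
  case (Suc t)
  have "visits \<tau> E v t = visits \<sigma> E v t" by (intro HOL.ext) (rule Suc)
  thus ?case using step_agree[of E \<tau> \<sigma>] assms by simp
qed auto

lemma late_agree: assumes "\<And>e. e \<in> E \<Longrightarrow> \<tau> e = \<sigma> e" shows "late \<tau> E v T j x = late \<sigma> E v T j x"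
proof (induction j arbitrary: x)
  case (Suc j)
  have "late \<tau> E v T j = late \<sigma> E v T j" by (intro HOL.ext) (rule Suc)
  thus ?case using step_agree[of E \<tau> \<sigma>] assms by simp
qed auto

lemma step_insert:
  assumes "(x, i) \<notin> E" "i < dout x"
  shows "step \<sigma> (insert (x, i) E) \<phi> u
    = step \<sigma> E \<phi> u + (if u = x then \<phi> (fst (\<sigma> (x, i))) / real (dout x) else 0)"
proof (cases "u = x")
  case True
  have "(\<Sum>j<dout x. if (x, j) \<in> insert (x, i) E then \<phi> (fst (\<sigma> (x, j))) else 0)
     = (\<Sum>j<dout x. (if (x, j) \<in> E then \<phi> (fst (\<sigma> (x, j))) else 0) + (if j = i then \<phi> (fst (\<sigma> (x, i))) else 0))"
    using assms by (intro sum.cong) auto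
  also have "\<dots> = (\<Sum>j<dout x. if (x, j) \<in> E then \<phi> (fst (\<sigma> (x, j))) else 0) + \<phi> (fst (\<sigma> (x, i)))"
    using assms by (simp add: sum.distrib)
  finally show ?thesis using True by (simp add: step_def add_divide_distrib)
qed (simp add: step_def)

text \<open>Decomposition of a path at its last use of the tail \<open>(x, i)\<close>.\<close>

lemma visits_insert:
  assumes \<sigma>: "\<sigma> \<in> S" and e: "(x, i) \<notin> E" "x \<in> V" "i < dout x" and z: "z = fst (\<sigma> (x, i))"
    and E': "E' = insert (x, i) E"
  shows "t \<le> j \<Longrightarrow> u \<in> V \<Longrightarrow>
    visits \<sigma> E' v t u \<le> visits \<sigma> E v t u + visits \<sigma> E v j z * step \<sigma> E' (visits \<sigma> E' z t) u"
proof (induction t arbitrary: u)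
  case 0
  have "step \<sigma> E' (\<lambda>_. 0) u = 0" by (simp add: step_def cong: if_cong)
  thus ?case by simp
next
  case (Suc t)
  let ?M = "visits \<sigma> E v j z"
  have zV: "z \<in> V" using z S_fst[OF \<sigma>] e by simp
  have M: "visits \<sigma> E v t z \<le> ?M" using visits_mono_le[of t j] Suc.prems \<sigma> zV by simp
  have d: "0 < real (dout x)" using dout_pos e by blast
  have vis': "visits \<sigma> E' z (Suc t) = (\<lambda>w. (if w = z then 1 else 0) + step \<sigma> E' (visits \<sigma> E' z t) w)"
    by (intro HOL.ext) simp
  have "step \<sigma> E' (visits \<sigma> E' v t) u \<le>
      step \<sigma> E' (\<lambda>w. visits \<sigma> E v t w + ?M * step \<sigma> E' (visits \<sigma> E' z t) w) u"
    by (rule step_mono[OF \<sigma>]) (use Suc in auto)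
  also have "\<dots> = step \<sigma> E (visits \<sigma> E v t) u + (if u = x then visits \<sigma> E v t z / real (dout x) else 0)
      + ?M * step \<sigma> E' (step \<sigma> E' (visits \<sigma> E' z t)) u"
    unfolding step_add step_cmult by (simp only: E' z step_insert[OF e(1,3), of \<sigma> "visits \<sigma> E v t"])
  \<comment> \<open>The weight of one crossing of the new tail is at most the probability of
    standing at \<open>z\<close> one step later.\<close>
  also have "(if u = x then visits \<sigma> E v t z / real (dout x) else 0)
      \<le> ?M * step \<sigma> E' (\<lambda>w. if w = z then 1 else 0) u"
  proof -
    have "0 \<le> step \<sigma> E (\<lambda>w. if w = z then 1 else 0) u" by (rule step_nonneg) (use \<sigma> Suc in auto)
    moreover have "0 \<le> ?M" using visits_nonneg[OF \<sigma> zV] .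
    ultimately have "0 \<le> ?M * step \<sigma> E (\<lambda>w. if w = z then 1 else 0) u" by (rule mult_nonneg_nonneg[rotated])
    moreover have "visits \<sigma> E v t z / real (dout x) \<le> ?M / real (dout x)" using M d by (simp add: divide_right_mono)
    ultimately show ?thesis using d \<open>0 \<le> ?M\<close> step_insert[OF e(1,3), of \<sigma> "\<lambda>w. if w = z then 1 else 0" u]
      by (auto simp: E' z[symmetric] algebra_simps)
  qed
  also have "step \<sigma> E (visits \<sigma> E v t) u + ?M * step \<sigma> E' (\<lambda>w. if w = z then 1 else 0) u
      + ?M * step \<sigma> E' (step \<sigma> E' (visits \<sigma> E' z t)) u
    = step \<sigma> E (visits \<sigma> E v t) u + ?M * step \<sigma> E' (visits \<sigma> E' z (Suc t)) u"
    unfolding vis' by (simp add: step_add algebra_simps)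
  finally show ?case by (simp del: visits.simps add: visits.simps(2)[of \<sigma> _ v])
qed

text \<open>A uniform bound on the Green function of the full walk. The 4 is the geometric series of
  a return probability of at most 3/4.\<close>

definition green :: "nat \<Rightarrow> (nat \<times> nat \<Rightarrow> nat \<times> nat) \<Rightarrow> bool" where
  "green N \<sigma> \<longleftrightarrow> (\<forall>w\<in>V. \<forall>x\<in>V. visits \<sigma> UNIV w (Suc N) x \<le> 4)"

text \<open>One green completion \<open>\<upsilon>\<close> suffices: \<open>visits\<close> along
  \<open>E\<close> depends on the revealed partners only, and it grows with the set of
  tails.\<close>

lemma green_visits:
  assumes "green N \<upsilon>" "\<upsilon> \<in> S" "\<upsilon> \<in> ext \<sigma> E" "t \<le> Suc N" "w \<in> V" "x \<in> V"
  shows "visits \<sigma> E w t x \<le> 4"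
proof -
  have "visits \<sigma> E w t x = visits \<upsilon> E w t x" by (rule visits_agree) (use ext_agree[OF assms(3)] in auto)
  also have "\<dots> \<le> visits \<upsilon> UNIV w t x" by (rule visits_mono_set) (use assms in auto)
  also have "\<dots> \<le> visits \<upsilon> UNIV w (Suc N) x" by (rule visits_mono_le) (use assms in auto)
  finally show ?thesis using assms by (force simp: green_def)
qed

text \<open>Started at \<open>z\<close>, the last-use decomposition becomes a product: 1 plus the
  later visits to \<open>z\<close> is \<open>visits\<close> from \<open>z\<close> to
  \<open>z\<close> up to time \<open>Suc j\<close>, at most 4 by \<open>green\<close>.\<close>

lemma visits_insert_le:
  assumes \<sigma>: "\<sigma> \<in> S" and e: "(x, i) \<notin> E" "x \<in> V" "i < dout x" and z: "z = fst (\<sigma> (x, i))"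
    and v: "green N \<upsilon>" "\<upsilon> \<in> ext \<sigma> (insert (x, i) E)" "j \<le> N"
  shows "visits \<sigma> (insert (x, i) E) v j z \<le> 4 * visits \<sigma> E v j z"
proof -
  let ?E' = "insert (x, i) E"
  have zV: "z \<in> V" using z S_fst[OF \<sigma>] e by simp
  have "visits \<sigma> ?E' v j z \<le> visits \<sigma> E v j z + visits \<sigma> E v j z * step \<sigma> ?E' (visits \<sigma> ?E' z j) z"
    by (rule visits_insert[OF \<sigma> e z refl]) (use zV in auto)
  also have "\<dots> = visits \<sigma> E v j z * visits \<sigma> ?E' z (Suc j) z" by (simp add: algebra_simps)
  also have "\<dots> \<le> visits \<sigma> E v j z * 4"
    by (rule mult_left_mono[OF green_visits[OF v(1) _ v(2)]])
      (use v zV ext_in_S visits_nonneg[OF \<sigma> zV] in auto)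
  finally show ?thesis by simp
qed

text \<open>The number of revealed edges that enter an already entered vertex, hence the number to
  delete before all in-degrees of the revealed graph are at most 1. Vertices are counted, as the
  heads of distinct tails always differ.\<close>

definition excess :: "(nat \<times> nat \<Rightarrow> nat \<times> nat) \<Rightarrow> (nat \<times> nat) set \<Rightarrow> nat" where
  "excess \<sigma> E = card E - card ((fst \<circ> \<sigma>) ` E)"

lemma excess_insert:
  assumes "finite E" "e \<notin> E"
  shows "excess \<sigma> (insert e E) \<le> Suc (excess \<sigma> E)"
    "fst (\<sigma> e) \<notin> (fst \<circ> \<sigma>) ` E \<Longrightarrow> excess \<sigma> (insert e E) = excess \<sigma> E"
  using assms card_image_le[OF assms(1), of "fst \<circ> \<sigma>"]
  by (auto simp: excess_def card_insert_if)

lemma excess_agree: "\<tau> \<in> ext \<sigma> E \<Longrightarrow> excess \<tau> E = excess \<sigma> E"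
proof -
  assume "\<tau> \<in> ext \<sigma> E"
  hence "(fst \<circ> \<tau>) ` E = (fst \<circ> \<sigma>) ` E" by (intro image_cong) (auto simp: ext_def)
  thus ?thesis by (simp add: excess_def)
qed

text \<open>Each vertex is entered by at most one tail of \<open>A\<close>, and that tail has
  probability at most 1/2. Summed over the starting point instead of the end point, the killed walk
  therefore contracts by 1/2.\<close>

lemma sum_step_inj:
  assumes \<sigma>: "\<sigma> \<in> S" and A: "A \<subseteq> tails" "inj_on (fst \<circ> \<sigma>) A" and \<phi>: "\<And>x. x \<in> V \<Longrightarrow> 0 \<le> \<phi> x"
  shows "(\<Sum>u\<in>V. step \<sigma> A \<phi> u) \<le> (\<Sum>u\<in>V. \<phi> u) / 2"
proof -
  have finA: "finite A" using A finite_subset by blast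
  have mem: "fst (\<sigma> e) \<in> V" if "e \<in> A" for e using that A S_heads[OF \<sigma>] head_fst by blast
  have "(\<Sum>u\<in>V. step \<sigma> A \<phi> u) \<le> (\<Sum>u\<in>V. (\<Sum>i<dout u. if (u, i) \<in> A then \<phi> (fst (\<sigma> (u, i))) else 0) / 2)"
  proof (rule sum_mono)
    fix u assume u: "u \<in> V"
    have "2 \<le> real (dout u)" using V_dout[OF u] by simp
    thus "step \<sigma> A \<phi> u \<le> (\<Sum>i<dout u. if (u, i) \<in> A then \<phi> (fst (\<sigma> (u, i))) else 0) / 2"
      unfolding step_def using \<phi> mem by (intro divide_left_mono sum_nonneg) auto
  qed
  also have "\<dots> = (\<Sum>e\<in>tails. if e \<in> A then \<phi> (fst (\<sigma> e)) else 0) / 2"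
    by (simp add: sum_tails sum_divide_distrib)
  also have "(\<Sum>e\<in>tails. if e \<in> A then \<phi> (fst (\<sigma> e)) else 0) = (\<Sum>e\<in>A. \<phi> (fst (\<sigma> e)))"
    using A(1) by (simp add: sum.inter_restrict[symmetric] Int_absorb1)
  also have "\<dots> = (\<Sum>u\<in>(fst \<circ> \<sigma>) ` A. \<phi> u)" using sum.reindex[OF A(2), of \<phi>] by simp
  also have "\<dots> \<le> (\<Sum>u\<in>V. \<phi> u)" using mem \<phi> by (intro sum_mono2) auto
  finally show ?thesis by simp
qed

lemma sum_visits_inj:
  assumes \<sigma>: "\<sigma> \<in> S" and A: "A \<subseteq> tails" "inj_on (fst \<circ> \<sigma>) A"
  shows "(\<Sum>u\<in>V. visits \<sigma> A w t u) \<le> 2"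
proof (induction t)
  case (Suc t)
  have "(\<Sum>u\<in>V. visits \<sigma> A w (Suc t) u) = (\<Sum>u\<in>V. if u = w then 1 else 0) + (\<Sum>u\<in>V. step \<sigma> A (visits \<sigma> A w t) u)"
    by (simp add: sum.distrib)
  also have "\<dots> \<le> 1 + (\<Sum>u\<in>V. visits \<sigma> A w t u) / 2"
    by (intro add_mono sum_step_inj[OF \<sigma> A]) (auto intro: visits_nonneg[OF \<sigma>])
  also have "\<dots> \<le> 2" using Suc by simp
  finally show ?case .
qed auto

lemma step_Diff:
  assumes "A \<subseteq> E" "E \<subseteq> tails" "u \<in> V"
  shows "step \<sigma> E \<phi> u
    = step \<sigma> A \<phi> u + (\<Sum>e\<in>E - A. if u = fst e then \<phi> (fst (\<sigma> e)) / real (dout u) else 0)"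
proof -
  have "(\<Sum>e\<in>E - A. if u = fst e then \<phi> (fst (\<sigma> e)) / real (dout u) else 0)
     = (\<Sum>e\<in>tails. if e \<in> E - A then (if u = fst e then \<phi> (fst (\<sigma> e)) / real (dout u) else 0) else 0)"
    using assms by (subst sum.inter_restrict[symmetric]) (auto intro: sum.cong)
  also have "\<dots> = (\<Sum>v\<in>V. if u = v then (\<Sum>i<dout u. if (u, i) \<in> E - A then \<phi> (fst (\<sigma> (u, i))) / real (dout u) else 0) else 0)"
    unfolding sum_tails by (intro sum.cong refl) (auto intro!: sum.cong sum.neutral)
  also have "\<dots> = (\<Sum>i<dout u. if (u, i) \<in> E - A then \<phi> (fst (\<sigma> (u, i))) else 0) / real (dout u)"
    using assms by (simp add: sum_divide_distrib if_distrib[of "\<lambda>x. x / _"] cong: if_cong)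
  finally have *: "(\<Sum>e\<in>E - A. if u = fst e then \<phi> (fst (\<sigma> e)) / real (dout u) else 0)
      = (\<Sum>i<dout u. if (u, i) \<in> E - A then \<phi> (fst (\<sigma> (u, i))) else 0) / real (dout u)" .
  have "(\<Sum>i<dout u. if (u, i) \<in> E then \<phi> (fst (\<sigma> (u, i))) else 0)
     = (\<Sum>i<dout u. (if (u, i) \<in> A then \<phi> (fst (\<sigma> (u, i))) else 0)
          + (if (u, i) \<in> E - A then \<phi> (fst (\<sigma> (u, i))) else 0))"
    using assms by (intro sum.cong) auto
  thus ?thesis unfolding * by (simp add: step_def sum.distrib add_divide_distrib)
qed

text \<open>Decomposition of a path at its first use of a tail outside a set \<open>A\<close> on which
  the visited vertices are distinct.\<close>

lemma sum_visits_le: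
  assumes \<sigma>: "\<sigma> \<in> S" and E: "E \<subseteq> tails" and v: "v \<in> V"
    and g: "\<And>t x. t \<le> N \<Longrightarrow> x \<in> V \<Longrightarrow> visits \<sigma> E v t x \<le> 4" and t: "t \<le> Suc N"
  shows "(\<Sum>u\<in>V. visits \<sigma> E v t u) \<le> 2 + 4 * real (excess \<sigma> E)"
proof -
  \<comment> \<open>One tail is kept for every entered vertex, so that
    \<open>excess \<sigma> E\<close> tails lie outside \<open>A\<close>.\<close>
  obtain A where A: "A \<subseteq> E" "inj_on (fst \<circ> \<sigma>) A" "(fst \<circ> \<sigma>) ` E = (fst \<circ> \<sigma>) ` A"
    using subset_image_inj[of "(fst \<circ> \<sigma>) ` E" "fst \<circ> \<sigma>" E] by auto
  have finE: "finite E" using E finite_subset by blast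
  have At: "A \<subseteq> tails" using A E by blast
  have cA: "card (E - A) = excess \<sigma> E"
    using A finE finite_subset[OF A(1) finE] by (simp only: excess_def card_Diff_subset card_image)
  have "visits \<sigma> E v t u \<le> visits \<sigma> A v t u + (\<Sum>e\<in>E - A. 2 * visits \<sigma> A (fst e) t u)"
    if "u \<in> V" "t \<le> Suc N" for t u
    using that
  proof (induction t arbitrary: u)
    case (Suc t)
    let ?R = "\<lambda>w. visits \<sigma> A v t w + (\<Sum>e\<in>E - A. 2 * visits \<sigma> A (fst e) t w)"
    \<comment> \<open>A tail outside \<open>A\<close> has probability at most 1/2, and at most 4
      visits follow it: hence the 2. Reaching the tail along \<open>A\<close> costs another factor 2
      when summed over all starting points, which makes 4 per unit of excess.\<close>
    have "(\<Sum>e\<in>E - A. if u = fst e then visits \<sigma> E v t (fst (\<sigma> e)) / real (dout u) else 0)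
        \<le> (\<Sum>e\<in>E - A. 2 * (if u = fst e then 1 else 0))"
    proof (rule sum_mono)
      fix e assume e: "e \<in> E - A"
      have "fst (\<sigma> e) \<in> V" using e E S_heads[OF \<sigma>] head_fst by blast
      hence "visits \<sigma> E v t (fst (\<sigma> e)) / real (dout u) \<le> 4 / 2"
        using g[of t] Suc.prems V_dout[of u] visits_nonneg[OF \<sigma>] by (intro frac_le) auto
      thus "(if u = fst e then visits \<sigma> E v t (fst (\<sigma> e)) / real (dout u) else 0) \<le> 2 * (if u = fst e then 1 else 0)"
        by auto
    qed
    moreover have "step \<sigma> A (visits \<sigma> E v t) u \<le> step \<sigma> A ?R u"
      by (rule step_mono[OF \<sigma>]) (use Suc in auto)
    moreover have "step \<sigma> A ?R u = step \<sigma> A (visits \<sigma> A v t) u + (\<Sum>e\<in>E - A. 2 * step \<sigma> A (visits \<sigma> A (fst e) t) u)"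
      by (simp add: step_add step_sum step_cmult)
    ultimately show ?case using step_Diff[OF A(1) E Suc.prems(1), of \<sigma> "visits \<sigma> E v t"]
      by (simp add: algebra_simps sum.distrib sum_distrib_left)
  qed auto
  hence "(\<Sum>u\<in>V. visits \<sigma> E v t u) \<le> (\<Sum>u\<in>V. visits \<sigma> A v t u + (\<Sum>e\<in>E - A. 2 * visits \<sigma> A (fst e) t u))"
    using t by (intro sum_mono) auto
  also have "\<dots> = (\<Sum>u\<in>V. visits \<sigma> A v t u) + (\<Sum>e\<in>E - A. 2 * (\<Sum>u\<in>V. visits \<sigma> A (fst e) t u))"
    by (simp add: sum.distrib sum.swap[of _ V] sum_distrib_left)
  also have "\<dots> \<le> 2 + (\<Sum>e\<in>E - A. 2 * 2)"
    by (intro add_mono sum_mono mult_left_mono sum_visits_inj[OF \<sigma> At A(2)]) auto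
  finally show ?thesis using cA by simp
qed

lemma sum_heads_le:
  assumes "\<And>x. x \<in> V \<Longrightarrow> 0 \<le> g x" shows "(\<Sum>f\<in>heads. g (fst f)) \<le> real D * (\<Sum>v\<in>V. g v)"
  unfolding sum_heads sum_distrib_left using assms din_le_D by (intro sum_mono mult_right_mono) auto

text \<open>The walk either follows tails in \<open>E\<close> or reveals a new tail, which can increase the excess only
  with probability \<open>rate s\<close>; the factor \<open>(1 + 1 / N) ^ j\<close> absorbs these increases.\<close>

lemma cexp_late_le:
  fixes B :: "nat \<Rightarrow> real" and s :: nat
  defines "\<Delta> \<equiv> \<lambda>J. 16 * (real J + 1) * B (Suc J) * real D / (real m - real s)"
  assumes F: "\<And>\<tau>. \<tau> \<in> S \<Longrightarrow> 0 \<le> F \<tau>" "\<And>\<tau>. \<tau> \<in> S \<Longrightarrow> F \<tau> \<noteq> 0 \<Longrightarrow> green N \<tau>"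
    and B: "mono B" "\<And>J. 0 \<le> B J" and s: "r \<le> s" "s < m" and v: "v \<in> V"
    and H: "\<And>\<sigma> E. \<sigma> \<in> S \<Longrightarrow> E \<subseteq> tails \<Longrightarrow> card E \<le> r \<Longrightarrow> cexp \<sigma> E F \<le> B (excess \<sigma> E)"
    and small: "\<And>J. rate s * \<Delta> (Suc J) * real N \<le> \<Delta> J"
  shows "\<lbrakk>\<sigma> \<in> S; E \<subseteq> tails; card E + j \<le> r; j \<le> N; x \<in> V\<rbrakk> \<Longrightarrow>
    cexp \<sigma> E (\<lambda>\<tau>. F \<tau> * late \<tau> UNIV v T j x) \<le>
      B (excess \<sigma> E) * late \<sigma> E v T j x + real j * \<Delta> (excess \<sigma> E) * (1 + 1 / real N) ^ j"
proof (induction j arbitrary: \<sigma> E x)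
  case 0 thus ?case by (simp add: cexp_const)
next
  case (Suc j)
  note \<sigma> = \<open>\<sigma> \<in> S\<close> and E = \<open>E \<subseteq> tails\<close> and x = \<open>x \<in> V\<close>
  let ?J = "excess \<sigma> E" and ?l = "1 + 1 / real N"
  let ?R = "real (Suc j) * \<Delta> ?J * ?l ^ Suc j"
  have N: "0 < real N" using Suc.prems by simp
  have pm: "0 < real m - real s" using s by simp
  have \<Delta>0: "0 \<le> \<Delta> J" for J unfolding \<Delta>_def using B(2)[of "Suc J"] pm by simp
  have l1: "1 \<le> ?l" using N by simp
  have lj: "1 \<le> ?l ^ i" for i using l1 one_le_power by blast
  have finE: "finite E" using E finite_subset by blast
  have q: "0 \<le> rate s" using rate_nonneg s by blast
  have Jle: "real j * \<Delta> ?J * ?l ^ j \<le> ?R"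
    using \<Delta>0 lj l1 by (intro mult_mono power_increasing) auto
  \<comment> \<open>If \<open>F\<close> vanishes on all completions, so does the left side.
    Otherwise some completion is green, and the Green function bounds hold on the revealed
    part.\<close>
  show ?case
  proof (cases "\<forall>\<upsilon>\<in>ext \<sigma> E. F \<upsilon> = 0")
    case True
    have "cexp \<sigma> E (\<lambda>\<tau>. F \<tau> * late \<tau> UNIV v T (Suc j) x) = cexp \<sigma> E (\<lambda>_. 0)"
      by (rule cexp_cong) (use True in auto)
    also have "\<dots> = 0" by (rule cexp_const[OF \<sigma>])
    also have "0 \<le> B ?J * late \<sigma> E v T (Suc j) x + ?R"
      using B(2) late_nonneg[OF \<sigma> x] \<Delta>0 lj[of "Suc j"]
      by (intro add_nonneg_nonneg mult_nonneg_nonneg) (auto simp del: late.simps)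
    finally show ?thesis .
  next
    case False
    then obtain \<upsilon>0 where \<upsilon>0: "\<upsilon>0 \<in> ext \<sigma> E" "green N \<upsilon>0" using F(2) ext_in_S by blast
    have sumv: "(\<Sum>u\<in>V. visits \<sigma> E v j u) \<le> 2 + 4 * real ?J"
      by (rule sum_visits_le[OF \<sigma> E v, where N=N])
        (use green_visits[OF \<upsilon>0(2) ext_in_S[OF \<upsilon>0(1)] \<upsilon>0(1)] v Suc.prems in auto)
    have new: "cexp \<sigma> E (\<lambda>\<tau>. F \<tau> * late \<tau> UNIV v T j (fst (\<tau> (x, i)))) \<le> ?R"
      if i: "i < dout x" and iE: "(x, i) \<notin> E" for i
    proof -
      let ?e = "(x, i)"
      let ?A = "(fst \<circ> \<sigma>) ` E"
      let ?g = "\<lambda>u. 4 * B (Suc ?J) * visits \<sigma> E v j u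
          + real j * ?l ^ j * (\<Delta> ?J + (if u \<in> ?A then 1 else 0) * \<Delta> (Suc ?J))"
      have e: "?e \<in> tails - E" using i iE x in_tails by auto
      note ins = card_insert_E[OF E e]
      have "cexp \<sigma> E (\<lambda>\<tau>. F \<tau> * late \<tau> UNIV v T j (fst (\<tau> ?e)))
          = cexp \<sigma> E (\<lambda>\<tau>. cexp \<tau> (insert ?e E) (\<lambda>\<tau>. F \<tau> * late \<tau> UNIV v T j (fst (\<tau> ?e))))"
        by (rule cexp_tower[OF \<sigma>]) auto
      also have "\<dots> \<le> cexp \<sigma> E (\<lambda>\<tau>. ?g (fst (\<tau> ?e)))"
      proof (rule cexp_mono)
        fix \<tau> assume \<tau>: "\<tau> \<in> ext \<sigma> E"
        have \<tau>S: "\<tau> \<in> S" using \<tau> by (rule ext_in_S)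
        let ?z = "fst (\<tau> ?e)" and ?E' = "insert ?e E"
        have zV: "?z \<in> V" using S_fst[OF \<tau>S x i] .
        have vag: "visits \<tau> E v j ?z = visits \<sigma> E v j ?z"
          by (rule visits_agree) (use ext_agree[OF \<tau>] in auto)
        have vn: "0 \<le> visits \<sigma> E v j ?z" using visits_nonneg[OF \<sigma> zV] .
        have gn: "0 \<le> ?g ?z" using vn B(2)[of "Suc ?J"] \<Delta>0 lj[of j]
          by (intro add_nonneg_nonneg mult_nonneg_nonneg) auto
        have "cexp \<tau> ?E' (\<lambda>\<tau>. F \<tau> * late \<tau> UNIV v T j (fst (\<tau> ?e))) = cexp \<tau> ?E' (\<lambda>\<upsilon>. F \<upsilon> * late \<upsilon> UNIV v T j ?z)"
          by (rule cexp_cong) (auto simp: ext_def)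
        also have "\<dots> \<le> ?g ?z"
        proof (cases "\<forall>\<upsilon>\<in>ext \<tau> ?E'. F \<upsilon> = 0")
          case True
          have "cexp \<tau> ?E' (\<lambda>\<upsilon>. F \<upsilon> * late \<upsilon> UNIV v T j ?z) = cexp \<tau> ?E' (\<lambda>_. 0)"
            by (rule cexp_cong) (use True in auto)
          thus ?thesis using gn cexp_const[OF \<tau>S] by simp
        next
          case False
          then obtain \<upsilon> where \<upsilon>: "\<upsilon> \<in> ext \<tau> ?E'" "green N \<upsilon>" using F(2) ext_in_S by blast
          let ?K = "excess \<tau> ?E'"
          have K: "?K \<le> Suc ?J" "?z \<notin> ?A \<Longrightarrow> ?K = ?J"
          proof -
            have im: "(fst \<circ> \<tau>) ` E = ?A" using \<tau> by (intro image_cong) (auto simp: ext_def)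
            show "?K \<le> Suc ?J" "?z \<notin> ?A \<Longrightarrow> ?K = ?J"
              using excess_insert[OF finE, of ?e \<tau>] e excess_agree[OF \<tau>] im by auto
          qed
          have "cexp \<tau> ?E' (\<lambda>\<upsilon>. F \<upsilon> * late \<upsilon> UNIV v T j ?z) \<le> B ?K * late \<tau> ?E' v T j ?z + real j * \<Delta> ?K * ?l ^ j"
            by (rule Suc.IH[OF \<tau>S _ _ _ zV]) (use ins Suc.prems in auto)
          \<comment> \<open>\<open>visits\<close> along the enlarged set depends on the landing
            vertex twice, as starting point and through the new edge. The comparison with
            \<open>visits\<close> along \<open>E\<close> removes the second dependence, after which
            the landing can be averaged out.\<close>
          also have "B ?K * late \<tau> ?E' v T j ?z \<le> B (Suc ?J) * (4 * visits \<sigma> E v j ?z)"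
          proof (rule mult_mono)
            show "B ?K \<le> B (Suc ?J)" using B(1) K(1) by (rule monoD)
            have "late \<tau> ?E' v T j ?z \<le> visits \<tau> ?E' v j ?z" using late_le_visits[OF \<tau>S zV] .
            also have "\<dots> \<le> 4 * visits \<tau> E v j ?z"
              by (rule visits_insert_le[OF \<tau>S iE x i refl \<upsilon>(2,1)]) (use Suc.prems in auto)
            finally show "late \<tau> ?E' v T j ?z \<le> 4 * visits \<sigma> E v j ?z" using vag by simp
          qed (use B late_nonneg[OF \<tau>S zV] in auto)
          also have "real j * \<Delta> ?K * ?l ^ j \<le> real j * ?l ^ j * (\<Delta> ?J + (if ?z \<in> ?A then 1 else 0) * \<Delta> (Suc ?J))"
          proof -
            have "\<Delta> ?K \<le> \<Delta> ?J + (if ?z \<in> ?A then 1 else 0) * \<Delta> (Suc ?J)"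
            proof (cases "?z \<in> ?A")
              case True
              have "\<Delta> ?K \<le> \<Delta> (Suc ?J)" unfolding \<Delta>_def
                using K(1) B(2)[of "Suc ?K"] monoD[OF B(1), of "Suc ?K" "Suc (Suc ?J)"] pm B(2)[of "Suc (Suc ?J)"]
                by (intro divide_right_mono mult_right_mono mult_mono) auto
              thus ?thesis using True \<Delta>0[of ?J] by simp
            qed (use K in auto)
            hence "(real j * ?l ^ j) * \<Delta> ?K \<le>
                (real j * ?l ^ j) * (\<Delta> ?J + (if ?z \<in> ?A then 1 else 0) * \<Delta> (Suc ?J))"
              using lj[of j] by (intro mult_left_mono) auto
            moreover have "real j * \<Delta> ?K * ?l ^ j = (real j * ?l ^ j) * \<Delta> ?K" by (simp only: mult_ac)
            ultimately show ?thesis by linarith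
          qed
          finally show ?thesis by simp
        qed
        finally show "cexp \<tau> ?E' (\<lambda>\<tau>. F \<tau> * late \<tau> UNIV v T j (fst (\<tau> ?e))) \<le> ?g ?z" .
      qed
      also have "\<dots> = 4 * B (Suc ?J) * cexp \<sigma> E (\<lambda>\<tau>. visits \<sigma> E v j (fst (\<tau> ?e)))
          + real j * ?l ^ j * (\<Delta> ?J + cexp \<sigma> E (\<lambda>\<tau>. if fst (\<tau> ?e) \<in> ?A then 1 else 0) * \<Delta> (Suc ?J))"
      proof -
        have "cexp \<sigma> E (\<lambda>\<tau>. (if fst (\<tau> ?e) \<in> ?A then 1 else 0) * \<Delta> (Suc ?J))
            = cexp \<sigma> E (\<lambda>\<tau>. (if fst (\<tau> ?e) \<in> ?A then 1 else 0)) * \<Delta> (Suc ?J)"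
          using cexp_mult[of \<sigma> E "\<Delta> (Suc ?J)" "\<lambda>\<tau>. (if fst (\<tau> ?e) \<in> ?A then 1 else 0)"] by (simp add: mult.commute)
        thus ?thesis by (simp only: cexp_add cexp_mult cexp_const[OF \<sigma>])
      qed
      also have "\<dots> \<le> 4 * B (Suc ?J) * (real D * (2 + 4 * real ?J) / (real m - real s))
          + real j * ?l ^ j * (\<Delta> ?J + rate s * \<Delta> (Suc ?J))"
      proof (intro add_mono mult_left_mono mult_right_mono order_refl)
        have "cexp \<sigma> E (\<lambda>\<tau>. visits \<sigma> E v j (fst (\<tau> ?e))) \<le> (\<Sum>f\<in>heads. visits \<sigma> E v j (fst f)) / (real m - real (card E))"
          by (rule landing_sum[OF \<sigma> E e]) (use visits_nonneg[OF \<sigma>] head_fst in auto)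
        also have "\<dots> \<le> real D * (2 + 4 * real ?J) / (real m - real s)"
        proof (rule frac_le)
          have "(\<Sum>f\<in>heads. visits \<sigma> E v j (fst f)) \<le> real D * (\<Sum>u\<in>V. visits \<sigma> E v j u)"
            by (rule sum_heads_le) (rule visits_nonneg[OF \<sigma>])
          also have "\<dots> \<le> real D * (2 + 4 * real ?J)" using sumv by (intro mult_left_mono) auto
          finally show "(\<Sum>f\<in>heads. visits \<sigma> E v j (fst f)) \<le> real D * (2 + 4 * real ?J)" .
        qed (use Suc.prems s in auto)
        finally show "cexp \<sigma> E (\<lambda>\<tau>. visits \<sigma> E v j (fst (\<tau> ?e))) \<le> real D * (2 + 4 * real ?J) / (real m - real s)" .
        have "cexp \<sigma> E (\<lambda>\<tau>. (if fst (\<tau> ?e) \<in> ?A then 1 else 0)) \<le> 0 + 1 * rate s"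
        proof (rule reveal[OF \<sigma> E e _ s(2)])
          show "card E \<le> s" "finite ?A" using Suc.prems s finE by auto
          show "card ?A \<le> s + 5" using card_image_le[OF finE, of "fst \<circ> \<sigma>"] Suc.prems s by simp
          fix \<tau> assume "\<tau> \<in> ext \<sigma> E"
          hence \<tau>: "\<tau> \<in> S" by (rule ext_in_S)
          have "cexp \<tau> (insert ?e E) (\<lambda>\<tau>. if fst (\<tau> ?e) \<in> ?A then 1 else 0)
             = cexp \<tau> (insert ?e E) (\<lambda>_. if fst (\<tau> ?e) \<in> ?A then 1 else 0)"
            by (rule cexp_cong) (auto simp: ext_def)
          thus "cexp \<tau> (insert ?e E) (\<lambda>\<tau>. if fst (\<tau> ?e) \<in> ?A then 1 else 0) \<le> 0 + (if fst (\<tau> ?e) \<in> ?A then 1 else 0)"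
            using cexp_const[OF \<tau>] by simp
        qed auto
        thus "cexp \<sigma> E (\<lambda>\<tau>. (if fst (\<tau> ?e) \<in> ?A then 1 else 0)) \<le> rate s" by simp
      qed (use B(2)[of "Suc ?J"] \<Delta>0 lj[of j] in auto)
      also have "\<dots> \<le> \<Delta> ?J * ?l ^ Suc j + real j * ?l ^ j * (\<Delta> ?J * ?l)"
      proof (intro add_mono mult_left_mono)
        have "4 * B (Suc ?J) * (real D * (2 + 4 * real ?J) / (real m - real s)) \<le> \<Delta> ?J"
        proof -
          \<comment> \<open>Origin of the 16 in \<open>\<Delta>\<close>: a factor 4 for the inserted
            tail and \<open>2 + 4 J\<close> for the visits summed over all landing vertices.\<close>
          have "4 * B (Suc ?J) * (real D * (2 + 4 * real ?J)) \<le> 16 * (real ?J + 1) * B (Suc ?J) * real D"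
          proof -
            have "(4 * (2 + 4 * real ?J)) * (B (Suc ?J) * real D) \<le> (16 * (real ?J + 1)) * (B (Suc ?J) * real D)"
              using B(2) by (intro mult_right_mono) auto
            moreover have "4 * B (Suc ?J) * (real D * (2 + 4 * real ?J)) = (4 * (2 + 4 * real ?J)) * (B (Suc ?J) * real D)"
              "16 * (real ?J + 1) * B (Suc ?J) * real D = (16 * (real ?J + 1)) * (B (Suc ?J) * real D)"
              by (simp_all only: mult_ac)
            ultimately show ?thesis by linarith
          qed
          thus ?thesis unfolding \<Delta>_def times_divide_eq_right using pm by (intro divide_right_mono) auto
        qed
        also have "\<Delta> ?J \<le> \<Delta> ?J * ?l ^ Suc j" using \<Delta>0[of ?J] lj[of "Suc j"] mult_left_mono[of 1 "?l ^ Suc j" "\<Delta> ?J"] by simp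
        finally show "4 * B (Suc ?J) * (real D * (2 + 4 * real ?J) / (real m - real s)) \<le> \<Delta> ?J * ?l ^ Suc j" .
        have "rate s * \<Delta> (Suc ?J) \<le> \<Delta> ?J / real N" using small[of ?J] N by (simp add: pos_le_divide_eq)
        thus "\<Delta> ?J + rate s * \<Delta> (Suc ?J) \<le> \<Delta> ?J * ?l" by (simp add: algebra_simps)
      qed (use lj[of j] in auto)
      also have "\<dots> = ?R" by (simp add: algebra_simps)
      finally show ?thesis .
    qed
    have each: "cexp \<sigma> E (\<lambda>\<tau>. F \<tau> * late \<tau> UNIV v T j (fst (\<tau> (x, i)))) \<le>
        (if (x, i) \<in> E then B ?J * late \<sigma> E v T j (fst (\<sigma> (x, i))) else 0) + ?R" if i: "i < dout x" for i
    proof (cases "(x, i) \<in> E")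
      case True
      have "cexp \<sigma> E (\<lambda>\<tau>. F \<tau> * late \<tau> UNIV v T j (fst (\<tau> (x, i)))) = cexp \<sigma> E (\<lambda>\<tau>. F \<tau> * late \<tau> UNIV v T j (fst (\<sigma> (x, i))))"
        by (rule cexp_cong) (use True in \<open>auto simp: ext_def\<close>)
      also have "\<dots> \<le> B ?J * late \<sigma> E v T j (fst (\<sigma> (x, i))) + real j * \<Delta> ?J * ?l ^ j"
        by (rule Suc.IH) (use Suc.prems S_fst[OF \<sigma> x i] in auto)
      finally show ?thesis using True Jle by simp
    next
      case False thus ?thesis using new[OF i] by simp
    qed
    have ind: "cexp \<sigma> E (\<lambda>\<tau>. F \<tau> * (if x = v \<and> Suc j \<le> T then 1 else 0)) \<le> B ?J * (if x = v \<and> Suc j \<le> T then 1 else 0)"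
      using H[OF \<sigma> E] Suc.prems cexp_const[OF \<sigma>] by auto
    have "cexp \<sigma> E (\<lambda>\<tau>. F \<tau> * late \<tau> UNIV v T (Suc j) x) =
        cexp \<sigma> E (\<lambda>\<tau>. F \<tau> * (if x = v \<and> Suc j \<le> T then 1 else 0))
        + (\<Sum>i<dout x. cexp \<sigma> E (\<lambda>\<tau>. F \<tau> * late \<tau> UNIV v T j (fst (\<tau> (x, i))))) / real (dout x)"
      by (simp only: late.simps distrib_left cexp_add step_def)
         (simp add: sum_distrib_left cexp_divide cexp_sum)
    also have "\<dots> \<le> B ?J * (if x = v \<and> Suc j \<le> T then 1 else 0) +
        (\<Sum>i<dout x. (if (x, i) \<in> E then B ?J * late \<sigma> E v T j (fst (\<sigma> (x, i))) else 0) + ?R) / real (dout x)"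
      by (intro add_mono ind divide_right_mono sum_mono each) auto
    also have "\<dots> = B ?J * (if x = v \<and> Suc j \<le> T then 1 else 0) + B ?J * step \<sigma> E (late \<sigma> E v T j) x + ?R"
    proof -
      have "(\<Sum>i<dout x. (if (x, i) \<in> E then B ?J * late \<sigma> E v T j (fst (\<sigma> (x, i))) else 0))
         = B ?J * (\<Sum>i<dout x. (if (x, i) \<in> E then late \<sigma> E v T j (fst (\<sigma> (x, i))) else 0))"
        by (simp add: sum_distrib_left if_distrib cong: if_cong)
      moreover have "real (dout x) * ?R / real (dout x) = ?R" using dout_pos[OF x] by simp
      ultimately show ?thesis by (simp only: sum.distrib sum_constant card_lessThan add_divide_distrib step_def) simp
    qed
    finally show ?thesis by (simp add: algebra_simps)
  qed
qed

text \<open>Visits during the first \<open>H\<close> steps are not counted, so these steps only have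
  to be survived inside \<open>E\<close>; the other \<open>T\<close> steps contain at most
  \<open>T\<close> visits.\<close>

lemma late_le_stay:
  assumes \<sigma>: "\<sigma> \<in> S" shows "x \<in> V \<Longrightarrow> late \<sigma> E v T (H + T) x \<le> real T * stay \<sigma> E H x"
proof (induction H arbitrary: x)
  case 0
  have "late \<sigma> E v T j x \<le> real j" if "x \<in> V" for j x
    using that
  proof (induction j arbitrary: x)
    case (Suc j)
    have "step \<sigma> E (late \<sigma> E v T j) x \<le> real j" by (rule step_le_const) (use \<sigma> Suc in auto)
    thus ?case by auto
  qed auto
  thus ?case using 0 by simp
next
  case (Suc H)
  have "late \<sigma> E v T (Suc H + T) x \<le> step \<sigma> E (\<lambda>z. real T * stay \<sigma> E H z) x"
    using Suc by (auto intro!: step_mono \<sigma>)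
  thus ?case by (simp add: step_cmult)
qed

lemma pochhammer_mono: "0 \<le> a \<Longrightarrow> a \<le> (b::real) \<Longrightarrow> pochhammer a j \<le> pochhammer b j"
  unfolding pochhammer_prod by (intro prod_mono) auto

text \<open>Induction on the number \<open>j\<close> of walks, which share one starting point. One
  more walk turns the bound at excess \<open>J\<close> into \<open>c (J + 1)\<close> times the
  previous bound at excess \<open>J + 1\<close>, so the bounds are rising factorials, and with
  nothing revealed the result is \<open>c^k\<close> times \<open>k!\<close>. A walk reveals at most
  \<open>N\<close> tails, which is why \<open>j N\<close> tails of the budget \<open>s\<close> are
  reserved.\<close>

lemma cexp_late_power_le:
  fixes \<gamma> :: real and H T s :: nat
  defines "N \<equiv> H + T"
  defines "c \<equiv> \<gamma> + 48 * real N * real D / (real m - real s)"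
  assumes good: "\<And>\<tau>. \<tau> \<in> S \<Longrightarrow> good \<tau> \<Longrightarrow> green N \<tau>"
      "\<And>\<tau> E x. \<tau> \<in> S \<Longrightarrow> good \<tau> \<Longrightarrow> E \<subseteq> tails \<Longrightarrow> card E \<le> s \<Longrightarrow> x \<in> V \<Longrightarrow> real T * stay \<tau> E H x \<le> \<gamma>"
    and s: "k * N \<le> s" "s < m" and v: "v \<in> V" and x: "x \<in> V" and N: "0 < N" and \<gamma>: "0 \<le> \<gamma>"
    and small: "rate s * (2 + real k) * real N \<le> 1" and \<sigma>: "\<sigma> \<in> S"
  shows "cexp \<sigma> {} (\<lambda>\<tau>. (if good \<tau> then 1 else 0) * late \<tau> UNIV v T N x ^ k) \<le> (c * real k) ^ k"
proof -
  define B where "B = (\<lambda>j J. c ^ j * pochhammer (real J + 1) j)"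
  let ?F = "\<lambda>j \<tau>. (if good \<tau> then 1 else 0) * late \<tau> UNIV v T N x ^ j"
  have pm: "0 < real m - real s" using s by simp
  have c: "0 \<le> c" using \<gamma> pm by (simp add: c_def)
  have B0: "0 \<le> B j J" for j J using c by (simp add: B_def pochhammer_nonneg)
  have Bm: "mono (B j)" for j unfolding B_def using c
    by (intro monoI mult_left_mono pochhammer_mono) auto
  have main: "cexp \<sigma> E (?F j) \<le> B j (excess \<sigma> E)"
    if "j \<le> k" "\<sigma> \<in> S" "E \<subseteq> tails" "card E \<le> s - j * N" for j \<sigma> E
    using that
  proof (induction j arbitrary: \<sigma> E)
    case 0
    show ?case using 0 by (auto simp: B_def intro!: cexp_le)
  next
    case (Suc j)
    let ?J = "excess \<sigma> E"
    let ?\<Delta> = "\<lambda>J. 16 * (real J + 1) * B j (Suc J) * real D / (real m - real s)"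
    have kN: "Suc j * N \<le> s" using Suc.prems(1) s(1) by (meson mult_le_mono1 order_trans)
    have sm: "rate s * ?\<Delta> (Suc J) * real N \<le> ?\<Delta> J" for J
    proof -
      \<comment> \<open>By this identity, \<open>\<Delta>\<close> grows by the factor
        \<open>(J + 2 + j) / (J + 1)\<close> when the excess grows by one. It is at most
        \<open>2 + k\<close>, the factor that appears in \<open>small\<close>.\<close>
      have a: "(real J + 2) * pochhammer (real J + 3) j = pochhammer (real J + 2) j * (real J + 2 + real j)"
        using pochhammer_rec[of "real J + 2" j] pochhammer_Suc[of "real J + 2" j] by (simp add: algebra_simps)
      have p0: "0 \<le> pochhammer (real J + 2) j" by (rule pochhammer_nonneg) simp
      have "(real J + 2) * pochhammer (real J + 3) j \<le> (2 + real k) * ((real J + 1) * pochhammer (real J + 2) j)"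
      proof -
        have "real J + 2 + real j \<le> (2 + real k) * (real J + 1)"
        proof -
          have "real j \<le> real k" "0 \<le> real k * real J" using Suc.prems(1) by auto
          moreover have "(2 + real k) * (real J + 1) = 2 * real J + 2 + real k * real J + real k"
            by (simp add: algebra_simps)
          ultimately show ?thesis by linarith
        qed
        from mult_left_mono[OF this p0] show ?thesis unfolding a by (simp add: algebra_simps)
      qed
      from mult_left_mono[OF this, of "c ^ j"] c
      have b: "(real J + 2) * B j (Suc (Suc J)) \<le> (2 + real k) * ((real J + 1) * B j (Suc J))"
        by (simp add: B_def algebra_simps)
      have "?\<Delta> (Suc J) \<le> (2 + real k) * ?\<Delta> J"
      proof -
        have "16 * ((real J + 2) * B j (Suc (Suc J))) * real D / (real m - real s)
          \<le> 16 * ((2 + real k) * ((real J + 1) * B j (Suc J))) * real D / (real m - real s)"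
          using pm b by (intro divide_right_mono mult_right_mono mult_left_mono) auto
        thus ?thesis by (simp add: algebra_simps)
      qed
      hence "rate s * ?\<Delta> (Suc J) * real N \<le> rate s * ((2 + real k) * ?\<Delta> J) * real N"
        using rate_nonneg[OF s(2)] by (intro mult_right_mono mult_left_mono) auto
      also have "\<dots> = (rate s * (2 + real k) * real N) * ?\<Delta> J" by (simp only: mult_ac)
      also have "\<dots> \<le> 1 * ?\<Delta> J" using B0 pm by (intro mult_right_mono small) auto
      finally show ?thesis by simp
    qed
    have F_Suc: "?F (Suc j) = (\<lambda>\<tau>. ?F j \<tau> * late \<tau> UNIV v T N x)" by (intro HOL.ext) simp
    have pe: "B (Suc j) ?J = c * ((real ?J + 1) * B j (Suc ?J))"
      using pochhammer_rec[of "real ?J + 1" j] by (simp add: B_def algebra_simps)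
    show ?case
    proof (cases "\<exists>\<upsilon>\<in>ext \<sigma> E. good \<upsilon>")
      case False
      have "cexp \<sigma> E (?F (Suc j)) = cexp \<sigma> E (\<lambda>_. 0)" by (rule cexp_cong) (use False in auto)
      thus ?thesis using B0 cexp_const[OF Suc.prems(2)] by simp
    next
      case True
      then obtain \<upsilon> where \<upsilon>: "\<upsilon> \<in> ext \<sigma> E" "good \<upsilon>" by blast
      \<comment> \<open>\<open>late\<close> along \<open>E\<close> is determined by the revealed
        partners, so the bound \<open>\<gamma>\<close> may be taken from any single good
        completion.\<close>
      have "late \<sigma> E v T N x = late \<upsilon> E v T N x"
        by (rule late_agree) (use ext_agree[OF \<upsilon>(1)] in auto)
      also have "\<dots> \<le> real T * stay \<upsilon> E H x"
        unfolding N_def by (rule late_le_stay[OF ext_in_S[OF \<upsilon>(1)] x])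
      also have "\<dots> \<le> \<gamma>"
        by (rule good(2)) (use \<upsilon> ext_in_S Suc.prems x in auto)
      finally have lg: "late \<sigma> E v T N x \<le> \<gamma>" .
      have "cexp \<sigma> E (?F (Suc j)) \<le>
          B j ?J * late \<sigma> E v T N x + real N * ?\<Delta> ?J * (1 + 1 / real N) ^ N"
        unfolding F_Suc
      proof (rule cexp_late_le[where F="?F j" and r="s - j * N" and s=s, OF _ _ Bm B0])
        show "card E + N \<le> s - j * N" using Suc.prems(4) kN by simp
        show "cexp \<sigma>' E' (?F j) \<le> B j (excess \<sigma>' E')"
          if "\<sigma>' \<in> S" "E' \<subseteq> tails" "card E' \<le> s - j * N" for \<sigma>' E'
          by (rule Suc.IH) (use that Suc.prems in auto)
        show "rate s * ?\<Delta> (Suc J) * real N \<le> ?\<Delta> J" for J by (rule sm)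
        show "0 \<le> ?F j \<tau>" if "\<tau> \<in> S" for \<tau> using late_nonneg[OF that x] by simp
        show "green N \<tau>" if "\<tau> \<in> S" "?F j \<tau> \<noteq> 0" for \<tau> using that good(1) by (auto split: if_splits)
      qed (use Suc.prems s v x in auto)
      \<comment> \<open>The 3 bounds \<open>(1 + 1 / N) ^ N\<close>; together with the 16 in
        \<open>\<Delta>\<close> it makes the 48 in \<open>c\<close>.\<close>
      also have "\<dots> \<le> ((real ?J + 1) * B j (Suc ?J)) * \<gamma> + real N * ?\<Delta> ?J * 3"
      proof (intro add_mono mult_mono lg)
        have "B j ?J \<le> B j (Suc ?J)" using Bm by (rule monoD) simp
        also have "\<dots> \<le> (real ?J + 1) * B j (Suc ?J)" using B0[of j "Suc ?J"] by (simp add: algebra_simps)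
        finally show "B j ?J \<le> (real ?J + 1) * B j (Suc ?J)" .
        have "(1 + 1 / real N) ^ N \<le> exp (1 / real N) ^ N"
          by (intro power_mono exp_ge_add_one_self) auto
        also have "\<dots> = exp 1" using N by (simp add: exp_of_nat_mult[symmetric])
        also have "\<dots> \<le> 3" by (rule exp_le)
        finally show "(1 + 1 / real N) ^ N \<le> 3" .
      qed (use B0 pm late_nonneg[OF Suc.prems(2) x] in auto)
      also have "\<dots> = B (Suc j) ?J" unfolding pe by (simp add: c_def algebra_simps)
      finally show ?thesis .
    qed
  qed
  have "cexp \<sigma> {} (?F k) \<le> B k (excess \<sigma> {})" by (rule main) (use \<sigma> in auto)
  also have "\<dots> = c ^ k * fact k" by (simp add: B_def excess_def pochhammer_fact)
  also have "\<dots> \<le> c ^ k * real k ^ k"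
    using c fact_le_power[where ?'a=real and n=k] by (intro mult_left_mono) auto
  finally show ?thesis by (simp add: power_mult_distrib)
qed

end

section \<open>Environments in which no vertex has two bad children\<close>

lemma average_le_of_single_large:
  fixes a :: "nat \<Rightarrow> real"
  assumes d: "2 \<le> d" and a: "\<And>i. i < d \<Longrightarrow> a i \<le> 1" and c: "0 \<le> c" "c \<le> 1"
    and single: "\<And>i j. i < d \<Longrightarrow> j < d \<Longrightarrow> i \<noteq> j \<Longrightarrow> \<not> (a i > c \<and> a j > c)"
  shows "(\<Sum>i<d. a i) / real d \<le> (1 + c) / 2"
proof -
  obtain i0 where i0: "i0 < d" "\<And>i. i < d \<Longrightarrow> i \<noteq> i0 \<Longrightarrow> a i \<le> c"
  proof (cases "\<exists>i<d. a i > c")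
    case True
    then obtain i where "i < d" "a i > c" by blast
    thus ?thesis using single that[of i] by force
  qed (use d that[of 0] in force)
  have "(\<Sum>i<d. a i) \<le> (\<Sum>i<d. c + (if i = i0 then 1 - c else 0))"
    using a i0 by (intro sum_mono) auto
  also have "\<dots> = real d * c + (1 - c)" using i0(1) by (simp add: sum.distrib)
  finally have "(\<Sum>i<d. a i) / real d \<le> (real d * c + (1 - c)) / real d" by (rule divide_right_mono) simp
  also have "\<dots> = c + (1 - c) / real d" using d by (simp add: field_simps)
  also have "(1 - c) / real d \<le> (1 - c) / 2" using d c by (intro divide_left_mono) auto
  hence "c + (1 - c) / real d \<le> (1 + c) / 2" by (simp add: field_simps)
  finally show ?thesis .
qed

context dcm_model
begin

definition walk :: "(nat \<times> nat \<Rightarrow> nat \<times> nat) \<Rightarrow> nat \<Rightarrow> (nat \<Rightarrow> real) \<Rightarrow> nat \<Rightarrow> real" where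
  "walk \<sigma> t \<phi> = (step \<sigma> UNIV ^^ t) \<phi>"

lemma walk_0 [simp]: "walk \<sigma> 0 \<phi> = \<phi>" by (simp add: walk_def)
lemma walk_Suc: "walk \<sigma> (Suc t) \<phi> = step \<sigma> UNIV (walk \<sigma> t \<phi>)" by (simp add: walk_def)
lemma walk_Suc2: "walk \<sigma> (Suc t) \<phi> = walk \<sigma> t (step \<sigma> UNIV \<phi>)"
  by (simp add: walk_def funpow_swap1)

lemma walk_nonneg: "\<sigma> \<in> S \<Longrightarrow> x \<in> V \<Longrightarrow> (\<And>z. z \<in> V \<Longrightarrow> 0 \<le> \<phi> z) \<Longrightarrow> 0 \<le> walk \<sigma> t \<phi> x"
  by (induction t arbitrary: x) (auto simp: walk_Suc intro!: step_nonneg)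

lemma walk_mono:
  "\<sigma> \<in> S \<Longrightarrow> x \<in> V \<Longrightarrow> (\<And>z. z \<in> V \<Longrightarrow> \<phi> z \<le> \<psi> z) \<Longrightarrow> walk \<sigma> t \<phi> x \<le> walk \<sigma> t \<psi> x"
  by (induction t arbitrary: x) (auto simp: walk_Suc intro!: step_mono)

lemma walk_sum: "walk \<sigma> t (\<lambda>z. \<Sum>a\<in>A. \<phi> a z) = (\<lambda>x. \<Sum>a\<in>A. walk \<sigma> t (\<phi> a) x)"
  by (induction t) (auto simp: walk_Suc step_sum)

lemma walk_cmult: "walk \<sigma> t (\<lambda>z. c * \<phi> z) = (\<lambda>x. c * walk \<sigma> t \<phi> x)"
  by (induction t) (auto simp: walk_Suc step_cmult)

lemma meet_eq_sum:
  assumes \<sigma>: "\<sigma> \<in> S"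
  shows "a \<in> V \<Longrightarrow> b \<in> V \<Longrightarrow> meet \<sigma> c t a b
    = (\<Sum>w\<in>V. c w * walk \<sigma> t (\<lambda>x. if x = w then 1 else 0) a * walk \<sigma> t (\<lambda>x. if x = w then 1 else 0) b)"
proof (induction t arbitrary: a b)
  case 0
  have "(\<Sum>w\<in>V. c w * (if a = w then 1 else 0) * (if b = w then 1 else 0))
      = (\<Sum>w\<in>V. if w = a then c a * (if b = a then 1 else 0) else 0)"
    by (intro sum.cong) auto
  thus ?case using 0 by auto
next
  case (Suc t)
  let ?p = "\<lambda>t w. walk \<sigma> t (\<lambda>x. if x = w then 1 else 0)"
  have "meet \<sigma> c (Suc t) a b = step \<sigma> UNIV (\<lambda>z. step \<sigma> UNIV (\<lambda>z'. \<Sum>w\<in>V. c w * ?p t w z * ?p t w z') b) a"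
    unfolding meet.simps using Suc.prems Suc.IH \<sigma> by (intro step_cong) auto
  also have "\<dots> = (\<Sum>w\<in>V. c w * ?p (Suc t) w a * ?p (Suc t) w b)"
    unfolding step_sum step_cmult walk_Suc
    using step_cmult[of \<sigma> UNIV "c w * step \<sigma> UNIV (?p t w) b" "?p t w" a for w]
    by (simp add: mult_ac)
  finally show ?case .
qed

lemma hit_mono: "\<sigma> \<in> S \<Longrightarrow> x \<in> V \<Longrightarrow> hit \<sigma> W t x \<le> hit \<sigma> W (Suc t) x"
proof (induction t arbitrary: x)
  case 0 show ?case using hit_nonneg[OF 0, of W "Suc 0"] by auto
next
  case (Suc t)
  have "step \<sigma> UNIV (hit \<sigma> W t) x \<le> step \<sigma> UNIV (hit \<sigma> W (Suc t)) x"
    by (rule step_mono) (use Suc in auto)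
  thus ?case by simp
qed

lemma hit_mono_le: "t \<le> t' \<Longrightarrow> \<sigma> \<in> S \<Longrightarrow> x \<in> V \<Longrightarrow> hit \<sigma> W t x \<le> hit \<sigma> W t' x"
  by (rule lift_Suc_mono_le[of "\<lambda>t. hit \<sigma> W t x"]) (rule hit_mono, assumption+)

text \<open>One bad child is harmless, since the average over at least two children is still at most
  \<open>(1 + c) / 2\<close>; and one bad child cannot be excluded at all vertices, while two of
  them take two coincidences. \<open>\<Phi>\<close> may depend on the parent, as for the probability
  of returning to it.\<close>

definition one_bad_child ::
    "(nat \<Rightarrow> nat \<Rightarrow> real) \<Rightarrow> real \<Rightarrow> (nat \<times> nat \<Rightarrow> nat \<times> nat) \<Rightarrow> bool" where
  "one_bad_child \<Phi> c \<sigma> \<longleftrightarrow> (\<forall>y\<in>V. \<forall>i<dout y. \<forall>j<dout y. i \<noteq> j \<longrightarrow>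
     \<not> (\<Phi> y (fst (\<sigma> (y, i))) > c \<and> \<Phi> y (fst (\<sigma> (y, j))) > c))"

lemma step_one_bad_child:
  assumes "\<sigma> \<in> S" "y \<in> V" "one_bad_child \<Phi> c \<sigma>" "\<And>x. x \<in> V \<Longrightarrow> \<Phi> y x \<le> 1" "0 \<le> c" "c \<le> 1"
  shows "step \<sigma> UNIV (\<Phi> y) y \<le> (1 + c) / 2"
proof -
  have "(\<Sum>i<dout y. \<Phi> y (fst (\<sigma> (y, i)))) / real (dout y) \<le> (1 + c) / 2"
    by (rule average_le_of_single_large)
      (use assms V_dout S_fst in \<open>auto simp: one_bad_child_def\<close>)
  thus ?thesis by (simp add: step_def)
qed

text \<open>Decomposition at the first visit to \<open>w\<close>. At \<open>w\<close> itself the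
  return probability is at most \<open>(1 + 1/2) / 2 = 3/4\<close>, and
  \<open>1 + 4 * 3/4 = 4\<close> closes the induction.\<close>

lemma green_of_hits:
  assumes \<sigma>: "\<sigma> \<in> S" and o: "one_bad_child (\<lambda>y x. hit \<sigma> {y} N x) (1 / 2) \<sigma>"
  shows "green N \<sigma>"
  unfolding green_def
proof (intro ballI)
  fix w x assume w: "w \<in> V" and x: "x \<in> V"
  have "visits \<sigma> UNIV w t x \<le> 4 * hit \<sigma> {w} t x" if "t \<le> Suc N" for t
    using that x
  proof (induction t arbitrary: x)
    case 0 thus ?case using hit_nonneg[OF \<sigma>, of x "{w}" 0] by simp
  next
    case (Suc t)
    have "step \<sigma> UNIV (visits \<sigma> UNIV w t) x \<le> step \<sigma> UNIV (\<lambda>z. 4 * hit \<sigma> {w} t z) x"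
      by (rule step_mono[OF \<sigma>]) (use Suc in auto)
    also have "\<dots> = 4 * step \<sigma> UNIV (hit \<sigma> {w} t) x" by (rule step_cmult)
    finally have *: "step \<sigma> UNIV (visits \<sigma> UNIV w t) x \<le> 4 * step \<sigma> UNIV (hit \<sigma> {w} t) x" .
    show ?case
    proof (cases "x = w")
      case True
      have "step \<sigma> UNIV (hit \<sigma> {w} t) w \<le> step \<sigma> UNIV (hit \<sigma> {w} N) w"
        using Suc.prems \<sigma> w by (intro step_mono hit_mono_le) auto
      also have "\<dots> \<le> (1 + 1 / 2) / 2"
        by (rule step_one_bad_child[OF \<sigma> w o]) (auto intro: hit_le_1[OF \<sigma>])
      finally show ?thesis using * True by simp
    qed (use * in simp)
  qed
  from this[of "Suc N"] have "visits \<sigma> UNIV w (Suc N) x \<le> 4 * hit \<sigma> {w} (Suc N) x" by simp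
  also have "\<dots> \<le> 4" using hit_le_1[OF \<sigma> x, of "{w}" "Suc N"] by linarith
  finally show "visits \<sigma> UNIV w (Suc N) x \<le> 4" .
qed

lemma stay_le_1: "\<sigma> \<in> S \<Longrightarrow> x \<in> V \<Longrightarrow> stay \<sigma> E t x \<le> 1"
  by (induction t arbitrary: x) (auto intro!: step_le_const)

text \<open>The last of \<open>h + 1\<close> steps starts at the position at time \<open>h\<close>,
  which must be the source of a tail in \<open>E\<close>.\<close>

lemma stay_Suc_le_walk:
  assumes \<sigma>: "\<sigma> \<in> S" and E: "E \<subseteq> tails"
  shows "x \<in> V \<Longrightarrow> stay \<sigma> E (Suc h) x \<le> walk \<sigma> h (\<lambda>x. if x \<in> fst ` E then 1 else 0) x"
proof (induction h arbitrary: x)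
  case 0
  show ?case
  proof (cases "x \<in> fst ` E")
    case True thus ?thesis using stay_le_1[OF \<sigma>, of x E "Suc 0"] 0 by simp
  next
    case False
    hence "\<forall>i. (x, i) \<notin> E" by force
    thus ?thesis using False by (simp add: step_def)
  qed
next
  case (Suc h)
  have "stay \<sigma> E (Suc (Suc h)) x \<le> step \<sigma> E (walk \<sigma> h (\<lambda>x. if x \<in> fst ` E then 1 else 0)) x"
    unfolding stay.simps(2)[of \<sigma> E "Suc h"] by (rule step_mono[OF \<sigma>]) (use Suc in auto)
  also have "\<dots> \<le> step \<sigma> UNIV (walk \<sigma> h (\<lambda>x. if x \<in> fst ` E then 1 else 0)) x"
    by (rule step_mono_set[OF \<sigma>]) (use Suc in \<open>auto intro!: walk_nonneg[OF \<sigma>]\<close>)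
  finally show ?case by (simp add: walk_Suc)
qed

text \<open>Cauchy-Schwarz over the sources of \<open>E\<close>: remaining in a small set requires
  an \<open>h\<close>-step law of large \<open>L^2\<close> norm, that is, two walks likely to be
  together. The right side sees only the size of \<open>E\<close>, so one condition on the matching
  serves all exposed sets, where a union bound over these sets would fail.\<close>

lemma stay_Suc_square_le:
  assumes \<sigma>: "\<sigma> \<in> S" and E: "E \<subseteq> tails" and x: "x \<in> V"
  shows "(stay \<sigma> E (Suc h) x)\<^sup>2 \<le> real (card E) * meet \<sigma> (\<lambda>_. 1) h x x"
proof -
  let ?A = "fst ` E" and ?p = "\<lambda>w. walk \<sigma> h (\<lambda>x. if x = w then 1 else 0) x"
  have finE: "finite E" using E finite_subset by blast
  have AV: "?A \<subseteq> V" using E tail_fst by auto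
  have p0: "0 \<le> ?p w" for w by (rule walk_nonneg[OF \<sigma> x]) auto
  have "(\<lambda>x. if x \<in> ?A then 1 else 0) = (\<lambda>x. \<Sum>w\<in>?A. if x = w then 1 else (0::real))"
    using finE by (intro HOL.ext) simp
  hence "walk \<sigma> h (\<lambda>x. if x \<in> ?A then 1 else 0) x = (\<Sum>w\<in>?A. ?p w)" by (simp only: walk_sum)
  hence "stay \<sigma> E (Suc h) x \<le> (\<Sum>w\<in>?A. ?p w)" using stay_Suc_le_walk[OF \<sigma> E x, of h] by simp
  hence "(stay \<sigma> E (Suc h) x)\<^sup>2 \<le> (\<Sum>w\<in>?A. ?p w * 1)\<^sup>2"
    using stay_nonneg[OF \<sigma> x, of E "Suc h"] by (intro power_mono) auto
  also have "\<dots> \<le> (\<Sum>w\<in>?A. (?p w)\<^sup>2) * (\<Sum>w\<in>?A. 1\<^sup>2)" by (rule Cauchy_Schwarz_ineq_sum)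
  also have "\<dots> \<le> (\<Sum>w\<in>V. (?p w)\<^sup>2) * real (card E)"
    using AV card_image_le[OF finE, of fst] by (intro mult_mono sum_mono2) (auto intro: sum_nonneg)
  also have "(\<Sum>w\<in>V. (?p w)\<^sup>2) = meet \<sigma> (\<lambda>_. 1) h x x"
    using meet_eq_sum[OF \<sigma> x x] by (simp add: power2_eq_square)
  finally show ?thesis by (simp add: mult.commute)
qed

lemma stay_add_le:
  assumes \<sigma>: "\<sigma> \<in> S" and M: "\<And>z. z \<in> V \<Longrightarrow> stay \<sigma> E u z \<le> M"
  shows "x \<in> V \<Longrightarrow> stay \<sigma> E (t + u) x \<le> M * stay \<sigma> E t x"
proof (induction t arbitrary: x)
  case (Suc t)
  have "stay \<sigma> E (Suc t + u) x \<le> step \<sigma> E (\<lambda>z. M * stay \<sigma> E t z) x"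
    using Suc by (auto intro!: step_mono[OF \<sigma>])
  thus ?case by (simp add: step_cmult)
qed (use M in auto)

text \<open>Meeting probability at most \<open>\<theta>\<close> forces \<open>stay\<close> to be at
  most \<open>sqrt (1/16) = 1/4\<close>. A block of \<open>h + 2\<close> steps consists of one step
  to a child and \<open>h + 1\<close> further steps; with at most one bad child it is survived with
  probability at most \<open>(1 + 1/4) / 2 = 5/8\<close>.\<close>

lemma stay_le_of_meets:
  assumes \<sigma>: "\<sigma> \<in> S" and o: "one_bad_child (\<lambda>_ x. meet \<sigma> (\<lambda>_. 1) h x x) \<theta> \<sigma>"
    and E: "E \<subseteq> tails" "real (card E) * \<theta> \<le> 1 / 16" and x: "x \<in> V"
  shows "stay \<sigma> E (r * (h + 2)) x \<le> (5 / 8) ^ r"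
proof -
  have o': "one_bad_child (\<lambda>_. stay \<sigma> E (Suc h)) (1 / 4) \<sigma>"
    unfolding one_bad_child_def
  proof (intro ballI allI impI notI)
    fix y i j assume a: "y \<in> V" "i < dout y" "j < dout y" "i \<noteq> j"
      "1 / 4 < stay \<sigma> E (Suc h) (fst (\<sigma> (y, i))) \<and> 1 / 4 < stay \<sigma> E (Suc h) (fst (\<sigma> (y, j)))"
    have *: "\<theta> < meet \<sigma> (\<lambda>_. 1) h z z" if "1 / 4 < stay \<sigma> E (Suc h) z" "z \<in> V" for z
    proof (rule ccontr)
      assume "\<not> \<theta> < meet \<sigma> (\<lambda>_. 1) h z z"
      hence "real (card E) * meet \<sigma> (\<lambda>_. 1) h z z \<le> 1 / 16"
        using E(2) mult_left_mono[of "meet \<sigma> (\<lambda>_. 1) h z z" \<theta> "real (card E)"] by linarith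
      hence "(stay \<sigma> E (Suc h) z)\<^sup>2 \<le> 1 / 16" using stay_Suc_square_le[OF \<sigma> E(1) that(2), of h] by linarith
      moreover have "(1 / 4)\<^sup>2 < (stay \<sigma> E (Suc h) z)\<^sup>2" using that(1) by (intro power_strict_mono) auto
      ultimately show False by (simp add: power2_eq_square)
    qed
    show False using a * S_fst[OF \<sigma>] o unfolding one_bad_child_def by blast
  qed
  have one: "stay \<sigma> E (h + 2) y \<le> 5 / 8" if "y \<in> V" for y
  proof -
    have "stay \<sigma> E (h + 2) y = step \<sigma> E (stay \<sigma> E (Suc h)) y" by simp
    also have "\<dots> \<le> step \<sigma> UNIV (stay \<sigma> E (Suc h)) y"
      using that by (intro step_mono_set[OF \<sigma>] stay_nonneg[OF \<sigma>]) auto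
    also have "\<dots> \<le> (1 + 1 / 4) / 2"
      by (rule step_one_bad_child[OF \<sigma> that o']) (auto intro!: stay_le_1[OF \<sigma>] simp del: stay.simps)
    finally show ?thesis by simp
  qed
  show ?thesis using x
  proof (induction r)
    case (Suc r)
    have "stay \<sigma> E (Suc r * (h + 2)) x \<le> 5 / 8 * stay \<sigma> E (r * (h + 2)) x"
      using stay_add_le[OF \<sigma> one Suc.prems, of "r * (h + 2)"]
      by (simp only: mult_Suc add.commute[of "h + 2"])
    also have "\<dots> \<le> 5 / 8 * (5 / 8) ^ r" using Suc by (intro mult_left_mono) auto
    finally show ?case by simp
  qed simp
qed

text \<open>Markov's inequality for the product of the two values, which exceeds \<open>c^2\<close>
  at a bad pair, and a union bound over the at most \<open>K^2\<close> pairs at each of the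
  \<open>n\<close> vertices.\<close>

lemma cexp_not_one_bad_child:
  assumes \<Phi>: "\<And>\<tau> y x. \<tau> \<in> S \<Longrightarrow> y \<in> V \<Longrightarrow> x \<in> V \<Longrightarrow> 0 \<le> \<Phi> \<tau> y x"
    and pair: "\<And>y i j. y \<in> V \<Longrightarrow> i < dout y \<Longrightarrow> j < dout y \<Longrightarrow> i \<noteq> j \<Longrightarrow>
      cexp \<sigma> {} (\<lambda>\<tau>. \<Phi> \<tau> y (fst (\<tau> (y, i))) * \<Phi> \<tau> y (fst (\<tau> (y, j)))) \<le> b"
    and c: "0 < c" and K: "\<And>y. y \<in> V \<Longrightarrow> dout y \<le> K" and b: "0 \<le> b"
  shows "cexp \<sigma> {} (\<lambda>\<tau>. if one_bad_child (\<Phi> \<tau>) c \<tau> then 0 else 1) \<le> real n * (real K)\<^sup>2 * b / c\<^sup>2"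
proof -
  let ?g = "\<lambda>y i j \<tau>. \<Phi> \<tau> y (fst (\<tau> (y, i))) * \<Phi> \<tau> y (fst (\<tau> (y, j)))"
  have "cexp \<sigma> {} (\<lambda>\<tau>. if one_bad_child (\<Phi> \<tau>) c \<tau> then 0 else 1) \<le>
     cexp \<sigma> {} (\<lambda>\<tau>. \<Sum>y\<in>V. \<Sum>i<dout y. \<Sum>j<dout y. (if i \<noteq> j then 1 / c\<^sup>2 else 0) * ?g y i j \<tau>)"
  proof (rule cexp_mono)
    fix \<tau> assume "\<tau> \<in> ext \<sigma> {}"
    hence \<tau>: "\<tau> \<in> S" by (rule ext_in_S)
    have nn: "0 \<le> (if i \<noteq> j then 1 / c\<^sup>2 else 0) * ?g y i j \<tau>"
      if "y \<in> V" "i < dout y" "j < dout y" for y i j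
      using \<Phi>[OF \<tau>] S_fst[OF \<tau>] that by (intro mult_nonneg_nonneg) auto
    show "(if one_bad_child (\<Phi> \<tau>) c \<tau> then 0 else 1) \<le>
        (\<Sum>y\<in>V. \<Sum>i<dout y. \<Sum>j<dout y. (if i \<noteq> j then 1 / c\<^sup>2 else 0) * ?g y i j \<tau>)"
    proof (cases "one_bad_child (\<Phi> \<tau>) c \<tau>")
      case True thus ?thesis using nn by (auto intro!: sum_nonneg)
    next
      case False
      then obtain y i j where y: "y \<in> V" "i < dout y" "j < dout y" "i \<noteq> j"
        "\<Phi> \<tau> y (fst (\<tau> (y, i))) > c" "\<Phi> \<tau> y (fst (\<tau> (y, j))) > c"
        unfolding one_bad_child_def by blast
      have "1 = 1 / c\<^sup>2 * (c * c)" using c by (simp add: power2_eq_square)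
      also have "\<dots> \<le> 1 / c\<^sup>2 * ?g y i j \<tau>" using y c by (intro mult_left_mono mult_mono) auto
      also have "\<dots> = (if i \<noteq> j then 1 / c\<^sup>2 else 0) * ?g y i j \<tau>" using y by simp
      also have "\<dots> \<le> (\<Sum>j<dout y. (if i \<noteq> j then 1 / c\<^sup>2 else 0) * ?g y i j \<tau>)"
        by (rule member_le_sum) (use nn y in auto)
      also have "\<dots> \<le> (\<Sum>i<dout y. \<Sum>j<dout y. (if i \<noteq> j then 1 / c\<^sup>2 else 0) * ?g y i j \<tau>)"
        by (rule member_le_sum[of i _ "\<lambda>i. \<Sum>j<dout y. (if i \<noteq> j then 1 / c\<^sup>2 else 0) * ?g y i j \<tau>"])
          (use nn y in \<open>auto intro!: sum_nonneg\<close>)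
      also have "\<dots> \<le> (\<Sum>y\<in>V. \<Sum>i<dout y. \<Sum>j<dout y. (if i \<noteq> j then 1 / c\<^sup>2 else 0) * ?g y i j \<tau>)"
        by (rule member_le_sum[of y _ "\<lambda>y. \<Sum>i<dout y. \<Sum>j<dout y. (if i \<noteq> j then 1 / c\<^sup>2 else 0) * ?g y i j \<tau>"])
          (use nn y in \<open>auto intro!: sum_nonneg\<close>)
      finally show ?thesis using False by simp
    qed
  qed
  also have "\<dots> = (\<Sum>y\<in>V. \<Sum>i<dout y. \<Sum>j<dout y. (if i \<noteq> j then 1 / c\<^sup>2 else 0) * cexp \<sigma> {} (?g y i j))"
    by (simp only: cexp_sum cexp_mult)
  also have "\<dots> \<le> (\<Sum>y\<in>V. \<Sum>i<dout y. \<Sum>j<dout y. b / c\<^sup>2)"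
  proof (intro sum_mono)
    fix y i j assume "y \<in> V" "i \<in> {..<dout y}" "j \<in> {..<dout y}"
    thus "(if i \<noteq> j then 1 / c\<^sup>2 else 0) * cexp \<sigma> {} (?g y i j) \<le> b / c\<^sup>2"
      using pair[of y i j] b by (auto simp: divide_right_mono)
  qed
  also have "\<dots> = (\<Sum>y\<in>V. (real (dout y))\<^sup>2 * (b / c\<^sup>2))" by (simp add: power2_eq_square mult.assoc)
  also have "\<dots> \<le> (\<Sum>y\<in>V. (real K)\<^sup>2 * (b / c\<^sup>2))"
    using K b by (intro sum_mono mult_right_mono power_mono) auto
  also have "\<dots> = real n * (real K)\<^sup>2 * b / c\<^sup>2" by (simp add: V_def)
  finally show ?thesis .
qed

section \<open>Stationary distributions and the upper tail of the maximal mass\<close>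

lemma count_graph:
  "\<sigma> \<in> S \<Longrightarrow> y \<in> V \<Longrightarrow>
    count (graph_of_matching n dout \<sigma>) (y, x) = card {i. i < dout y \<and> fst (\<sigma> (y, i)) = x}"
proof -
  assume \<sigma>: "\<sigma> \<in> S" and y: "y \<in> V"
  have "count (graph_of_matching n dout \<sigma>) (y, x) = card {e \<in> tails. fst e = y \<and> fst (\<sigma> e) = x}"
    unfolding graph_of_matching_def count_image_mset
    by (simp add: sum.If_cases vimage_def Int_def conj_commute cong: conj_cong)
  also have "{e \<in> tails. fst e = y \<and> fst (\<sigma> e) = x} = (\<lambda>i. (y, i)) ` {i. i < dout y \<and> fst (\<sigma> (y, i)) = x}"
    using y by (auto simp: in_tails image_def)
  also have "card \<dots> = card {i. i < dout y \<and> fst (\<sigma> (y, i)) = x}"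
    by (rule card_image) (auto simp: inj_on_def)
  finally show ?thesis .
qed

lemma stationary_step:
  assumes \<sigma>: "\<sigma> \<in> S" and p: "stationary n dout (graph_of_matching n dout \<sigma>) p"
  shows "(\<Sum>y\<in>V. pmf p y * step \<sigma> UNIV \<phi> y) = (\<Sum>x\<in>V. pmf p x * \<phi> x)"
proof -
  let ?t = "transition dout (graph_of_matching n dout \<sigma>)"
  have st: "step \<sigma> UNIV \<phi> y = (\<Sum>x\<in>V. ?t y x * \<phi> x)" if y: "y \<in> V" for y
  proof -
    have "(\<Sum>i<dout y. \<phi> (fst (\<sigma> (y, i)))) = (\<Sum>i<dout y. \<Sum>x\<in>V. if fst (\<sigma> (y, i)) = x then \<phi> x else 0)"
      using S_fst[OF \<sigma> y] by (intro sum.cong) auto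
    also have "\<dots> = (\<Sum>x\<in>V. \<Sum>i<dout y. if fst (\<sigma> (y, i)) = x then \<phi> x else 0)" by (rule sum.swap)
    also have "\<dots> = (\<Sum>x\<in>V. real (card {i. i < dout y \<and> fst (\<sigma> (y, i)) = x}) * \<phi> x)"
      by (intro sum.cong refl) (simp add: sum.If_cases Int_def)
    finally show ?thesis
      by (simp add: step_def transition_def count_graph[OF \<sigma> y] sum_divide_distrib)
  qed
  have "(\<Sum>y\<in>V. pmf p y * step \<sigma> UNIV \<phi> y) = (\<Sum>y\<in>V. \<Sum>x\<in>V. pmf p y * ?t y x * \<phi> x)"
    using st by (simp add: sum_distrib_left mult.assoc)
  also have "\<dots> = (\<Sum>x\<in>V. \<Sum>y\<in>V. pmf p y * ?t y x * \<phi> x)" by (rule sum.swap)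
  also have "\<dots> = (\<Sum>x\<in>V. pmf p x * \<phi> x)"
    using p by (simp add: stationary_def V_def sum_distrib_right[symmetric])
  finally show ?thesis .
qed

lemma stationary_sum_1:
  "stationary n dout G p \<Longrightarrow> (\<Sum>y\<in>V. pmf p y) = 1"
  by (simp add: stationary_def V_def sum_pmf_eq_1)

lemma stationary_walk:
  assumes "\<sigma> \<in> S" "stationary n dout (graph_of_matching n dout \<sigma>) p"
  shows "(\<Sum>y\<in>V. pmf p y * walk \<sigma> t \<phi> y) = (\<Sum>x\<in>V. pmf p x * \<phi> x)"
  by (induction t) (simp_all add: walk_Suc stationary_step[OF assms])

lemma stationary_late:
  assumes \<sigma>: "\<sigma> \<in> S" and p: "stationary n dout (graph_of_matching n dout \<sigma>) p" and v: "v \<in> V"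
  shows "(\<Sum>y\<in>V. pmf p y * late \<sigma> UNIV v T j y) = real (min j T) * pmf p v"
proof (induction j)
  case (Suc j)
  have "(\<Sum>y\<in>V. pmf p y * late \<sigma> UNIV v T (Suc j) y)
      = (\<Sum>y\<in>V. if y = v then (if Suc j \<le> T then pmf p v else 0) else 0)
        + (\<Sum>y\<in>V. pmf p y * step \<sigma> UNIV (late \<sigma> UNIV v T j) y)"
    unfolding sum.distrib[symmetric] by (intro sum.cong) (auto simp: algebra_simps)
  also have "\<dots> = (if Suc j \<le> T then pmf p v else 0) + real (min j T) * pmf p v"
    using v by (simp add: stationary_step[OF \<sigma> p] Suc)
  also have "\<dots> = real (min (Suc j) T) * pmf p v" by (simp add: algebra_simps min_def)
  finally show ?case .
qed auto

lemma max_mass_le: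
  assumes "\<And>v. v \<in> V \<Longrightarrow> pmf p v \<le> b" shows "max_mass n p \<le> b"
  using assms n_pos by (auto simp: max_mass_def V_def)

lemma pmf_le_max_mass: "v \<in> V \<Longrightarrow> pmf p v \<le> max_mass n p"
  by (simp add: max_mass_def V_def)

text \<open>Under stationarity the mean of \<open>late\<close> is exactly
  \<open>T * pmf p v\<close>, and a mean is at most the largest value over the starting points. This
  holds for every stationary \<open>p\<close>.\<close>

lemma stationary_mass_le:
  assumes \<sigma>: "\<sigma> \<in> S" and p: "stationary n dout (graph_of_matching n dout \<sigma>) p" and v: "v \<in> V"
    and T: "0 < T" and U: "\<And>x. x \<in> V \<Longrightarrow> late \<sigma> UNIV v T (H + T) x \<le> U"
  shows "pmf p v \<le> U / real T"
proof -
  have "real T * pmf p v = (\<Sum>y\<in>V. pmf p y * late \<sigma> UNIV v T (H + T) y)"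
    using stationary_late[OF \<sigma> p v, of T "H + T"] by simp
  also have "\<dots> \<le> (\<Sum>y\<in>V. pmf p y * U)" using U by (intro sum_mono mult_left_mono) auto
  also have "\<dots> = U" using stationary_sum_1[OF p] by (simp add: sum_distrib_right[symmetric])
  finally show ?thesis using T by (simp add: pos_le_divide_eq mult.commute)
qed

text \<open>The three error terms: two children of a vertex with likely returns, two children with
  likely meetings, and Markov's inequality for the \<open>k\<close>-th moment at each of
  \<open>n^2\<close> pairs. The \<open>exp 4\<close> in the threshold turns the last one into
  \<open>exp (- 4 k)\<close>. Burn-in and counting window have the same length \<open>H\<close>, so
  dividing by \<open>H\<close> leaves a bounded multiple of \<open>\<delta>\<close> apart from
  \<open>\<gamma>\<close>. The event ranges over all stationary \<open>p\<close> and thereby covers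
  any choice of one.\<close>

theorem max_mass_tail:
  fixes k h H T s r K :: nat
  defines "H \<equiv> r * (h + 2)"
  defines "N \<equiv> 2 * H"
  defines "\<gamma> \<equiv> real H * (5 / 8) ^ r"
  defines "c \<equiv> \<gamma> + 48 * real N * real D / (real m - real s)"
  assumes pos: "0 < r" "0 < k" and s: "k * N \<le> s" "2 + 2 * N \<le> s" "2 + 4 * h \<le> s" "s < m"
    and small: "rate s * (2 + real k) * real N \<le> 1" and K: "\<And>y. y \<in> V \<Longrightarrow> dout y \<le> K"
    and \<sigma>: "\<sigma> \<in> S"
  shows "cexp \<sigma> {} (\<lambda>\<tau>. if \<exists>p. stationary n dout (graph_of_matching n dout \<tau>) p
        \<and> max_mass n p > exp 4 * c * real k / real H then 1 else 0)
    \<le> 4 * real n * (real K)\<^sup>2 * ((real N + 1) * rate s)\<^sup>2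
      + 256 * (real s)\<^sup>2 * real n * (real K)\<^sup>2 * (1 / 2 ^ h + (2 * real h + 1) * rate s)\<^sup>2
      + (real n)\<^sup>2 * exp (- 4 * real k)"
proof -
  let ?o1 = "\<lambda>\<tau>. one_bad_child (\<lambda>y x. hit \<tau> {y} N x) (1 / 2) \<tau>"
  \<comment> \<open>With this value every exposed set of at most \<open>s\<close> tails satisfies
    the size condition of \<open>stay_le_of_meets\<close>; \<open>1 / \<theta>^2\<close> is the
    factor \<open>256 s^2\<close> in the claim.\<close>
  define \<theta> where "\<theta> = 1 / (16 * real s)"
  let ?o2 = "\<lambda>\<tau>. one_bad_child (\<lambda>_ x. meet \<tau> (\<lambda>_. 1) h x x) \<theta> \<tau>"
  define good where "good \<tau> \<longleftrightarrow> ?o1 \<tau> \<and> ?o2 \<tau>" for \<tau>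
  define U where "U = exp 4 * c * real k"
  let ?L = "\<lambda>\<tau> v x. late \<tau> UNIV v H N x"
  have s0: "0 < real s" using s by simp
  have \<theta>: "0 < \<theta>" "real s * \<theta> = 1 / 16" using s0 by (auto simp: \<theta>_def)
  have pm: "0 < real m - real s" using s by simp
  have H0: "0 < H" using pos by (simp add: H_def)
  have N0: "0 < N" using H0 by (simp add: N_def)
  have c0: "0 < c" unfolding c_def \<gamma>_def using H0 N0 D_pos pm by (intro add_nonneg_pos) auto
  have U0: "0 < U" using c0 pos by (simp add: U_def)
  have q: "0 \<le> rate s" by (rule rate_nonneg[OF s(4)])
  have p1: "cexp \<sigma> {} (\<lambda>\<tau>. if ?o1 \<tau> then 0 else 1) \<le> real n * (real K)\<^sup>2 * ((real N * rate s + rate s)\<^sup>2) / (1 / 2)\<^sup>2"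
  proof (rule cexp_not_one_bad_child[OF _ _ _ K])
    fix y i j assume y: "y \<in> V" "i < dout y" "j < dout y" "i \<noteq> j"
    show "cexp \<sigma> {} (\<lambda>\<tau>. hit \<tau> {y} N (fst (\<tau> (y, i))) * hit \<tau> {y} N (fst (\<tau> (y, j)))) \<le> (real N * rate s + rate s)\<^sup>2"
    proof (rule two_children[OF _ y s(2,4) _ _ \<sigma>])
      fix F Z r' \<beta> \<sigma>' E x
      assume a: "bounded_off F Z r' \<beta>" "\<And>\<tau>. \<tau> \<in> S \<Longrightarrow> 0 \<le> F \<tau>" "0 \<le> \<beta>" "r' \<le> s"
        "finite Z" "card Z \<le> 1" "\<sigma>' \<in> S" "E \<subseteq> tails" "card E + N \<le> r'" "fst ` E \<inter> Z = {}"
        "x \<in> V" "x \<notin> fst ` E" "x \<notin> Z" "x \<noteq> y"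
      show "cexp \<sigma>' E (\<lambda>\<tau>. F \<tau> * hit \<tau> {y} N x) \<le> \<beta> * (real N * rate s)"
        by (rule cexp_hit_le[OF a(1-4) s(4) a(5)]) (use a in auto)
    qed (use q hit_nonneg hit_le_1 in auto)
  qed (use hit_nonneg in auto)
  have p2: "cexp \<sigma> {} (\<lambda>\<tau>. if ?o2 \<tau> then 0 else 1)
      \<le> real n * (real K)\<^sup>2 * ((1 / 2 ^ h + 2 * real h * rate s + rate s)\<^sup>2) / \<theta>\<^sup>2"
  proof (rule cexp_not_one_bad_child[OF _ _ \<theta>(1) K])
    fix y i j assume y: "y \<in> V" "i < dout y" "j < dout y" "i \<noteq> j"
    show "cexp \<sigma> {} (\<lambda>\<tau>. meet \<tau> (\<lambda>_. 1) h (fst (\<tau> (y, i))) (fst (\<tau> (y, i))) * meet \<tau> (\<lambda>_. 1) h (fst (\<tau> (y, j))) (fst (\<tau> (y, j))))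
       \<le> (1 / 2 ^ h + 2 * real h * rate s + rate s)\<^sup>2"
    proof (rule two_children[OF _ y _ s(4) _ _ \<sigma>, where \<Phi>="\<lambda>\<tau> x. meet \<tau> (\<lambda>_. 1) h x x" and L="2 * h"])
      fix F Z r' \<beta> \<sigma>' E x
      assume a: "bounded_off F Z r' \<beta>" "\<And>\<tau>. \<tau> \<in> S \<Longrightarrow> 0 \<le> F \<tau>" "0 \<le> \<beta>" "r' \<le> s"
        "finite Z" "card Z \<le> 1" "\<sigma>' \<in> S" "E \<subseteq> tails" "card E + 2 * h \<le> r'" "fst ` E \<inter> Z = {}"
        "x \<in> V" "x \<notin> fst ` E" "x \<notin> Z" "x \<noteq> y"
      have "cexp \<sigma>' E (\<lambda>\<tau>. F \<tau> * meet \<tau> (\<lambda>_. 1) h x x) \<le> \<beta> * ((if x = x then 1 / 2 ^ h else 0) + 2 * real h * rate s)"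
        by (rule cexp_meet_le[OF a(1-4) s(4) a(5)]) (use a in auto)
      thus "cexp \<sigma>' E (\<lambda>\<tau>. F \<tau> * meet \<tau> (\<lambda>_. 1) h x x) \<le> \<beta> * (1 / 2 ^ h + 2 * real h * rate s)" by simp
    qed (use q s meet_nonneg meet_le_1 in auto)
  qed (use meet_nonneg in auto)
  have p3: "cexp \<sigma> {} (\<lambda>\<tau>. if good \<tau> \<and> ?L \<tau> v x > U then 1 else 0) \<le> exp (- 4 * real k)"
    if v: "v \<in> V" and x: "x \<in> V" for v x
  proof -
    have "cexp \<sigma> {} (\<lambda>\<tau>. if good \<tau> \<and> ?L \<tau> v x > U then 1 else 0) \<le>
       cexp \<sigma> {} (\<lambda>\<tau>. (1 / U ^ k) * ((if good \<tau> then 1 else 0) * ?L \<tau> v x ^ k))"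
    proof (rule cexp_mono)
      fix \<tau> assume "\<tau> \<in> ext \<sigma> {}"
      hence \<tau>: "\<tau> \<in> S" by (rule ext_in_S)
      have "U ^ k \<le> ?L \<tau> v x ^ k" if "?L \<tau> v x > U" using that U0 by (intro power_mono) auto
      thus "(if good \<tau> \<and> ?L \<tau> v x > U then 1 else 0) \<le> (1 / U ^ k) * ((if good \<tau> then 1 else 0) * ?L \<tau> v x ^ k)"
        using U0 late_nonneg[OF \<tau> x] by (auto simp: field_simps)
    qed
    also have "\<dots> = (1 / U ^ k) * cexp \<sigma> {} (\<lambda>\<tau>. (if good \<tau> then 1 else 0) * ?L \<tau> v x ^ k)" by (rule cexp_mult)
    also have "\<dots> \<le> (1 / U ^ k) * (c * real k) ^ k"
    proof (intro mult_left_mono)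
      have NN: "N = H + H" by (simp add: N_def)
      show "cexp \<sigma> {} (\<lambda>\<tau>. (if good \<tau> then 1 else 0) * ?L \<tau> v x ^ k) \<le> (c * real k) ^ k"
        unfolding c_def NN
      proof (rule cexp_late_power_le[OF _ _ _ s(4) v x])
        show "green (H + H) \<tau>" if "\<tau> \<in> S" "good \<tau>" for \<tau>
          using green_of_hits[OF that(1), of N] that(2) by (simp add: good_def NN)
        show "real H * stay \<tau> E H y \<le> \<gamma>"
          if a: "\<tau> \<in> S" "good \<tau>" "E \<subseteq> tails" "card E \<le> s" "y \<in> V" for \<tau> E y
        proof -
          have "real (card E) * \<theta> \<le> 1 / 16"
          proof -
            have "real (card E) * \<theta> \<le> real s * \<theta>" using a(4) \<theta>(1) by (intro mult_right_mono) auto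
            thus ?thesis using \<theta>(2) by simp
          qed
          hence "stay \<tau> E H y \<le> (5 / 8) ^ r"
            unfolding H_def using a by (intro stay_le_of_meets) (auto simp: good_def)
          thus ?thesis unfolding \<gamma>_def by (intro mult_left_mono) auto
        qed
        show "0 \<le> \<gamma>" by (simp add: \<gamma>_def)
        show "k * (H + H) \<le> s" using s(1) by (simp only: NN)
        show "rate s * (2 + real k) * real (H + H) \<le> 1" using small by (simp only: NN)
        show "0 < H + H" using H0 by simp
        show "\<sigma> \<in> S" by (rule \<sigma>)
      qed
    qed (use U0 in auto)
    also have "\<dots> = exp (- 4 * real k)"
    proof -
      have "U ^ k = exp 4 ^ k * (c * real k) ^ k" by (simp add: U_def power_mult_distrib)
      moreover have "exp (- 4 * real k) = 1 / exp 4 ^ k"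
        by (simp add: exp_of_nat_mult[symmetric] exp_minus field_simps)
      ultimately show ?thesis using c0 pos by simp
    qed
    finally show ?thesis .
  qed
  have "cexp \<sigma> {} (\<lambda>\<tau>. if \<exists>p. stationary n dout (graph_of_matching n dout \<tau>) p
        \<and> max_mass n p > exp 4 * c * real k / real H then 1 else 0)
    \<le> cexp \<sigma> {} (\<lambda>\<tau>. (if ?o1 \<tau> then 0 else 1) + (if ?o2 \<tau> then 0 else 1) +
        (\<Sum>v\<in>V. \<Sum>x\<in>V. if good \<tau> \<and> ?L \<tau> v x > U then 1 else 0))"
  proof (rule cexp_mono)
    fix \<tau> assume "\<tau> \<in> ext \<sigma> {}"
    hence \<tau>: "\<tau> \<in> S" by (rule ext_in_S)
    let ?X = "\<Sum>v\<in>V. \<Sum>x\<in>V. if good \<tau> \<and> ?L \<tau> v x > U then 1 else (0::real)"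
    have X0: "0 \<le> ?X" by (intro sum_nonneg) auto
    show "(if \<exists>p. stationary n dout (graph_of_matching n dout \<tau>) p
        \<and> max_mass n p > exp 4 * c * real k / real H then 1 else 0) \<le>
       (if ?o1 \<tau> then 0 else 1) + (if ?o2 \<tau> then 0 else 1) + ?X"
    proof (cases "good \<tau> \<and> (\<exists>p. stationary n dout (graph_of_matching n dout \<tau>) p
        \<and> max_mass n p > exp 4 * c * real k / real H)")
      case True
      then obtain p where p: "stationary n dout (graph_of_matching n dout \<tau>) p"
        "max_mass n p > U / real H" by (auto simp: U_def)
      have "\<exists>v\<in>V. \<exists>x\<in>V. ?L \<tau> v x > U"
      proof (rule ccontr)
        assume "\<not> ?thesis"
        hence "pmf p v \<le> U / real H" if "v \<in> V" for v
          using stationary_mass_le[OF \<tau> p(1) that H0, of H U] that by (auto simp: N_def mult_2 not_less)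
        hence "max_mass n p \<le> U / real H" by (rule max_mass_le)
        thus False using p(2) by simp
      qed
      then obtain v x where vx: "v \<in> V" "x \<in> V" "?L \<tau> v x > U" by blast
      have "1 = (if good \<tau> \<and> ?L \<tau> v x > U then 1 else (0::real))" using True vx by simp
      also have "\<dots> \<le> (\<Sum>x\<in>V. if good \<tau> \<and> ?L \<tau> v x > U then 1 else 0)"
        by (rule member_le_sum) (use vx in auto)
      also have "\<dots> \<le> ?X"
        by (rule member_le_sum[of v _ "\<lambda>v. \<Sum>x\<in>V. if good \<tau> \<and> ?L \<tau> v x > U then 1 else (0::real)"])
          (use vx in \<open>auto intro!: sum_nonneg\<close>)
      finally have "1 \<le> ?X" .
      thus ?thesis by auto
    next
      case False
      thus ?thesis using X0 by (auto simp: good_def)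
    qed
  qed
  also have "\<dots> = cexp \<sigma> {} (\<lambda>\<tau>. if ?o1 \<tau> then 0 else 1) + cexp \<sigma> {} (\<lambda>\<tau>. if ?o2 \<tau> then 0 else 1)
      + (\<Sum>v\<in>V. \<Sum>x\<in>V. cexp \<sigma> {} (\<lambda>\<tau>. if good \<tau> \<and> ?L \<tau> v x > U then 1 else 0))"
    by (simp only: cexp_add cexp_sum)
  also have "\<dots> \<le> real n * (real K)\<^sup>2 * ((real N * rate s + rate s)\<^sup>2) / (1 / 2)\<^sup>2
      + real n * (real K)\<^sup>2 * ((1 / 2 ^ h + 2 * real h * rate s + rate s)\<^sup>2) / \<theta>\<^sup>2
      + (\<Sum>v\<in>V. \<Sum>x\<in>V. exp (- 4 * real k))"
    by (intro add_mono p1 p2 sum_mono p3)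
  also have "\<dots> = 4 * real n * (real K)\<^sup>2 * ((real N + 1) * rate s)\<^sup>2
      + 256 * (real s)\<^sup>2 * real n * (real K)\<^sup>2 * (1 / 2 ^ h + (2 * real h + 1) * rate s)\<^sup>2
      + (real n)\<^sup>2 * exp (- 4 * real k)"
  proof -
    have "X / \<theta>\<^sup>2 = 256 * (real s)\<^sup>2 * X" for X using s0 by (simp add: \<theta>_def power2_eq_square)
    thus ?thesis by (simp add: V_def power2_eq_square algebra_simps)
  qed
  finally show ?thesis .
qed

section \<open>Meeting probabilities of two walks\<close>

text \<open>Bounds the probability that two new tails land at a common vertex. It involves the
  second moment of the in-degrees and not their maximum, and is thus of order \<open>1 / n\<close>
  in the application.\<close>

definition pair_rate :: "nat \<Rightarrow> real" where
  "pair_rate s = (\<Sum>v\<in>V. (real (din v))\<^sup>2) / (real m - real s)\<^sup>2"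

lemma pair_rate_nonneg: "0 \<le> pair_rate s"
  by (auto simp: pair_rate_def intro!: divide_nonneg_nonneg sum_nonneg)

text \<open>The outcomes of two landings: no coincidence, a common fresh vertex, one exposed vertex,
  two exposed vertices. They are kept apart so that a single coincidence can still be multiplied by
  the probability of a second one.\<close>

lemma cexp_two_landings:
  assumes \<sigma>: "\<sigma> \<in> S" and E: "E \<subseteq> tails" and e: "e \<in> tails - E" and e': "e' \<in> tails - E" "e \<noteq> e'"
    and s: "card E + 2 \<le> s" "s < m" and A: "finite A" "card A \<le> s + 5"
    and b: "0 \<le> b1" "0 \<le> b2" "0 \<le> b3"
    and H: "\<And>\<tau> z z'. \<tau> \<in> ext \<sigma> E \<Longrightarrow> z \<in> V \<Longrightarrow> z' \<in> V \<Longrightarrow>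
       cexp \<tau> (insert e' (insert e E)) (\<lambda>\<upsilon>. \<phi> \<upsilon> z z') \<le>
       (if z \<in> A then if z' \<in> A then 1 else b3 else if z' \<in> A then b3 else if z = z' then b2 else b1)"
  shows "cexp \<sigma> E (\<lambda>\<upsilon>. \<phi> \<upsilon> (fst (\<upsilon> e)) (fst (\<upsilon> e')))
    \<le> b1 + pair_rate s * b2 + 2 * rate s * b3 + (rate s)\<^sup>2"
proof -
  let ?i = "\<lambda>f. if fst f \<in> A then 1 else (0::real)"
  let ?k = "\<lambda>f f'. if fst f = fst f' then 1 else (0::real)"
  have pm: "0 < real m - real s" using s by simp
  have ind: "cexp \<sigma> E (\<lambda>\<tau>. ?i (\<tau> d)) \<le> rate s" if d: "d \<in> tails - E" for d
  proof -
    have "cexp \<sigma> E (\<lambda>\<tau>. ?i (\<tau> d)) \<le> (\<Sum>f\<in>heads. ?i f) / (real m - real (card E))"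
      by (rule landing_sum[OF \<sigma> E d]) auto
    also have "\<dots> \<le> ((real s + 5) * real D) / (real m - real s)"
      using heads_in_set[OF A(1)] A(2) s
      by (intro frac_le order_trans[OF heads_in_set[OF A(1)]] mult_right_mono) auto
    finally show ?thesis by (simp add: rate_def)
  qed
  have both: "cexp \<sigma> E (\<lambda>\<tau>. ?i (\<tau> e) * ?i (\<tau> e')) \<le> (rate s)\<^sup>2"
  proof -
    have "cexp \<sigma> E (\<lambda>\<tau>. ?i (\<tau> e) * ?i (\<tau> e')) \<le> (\<Sum>f\<in>heads. \<Sum>f'\<in>heads. ?i f * ?i f') / (real m - real s)^2"
      by (rule landing_pair_sum[OF \<sigma> E e e' _ s(2)]) (use s in auto)
    also have "\<dots> = ((\<Sum>f\<in>heads. ?i f) / (real m - real s))\<^sup>2"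
      by (simp only: sum_product[symmetric] power2_eq_square) simp
    also have "\<dots> \<le> (rate s)\<^sup>2" unfolding rate_def
      using heads_in_set[OF A(1)] A(2) pm
      by (intro power_mono divide_right_mono order_trans[OF heads_in_set[OF A(1)]] mult_right_mono
          divide_nonneg_pos sum_nonneg) auto
    finally show ?thesis .
  qed
  have same: "cexp \<sigma> E (\<lambda>\<tau>. ?k (\<tau> e) (\<tau> e')) \<le> pair_rate s"
  proof -
    have "cexp \<sigma> E (\<lambda>\<tau>. ?k (\<tau> e) (\<tau> e')) \<le> (\<Sum>f\<in>heads. \<Sum>f'\<in>heads. ?k f f') / (real m - real s)^2"
      by (rule landing_pair_sum[OF \<sigma> E e e' _ s(2)]) (use s in auto)
    also have "(\<Sum>f\<in>heads. \<Sum>f'\<in>heads. ?k f f') = (\<Sum>f\<in>heads. real (din (fst f)))"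
    proof (rule sum.cong[OF refl])
      fix f assume f: "f \<in> heads"
      have "(\<Sum>f'\<in>heads. ?k f f') = (\<Sum>v\<in>V. real (din v) * (if fst f = v then 1 else 0))"
        by (rule sum_heads[of "\<lambda>v. if fst f = v then 1 else 0"])
      also have "\<dots> = (\<Sum>v\<in>V. if fst f = v then real (din v) else 0)" by (rule sum.cong) auto
      finally show "(\<Sum>f'\<in>heads. ?k f f') = real (din (fst f))" using head_fst[OF f] by simp
    qed
    also have "\<dots> = (\<Sum>v\<in>V. (real (din v))\<^sup>2)"
      by (simp add: sum_heads[of "\<lambda>v. real (din v)"] power2_eq_square)
    finally show ?thesis by (simp add: pair_rate_def)
  qed
  have "cexp \<sigma> E (\<lambda>\<upsilon>. \<phi> \<upsilon> (fst (\<upsilon> e)) (fst (\<upsilon> e')))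
     = cexp \<sigma> E (\<lambda>\<tau>. cexp \<tau> (insert e' (insert e E)) (\<lambda>\<upsilon>. \<phi> \<upsilon> (fst (\<upsilon> e)) (fst (\<upsilon> e'))))"
    by (rule cexp_tower[OF \<sigma>]) auto
  also have "\<dots> \<le> cexp \<sigma> E (\<lambda>\<tau>. b1 + b2 * ?k (\<tau> e) (\<tau> e') + b3 * ?i (\<tau> e) + b3 * ?i (\<tau> e') + ?i (\<tau> e) * ?i (\<tau> e'))"
  proof (rule cexp_mono)
    fix \<tau> assume \<tau>: "\<tau> \<in> ext \<sigma> E"
    have zV: "fst (\<tau> e) \<in> V" "fst (\<tau> e') \<in> V"
      using S_heads[OF ext_in_S[OF \<tau>]] head_fst e e' by auto
    have "cexp \<tau> (insert e' (insert e E)) (\<lambda>\<upsilon>. \<phi> \<upsilon> (fst (\<upsilon> e)) (fst (\<upsilon> e')))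
        = cexp \<tau> (insert e' (insert e E)) (\<lambda>\<upsilon>. \<phi> \<upsilon> (fst (\<tau> e)) (fst (\<tau> e')))"
      by (rule cexp_cong) (auto simp: ext_def)
    also note H[OF \<tau> zV]
    finally show "cexp \<tau> (insert e' (insert e E)) (\<lambda>\<upsilon>. \<phi> \<upsilon> (fst (\<upsilon> e)) (fst (\<upsilon> e')))
      \<le> b1 + b2 * ?k (\<tau> e) (\<tau> e') + b3 * ?i (\<tau> e) + b3 * ?i (\<tau> e') + ?i (\<tau> e) * ?i (\<tau> e')"
      using b by (auto split: if_splits)
  qed
  also have "\<dots> = b1 + b2 * cexp \<sigma> E (\<lambda>\<tau>. ?k (\<tau> e) (\<tau> e')) + b3 * cexp \<sigma> E (\<lambda>\<tau>. ?i (\<tau> e))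
      + b3 * cexp \<sigma> E (\<lambda>\<tau>. ?i (\<tau> e')) + cexp \<sigma> E (\<lambda>\<tau>. ?i (\<tau> e) * ?i (\<tau> e'))"
    by (simp only: cexp_add cexp_mult cexp_const[OF \<sigma>])
  also have "\<dots> \<le> b1 + b2 * pair_rate s + b3 * rate s + b3 * rate s + (rate s)\<^sup>2"
    using b by (intro add_mono mult_left_mono order_refl same ind both e e'(1)) auto
  finally show ?thesis by (simp add: algebra_simps)
qed

text \<open>The part of \<open>meet\<close> in which one of the two walks visits \<open>Y\<close>; only this part changes when the
  tails at \<open>Y\<close> are permuted.\<close>

fun meet_via :: "(nat \<times> nat \<Rightarrow> nat \<times> nat) \<Rightarrow> (nat \<Rightarrow> real) \<Rightarrow> nat set \<Rightarrow> nat \<Rightarrow> nat \<Rightarrow> nat \<Rightarrow> real" where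
  "meet_via \<sigma> c Y 0 a b = (if a \<in> Y \<or> b \<in> Y then meet \<sigma> c 0 a b else 0)"
| "meet_via \<sigma> c Y (Suc t) a b = (if a \<in> Y \<or> b \<in> Y then meet \<sigma> c (Suc t) a b
     else step \<sigma> UNIV (\<lambda>z. step \<sigma> UNIV (\<lambda>z'. meet_via \<sigma> c Y t z z') b) a)"

end

section \<open>Meetings of two walks up to second order in the coincidences\<close>

locale weighted_dcm = dcm_model +
  fixes c :: "nat \<Rightarrow> real" and s :: nat
  assumes c_nonneg: "\<And>x. x \<in> V \<Longrightarrow> 0 \<le> c x" and c_le_1: "\<And>x. x \<in> V \<Longrightarrow> c x \<le> 1"
    and s_less: "s < m"
begin

abbreviation q :: real where "q \<equiv> rate s"
abbreviation \<kappa> :: real where "\<kappa> \<equiv> pair_rate s"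

lemma q_nonneg: "0 \<le> q" by (rule rate_nonneg[OF s_less])

lemma cexp_meet_le_1:
  "\<lbrakk>\<sigma> \<in> S; a \<in> V; b \<in> V\<rbrakk> \<Longrightarrow> cexp \<sigma> E (\<lambda>\<tau>. meet \<tau> c t a b) \<le> 1"
  by (rule cexp_le) (auto intro!: meet_le_1 c_le_1 dest: ext_in_S)

lemma meet_via_le_meet:
  assumes \<sigma>: "\<sigma> \<in> S"
  shows "a \<in> V \<Longrightarrow> b \<in> V \<Longrightarrow> meet_via \<sigma> c Y t a b \<le> meet \<sigma> c t a b"
proof (induction t arbitrary: a b)
  case 0 thus ?case using c_nonneg by auto
next
  case (Suc t)
  have "step \<sigma> UNIV (\<lambda>z. step \<sigma> UNIV (\<lambda>z'. meet_via \<sigma> c Y t z z') b) a \<le> meet \<sigma> c (Suc t) a b"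
    unfolding meet.simps using Suc by (intro step_mono[OF \<sigma>]) auto
  thus ?case by simp
qed

lemma meet_via_le_hit:
  assumes \<sigma>: "\<sigma> \<in> S"
  shows "a \<in> V \<Longrightarrow> b \<in> V \<Longrightarrow> meet_via \<sigma> c Y t a b \<le> hit \<sigma> Y t a + hit \<sigma> Y t b"
proof (induction t arbitrary: a b)
  case 0 thus ?case using c_le_1 by (auto intro: order_trans[of _ 1])
next
  case (Suc t)
  show ?case
  proof (cases "a \<in> Y \<or> b \<in> Y")
    case True
    have "meet \<sigma> c (Suc t) a b \<le> 1" by (rule meet_le_1[OF \<sigma> Suc.prems c_le_1])
    moreover have "1 \<le> hit \<sigma> Y (Suc t) a + hit \<sigma> Y (Suc t) b"
      using True hit_nonneg[OF \<sigma> Suc.prems(1), of Y "Suc t"] hit_nonneg[OF \<sigma> Suc.prems(2), of Y "Suc t"] by auto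
    ultimately show ?thesis using True by simp
  next
    case False
    have "step \<sigma> UNIV (\<lambda>z. step \<sigma> UNIV (\<lambda>z'. meet_via \<sigma> c Y t z z') b) a
       \<le> step \<sigma> UNIV (\<lambda>z. step \<sigma> UNIV (\<lambda>z'. hit \<sigma> Y t z + hit \<sigma> Y t z') b) a"
      using Suc by (intro step_mono[OF \<sigma>]) auto
    also have "\<dots> = step \<sigma> UNIV (hit \<sigma> Y t) a + step \<sigma> UNIV (hit \<sigma> Y t) b"
      by (simp add: step_add step_const Suc.prems)
    finally show ?thesis using False by simp
  qed
qed

lemma cexp_meet_fresh:
  "\<lbrakk>\<sigma> \<in> S; E \<subseteq> tails; card E + 2 * t \<le> s; a \<in> V; a \<notin> fst ` E; b \<in> V; b \<notin> fst ` E\<rbrakk>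
    \<Longrightarrow> cexp \<sigma> E (\<lambda>\<tau>. meet \<tau> c t a b) \<le> (if a = b then 1 / 2 ^ t else 0) + 2 * real t * q"
  using cexp_meet_le[OF bounded_off_one[of "{}" s], of s c \<sigma> E t a b] c_nonneg c_le_1 s_less by auto

lemma cexp_hit_fresh:
  "\<lbrakk>finite Y; card Y \<le> 4; \<sigma> \<in> S; E \<subseteq> tails; card E + t \<le> s; x \<in> V; x \<notin> fst ` E; x \<notin> Y\<rbrakk>
    \<Longrightarrow> cexp \<sigma> E (\<lambda>\<tau>. hit \<tau> Y t x) \<le> real t * q"
  using cexp_hit_le[OF bounded_off_one[of "{}" s], of s Y \<sigma> E t x] s_less by auto

lemma cexp_pair_le:
  assumes "a \<in> V" "b \<in> V"
    and "\<And>i j. i < dout a \<Longrightarrow> j < dout b \<Longrightarrow> cexp \<sigma> E (\<lambda>\<tau>. \<phi> \<tau> (fst (\<tau> (a, i))) (fst (\<tau> (b, j)))) \<le> r"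
  shows "cexp \<sigma> E (\<lambda>\<tau>. step \<tau> UNIV (\<lambda>z. step \<tau> UNIV (\<lambda>z'. \<phi> \<tau> z z') b) a) \<le> r"
  using cexp_step_pair_le[OF assms(1,2), of \<sigma> E "\<lambda>_. 1" \<phi> r] assms(3) by simp

lemma cexp_diag_le:
  assumes "a \<in> V"
    and "\<And>i. i < dout a \<Longrightarrow> cexp \<sigma> E (\<lambda>\<tau>. \<phi> \<tau> (fst (\<tau> (a, i))) (fst (\<tau> (a, i)))) \<le> c1"
    and "\<And>i j. i < dout a \<Longrightarrow> j < dout a \<Longrightarrow> i \<noteq> j \<Longrightarrow>
      cexp \<sigma> E (\<lambda>\<tau>. \<phi> \<tau> (fst (\<tau> (a, i))) (fst (\<tau> (a, j)))) \<le> c2"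
    and "c2 \<le> c1"
  shows "cexp \<sigma> E (\<lambda>\<tau>. step \<tau> UNIV (\<lambda>z. step \<tau> UNIV (\<lambda>z'. \<phi> \<tau> z z') a) a) \<le> (c1 + c2) / 2"
  using cexp_step_diag_le[OF assms(1), of \<sigma> E "\<lambda>_. 1" \<phi> c1 c2] assms(2-4) by simp

text \<open>The induction step of \<open>cexp_meet_dirty\<close>. The tail \<open>e\<close> of the
  first walk may be exposed already; if not, it is revealed first. The randomness used is the
  landing of the fresh tail \<open>e'\<close>, which has to avoid the exposed vertices and the
  position of the first walk.\<close>

lemma cexp_meet_fresh_tail:
  assumes dirty: "\<And>\<tau> E a b. \<lbrakk>\<tau> \<in> S; E \<subseteq> tails; card E + 2 * t \<le> s; a \<in> V; b \<in> V; b \<notin> fst ` E; a \<noteq> b\<rbrakk>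
      \<Longrightarrow> cexp \<tau> E (\<lambda>\<tau>. meet \<tau> c t a b) \<le> real t * q"
    and \<sigma>: "\<sigma> \<in> S" and E: "E \<subseteq> tails" and e: "e \<in> tails" "e' \<in> tails - E" "e \<noteq> e'" and s: "card E + 2 + 2 * t \<le> s"
  shows "cexp \<sigma> E (\<lambda>\<tau>. meet \<tau> c t (fst (\<tau> e)) (fst (\<tau> e'))) \<le> real t * q + q"
proof -
  note q_nonneg [simp]
  have inner: "cexp \<tau> E1 (\<lambda>\<upsilon>. meet \<upsilon> c t (fst (\<upsilon> e)) (fst (\<upsilon> e'))) \<le> real t * q + q"
    if a: "\<tau> \<in> S" "E1 \<subseteq> tails" "e \<in> E1" "card E1 + 1 + 2 * t \<le> s" "e' \<in> tails - E1" for \<tau> E1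
  proof -
    let ?z = "fst (\<tau> e)"
    have zV: "?z \<in> V" using a S_heads head_fst by blast
    have "cexp \<tau> E1 (\<lambda>\<upsilon>. meet \<upsilon> c t (fst (\<upsilon> e)) (fst (\<upsilon> e'))) = cexp \<tau> E1 (\<lambda>\<upsilon>. meet \<upsilon> c t ?z (fst (\<upsilon> e')))"
      using a(3) by (intro cexp_cong) (auto simp: ext_def)
    also have "\<dots> \<le> real t * q + 1 * q"
    proof (rule reveal_landing[OF a(1,2,5) _ s_less, where A="fst ` E1 \<union> {fst e', ?z}" and \<psi>="\<lambda>\<upsilon> z'. meet \<upsilon> c t ?z z'"])
      show "card E1 \<le> s" "(0::real) \<le> 1" using a by auto
      have "card {fst e', ?z} \<le> 2" by (simp add: card_insert_if)
      thus "finite (fst ` E1 \<union> {fst e', ?z})" "card (fst ` E1 \<union> {fst e', ?z}) \<le> s + 5"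
        using card_dirty_le[OF a(2), of "{fst e', ?z}"] a(4) by auto
      fix \<upsilon> assume \<upsilon>: "\<upsilon> \<in> ext \<tau> E1" and z': "fst (\<upsilon> e') \<in> V"
      note \<upsilon>S = ext_in_S[OF \<upsilon>]
      note ins = card_insert_E[OF a(2,5)]
      show "cexp \<upsilon> (insert e' E1) (\<lambda>\<upsilon>'. meet \<upsilon>' c t ?z (fst (\<upsilon> e'))) \<le> real t * q"
        if "fst (\<upsilon> e') \<notin> fst ` E1 \<union> {fst e', ?z}"
        by (rule dirty[OF \<upsilon>S]) (use that ins a(4) zV z' in auto)
      have "cexp \<upsilon> (insert e' E1) (\<lambda>\<upsilon>'. meet \<upsilon>' c t ?z (fst (\<upsilon> e'))) \<le> 1"
        by (rule cexp_meet_le_1[OF \<upsilon>S zV z'])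
      thus "cexp \<upsilon> (insert e' E1) (\<lambda>\<upsilon>'. meet \<upsilon>' c t ?z (fst (\<upsilon> e'))) \<le> real t * q + 1"
        by (simp add: add_increasing)
    qed
    finally show ?thesis by simp
  qed
  show ?thesis
  proof (cases "e \<in> E")
    case True thus ?thesis using \<sigma> E e s by (intro inner) auto
  next
    case False
    hence eE: "e \<in> tails - E" using e by simp
    note ins = card_insert_E[OF E eE]
    have "cexp \<sigma> E (\<lambda>\<tau>. meet \<tau> c t (fst (\<tau> e)) (fst (\<tau> e')))
       = cexp \<sigma> E (\<lambda>\<tau>. cexp \<tau> (insert e E) (\<lambda>\<tau>. meet \<tau> c t (fst (\<tau> e)) (fst (\<tau> e'))))"
      by (rule cexp_tower[OF \<sigma>]) auto
    also have "\<dots> \<le> real t * q + q"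
      by (rule cexp_le[OF \<sigma>], rule inner) (use ins e s ext_in_S in auto)
    finally show ?thesis .
  qed
qed

text \<open>Only the second walk has to be fresh. After one coincidence has put a walk on an exposed
  vertex, the other walk still makes a further coincidence necessary for a meeting.\<close>

lemma cexp_meet_dirty:
  "\<lbrakk>\<sigma> \<in> S; E \<subseteq> tails; card E + 2 * t \<le> s; a \<in> V; b \<in> V; b \<notin> fst ` E; a \<noteq> b\<rbrakk>
    \<Longrightarrow> cexp \<sigma> E (\<lambda>\<tau>. meet \<tau> c t a b) \<le> real t * q"
proof (induction t arbitrary: \<sigma> E a b)
  case 0 thus ?case by (simp add: cexp_const)
next
  case (Suc t)
  have "cexp \<sigma> E (\<lambda>\<tau>. meet \<tau> c (Suc t) a b) \<le> real t * q + q"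
    unfolding meet.simps
  proof (rule cexp_pair_le[OF Suc.prems(4,5)])
    fix i j assume i: "i < dout a" and j: "j < dout b"
    show "cexp \<sigma> E (\<lambda>\<tau>. meet \<tau> c t (fst (\<tau> (a, i))) (fst (\<tau> (b, j)))) \<le> real t * q + q"
      by (rule cexp_meet_fresh_tail[OF Suc.IH Suc.prems(1,2) _ fresh_tail[OF Suc.prems(5,6) j]])
        (use Suc.prems i in \<open>auto simp: in_tails\<close>)
  qed
  thus ?case by (simp add: algebra_simps)
qed

text \<open>\<open>cexp_two_landings\<close> with the price \<open>t q\<close> after one bad
  landing, taken from \<open>cexp_meet_dirty\<close>; after two bad landings the meeting probability
  is estimated by 1.\<close>

lemma cexp_tails_le:
  assumes \<sigma>: "\<sigma> \<in> S" and E: "E \<subseteq> tails" and e: "e \<in> tails - E" "e' \<in> tails - E" "e \<noteq> e'"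
    and cE: "card E + 2 + 2 * t \<le> s" and Y: "finite Y" "card Y \<le> 4"
    and \<phi>: "\<And>\<tau> z z'. \<tau> \<in> S \<Longrightarrow> z \<in> V \<Longrightarrow> z' \<in> V \<Longrightarrow> \<phi> \<tau> z z' \<le> meet \<tau> c t z z'"
    and b: "0 \<le> b1" "0 \<le> b2"
    and distinct: "\<And>\<tau> z z'. \<tau> \<in> S \<Longrightarrow> z \<in> V \<Longrightarrow> z' \<in> V \<Longrightarrow> z \<noteq> z' \<Longrightarrow>
      z \<notin> fst ` insert e' (insert e E) \<union> Y \<Longrightarrow> z' \<notin> fst ` insert e' (insert e E) \<union> Y \<Longrightarrow>
      cexp \<tau> (insert e' (insert e E)) (\<lambda>\<upsilon>. \<phi> \<upsilon> z z') \<le> b1"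
    and equal: "\<And>\<tau> z. \<tau> \<in> S \<Longrightarrow> z \<in> V \<Longrightarrow> z \<notin> fst ` insert e' (insert e E) \<union> Y \<Longrightarrow>
      cexp \<tau> (insert e' (insert e E)) (\<lambda>\<upsilon>. \<phi> \<upsilon> z z) \<le> b2"
  shows "cexp \<sigma> E (\<lambda>\<tau>. \<phi> \<tau> (fst (\<tau> e)) (fst (\<tau> e'))) \<le> b1 + \<kappa> * b2 + 2 * q * (real t * q) + q\<^sup>2"
proof -
  let ?E = "insert e' (insert e E)" and ?A = "fst ` insert e' (insert e E) \<union> Y"
  note ins = card_insert_E[OF E e(1)]
  have e'': "e' \<in> tails - insert e E" using e by auto
  note ins' = card_insert_E[OF conjunct1[OF ins] e'']
  have cE': "card ?E + 2 * t \<le> s" "?E \<subseteq> tails" using ins ins' cE by auto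
  show ?thesis
  proof (rule cexp_two_landings[OF \<sigma> E e _ s_less, where A="?A"])
    show "card E + 2 \<le> s" "finite ?A" "card ?A \<le> s + 5"
      using card_dirty_le[OF cE'(2) Y(1)] cE cE' Y by auto
    fix \<tau> z z' assume \<tau>: "\<tau> \<in> ext \<sigma> E" and z: "z \<in> V" "z' \<in> V"
    note \<tau>S = ext_in_S[OF \<tau>]
    have le: "cexp \<tau> ?E (\<lambda>\<upsilon>. \<phi> \<upsilon> z z') \<le> cexp \<tau> ?E (\<lambda>\<upsilon>. meet \<upsilon> c t z z')"
      by (rule cexp_mono) (use \<phi> z ext_in_S in auto)
    have 1: "cexp \<tau> ?E (\<lambda>\<upsilon>. \<phi> \<upsilon> z z') \<le> 1" using le cexp_meet_le_1[OF \<tau>S z] by (rule order_trans)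
    have 2: "cexp \<tau> ?E (\<lambda>\<upsilon>. \<phi> \<upsilon> z z') \<le> real t * q" if "z \<in> ?A" "z' \<notin> ?A"
      using le cexp_meet_dirty[OF \<tau>S cE'(2,1) z] that by fastforce
    have 3: "cexp \<tau> ?E (\<lambda>\<upsilon>. \<phi> \<upsilon> z z') \<le> real t * q" if "z \<notin> ?A" "z' \<in> ?A"
    proof -
      have "cexp \<tau> ?E (\<lambda>\<upsilon>. meet \<upsilon> c t z' z) \<le> real t * q"
        by (rule cexp_meet_dirty[OF \<tau>S cE'(2,1) z(2,1)]) (use that in auto)
      thus ?thesis using le by (simp add: meet_sym[of _ _ t z z'])
    qed
    show "cexp \<tau> ?E (\<lambda>\<upsilon>. \<phi> \<upsilon> z z') \<le> (if z \<in> ?A then if z' \<in> ?A then 1 else real t * q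
       else if z' \<in> ?A then real t * q else if z = z' then b2 else b1)"
      using 1 2 3 distinct[OF \<tau>S z] equal[OF \<tau>S z(1)] by auto
  qed (use b q_nonneg in auto)
qed

text \<open>The cost of two coincidences that begin in one given step of the pair of walks: a common
  landing and a later coincidence, one bad landing and a later coincidence, or two bad landings at
  once.\<close>

definition err :: "nat \<Rightarrow> real" where
  "err N = \<kappa> * (2 * real N * q) + 2 * q * (real N * q) + q\<^sup>2"

lemma err_nonneg: "0 \<le> err N"
  using pair_rate_nonneg[of s] q_nonneg by (simp add: err_def)

lemma err_bound: "t \<le> N \<Longrightarrow> b + \<kappa> * (x + 2 * real t * q) + 2 * q * (real t * q) + q\<^sup>2 \<le> b + \<kappa> * x + err N"
proof -
  assume t: "t \<le> N"
  have "\<kappa> * (2 * real t * q) \<le> \<kappa> * (2 * real N * q)" "2 * q * (real t * q) \<le> 2 * q * (real N * q)"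
    using t pair_rate_nonneg[of s] q_nonneg by (auto intro!: mult_left_mono mult_right_mono)
  thus ?thesis by (simp add: err_def algebra_simps)
qed

text \<open>The first-order term describes walks that land together once, with probability
  \<open>\<kappa>\<close>, and then choose equal tails until time \<open>t\<close>. Summing over the
  time of that landing gives the geometric series \<open>2 \<kappa> (1 - 1 / 2 ^ t)\<close>; every
  other scenario is of second order.\<close>

lemma cexp_meet_distinct:
  "\<lbrakk>t \<le> N; \<sigma> \<in> S; E \<subseteq> tails; card E + 2 * t \<le> s; a \<in> V; b \<in> V; a \<notin> fst ` E; b \<notin> fst ` E; a \<noteq> b\<rbrakk>
    \<Longrightarrow> cexp \<sigma> E (\<lambda>\<tau>. meet \<tau> c t a b) \<le> 2 * \<kappa> * (1 - 1 / 2 ^ t) + real t * err N"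
proof (induction t arbitrary: \<sigma> E a b)
  case 0 thus ?case by (simp add: cexp_const)
next
  case (Suc t)
  have "cexp \<sigma> E (\<lambda>\<tau>. meet \<tau> c (Suc t) a b) \<le> (2 * \<kappa> * (1 - 1 / 2 ^ t) + real t * err N) + \<kappa> * (1 / 2 ^ t) + err N"
    unfolding meet.simps
  proof (rule cexp_pair_le[OF Suc.prems(5,6)])
    fix i j assume i: "i < dout a" and j: "j < dout b"
    have e: "(a, i) \<in> tails - E" "(b, j) \<in> tails - E" "(a, i) \<noteq> (b, j)"
      using fresh_tail[OF Suc.prems(5,7) i] fresh_tail[OF Suc.prems(6,8) j] Suc.prems by auto
    note ins = card_insert_E[OF Suc.prems(3) e(1)]
    have e'': "(b, j) \<in> tails - insert (a, i) E" using e by auto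
    note ins' = card_insert_E[OF conjunct1[OF ins] e'']
    have "cexp \<sigma> E (\<lambda>\<tau>. meet \<tau> c t (fst (\<tau> (a, i))) (fst (\<tau> (b, j)))) \<le>
       (2 * \<kappa> * (1 - 1 / 2 ^ t) + real t * err N) + \<kappa> * (1 / 2 ^ t + 2 * real t * q) + 2 * q * (real t * q) + q\<^sup>2"
    proof (rule cexp_tails_le[OF Suc.prems(2,3) e, where Y="{}"])
      fix \<tau> z z' assume a: "\<tau> \<in> S" "z \<in> V" "z' \<in> V" "z \<noteq> z'"
        "z \<notin> fst ` insert (b, j) (insert (a, i) E) \<union> {}" "z' \<notin> fst ` insert (b, j) (insert (a, i) E) \<union> {}"
      show "cexp \<tau> (insert (b, j) (insert (a, i) E)) (\<lambda>\<upsilon>. meet \<upsilon> c t z z') \<le> 2 * \<kappa> * (1 - 1 / 2 ^ t) + real t * err N"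
        by (rule Suc.IH) (use a ins ins' Suc.prems in auto)
    next
      fix \<tau> z assume a: "\<tau> \<in> S" "z \<in> V" "z \<notin> fst ` insert (b, j) (insert (a, i) E) \<union> {}"
      show "cexp \<tau> (insert (b, j) (insert (a, i) E)) (\<lambda>\<upsilon>. meet \<upsilon> c t z z) \<le> 1 / 2 ^ t + 2 * real t * q"
        using cexp_meet_fresh[OF a(1) conjunct1[OF ins'], of t z z] a ins ins' Suc.prems by auto
    next
      have "(1::real) / 2 ^ t \<le> 1" by (simp add: divide_simps)
      thus "0 \<le> 2 * \<kappa> * (1 - 1 / 2 ^ t) + real t * err N"
        using pair_rate_nonneg[of s] err_nonneg by (intro add_nonneg_nonneg mult_nonneg_nonneg) auto
    qed (use Suc.prems q_nonneg in auto)
    also have "\<dots> \<le> (2 * \<kappa> * (1 - 1 / 2 ^ t) + real t * err N) + \<kappa> * (1 / 2 ^ t) + err N"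
      by (rule err_bound) (use Suc.prems in simp)
    finally show "cexp \<sigma> E (\<lambda>\<tau>. meet \<tau> c t (fst (\<tau> (a, i))) (fst (\<tau> (b, j)))) \<le>
       (2 * \<kappa> * (1 - 1 / 2 ^ t) + real t * err N) + \<kappa> * (1 / 2 ^ t) + err N" .
  qed
  also have "\<dots> = 2 * \<kappa> * (1 - 1 / 2 ^ Suc t) + real (Suc t) * err N"
    by (simp add: field_simps)
  finally show ?case .
qed

lemma cexp_meet_via_equal:
  assumes Y: "finite Y" "card Y \<le> 4" and a: "\<sigma> \<in> S" "E \<subseteq> tails" "card E + 2 * t \<le> s" "x \<in> V" "x \<notin> fst ` E" "x \<notin> Y"
  shows "cexp \<sigma> E (\<lambda>\<tau>. meet_via \<tau> c Y t x x) \<le> 2 * real t * q"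
proof -
  have "cexp \<sigma> E (\<lambda>\<tau>. meet_via \<tau> c Y t x x) \<le> cexp \<sigma> E (\<lambda>\<tau>. hit \<tau> Y t x + hit \<tau> Y t x)"
    by (rule cexp_mono, rule meet_via_le_hit) (use a ext_in_S in auto)
  also have "\<dots> \<le> real t * q + real t * q"
    unfolding cexp_add using a Y by (intro add_mono cexp_hit_fresh) auto
  finally show ?thesis by simp
qed

lemma cexp_meet_via_tails:
  assumes t: "t \<le> N" and Y: "finite Y" "card Y \<le> 4"
    and \<sigma>: "\<sigma> \<in> S" and E: "E \<subseteq> tails" and e: "e \<in> tails - E" "e' \<in> tails - E" "e \<noteq> e'"
    and cE: "card E + 2 + 2 * t \<le> s" and b: "0 \<le> b1"
    and distinct: "\<And>\<tau> E z z'. \<tau> \<in> S \<Longrightarrow> E \<subseteq> tails \<Longrightarrow> card E + 2 * t \<le> s \<Longrightarrow> z \<in> V \<Longrightarrow> z' \<in> V \<Longrightarrow> z \<noteq> z' \<Longrightarrow>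
      z \<notin> fst ` E \<Longrightarrow> z' \<notin> fst ` E \<Longrightarrow> z \<notin> Y \<Longrightarrow> z' \<notin> Y \<Longrightarrow> cexp \<tau> E (\<lambda>\<upsilon>. meet_via \<upsilon> c Y t z z') \<le> b1"
  shows "cexp \<sigma> E (\<lambda>\<tau>. meet_via \<tau> c Y t (fst (\<tau> e)) (fst (\<tau> e'))) \<le> b1 + err N"
proof -
  note ins = card_insert_E[OF E e(1)]
  have e'': "e' \<in> tails - insert e E" using e by auto
  note ins' = card_insert_E[OF conjunct1[OF ins] e'']
  have "cexp \<sigma> E (\<lambda>\<tau>. meet_via \<tau> c Y t (fst (\<tau> e)) (fst (\<tau> e'))) \<le>
     b1 + \<kappa> * (2 * real t * q) + 2 * q * (real t * q) + q\<^sup>2"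
    by (rule cexp_tails_le[OF \<sigma> E e cE Y])
      (use ins ins' cE b q_nonneg in \<open>auto intro!: distinct cexp_meet_via_equal[OF Y] meet_via_le_meet\<close>)
  also have "\<dots> \<le> b1 + err N" using err_bound[OF t, of b1 0] by simp
  finally show ?thesis .
qed

text \<open>There is no first-order term: starting at distinct fresh vertices outside
  \<open>Y\<close>, the walks have to meet and one of them has to touch \<open>Y\<close>, which
  takes two coincidences.\<close>

lemma cexp_meet_via_distinct:
  assumes Y: "finite Y" "card Y \<le> 4"
  shows "\<lbrakk>t \<le> N; \<sigma> \<in> S; E \<subseteq> tails; card E + 2 * t \<le> s; a \<in> V; b \<in> V; a \<noteq> b;
      a \<notin> fst ` E; b \<notin> fst ` E; a \<notin> Y; b \<notin> Y\<rbrakk>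
    \<Longrightarrow> cexp \<sigma> E (\<lambda>\<tau>. meet_via \<tau> c Y t a b) \<le> real t * err N"
proof (induction t arbitrary: \<sigma> E a b)
  case 0 thus ?case by (simp add: cexp_const)
next
  case (Suc t)
  have "cexp \<sigma> E (\<lambda>\<tau>. meet_via \<tau> c Y (Suc t) a b) =
     cexp \<sigma> E (\<lambda>\<tau>. step \<tau> UNIV (\<lambda>z. step \<tau> UNIV (\<lambda>z'. meet_via \<tau> c Y t z z') b) a)"
    using Suc.prems by simp
  also have "\<dots> \<le> real t * err N + err N"
  proof (rule cexp_pair_le[OF Suc.prems(5,6)])
    fix i j assume i: "i < dout a" and j: "j < dout b"
    have e: "(a, i) \<in> tails - E" "(b, j) \<in> tails - E" "(a, i) \<noteq> (b, j)"
      using fresh_tail[OF Suc.prems(5,8) i] fresh_tail[OF Suc.prems(6,9) j] Suc.prems by auto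
    show "cexp \<sigma> E (\<lambda>\<tau>. meet_via \<tau> c Y t (fst (\<tau> (a, i))) (fst (\<tau> (b, j)))) \<le> real t * err N + err N"
      by (rule cexp_meet_via_tails[OF _ Y Suc.prems(2,3) e])
        (use Suc err_nonneg in auto)
  qed
  finally show ?case by (simp add: algebra_simps)
qed

lemma cexp_meet_via_two_tails:
  assumes "t \<le> N" "finite Y" "card Y \<le> 4" "\<sigma> \<in> S" "E \<subseteq> tails" "e \<in> tails - E" "e' \<in> tails - E" "e \<noteq> e'"
    "card E + 2 + 2 * t \<le> s"
  shows "cexp \<sigma> E (\<lambda>\<tau>. meet_via \<tau> c Y t (fst (\<tau> e)) (fst (\<tau> e'))) \<le> (real N + 1) * err N"
proof -
  have "cexp \<sigma> E (\<lambda>\<tau>. meet_via \<tau> c Y t (fst (\<tau> e)) (fst (\<tau> e'))) \<le> real t * err N + err N"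
    by (rule cexp_meet_via_tails[OF assms(1-8)]) (use assms err_nonneg cexp_meet_via_distinct in auto)
  also have "\<dots> \<le> real N * err N + err N"
    using assms(1) err_nonneg by (intro add_mono mult_right_mono) auto
  finally show ?thesis by (simp add: algebra_simps)
qed

text \<open>If every vertex has at most one exposed tail, two walks can only stay together or follow
  an exposed path by choosing equal tails.\<close>

lemma cexp_meet_path:
  "\<lbrakk>\<sigma> \<in> S; E \<subseteq> tails; card E + 2 * t \<le> s; inj_on fst E; x \<in> V\<rbrakk>
    \<Longrightarrow> cexp \<sigma> E (\<lambda>\<tau>. meet \<tau> c t x x) \<le> 1 / 2 ^ t + 4 * real t * q"
proof (induction t arbitrary: \<sigma> E x)
  case 0 thus ?case using cexp_meet_le_1[of \<sigma> x x E 0] by simp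
next
  case (Suc t)
  note q_nonneg [simp]
  let ?c1 = "1 / 2 ^ t + 4 * real t * q + q" and ?c2 = "real t * q + q"
  have mono2: "1 / 2 ^ t + 2 * real t * q \<le> 1 / 2 ^ t + 4 * real t * q"
    by (intro add_mono mult_right_mono) auto
  have "cexp \<sigma> E (\<lambda>\<tau>. meet \<tau> c (Suc t) x x) \<le> (?c1 + ?c2) / 2"
    unfolding meet.simps
  proof (rule cexp_diag_le[OF Suc.prems(5)])
    fix i assume i: "i < dout x"
    have eT: "(x, i) \<in> tails" using i Suc.prems by (simp add: in_tails)
    show "cexp \<sigma> E (\<lambda>\<tau>. meet \<tau> c t (fst (\<tau> (x, i))) (fst (\<tau> (x, i)))) \<le> ?c1"
    proof (cases "(x, i) \<in> E")
      case True
      have "cexp \<sigma> E (\<lambda>\<tau>. meet \<tau> c t (fst (\<tau> (x, i))) (fst (\<tau> (x, i)))) =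
         cexp \<sigma> E (\<lambda>\<tau>. meet \<tau> c t (fst (\<sigma> (x, i))) (fst (\<sigma> (x, i))))"
        using True by (intro cexp_cong) (auto simp: ext_def)
      also have "\<dots> \<le> 1 / 2 ^ t + 4 * real t * q"
        by (rule Suc.IH) (use Suc.prems S_fst i in auto)
      finally show ?thesis by (simp add: add_increasing2)
    next
      case False
      hence e: "(x, i) \<in> tails - E" using eT by simp
      note ins = card_insert_E[OF Suc.prems(2) e]
      have "cexp \<sigma> E (\<lambda>\<tau>. meet \<tau> c t (fst (\<tau> (x, i))) (fst (\<tau> (x, i)))) \<le> (1 / 2 ^ t + 4 * real t * q) + 1 * q"
      proof (rule reveal_landing[OF Suc.prems(1,2) e _ s_less, where A="fst ` E \<union> {x}" and \<psi>="\<lambda>\<tau> z. meet \<tau> c t z z"])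
        show "card E \<le> s" "finite (fst ` E \<union> {x})" "card (fst ` E \<union> {x}) \<le> s + 5" "(0::real) \<le> 1"
          using card_dirty_le[OF Suc.prems(2), of "{x}"] Suc.prems(3) by auto
        fix \<tau> assume \<tau>: "\<tau> \<in> ext \<sigma> E" and z: "fst (\<tau> (x, i)) \<in> V"
        note \<tau>S = ext_in_S[OF \<tau>]
        show "cexp \<tau> (insert (x, i) E) (\<lambda>\<upsilon>. meet \<upsilon> c t (fst (\<tau> (x, i))) (fst (\<tau> (x, i)))) \<le> 1 / 2 ^ t + 4 * real t * q"
          if "fst (\<tau> (x, i)) \<notin> fst ` E \<union> {x}"
          using cexp_meet_fresh[OF \<tau>S conjunct1[OF ins], of t "fst (\<tau> (x, i))" "fst (\<tau> (x, i))"] that z ins Suc.prems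
          by (intro order_trans[OF _ mono2]) auto
        have "cexp \<tau> (insert (x, i) E) (\<lambda>\<upsilon>. meet \<upsilon> c t (fst (\<tau> (x, i))) (fst (\<tau> (x, i)))) \<le> 1"
          by (rule cexp_meet_le_1[OF \<tau>S z z])
        thus "cexp \<tau> (insert (x, i) E) (\<lambda>\<upsilon>. meet \<upsilon> c t (fst (\<tau> (x, i))) (fst (\<tau> (x, i)))) \<le> 1 / 2 ^ t + 4 * real t * q + 1"
          by (simp add: add_increasing)
      qed
      thus ?thesis by simp
    qed
  next
    fix i j assume ij: "i < dout x" "j < dout x" "i \<noteq> j"
    have one: "cexp \<sigma> E (\<lambda>\<tau>. meet \<tau> c t (fst (\<tau> e)) (fst (\<tau> e'))) \<le> real t * q + q"
      if e: "e \<in> tails" "e' \<in> tails - E" "e \<noteq> e'" for e e'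
      by (rule cexp_meet_fresh_tail[OF cexp_meet_dirty Suc.prems(1,2) e]) (use Suc.prems in auto)
    have T: "(x, i) \<in> tails" "(x, j) \<in> tails" using ij Suc.prems by (auto simp: in_tails)
    have "(x, i) \<notin> E \<or> (x, j) \<notin> E" using ij inj_onD[OF Suc.prems(4), of "(x, i)" "(x, j)"] by auto
    thus "cexp \<sigma> E (\<lambda>\<tau>. meet \<tau> c t (fst (\<tau> (x, i))) (fst (\<tau> (x, j)))) \<le> ?c2"
    proof
      assume "(x, j) \<notin> E" thus ?thesis using one[of "(x, i)" "(x, j)"] T ij by simp
    next
      assume "(x, i) \<notin> E"
      thus ?thesis using one[of "(x, j)" "(x, i)"] T ij by (simp add: meet_sym[of _ _ t "fst (_ (x, i))"])
    qed
  next
    show "?c2 \<le> ?c1" by (intro add_mono order_refl order_trans[OF mult_right_mono[of "real t" "4 * real t" q]]) auto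
  qed
  also have "\<dots> \<le> 1 / 2 ^ Suc t + 4 * real (Suc t) * q"
  proof -
    have "0 \<le> real t * q" by simp
    thus ?thesis using q_nonneg by (simp add: field_simps)
  qed
  finally show ?case .
qed

text \<open>Walks that start together reach \<open>Y\<close> by one coincidence of cost
  \<open>q\<close>, but only if they choose equal tails before it, and they have to stay together
  after it. The halvings over all \<open>t\<close> steps multiply to \<open>1 / 2 ^ t\<close>, and
  summing over the time of the coincidence gives \<open>t q / 2 ^ t\<close>. Up to then both walks
  expose one common path, which is why \<open>E\<close> has at most one tail at each vertex.\<close>

lemma cexp_meet_via_diag:
  assumes Y: "finite Y" "card Y \<le> 4"
  shows "\<lbrakk>t \<le> N; \<sigma> \<in> S; E \<subseteq> tails; card E + 2 * t \<le> s; inj_on fst E; a \<in> V; a \<notin> fst ` E; a \<notin> Y\<rbrakk>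
    \<Longrightarrow> cexp \<sigma> E (\<lambda>\<tau>. meet_via \<tau> c Y t a a) \<le> (real N + 1) * err N + 4 * real N * q\<^sup>2 + real t * q / 2 ^ t"
proof (induction t arbitrary: \<sigma> E a)
  case 0 thus ?case using err_nonneg[of N] by (simp add: cexp_const)
next
  case (Suc t)
  note q_nonneg [simp]
  let ?L = "(real N + 1) * err N" and ?b0 = "(real N + 1) * err N + 4 * real N * q\<^sup>2 + real t * q / 2 ^ t"
  have L0: "0 \<le> ?L" using err_nonneg by simp
  have "cexp \<sigma> E (\<lambda>\<tau>. meet_via \<tau> c Y (Suc t) a a) =
     cexp \<sigma> E (\<lambda>\<tau>. step \<tau> UNIV (\<lambda>z. step \<tau> UNIV (\<lambda>z'. meet_via \<tau> c Y t z z') a) a)"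
    using Suc.prems by simp
  also have "\<dots> \<le> ((?b0 + (1 / 2 ^ t + 4 * real t * q) * q) + ?L) / 2"
  proof (rule cexp_diag_le[OF Suc.prems(6)])
    fix i assume i: "i < dout a"
    have e: "(a, i) \<in> tails - E" by (rule fresh_tail[OF Suc.prems(6,7) i])
    note ins = card_insert_E[OF Suc.prems(3) e]
    have inj: "inj_on fst (insert (a, i) E)" using Suc.prems by auto
    have cE: "card (insert (a, i) E) + 2 * t \<le> s" using ins Suc.prems by simp
    show "cexp \<sigma> E (\<lambda>\<tau>. meet_via \<tau> c Y t (fst (\<tau> (a, i))) (fst (\<tau> (a, i)))) \<le> ?b0 + (1 / 2 ^ t + 4 * real t * q) * q"
    proof (rule reveal_landing[OF Suc.prems(2,3) e _ s_less, where A="fst ` E \<union> insert a Y" and \<psi>="\<lambda>\<tau> z. meet_via \<tau> c Y t z z"])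
      have "card (insert a Y) \<le> 5" using Y card_insert_le_m1[of 5 Y a] by simp
      thus "card E \<le> s" "finite (fst ` E \<union> insert a Y)" "card (fst ` E \<union> insert a Y) \<le> s + 5"
        using card_dirty_le[OF Suc.prems(3), of "insert a Y"] Suc.prems(4) Y by auto
      fix \<tau> assume \<tau>: "\<tau> \<in> ext \<sigma> E" and z: "fst (\<tau> (a, i)) \<in> V"
      note \<tau>S = ext_in_S[OF \<tau>]
      show "cexp \<tau> (insert (a, i) E) (\<lambda>\<upsilon>. meet_via \<upsilon> c Y t (fst (\<tau> (a, i))) (fst (\<tau> (a, i)))) \<le> ?b0"
        if "fst (\<tau> (a, i)) \<notin> fst ` E \<union> insert a Y"
        by (rule Suc.IH) (use that z \<tau>S ins inj cE Suc.prems in auto)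
      have "cexp \<tau> (insert (a, i) E) (\<lambda>\<upsilon>. meet_via \<upsilon> c Y t (fst (\<tau> (a, i))) (fst (\<tau> (a, i)))) \<le>
          cexp \<tau> (insert (a, i) E) (\<lambda>\<upsilon>. meet \<upsilon> c t (fst (\<tau> (a, i))) (fst (\<tau> (a, i))))"
        by (rule cexp_mono, rule meet_via_le_meet) (use z ext_in_S in auto)
      also have "\<dots> \<le> 1 / 2 ^ t + 4 * real t * q"
        by (rule cexp_meet_path[OF \<tau>S conjunct1[OF ins] cE inj z])
      also have "\<dots> \<le> ?b0 + (1 / 2 ^ t + 4 * real t * q)" using L0 by simp
      finally show "cexp \<tau> (insert (a, i) E) (\<lambda>\<upsilon>. meet_via \<upsilon> c Y t (fst (\<tau> (a, i))) (fst (\<tau> (a, i)))) \<le>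
         ?b0 + (1 / 2 ^ t + 4 * real t * q)" .
    qed simp
  next
    fix i j assume ij: "i < dout a" "j < dout a" "i \<noteq> j"
    show "cexp \<sigma> E (\<lambda>\<tau>. meet_via \<tau> c Y t (fst (\<tau> (a, i))) (fst (\<tau> (a, j)))) \<le> ?L"
      by (rule cexp_meet_via_two_tails[OF _ Y Suc.prems(2,3)])
        (use ij Suc.prems fresh_tail[OF Suc.prems(6,7)] in auto)
  next
    show "?L \<le> ?b0 + (1 / 2 ^ t + 4 * real t * q) * q" by simp
  qed
  also have "\<dots> \<le> ?L + 4 * real N * q\<^sup>2 + real (Suc t) * q / 2 ^ Suc t"
  proof -
    have "real t * q\<^sup>2 \<le> real N * q\<^sup>2" using Suc.prems by (intro mult_right_mono) auto
    moreover have "((?b0 + (1 / 2 ^ t + 4 * real t * q) * q) + ?L) / 2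
        = ?L + 2 * real N * q\<^sup>2 + 2 * (real t * q\<^sup>2) + real (Suc t) * q / 2 ^ Suc t"
      by (simp add: field_simps power2_eq_square)
    ultimately show ?thesis by linarith
  qed
  finally show ?case .
qed

lemma cexp_meet_via_one_tail:
  assumes t: "t \<le> N" and Y: "finite Y" "card Y \<le> 4" and \<sigma>: "\<sigma> \<in> S" and e: "e \<in> tails" and s: "1 + 2 * t \<le> s"
  shows "cexp \<sigma> {} (\<lambda>\<tau>. meet_via \<tau> c Y t (fst (\<tau> e)) (fst (\<tau> e)))
    \<le> (real N + 1) * err N + 8 * real N * q\<^sup>2 + (real t + 1) * q / 2 ^ t"
proof -
  let ?b0 = "(real N + 1) * err N + 4 * real N * q\<^sup>2 + real t * q / 2 ^ t"
  have L0: "0 \<le> (real N + 1) * err N" using err_nonneg by simp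
  have "cexp \<sigma> {} (\<lambda>\<tau>. meet_via \<tau> c Y t (fst (\<tau> e)) (fst (\<tau> e))) \<le> ?b0 + (1 / 2 ^ t + 4 * real t * q) * q"
  proof (rule reveal_landing[OF \<sigma> _ _ _ s_less, where A="insert (fst e) Y" and \<psi>="\<lambda>\<tau> z. meet_via \<tau> c Y t z z"])
    show "finite (insert (fst e) Y)" "card (insert (fst e) Y) \<le> s + 5"
      using Y card_insert_le_m1[of 5 Y "fst e"] by auto
    fix \<tau> assume \<tau>: "\<tau> \<in> ext \<sigma> {}" and z: "fst (\<tau> e) \<in> V"
    note \<tau>S = ext_in_S[OF \<tau>]
    show "cexp \<tau> {e} (\<lambda>\<upsilon>. meet_via \<upsilon> c Y t (fst (\<tau> e)) (fst (\<tau> e))) \<le> ?b0" if "fst (\<tau> e) \<notin> insert (fst e) Y"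
      by (rule cexp_meet_via_diag[OF Y t \<tau>S]) (use e s z that in auto)
    have "cexp \<tau> {e} (\<lambda>\<upsilon>. meet_via \<upsilon> c Y t (fst (\<tau> e)) (fst (\<tau> e))) \<le> cexp \<tau> {e} (\<lambda>\<upsilon>. meet \<upsilon> c t (fst (\<tau> e)) (fst (\<tau> e)))"
      by (rule cexp_mono, rule meet_via_le_meet) (use z ext_in_S in auto)
    also have "\<dots> \<le> 1 / 2 ^ t + 4 * real t * q"
      by (rule cexp_meet_path[OF \<tau>S _ _ _ z]) (use e s in auto)
    also have "\<dots> \<le> ?b0 + (1 / 2 ^ t + 4 * real t * q)" using L0 q_nonneg by simp
    finally show "cexp \<tau> {e} (\<lambda>\<upsilon>. meet_via \<upsilon> c Y t (fst (\<tau> e)) (fst (\<tau> e))) \<le> ?b0 + (1 / 2 ^ t + 4 * real t * q)" .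
  qed (use e q_nonneg in auto)
  also have "\<dots> \<le> (real N + 1) * err N + 8 * real N * q\<^sup>2 + (real t + 1) * q / 2 ^ t"
  proof -
    have "real t * q\<^sup>2 \<le> real N * q\<^sup>2" using t by (intro mult_right_mono) auto
    moreover have "?b0 + (1 / 2 ^ t + 4 * real t * q) * q
        = (real N + 1) * err N + 4 * real N * q\<^sup>2 + 4 * (real t * q\<^sup>2) + (real t + 1) * q / 2 ^ t"
      by (simp add: field_simps power2_eq_square)
    ultimately show ?thesis by linarith
  qed
  finally show ?thesis .
qed

end

section \<open>Invariance of the matching under permutations of tails and of heads\<close>

context dcm_model
begin

definition avg :: "((nat \<times> nat \<Rightarrow> nat \<times> nat) \<Rightarrow> real) \<Rightarrow> real" where
  "avg F = (\<Sum>\<sigma>\<in>S. F \<sigma>) / real (card S)"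

lemma cexp_empty: "cexp \<sigma> {} F = avg F"
  by (simp add: cexp_def avg_def ext_empty)

lemma avg_mono: "(\<And>\<sigma>. \<sigma> \<in> S \<Longrightarrow> F \<sigma> \<le> G \<sigma>) \<Longrightarrow> avg F \<le> avg G"
  unfolding avg_def by (intro divide_right_mono sum_mono) auto

lemma avg_cong: "(\<And>\<sigma>. \<sigma> \<in> S \<Longrightarrow> F \<sigma> = G \<sigma>) \<Longrightarrow> avg F = avg G"
  by (intro antisym avg_mono) auto

lemma avg_const: "avg (\<lambda>_. c) = c"
  using S_nonempty finite_S by (simp add: avg_def)

lemma avg_nonneg: "(\<And>\<sigma>. \<sigma> \<in> S \<Longrightarrow> 0 \<le> F \<sigma>) \<Longrightarrow> 0 \<le> avg F"
  using avg_mono[of "\<lambda>_. 0" F] avg_const by simp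

lemma avg_add: "avg (\<lambda>\<sigma>. F \<sigma> + G \<sigma>) = avg F + avg G"
  by (simp add: avg_def sum.distrib add_divide_distrib)

lemma avg_diff: "avg (\<lambda>\<sigma>. F \<sigma> - G \<sigma>) = avg F - avg G"
  by (simp add: avg_def sum_subtractf diff_divide_distrib)

lemma avg_mult: "avg (\<lambda>\<sigma>. c * F \<sigma>) = c * avg F"
  by (simp add: avg_def sum_distrib_left)

lemma avg_sum: "avg (\<lambda>\<sigma>. \<Sum>a\<in>A. F a \<sigma>) = (\<Sum>a\<in>A. avg (F a))"
  unfolding avg_def by (subst sum.swap) (simp add: sum_divide_distrib)

lemma avg_reindex:
  assumes "inj_on h S" "h ` S \<subseteq> S" shows "avg (\<lambda>\<sigma>. F (h \<sigma>)) = avg F"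
proof -
  have "h ` S = S" using assms endo_inj_surj[OF finite_S] by blast
  thus ?thesis using sum.reindex[OF assms(1), of F] by (simp add: avg_def)
qed

lemma avg_precompose:
  assumes "bij_betw \<alpha> tails tails"
  shows "avg (\<lambda>\<sigma>. F (restrict (\<sigma> \<circ> \<alpha>) tails)) = avg F"
proof (rule avg_reindex)
  show "(\<lambda>\<sigma>. restrict (\<sigma> \<circ> \<alpha>) tails) ` S \<subseteq> S" using S_pre[OF _ assms] by blast
  show "inj_on (\<lambda>\<sigma>. restrict (\<sigma> \<circ> \<alpha>) tails) S"
  proof (rule inj_onI, rule S_eqI)
    fix \<sigma> \<tau> e assume a: "\<sigma> \<in> S" "\<tau> \<in> S" "restrict (\<sigma> \<circ> \<alpha>) tails = restrict (\<tau> \<circ> \<alpha>) tails" "e \<in> tails"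
    then obtain d where d: "d \<in> tails" "e = \<alpha> d" using assms unfolding bij_betw_def by blast
    from fun_cong[OF a(3), of d] d show "\<sigma> e = \<tau> e" by simp
  qed auto
qed

lemma avg_postcompose:
  assumes "bij_betw \<alpha> heads heads"
  shows "avg (\<lambda>\<sigma>. F (restrict (\<alpha> \<circ> \<sigma>) tails)) = avg F"
proof (rule avg_reindex)
  show "(\<lambda>\<sigma>. restrict (\<alpha> \<circ> \<sigma>) tails) ` S \<subseteq> S" using S_post[OF _ assms] by blast
  show "inj_on (\<lambda>\<sigma>. restrict (\<alpha> \<circ> \<sigma>) tails) S"
  proof (rule inj_onI, rule S_eqI)
    fix \<sigma> \<tau> e assume a: "\<sigma> \<in> S" "\<tau> \<in> S" "restrict (\<alpha> \<circ> \<sigma>) tails = restrict (\<alpha> \<circ> \<tau>) tails" "e \<in> tails"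
    from fun_cong[OF a(3), of e] a(4) have "\<alpha> (\<sigma> e) = \<alpha> (\<tau> e)" by simp
    thus "\<sigma> e = \<tau> e"
      by (rule inj_onD[OF bij_betw_imp_inj_on[OF assms]]) (use S_heads a in auto)
  qed auto
qed

end

context weighted_dcm
begin

text \<open>Pairs of walks that avoid \<open>Y\<close> up to time \<open>t\<close> see the same
  edges in both matchings, so only the pairs counted by \<open>meet_via\<close> can be lost.\<close>

lemma meet_ge_not_via:
  assumes \<sigma>: "\<sigma> \<in> S" and \<sigma>': "\<sigma>' \<in> S"
    and ag: "\<And>e. e \<in> tails \<Longrightarrow> fst e \<notin> Y \<Longrightarrow> \<sigma>' e = \<sigma> e"
  shows "a \<in> V \<Longrightarrow> b \<in> V \<Longrightarrow> meet \<sigma> c t a b - meet_via \<sigma> c Y t a b \<le> meet \<sigma>' c t a b"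
proof (induction t arbitrary: a b)
  case 0 thus ?case using c_nonneg by auto
next
  case (Suc t)
  show ?case
  proof (cases "a \<in> Y \<or> b \<in> Y")
    case True thus ?thesis using meet_nonneg[OF \<sigma>' Suc.prems c_nonneg, where t="Suc t"] by simp
  next
    case False
    have st: "step \<sigma>' UNIV \<phi> x = step \<sigma> UNIV \<phi> x" if "x \<in> V" "x \<notin> Y" for \<phi> x
      unfolding step_def using ag that by (auto intro!: sum.cong simp: in_tails)
    have "meet \<sigma> c (Suc t) a b - meet_via \<sigma> c Y (Suc t) a b
       = step \<sigma> UNIV (\<lambda>z. step \<sigma> UNIV (\<lambda>z'. meet \<sigma> c t z z' - meet_via \<sigma> c Y t z z') b) a"
      using False by (simp add: step_diff)
    also have "\<dots> \<le> step \<sigma> UNIV (\<lambda>z. step \<sigma> UNIV (\<lambda>z'. meet \<sigma>' c t z z') b) a"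
      using Suc by (intro step_mono[OF \<sigma>]) auto
    also have "\<dots> = meet \<sigma>' c (Suc t) a b" using st Suc.prems False by simp
    finally show ?thesis .
  qed
qed

text \<open>Indexed by the first tails used and not by vertices: the law of the matching is
  invariant under permutations of tails, which makes all pairs of distinct tails comparable whatever
  the out-degrees of their vertices.\<close>

definition tail_meet :: "nat \<Rightarrow> nat \<times> nat \<Rightarrow> nat \<times> nat \<Rightarrow> real" where
  "tail_meet t e e' = avg (\<lambda>\<sigma>. meet \<sigma> c t (fst (\<sigma> e)) (fst (\<sigma> e')))"

lemma tail_meet_nonneg: "e \<in> tails \<Longrightarrow> e' \<in> tails \<Longrightarrow> 0 \<le> tail_meet t e e'"
  unfolding tail_meet_def
  by (intro avg_nonneg meet_nonneg c_nonneg) (auto simp: head_fst[OF S_heads])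

lemma tail_meet_le_1: "e \<in> tails \<Longrightarrow> e' \<in> tails \<Longrightarrow> tail_meet t e e' \<le> 1"
proof -
  assume "e \<in> tails" "e' \<in> tails"
  hence "tail_meet t e e' \<le> avg (\<lambda>_. 1)" unfolding tail_meet_def
    by (intro avg_mono meet_le_1 c_le_1) (auto simp: head_fst[OF S_heads])
  thus ?thesis by (simp add: avg_const)
qed

lemma tail_meet_permute:
  assumes \<alpha>: "bij_betw \<alpha> tails tails" and Y: "\<And>e. e \<in> tails \<Longrightarrow> fst e \<notin> Y \<Longrightarrow> \<alpha> e = e"
    and e: "d \<in> tails" "d' \<in> tails" "\<alpha> d = e" "\<alpha> d' = e'"
  shows "tail_meet t e e' \<le> tail_meet t d d' + avg (\<lambda>\<sigma>. meet_via \<sigma> c Y t (fst (\<sigma> e)) (fst (\<sigma> e')))"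
proof -
  have eT: "e \<in> tails" "e' \<in> tails" using \<alpha> e by (auto dest: bij_betwE)
  have "tail_meet t e e' - avg (\<lambda>\<sigma>. meet_via \<sigma> c Y t (fst (\<sigma> e)) (fst (\<sigma> e'))) =
     avg (\<lambda>\<sigma>. meet \<sigma> c t (fst (\<sigma> e)) (fst (\<sigma> e')) - meet_via \<sigma> c Y t (fst (\<sigma> e)) (fst (\<sigma> e')))"
    by (simp add: tail_meet_def avg_diff)
  also have "\<dots> \<le> avg (\<lambda>\<sigma>. meet (restrict (\<sigma> \<circ> \<alpha>) tails) c t (fst (restrict (\<sigma> \<circ> \<alpha>) tails d)) (fst (restrict (\<sigma> \<circ> \<alpha>) tails d')))"
  proof (rule avg_mono)
    fix \<sigma> assume \<sigma>: "\<sigma> \<in> S"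
    show "meet \<sigma> c t (fst (\<sigma> e)) (fst (\<sigma> e')) - meet_via \<sigma> c Y t (fst (\<sigma> e)) (fst (\<sigma> e')) \<le>
       meet (restrict (\<sigma> \<circ> \<alpha>) tails) c t (fst (restrict (\<sigma> \<circ> \<alpha>) tails d)) (fst (restrict (\<sigma> \<circ> \<alpha>) tails d'))"
      using meet_ge_not_via[OF \<sigma> S_pre[OF \<sigma> \<alpha>], of Y "fst (\<sigma> e)" "fst (\<sigma> e')" t] Y e eT
        head_fst[OF S_heads[OF \<sigma>]] by simp
  qed
  also have "\<dots> = tail_meet t d d'"
    unfolding tail_meet_def
    by (rule avg_precompose[OF \<alpha>, of "\<lambda>\<sigma>. meet \<sigma> c t (fst (\<sigma> d)) (fst (\<sigma> d'))"])
  finally show ?thesis by simp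
qed

lemma tail_meet_distinct_le:
  assumes t: "t \<le> N" and s: "2 + 2 * t \<le> s"
    and e: "e \<in> tails" "e' \<in> tails" "e \<noteq> e'" and d: "d \<in> tails" "d' \<in> tails" "d \<noteq> d'"
  shows "tail_meet t e e' \<le> tail_meet t d d' + (real N + 1) * err N"
proof -
  obtain \<sigma>0 where \<sigma>0: "\<sigma>0 \<in> S" using S_nonempty by blast
  let ?Y = "{fst e, fst e', fst d, fst d'}"
  let ?t1 = "Transposition.transpose d e"
  \<comment> \<open>\<open>d'\<close> may coincide with \<open>e\<close> and be moved by the first
    transposition, so the second one is applied to its image.\<close>
  define d'' where "d'' = ?t1 d'"
  let ?t2 = "Transposition.transpose d'' e'"
  have d'': "d'' \<in> {e, d, d'}" by (auto simp: d''_def Transposition.transpose_def)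
  have d''e: "d'' \<noteq> e" using d by (auto simp: d''_def Transposition.transpose_def)
  have bij: "bij_betw (Transposition.transpose x y) tails tails" if "x \<in> tails" "y \<in> tails" for x y
    using that by (metis bij_betw_def inj_on_transpose transpose_image_eq)
  have \<alpha>: "bij_betw (?t2 \<circ> ?t1) tails tails"
    by (rule bij_betw_trans[OF bij bij]) (use d e d'' in auto)
  have "tail_meet t e e' \<le> tail_meet t d d' + avg (\<lambda>\<sigma>. meet_via \<sigma> c ?Y t (fst (\<sigma> e)) (fst (\<sigma> e')))"
  proof (rule tail_meet_permute[OF \<alpha>])
    fix f assume f: "f \<in> tails" "fst f \<notin> ?Y"
    hence ne: "f \<noteq> e" "f \<noteq> e'" "f \<noteq> d" "f \<noteq> d'" by auto
    hence "?t1 f = f" by simp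
    moreover have "f \<noteq> d''" using ne d'' by auto
    ultimately show "(?t2 \<circ> ?t1) f = f" using ne by simp
  next
    show "(?t2 \<circ> ?t1) d = e" using d''e e(3) by (simp add: transpose_apply_other)
    show "(?t2 \<circ> ?t1) d' = e'" by (simp add: d''_def[symmetric])
  qed (use d in auto)
  also have "avg (\<lambda>\<sigma>. meet_via \<sigma> c ?Y t (fst (\<sigma> e)) (fst (\<sigma> e'))) \<le> (real N + 1) * err N"
  proof -
    have "card ?Y \<le> 4" by (simp add: card_insert_if)
    thus ?thesis using cexp_meet_via_two_tails[OF t, of ?Y \<sigma>0 "{}" e e'] e s \<sigma>0 by (simp add: cexp_empty)
  qed
  finally show ?thesis by simp
qed

lemma tail_meet_same_le:
  assumes t: "t \<le> N" and s: "1 + 2 * t \<le> s" and e: "e \<in> tails" "d \<in> tails"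
  shows "tail_meet t e e \<le> tail_meet t d d + ((real N + 1) * err N + 8 * real N * q\<^sup>2 + (real t + 1) * q / 2 ^ t)"
proof -
  obtain \<sigma>0 where \<sigma>0: "\<sigma>0 \<in> S" using S_nonempty by blast
  let ?Y = "{fst e, fst d}"
  have \<alpha>: "bij_betw (Transposition.transpose d e) tails tails"
    using e by (metis bij_betw_def inj_on_transpose transpose_image_eq)
  have "tail_meet t e e \<le> tail_meet t d d + avg (\<lambda>\<sigma>. meet_via \<sigma> c ?Y t (fst (\<sigma> e)) (fst (\<sigma> e)))"
    by (rule tail_meet_permute[OF \<alpha>]) (use e in \<open>auto simp: Transposition.transpose_def\<close>)
  also have "avg (\<lambda>\<sigma>. meet_via \<sigma> c ?Y t (fst (\<sigma> e)) (fst (\<sigma> e))) \<le> (real N + 1) * err N + 8 * real N * q\<^sup>2 + (real t + 1) * q / 2 ^ t"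
  proof -
    have "card ?Y \<le> 4" by (simp add: card_insert_if)
    thus ?thesis using cexp_meet_via_one_tail[OF t, of ?Y \<sigma>0 e] e s \<sigma>0 by (simp add: cexp_empty)
  qed
  finally show ?thesis by simp
qed

lemma tail_meet_distinct_bound:
  assumes t: "t \<le> N" and s: "2 + 2 * t \<le> s" and e: "e \<in> tails" "e' \<in> tails" "e \<noteq> e'"
  shows "tail_meet t e e' \<le> 2 * \<kappa> + (real N + 1) * err N"
proof -
  obtain \<sigma>0 where \<sigma>0: "\<sigma>0 \<in> S" using S_nonempty by blast
  have e'': "e' \<in> tails - {e}" using e by auto
  have T: "insert e' (insert e {}) \<subseteq> tails" "card (insert e' (insert e {})) = 2" using e by auto
  have "cexp \<sigma>0 {} (\<lambda>\<tau>. meet \<tau> c t (fst (\<tau> e)) (fst (\<tau> e'))) \<le>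
       (2 * \<kappa> * (1 - 1 / 2 ^ t) + real t * err N) + \<kappa> * (1 / 2 ^ t + 2 * real t * q) + 2 * q * (real t * q) + q\<^sup>2"
  proof (rule cexp_tails_le[OF \<sigma>0, where Y="{}"])
    fix \<tau> z z' assume a: "\<tau> \<in> S" "z \<in> V" "z' \<in> V" "z \<noteq> z'"
      "z \<notin> fst ` insert e' (insert e {}) \<union> {}" "z' \<notin> fst ` insert e' (insert e {}) \<union> {}"
    show "cexp \<tau> (insert e' (insert e {})) (\<lambda>\<upsilon>. meet \<upsilon> c t z z') \<le> 2 * \<kappa> * (1 - 1 / 2 ^ t) + real t * err N"
      by (rule cexp_meet_distinct[OF t a(1) T(1)]) (use a T s in auto)
  next
    fix \<tau> z assume a: "\<tau> \<in> S" "z \<in> V" "z \<notin> fst ` insert e' (insert e {}) \<union> {}"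
    show "cexp \<tau> (insert e' (insert e {})) (\<lambda>\<upsilon>. meet \<upsilon> c t z z) \<le> 1 / 2 ^ t + 2 * real t * q"
      using cexp_meet_fresh[OF a(1) T(1), of t z z] a T s by auto
  next
    have "(1::real) / 2 ^ t \<le> 1" by (simp add: divide_simps)
    thus "0 \<le> 2 * \<kappa> * (1 - 1 / 2 ^ t) + real t * err N"
      using pair_rate_nonneg[of s] err_nonneg by (intro add_nonneg_nonneg mult_nonneg_nonneg) auto
  qed (use e s q_nonneg in auto)
  also have "\<dots> \<le> (2 * \<kappa> * (1 - 1 / 2 ^ t) + real t * err N) + \<kappa> * (1 / 2 ^ t) + err N"
    by (rule err_bound[OF t])
  also have "\<dots> \<le> 2 * \<kappa> + (real N + 1) * err N"
  proof -
    have "0 \<le> \<kappa> * (1 / 2 ^ t)" using pair_rate_nonneg[of s] by simp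
    moreover have "real t * err N \<le> real N * err N" using t err_nonneg by (intro mult_right_mono) auto
    ultimately show ?thesis by (simp add: algebra_simps)
  qed
  finally show ?thesis by (simp add: cexp_empty tail_meet_def)
qed

lemma avg_meet_pair:
  assumes "a \<in> V" "b \<in> V"
  shows "avg (\<lambda>\<sigma>. meet \<sigma> c (Suc t) a b)
    = (\<Sum>i<dout a. \<Sum>j<dout b. tail_meet t (a, i) (b, j)) / (real (dout a) * real (dout b))"
  using cexp_step_pair[OF assms, of undefined "{}" "\<lambda>_. 1" "\<lambda>\<tau>. meet \<tau> c t"]
  by (simp add: cexp_empty tail_meet_def)

lemma avg_meet_pair_ge:
  assumes a: "a \<in> V" "b \<in> V" "a \<noteq> b"
    and g: "\<And>e e'. e \<in> tails \<Longrightarrow> e' \<in> tails \<Longrightarrow> e \<noteq> e' \<Longrightarrow> g \<le> tail_meet t e e'"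
  shows "g \<le> avg (\<lambda>\<sigma>. meet \<sigma> c (Suc t) a b)"
proof -
  have "(\<Sum>i<dout a. \<Sum>j<dout b. g) \<le> (\<Sum>i<dout a. \<Sum>j<dout b. tail_meet t (a, i) (b, j))"
    using a by (intro sum_mono g) (auto simp: in_tails)
  hence "(\<Sum>i<dout a. \<Sum>j<dout b. g) / (real (dout a) * real (dout b)) \<le> avg (\<lambda>\<sigma>. meet \<sigma> c (Suc t) a b)"
    unfolding avg_meet_pair[OF a(1,2)] by (rule divide_right_mono) simp
  thus ?thesis using dout_pos[OF a(1)] dout_pos[OF a(2)] by simp
qed

lemma avg_meet_diag_le:
  assumes a: "a \<in> V" and h: "h' \<le> h"
    and same: "\<And>e. e \<in> tails \<Longrightarrow> tail_meet t e e \<le> h"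
    and diff: "\<And>e e'. e \<in> tails \<Longrightarrow> e' \<in> tails \<Longrightarrow> e \<noteq> e' \<Longrightarrow> tail_meet t e e' \<le> h'"
  shows "avg (\<lambda>\<sigma>. meet \<sigma> c (Suc t) a a) \<le> (h + h') / 2"
proof -
  have "cexp undefined {} (\<lambda>\<tau>. meet \<tau> c (Suc t) a a) \<le> (h + h') / 2"
    unfolding meet.simps
  proof (rule cexp_diag_le[OF a _ _ h])
    fix i assume "i < dout a"
    thus "cexp undefined {} (\<lambda>\<tau>. meet \<tau> c t (fst (\<tau> (a, i))) (fst (\<tau> (a, i)))) \<le> h"
      using same[of "(a, i)"] a by (simp add: cexp_empty tail_meet_def in_tails)
  next
    fix i j assume "i < dout a" "j < dout a" "i \<noteq> j"
    thus "cexp undefined {} (\<lambda>\<tau>. meet \<tau> c t (fst (\<tau> (a, i))) (fst (\<tau> (a, j)))) \<le> h'"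
      using diff[of "(a, i)" "(a, j)"] a by (simp add: cexp_empty tail_meet_def in_tails)
  qed
  thus ?thesis by (simp add: cexp_empty)
qed

text \<open>In every matching each head is used exactly once. Averaged over all tails, the landing
  vertex is therefore exactly size-biased by in-degree, with no error from conditioning.\<close>

lemma sum_tail_meet_same:
  "(\<Sum>e\<in>tails. tail_meet t e e) = (\<Sum>x\<in>V. real (din x) * avg (\<lambda>\<sigma>. meet \<sigma> c t x x))"
proof -
  have "(\<Sum>e\<in>tails. tail_meet t e e) = avg (\<lambda>\<sigma>. \<Sum>e\<in>tails. meet \<sigma> c t (fst (\<sigma> e)) (fst (\<sigma> e)))"
    by (simp add: tail_meet_def avg_sum)
  also have "\<dots> = avg (\<lambda>\<sigma>. \<Sum>f\<in>heads. meet \<sigma> c t (fst f) (fst f))"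
    by (rule avg_cong) (rule sum.reindex_bij_betw[OF S_bij])
  also have "\<dots> = avg (\<lambda>\<sigma>. \<Sum>x\<in>V. real (din x) * meet \<sigma> c t x x)"
    by (rule avg_cong) (rule sum_heads)
  finally show ?thesis by (simp add: avg_sum avg_mult)
qed

lemma sum_tail_meet_all:
  "(\<Sum>e\<in>tails. \<Sum>e'\<in>tails. if e = e' then 0 else tail_meet t e e')
    = avg (\<lambda>\<sigma>. \<Sum>f\<in>heads. \<Sum>f'\<in>heads. if f = f' then 0 else meet \<sigma> c t (fst f) (fst f'))"
proof -
  have "(\<Sum>e\<in>tails. \<Sum>e'\<in>tails. if e = e' then 0 else tail_meet t e e')
     = avg (\<lambda>\<sigma>. \<Sum>e\<in>tails. \<Sum>e'\<in>tails. if e = e' then 0 else meet \<sigma> c t (fst (\<sigma> e)) (fst (\<sigma> e')))"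
    unfolding avg_sum by (intro sum.cong refl) (simp add: tail_meet_def avg_const)
  also have "\<dots> = avg (\<lambda>\<sigma>. \<Sum>f\<in>heads. \<Sum>f'\<in>heads. if f = f' then 0 else meet \<sigma> c t (fst f) (fst f'))"
  proof (rule avg_cong)
    fix \<sigma> assume \<sigma>: "\<sigma> \<in> S"
    have "(\<Sum>e\<in>tails. \<Sum>e'\<in>tails. if e = e' then 0 else meet \<sigma> c t (fst (\<sigma> e)) (fst (\<sigma> e')))
      = (\<Sum>e\<in>tails. \<Sum>e'\<in>tails. if \<sigma> e = \<sigma> e' then 0 else meet \<sigma> c t (fst (\<sigma> e)) (fst (\<sigma> e')))"
      using S_inj[OF \<sigma>] by (intro sum.cong refl) (auto dest: inj_onD)
    also have "\<dots> = (\<Sum>e\<in>tails. \<Sum>f'\<in>heads. if \<sigma> e = f' then 0 else meet \<sigma> c t (fst (\<sigma> e)) (fst f'))"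
    proof (rule sum.cong[OF refl])
      fix e
      show "(\<Sum>e'\<in>tails. if \<sigma> e = \<sigma> e' then 0 else meet \<sigma> c t (fst (\<sigma> e)) (fst (\<sigma> e')))
        = (\<Sum>f'\<in>heads. if \<sigma> e = f' then 0 else meet \<sigma> c t (fst (\<sigma> e)) (fst f'))"
        by (rule sum.reindex_bij_betw[OF S_bij[OF \<sigma>], of "\<lambda>f'. if \<sigma> e = f' then 0 else meet \<sigma> c t (fst (\<sigma> e)) (fst f')"])
    qed
    also have "\<dots> = (\<Sum>f\<in>heads. \<Sum>f'\<in>heads. if f = f' then 0 else meet \<sigma> c t (fst f) (fst f'))"
      by (rule sum.reindex_bij_betw[OF S_bij[OF \<sigma>], of "\<lambda>f. \<Sum>f'\<in>heads. if f = f' then 0 else meet \<sigma> c t (fst f) (fst f')"])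
    finally show "(\<Sum>e\<in>tails. \<Sum>e'\<in>tails. if e = e' then 0 else meet \<sigma> c t (fst (\<sigma> e)) (fst (\<sigma> e')))
      = (\<Sum>f\<in>heads. \<Sum>f'\<in>heads. if f = f' then 0 else meet \<sigma> c t (fst f) (fst f'))" .
  qed
  finally show ?thesis .
qed

text \<open>Summing over all pairs of tails amounts to summing over all pairs of heads. A proportion
  of at least \<open>1 - \<kappa>\<close> of these lies at distinct vertices, where the next two
  tails are distinct again. So the meeting probability of distinct tails hardly drops from
  \<open>t\<close> to \<open>t + 1\<close>.\<close>

lemma tail_meet_Suc_ge:
  assumes g0: "0 \<le> g" and g: "\<And>e e'. e \<in> tails \<Longrightarrow> e' \<in> tails \<Longrightarrow> e \<noteq> e' \<Longrightarrow> g \<le> tail_meet t e e'"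
    and h: "\<And>e e'. e \<in> tails \<Longrightarrow> e' \<in> tails \<Longrightarrow> e \<noteq> e' \<Longrightarrow> tail_meet (Suc t) e e' \<le> h" and h0: "0 \<le> h"
  shows "(1 - \<kappa>) * g \<le> h"
proof -
  let ?S2 = "\<Sum>v\<in>V. (real (din v))\<^sup>2"
  have m: "0 < real m" using m_pos by simp
  have "(\<Sum>f\<in>heads. \<Sum>f'\<in>heads. if fst f = fst f' then 0 else g)
     \<le> (\<Sum>f\<in>heads. \<Sum>f'\<in>heads. if f = f' then 0 else avg (\<lambda>\<sigma>. meet \<sigma> c (Suc t) (fst f) (fst f')))"
  proof (intro sum_mono)
    fix f f' assume f: "f \<in> heads" "f' \<in> heads"
    have "0 \<le> avg (\<lambda>\<sigma>. meet \<sigma> c (Suc t) (fst f) (fst f'))"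
      by (rule avg_nonneg, rule meet_nonneg) (use f head_fst c_nonneg in auto)
    thus "(if fst f = fst f' then 0 else g) \<le> (if f = f' then 0 else avg (\<lambda>\<sigma>. meet \<sigma> c (Suc t) (fst f) (fst f')))"
      using avg_meet_pair_ge[OF head_fst[OF f(1)] head_fst[OF f(2)] _ g] by auto
  qed
  also have "\<dots> = avg (\<lambda>\<sigma>. \<Sum>f\<in>heads. \<Sum>f'\<in>heads. if f = f' then 0 else meet \<sigma> c (Suc t) (fst f) (fst f'))"
    unfolding avg_sum by (intro sum.cong refl) (simp add: avg_const)
  also have "\<dots> = (\<Sum>e\<in>tails. \<Sum>e'\<in>tails. if e = e' then 0 else tail_meet (Suc t) e e')"
    by (rule sum_tail_meet_all[symmetric])
  also have "\<dots> \<le> (\<Sum>e\<in>tails. \<Sum>e'\<in>tails. h)" using h h0 by (intro sum_mono) auto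
  also have "\<dots> = (real m)\<^sup>2 * h" by (simp add: card_tails power2_eq_square)
  finally have up: "(\<Sum>f\<in>heads. \<Sum>f'\<in>heads. if fst f = fst f' then 0 else g) \<le> (real m)\<^sup>2 * h" .
  have "(\<Sum>f\<in>heads. \<Sum>f'\<in>heads. if fst f = fst f' then 0 else g) = (\<Sum>f\<in>heads. (real m - real (din (fst f))) * g)"
  proof (rule sum.cong[OF refl])
    fix f assume f: "f \<in> heads"
    have "(\<Sum>f'\<in>heads. if fst f = fst f' then 0 else g) = (\<Sum>f'\<in>heads. g - (if fst f = fst f' then g else 0))"
      by (intro sum.cong) auto
    also have "\<dots> = real m * g - (\<Sum>f'\<in>heads. if fst f = fst f' then g else 0)"
      by (simp add: sum_subtractf card_heads)
    also have "(\<Sum>f'\<in>heads. if fst f = fst f' then g else 0) = (\<Sum>v\<in>V. real (din v) * (if fst f = v then g else 0))"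
      by (rule sum_heads[of "\<lambda>v. if fst f = v then g else 0"])
    also have "\<dots> = (\<Sum>v\<in>V. if fst f = v then real (din v) * g else 0)" by (rule sum.cong) auto
    also have "\<dots> = real (din (fst f)) * g" using head_fst[OF f] by simp
    finally show "(\<Sum>f'\<in>heads. if fst f = fst f' then 0 else g) = (real m - real (din (fst f))) * g"
      by (simp add: algebra_simps)
  qed
  also have "\<dots> = (\<Sum>v\<in>V. real (din v) * ((real m - real (din v)) * g))"
    by (rule sum_heads)
  also have "\<dots> = real m * (\<Sum>v\<in>V. real (din v)) * g - ?S2 * g"
    by (simp add: sum_subtractf[symmetric] sum_distrib_left sum_distrib_right algebra_simps power2_eq_square)
  also have "(\<Sum>v\<in>V. real (din v)) = real m" using sum_heads[of "\<lambda>_. 1"] card_heads by simp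
  finally have "(real m * real m - ?S2) * g \<le> (real m)\<^sup>2 * h" using up by (simp add: algebra_simps)
  hence "(1 - ?S2 / (real m)\<^sup>2) * g \<le> h" using m by (simp add: field_simps power2_eq_square)
  moreover have "?S2 / (real m)\<^sup>2 \<le> \<kappa>" unfolding pair_rate_def
    using s_less by (intro divide_left_mono power_mono sum_nonneg) (auto simp: mult_pos_pos)
  hence "(1 - \<kappa>) * g \<le> (1 - ?S2 / (real m)\<^sup>2) * g" using g0 by (intro mult_right_mono) auto
  ultimately show ?thesis by linarith
qed

definition gap :: "nat \<Rightarrow> real" where
  "gap N = 12 * ((real N + 1) * err N) + 16 * real N * q\<^sup>2 + 2 * \<kappa> * (2 * \<kappa> + (real N + 1) * err N)
     + (1 + (real N + 1)\<^sup>2 * q) / 2 ^ N"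

text \<open>A common value \<open>g\<close> for meetings from equal and from distinct starts makes
  the expected squared \<open>L^2\<close> distance \<open>meet a a + meet b b - 2 meet a b\<close>
  of two laws small. For equal starts, \<open>Q\<close> relaxes towards \<open>g\<close>: at a
  common vertex the walks choose different tails with probability at least 1/2, and then they behave
  like any pair of distinct tails.\<close>

theorem avg_meet_bounds:
  assumes s: "2 + 2 * N \<le> s"
  shows "\<exists>g. 0 \<le> g \<and> g \<le> 2 * \<kappa> + (real N + 1) * err N \<and>
    (\<forall>a\<in>V. avg (\<lambda>\<sigma>. meet \<sigma> c (Suc N) a a) \<le> g + gap N / 2) \<and>
    (\<forall>a\<in>V. \<forall>b\<in>V. a \<noteq> b \<longrightarrow> g - gap N / 2 \<le> avg (\<lambda>\<sigma>. meet \<sigma> c (Suc N) a b)) \<and> 0 \<le> gap N"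
proof -
  note q_nonneg [simp]
  have k0 [simp]: "0 \<le> \<kappa>" by (rule pair_rate_nonneg)
  have m2: "2 \<le> m" using m_ge n_pos by simp
  have "1 \<in> V" using n_pos by (simp add: V_def)
  hence "(1, 0) \<in> tails" "(1, 1) \<in> tails" using V_dout[of 1] by (auto simp: in_tails)
  then obtain e0 e1 where e01: "e0 \<in> tails" "e1 \<in> tails" "e0 \<noteq> e1" by (metis prod.inject zero_neq_one)
  define E where "E = (real N + 1) * err N"
  define Gub where "Gub = 2 * \<kappa> + E"
  define E3 where "E3 t = E + 8 * real N * q\<^sup>2 + (real t + 1) * q / 2 ^ t" for t :: nat
  define g where "g t = tail_meet t e0 e1" for t
  define Q where "Q t = (\<Sum>e\<in>tails. tail_meet t e e) / real m" for t
  have E0 [simp]: "0 \<le> E" using err_nonneg by (simp add: E_def)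
  have Gub0: "0 \<le> Gub" by (simp add: Gub_def)
  have E30 [simp]: "0 \<le> E3 t" for t by (simp add: E3_def)
  have g0: "0 \<le> g t" for t unfolding g_def using e01 by (intro tail_meet_nonneg)
  have gub: "g t \<le> Gub" if "t \<le> N" for t
    unfolding g_def Gub_def E_def using that s by (intro tail_meet_distinct_bound e01) auto
  have up: "tail_meet t e e' \<le> g t + E" if "t \<le> N" "e \<in> tails" "e' \<in> tails" "e \<noteq> e'" for t e e'
    unfolding g_def E_def using that s by (intro tail_meet_distinct_le e01) auto
  have lo: "g t - E \<le> tail_meet t e e'" if "t \<le> N" "e \<in> tails" "e' \<in> tails" "e \<noteq> e'" for t e e'
    using tail_meet_distinct_le[of t N e0 e1 e e'] that s e01 by (simp add: g_def E_def)
  have Qup: "tail_meet t e e \<le> Q t + E3 t" if "t \<le> N" "e \<in> tails" for t e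
  proof -
    have "(\<Sum>d\<in>tails. tail_meet t e e) \<le> (\<Sum>d\<in>tails. tail_meet t d d + E3 t)"
      unfolding E3_def E_def using that s by (intro sum_mono tail_meet_same_le) auto
    hence "real m * tail_meet t e e \<le> (\<Sum>d\<in>tails. tail_meet t d d) + real m * E3 t"
      by (simp add: sum.distrib card_tails)
    thus ?thesis using m2 by (simp add: Q_def field_simps)
  qed
  have gstep: "g t \<le> g (Suc t) + 2 * E + \<kappa> * Gub" if "Suc t \<le> N" for t
  proof (cases "g t - E \<ge> 0")
    case True
    have "(1 - \<kappa>) * (g t - E) \<le> g (Suc t) + E"
    proof (rule tail_meet_Suc_ge[OF True, where t=t])
      show "0 \<le> g (Suc t) + E" using g0 E0 by (rule add_nonneg_nonneg)
    qed (use lo up that in auto)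
    moreover have "\<kappa> * (g t - E) \<le> \<kappa> * Gub" using gub[of t] that by (intro mult_left_mono) (auto intro: order_trans[of _ "g t"])
    ultimately show ?thesis by (simp add: algebra_simps)
  next
    case False
    thus ?thesis using g0[of "Suc t"] E0 mult_nonneg_nonneg[OF k0 Gub0] by linarith
  qed
  have diag: "avg (\<lambda>\<sigma>. meet \<sigma> c (Suc t) a a) \<le> g t + E + (X + E3 t) / 2"
    if "t \<le> N" "a \<in> V" "Q t \<le> g t + X" "0 \<le> X" for t a X
  proof -
    have "avg (\<lambda>\<sigma>. meet \<sigma> c (Suc t) a a) \<le> ((g t + X + E + E3 t) + (g t + E)) / 2"
    proof (rule avg_meet_diag_le[OF that(2)])
      fix e assume "e \<in> tails" thus "tail_meet t e e \<le> g t + X + E + E3 t"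
        using Qup[OF that(1), of e] that(3) E0 by linarith
    qed (use up that E30[of t] in auto)
    thus ?thesis by (simp add: field_simps)
  qed
  define Bd where "Bd = E / 2 + 4 * real N * q\<^sup>2 + 3 * E + \<kappa> * Gub"
  \<comment> \<open>The solution of
    \<open>X (t + 1) = X t / 2 + (N + 1) q / 2 ^ (t + 1) + Bd\<close> with
    \<open>X 0 = 1 + 2 Bd\<close>; it bounds the distance by which \<open>Q t\<close> exceeds
    \<open>g t\<close>.\<close>
  define X where "X t = (1 + real t * (real N + 1) * q) / 2 ^ t + 2 * Bd" for t :: nat
  have Bd0: "0 \<le> Bd" using Gub0 by (simp add: Bd_def)
  have X0: "0 \<le> X t" for t using Bd0 by (simp add: X_def)
  have QX: "Q t \<le> g t + X t" if "t \<le> N" for t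
    using that
  proof (induction t)
    case 0
    have "(\<Sum>e\<in>tails. tail_meet 0 e e) \<le> (\<Sum>e\<in>tails. 1)" by (intro sum_mono tail_meet_le_1)
    hence "Q 0 \<le> 1" using m2 by (simp add: Q_def card_tails)
    thus ?case using g0[of 0] Bd0 by (simp add: X_def)
  next
    case (Suc t)
    have "(\<Sum>e\<in>tails. tail_meet (Suc t) e e) \<le> (\<Sum>x\<in>V. real (din x) * (g t + E + (X t + E3 t) / 2))"
      unfolding sum_tail_meet_same using Suc X0 by (intro sum_mono mult_left_mono diag) auto
    also have "\<dots> = real m * (g t + E + (X t + E3 t) / 2)"
      using sum_heads[of "\<lambda>_. 1"] card_heads by (simp add: sum_distrib_right[symmetric])
    finally have "Q (Suc t) \<le> g t + E + (X t + E3 t) / 2" using m2 by (simp add: Q_def field_simps)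
    also have "\<dots> \<le> g (Suc t) + (3 * E + \<kappa> * Gub + (X t + E3 t) / 2)" using gstep[of t] Suc.prems by simp
    also have "3 * E + \<kappa> * Gub + (X t + E3 t) / 2 \<le> X (Suc t)"
    proof -
      have "(real t + 1) * q \<le> (real N + 1) * q" using Suc.prems by (intro mult_right_mono) auto
      hence "(real t + 1) * q / 2 ^ Suc t \<le> (real N + 1) * q / 2 ^ Suc t" by (intro divide_right_mono) auto
      moreover have "3 * E + \<kappa> * Gub + (X t + E3 t) / 2
         = (1 + real t * (real N + 1) * q) / 2 ^ Suc t + (real t + 1) * q / 2 ^ Suc t + 2 * Bd"
        by (simp add: X_def E3_def Bd_def field_simps)
      moreover have "X (Suc t) = (1 + real t * (real N + 1) * q) / 2 ^ Suc t + (real N + 1) * q / 2 ^ Suc t + 2 * Bd"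
        by (simp add: X_def field_simps)
      ultimately show ?thesis by linarith
    qed
    finally show ?case by simp
  qed
  have gapeq: "gap N = 2 * (2 * E + (X N + E3 N) / 2)"
    unfolding gap_def X_def E3_def Bd_def Gub_def E_def[symmetric]
    by (simp add: field_simps power2_eq_square)
  hence gap2: "gap N / 2 = 2 * E + (X N + E3 N) / 2" by simp
  show ?thesis
  proof (intro exI[of _ "g N"] conjI ballI impI)
    show "g N \<le> 2 * \<kappa> + (real N + 1) * err N" using gub[of N] by (simp add: Gub_def E_def)
    fix a assume a: "a \<in> V"
    show "avg (\<lambda>\<sigma>. meet \<sigma> c (Suc N) a a) \<le> g N + gap N / 2"
      by (rule order_trans[OF diag[OF order_refl a QX[OF order_refl] X0]]) (use E0 gap2 in auto)
    fix b assume b: "b \<in> V" "a \<noteq> b"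
    have "0 \<le> E + (X N + E3 N) / 2" using X0[of N] by (intro add_nonneg_nonneg divide_nonneg_pos) auto
    hence "g N - gap N / 2 \<le> g N - E" unfolding gap2 by simp
    also    have "g N - E \<le> avg (\<lambda>\<sigma>. meet \<sigma> c (Suc N) a b)"
      by (rule avg_meet_pair_ge[OF a b]) (use lo in auto)
    finally show "g N - gap N / 2 \<le> avg (\<lambda>\<sigma>. meet \<sigma> c (Suc N) a b)" .
  next
    show "0 \<le> gap N" using E0 X0[of N] E30[of N] unfolding gapeq by simp
  qed (rule g0)
qed

end

section \<open>Random rerouting\<close>

definition subset_avg :: "'a set \<Rightarrow> nat \<Rightarrow> ('a set \<Rightarrow> real) \<Rightarrow> real" where
  "subset_avg A k F = (\<Sum>R | R \<subseteq> A \<and> card R = k. F R) / real (card A choose k)"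

lemma finite_subsets_card: "finite A \<Longrightarrow> finite {R. R \<subseteq> A \<and> card R = k}"
  by (rule finite_subset[of _ "Pow A"]) auto

lemma subset_avg_mono:
  "(\<And>R. R \<subseteq> A \<Longrightarrow> card R = k \<Longrightarrow> F R \<le> G R) \<Longrightarrow> subset_avg A k F \<le> subset_avg A k G"
  unfolding subset_avg_def by (intro divide_right_mono sum_mono) auto

lemma subset_avg_cong:
  "(\<And>R. R \<subseteq> A \<Longrightarrow> card R = k \<Longrightarrow> F R = G R) \<Longrightarrow> subset_avg A k F = subset_avg A k G"
  by (intro antisym subset_avg_mono) auto

lemma subset_avg_add: "subset_avg A k (\<lambda>R. F R + G R) = subset_avg A k F + subset_avg A k G"
  by (simp add: subset_avg_def sum.distrib add_divide_distrib)

lemma subset_avg_mult: "subset_avg A k (\<lambda>R. c * F R) = c * subset_avg A k F"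
  by (simp add: subset_avg_def sum_distrib_left)

lemma subset_avg_sum: "subset_avg A k (\<lambda>R. \<Sum>b\<in>B. F b R) = (\<Sum>b\<in>B. subset_avg A k (F b))"
  unfolding subset_avg_def by (subst sum.swap) (simp add: sum_divide_distrib)

lemma subset_avg_const:
  assumes "finite A" "k \<le> card A" shows "subset_avg A k (\<lambda>_. c) = c"
  using assms by (simp add: subset_avg_def n_subsets)

lemma subset_avg_member:
  assumes A: "finite A" "f \<in> A" and k: "0 < k" "k \<le> card A"
  shows "subset_avg A k (\<lambda>R. if f \<in> R then 1 else 0) = real k / real (card A)"
proof -
  have "{R. R \<subseteq> A \<and> card R = k} \<inter> {R. f \<in> R} = insert f ` {R. R \<subseteq> A - {f} \<and> card R = k - 1}"
  proof (intro equalityI subsetI)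
    fix R assume R: "R \<in> {R. R \<subseteq> A \<and> card R = k} \<inter> {R. f \<in> R}"
    hence "R - {f} \<in> {R. R \<subseteq> A - {f} \<and> card R = k - 1}" "R = insert f (R - {f})"
      using A finite_subset by auto
    thus "R \<in> insert f ` {R. R \<subseteq> A - {f} \<and> card R = k - 1}" by blast
  next
    fix R assume "R \<in> insert f ` {R. R \<subseteq> A - {f} \<and> card R = k - 1}"
    then obtain R' where R': "R' \<subseteq> A - {f}" "card R' = k - 1" "R = insert f R'" by blast
    moreover have "finite R'" "f \<notin> R'" using R'(1) A finite_subset by blast+
    ultimately show "R \<in> {R. R \<subseteq> A \<and> card R = k} \<inter> {R. f \<in> R}" using A k by auto
  qed
  moreover have "inj_on (insert f) {R. R \<subseteq> A - {f} \<and> card R = k - 1}"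
    by (rule inj_onI) (metis (no_types, lifting) Diff_insert_absorb insert_Diff_single mem_Collect_eq subset_Diff_insert)
  ultimately have "card ({R. R \<subseteq> A \<and> card R = k} \<inter> {R. f \<in> R}) = (card A - 1) choose (k - 1)"
    using A by (simp add: card_image n_subsets)
  hence "subset_avg A k (\<lambda>R. if f \<in> R then 1 else 0) = real ((card A - 1) choose (k - 1)) / real (card A choose k)"
    using finite_subsets_card[OF A(1), of k] by (simp add: subset_avg_def sum.If_cases)
  moreover have "real k * real (card A choose k) = real (card A) * real ((card A - 1) choose (k - 1))"
    using times_binomial_minus1_eq[OF k(1), of "card A"] by (metis of_nat_mult)
  moreover have "0 < real (card A choose k)" "0 < real (card A)" using k by auto
  moreover have "a = x / M" if "a = B / C" "x * C = M * B" "0 < C" "0 < M" for a x B C M :: real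
  proof -
    have "x = M * B / C" by (rule eq_divide_imp) (use that in auto)
    hence "x / M = B / C" using that by simp
    thus ?thesis using that by simp
  qed
  ultimately show ?thesis by blast
qed

lemma subset_avg_two_members:
  assumes A: "finite A" "f \<in> A" "g \<in> A" "f \<noteq> g" and k: "0 < k" "k \<le> card A"
  shows "subset_avg A k (\<lambda>R. if f \<in> R \<and> g \<in> R then 1 else 0)
    = real k * (real k - 1) / (real (card A) * (real (card A) - 1))"
proof (cases "k = 1")
  case True
  have "subset_avg A k (\<lambda>R. if f \<in> R \<and> g \<in> R then 1 else 0) = subset_avg A k (\<lambda>_. 0)"
    using A(4) True by (intro subset_avg_cong) (auto simp: card_1_singleton_iff)
  thus ?thesis using True subset_avg_const[OF A(1) k(2)] by simp
next
  case False
  hence k2: "2 \<le> k" using k by simp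
  have "{R. R \<subseteq> A \<and> card R = k} \<inter> {R. f \<in> R \<and> g \<in> R} = (\<lambda>R. insert f (insert g R)) ` {R. R \<subseteq> A - {f, g} \<and> card R = k - 2}"
  proof (intro equalityI subsetI)
    fix R assume R: "R \<in> {R. R \<subseteq> A \<and> card R = k} \<inter> {R. f \<in> R \<and> g \<in> R}"
    hence "R - {f, g} \<in> {R. R \<subseteq> A - {f, g} \<and> card R = k - 2}" "R = insert f (insert g (R - {f, g}))"
      using A finite_subset[of R A] by (auto simp: card_Diff_subset)
    thus "R \<in> (\<lambda>R. insert f (insert g R)) ` {R. R \<subseteq> A - {f, g} \<and> card R = k - 2}" by blast
  next
    fix R assume "R \<in> (\<lambda>R. insert f (insert g R)) ` {R. R \<subseteq> A - {f, g} \<and> card R = k - 2}"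
    then obtain R' where R': "R' \<subseteq> A - {f, g}" "card R' = k - 2" "R = insert f (insert g R')" by blast
    moreover have "finite R'" using R'(1) A finite_subset by blast
    moreover have "f \<notin> R'" "g \<notin> R'" using R'(1) by auto
    ultimately show "R \<in> {R. R \<subseteq> A \<and> card R = k} \<inter> {R. f \<in> R \<and> g \<in> R}" using A k2 by auto
  qed
  moreover have "inj_on (\<lambda>R. insert f (insert g R)) {R. R \<subseteq> A - {f, g} \<and> card R = k - 2}"
  proof (rule inj_onI)
    fix R R' assume a: "R \<in> {R. R \<subseteq> A - {f, g} \<and> card R = k - 2}" "R' \<in> {R. R \<subseteq> A - {f, g} \<and> card R = k - 2}"
      "insert f (insert g R) = insert f (insert g R')"
    have "R = insert f (insert g R) - {f, g}" "R' = insert f (insert g R') - {f, g}" using a(1,2) by auto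
    thus "R = R'" using a(3) by simp
  qed
  moreover have "card (A - {f, g}) = card A - 2" using A by (simp add: card_Diff_subset)
  ultimately have "card ({R. R \<subseteq> A \<and> card R = k} \<inter> {R. f \<in> R \<and> g \<in> R}) = (card A - 2) choose (k - 2)"
    using A by (simp add: card_image n_subsets)
  hence e: "subset_avg A k (\<lambda>R. if f \<in> R \<and> g \<in> R then 1 else 0) = real ((card A - 2) choose (k - 2)) / real (card A choose k)"
    using finite_subsets_card[OF A(1), of k] by (simp add: subset_avg_def sum.If_cases)
  have 1: "real k * real (card A choose k) = real (card A) * real ((card A - 1) choose (k - 1))"
    using times_binomial_minus1_eq[OF k(1), of "card A"] by (metis of_nat_mult)
  have "(k - 1) * ((card A - 1) choose (k - 1)) = (card A - 1) * ((card A - 1 - 1) choose (k - 1 - 1))"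
    using k2 by (intro times_binomial_minus1_eq) simp
  hence "real (k - 1) * real ((card A - 1) choose (k - 1)) = real (card A - 1) * real ((card A - 2) choose (k - 2))"
    by (simp only: of_nat_mult[symmetric] diff_diff_left one_add_one)
  moreover have "real (k - 1) = real k - 1" "real (card A - 1) = real (card A) - 1" using k by (auto simp: of_nat_diff)
  ultimately have 2: "(real k - 1) * real ((card A - 1) choose (k - 1)) = (real (card A) - 1) * real ((card A - 2) choose (k - 2))"
    by simp
  have "real k * (real k - 1) * real (card A choose k)
      = real (card A) * (real (card A) - 1) * real ((card A - 2) choose (k - 2))"
  proof -
    have "real k * (real k - 1) * real (card A choose k) = (real k - 1) * (real k * real (card A choose k))" by simp
    also have "\<dots> = real (card A) * ((real k - 1) * real ((card A - 1) choose (k - 1)))" unfolding 1 by simp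
    finally show ?thesis unfolding 2 by simp
  qed
  moreover have "0 < real (card A choose k)" "0 < real (card A)" "0 < real (card A) - 1" using k k2 by auto
  ultimately show ?thesis unfolding e by (simp add: field_simps)
qed

lemma two_members_le:
  assumes "1 \<le> k" "k \<le> (M::nat)"
  shows "real k * (real k - 1) / (real M * (real M - 1)) \<le> (real k / real M)\<^sup>2"
    "0 \<le> real k * (real k - 1) / (real M * (real M - 1))"
proof -
  show "0 \<le> real k * (real k - 1) / (real M * (real M - 1))" using assms by auto
  show "real k * (real k - 1) / (real M * (real M - 1)) \<le> (real k / real M)\<^sup>2"
  proof (cases "M = 1")
    case False
    hence "(real k - 1) / (real M - 1) \<le> real k / real M" using assms by (simp add: divide_simps) (simp add: algebra_simps)
    from mult_left_mono[OF this, of "real k / real M"] show ?thesis by (simp add: power2_eq_square)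
  qed (use assms in simp)
qed

text \<open>All pairs of elements have the same joint inclusion probability
  \<open>b \<ge> 0\<close>. For a centred \<open>z\<close> the term \<open>b * (sum of z)^2\<close>
  vanishes and the diagonal remains, with a coefficient below \<open>k / card A\<close>.\<close>

lemma subset_avg_square_le:
  assumes A: "finite A" and k: "0 < k" "k \<le> card A" and z: "(\<Sum>f\<in>A. z f) = 0"
  shows "subset_avg A k (\<lambda>R. (\<Sum>f\<in>R. z f)\<^sup>2) \<le> real k / real (card A) * (\<Sum>f\<in>A. (z f)\<^sup>2)"
proof -
  define b where "b = real k * (real k - 1) / (real (card A) * (real (card A) - 1))"
  let ?a = "real k / real (card A)"
  have b0: "0 \<le> b" unfolding b_def using two_members_le(2)[of k "card A"] k by simp
  have "subset_avg A k (\<lambda>R. (\<Sum>f\<in>R. z f)\<^sup>2)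
      = subset_avg A k (\<lambda>R. \<Sum>f\<in>A. \<Sum>g\<in>A. z f * z g * (if f \<in> R \<and> g \<in> R then 1 else 0))"
  proof (rule subset_avg_cong)
    fix R assume R: "R \<subseteq> A"
    have "(\<Sum>f\<in>R. z f) = (\<Sum>f\<in>A. if f \<in> R then z f else 0)"
      using R A by (simp add: sum.inter_restrict[symmetric] Int_absorb1)
    hence "(\<Sum>f\<in>R. z f)\<^sup>2 = (\<Sum>f\<in>A. if f \<in> R then z f else 0) * (\<Sum>f\<in>A. if f \<in> R then z f else 0)"
      by (simp add: power2_eq_square)
    also have "\<dots> = (\<Sum>f\<in>A. \<Sum>g\<in>A. z f * z g * (if f \<in> R \<and> g \<in> R then 1 else 0))"
      unfolding sum_product by (intro sum.cong) auto
    finally show "(\<Sum>f\<in>R. z f)\<^sup>2 = (\<Sum>f\<in>A. \<Sum>g\<in>A. z f * z g * (if f \<in> R \<and> g \<in> R then 1 else 0))" .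
  qed
  also have "\<dots> = (\<Sum>f\<in>A. \<Sum>g\<in>A. z f * z g * subset_avg A k (\<lambda>R. if f \<in> R \<and> g \<in> R then 1 else 0))"
    by (simp add: subset_avg_sum subset_avg_mult)
  also have "\<dots> = (\<Sum>f\<in>A. \<Sum>g\<in>A. b * (z f * z g) + (if f = g then (?a - b) * (z f)\<^sup>2 else 0))"
    using subset_avg_member[OF A _ k] subset_avg_two_members[OF A _ _ _ k]
    by (intro sum.cong refl) (auto simp: b_def algebra_simps power2_eq_square)
  also have "\<dots> = b * ((\<Sum>f\<in>A. z f) * (\<Sum>g\<in>A. z g)) + (?a - b) * (\<Sum>f\<in>A. (z f)\<^sup>2)"
    using A by (simp add: sum.distrib sum_product sum_distrib_left[symmetric])
  also have "\<dots> \<le> ?a * (\<Sum>f\<in>A. (z f)\<^sup>2)" using z b0 by (simp add: algebra_simps sum_nonneg)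
  finally show ?thesis .
qed

context dcm_model
begin

lemma max_degree_attained: obtains v where "v \<in> V" "din v = D"
proof -
  have "D \<in> din ` V" unfolding max_degree_def V_def by (rule Max_in) (use n_pos in auto)
  then obtain v where "v \<in> V" "D = din v" by (rule imageE)
  thus thesis using that[of v] by simp
qed

lemma D_le_m: "D \<le> m"
proof -
  obtain v where v: "v \<in> V" "din v = D" by (rule max_degree_attained)
  have "din v \<le> (\<Sum>v\<in>V. din v)" using v by (intro member_le_sum) auto
  also have "\<dots> = m" using bidegree by (simp add: bidegree_sequence_def num_edges_def V_def)
  finally show ?thesis using v by simp
qed

section \<open>The exchange of heads and the walk after it\<close>

abbreviation \<delta> :: real where "\<delta> \<equiv> real D / real m"
abbreviation ind :: "nat \<Rightarrow> nat \<Rightarrow> real" where "ind v \<equiv> \<lambda>x. if x = v then 1 else 0"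

definition use_heads :: "(nat \<times> nat \<Rightarrow> nat \<times> nat) \<Rightarrow> (nat \<times> nat) set \<Rightarrow> nat \<Rightarrow> real" where
  "use_heads \<sigma> R x = (\<Sum>i<dout x. if \<sigma> (x, i) \<in> R then 1 else 0) / real (dout x)"

text \<open>The law of the head used in step \<open>t + 1\<close>. It is resolved by heads and not
  by vertices because the random set \<open>R\<close> consists of heads.\<close>

definition flow :: "(nat \<times> nat \<Rightarrow> nat \<times> nat) \<Rightarrow> nat \<Rightarrow> nat \<Rightarrow> nat \<times> nat \<Rightarrow> real" where
  "flow \<sigma> t x f = walk \<sigma> t (use_heads \<sigma> {f}) x"

lemma use_heads_nonneg: "0 \<le> use_heads \<sigma> R x"
  unfolding use_heads_def by (intro divide_nonneg_nonneg sum_nonneg) auto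

lemma flow_nonneg: "\<sigma> \<in> S \<Longrightarrow> x \<in> V \<Longrightarrow> 0 \<le> flow \<sigma> t x f"
  unfolding flow_def by (rule walk_nonneg) (rule use_heads_nonneg | assumption)+

lemma walk_cong:
  "\<sigma> \<in> S \<Longrightarrow> x \<in> V \<Longrightarrow> (\<And>z. z \<in> V \<Longrightarrow> \<phi> z = \<psi> z) \<Longrightarrow> walk \<sigma> t \<phi> x = walk \<sigma> t \<psi> x"
  by (intro antisym walk_mono) auto

lemma walk_const: "\<sigma> \<in> S \<Longrightarrow> x \<in> V \<Longrightarrow> walk \<sigma> t (\<lambda>_. c) x = c"
proof (induction t arbitrary: x)
  case (Suc t)
  have "step \<sigma> UNIV (walk \<sigma> t (\<lambda>_. c)) x = step \<sigma> UNIV (\<lambda>_. c) x"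
    by (rule step_cong) (use Suc in auto)
  thus ?case using Suc.prems by (simp add: walk_Suc step_const)
qed simp

lemma walk_use_heads:
  assumes "finite R" shows "walk \<sigma> t (use_heads \<sigma> R) x = (\<Sum>f\<in>R. flow \<sigma> t x f)"
proof -
  have "use_heads \<sigma> R = (\<lambda>z. \<Sum>f\<in>R. use_heads \<sigma> {f} z)"
  proof
    fix z
    have "(\<Sum>f\<in>R. use_heads \<sigma> {f} z) = (\<Sum>f\<in>R. \<Sum>i<dout z. if \<sigma> (z, i) = f then 1 else 0) / real (dout z)"
      by (simp add: use_heads_def sum_divide_distrib)
    also have "(\<Sum>f\<in>R. \<Sum>i<dout z. if \<sigma> (z, i) = f then 1 else (0::real)) = (\<Sum>i<dout z. \<Sum>f\<in>R. if \<sigma> (z, i) = f then 1 else 0)"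
      by (rule sum.swap)
    also have "\<dots> = (\<Sum>i<dout z. if \<sigma> (z, i) \<in> R then 1 else 0)"
      using assms by (intro sum.cong refl) simp
    finally show "use_heads \<sigma> R z = (\<Sum>f\<in>R. use_heads \<sigma> {f} z)" by (simp add: use_heads_def)
  qed
  thus ?thesis by (simp add: walk_sum flow_def)
qed

lemma sum_flow: "\<sigma> \<in> S \<Longrightarrow> x \<in> V \<Longrightarrow> (\<Sum>f\<in>heads. flow \<sigma> t x f) = 1"
proof -
  assume \<sigma>: "\<sigma> \<in> S" and x: "x \<in> V"
  have "(\<Sum>f\<in>heads. flow \<sigma> t x f) = walk \<sigma> t (use_heads \<sigma> heads) x" by (rule walk_use_heads[symmetric]) simp
  also have "\<dots> = walk \<sigma> t (\<lambda>_. 1) x"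
  proof (rule walk_cong[OF \<sigma> x])
    fix z assume z: "z \<in> V"
    have "\<sigma> (z, i) \<in> heads" if "i < dout z" for i using S_heads[OF \<sigma>] z that by (simp add: in_tails)
    thus "use_heads \<sigma> heads z = 1" using dout_pos[OF z] by (simp add: use_heads_def)
  qed
  finally show ?thesis by (simp add: walk_const[OF \<sigma> x])
qed

text \<open>Two walks use the same head precisely when they stand at the same vertex and choose the
  same tail there. The second event has conditional probability \<open>1 / dout\<close>; this is the
  weight for which the meeting estimates are applied.\<close>

lemma sum_flow_product:
  assumes \<sigma>: "\<sigma> \<in> S" and a: "a \<in> V" and b: "b \<in> V"
  shows "(\<Sum>f\<in>heads. flow \<sigma> t a f * flow \<sigma> t b f) = meet \<sigma> (\<lambda>x. 1 / real (dout x)) t a b"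
proof -
  let ?p = "\<lambda>x. walk \<sigma> t (ind x)"
  have fl: "flow \<sigma> t x (\<sigma> e) = ?p (fst e) x / real (dout (fst e))" if e: "e \<in> tails" and x: "x \<in> V" for e x
  proof -
    have "flow \<sigma> t x (\<sigma> e) = walk \<sigma> t (\<lambda>z. 1 / real (dout (fst e)) * ind (fst e) z) x"
      unfolding flow_def
    proof (rule walk_cong[OF \<sigma> x])
      fix z assume z: "z \<in> V"
      have "(\<Sum>i<dout z. if \<sigma> (z, i) \<in> {\<sigma> e} then 1 else 0) = (\<Sum>i<dout z. if i = snd e \<and> z = fst e then 1 else (0::real))"
      proof (rule sum.cong[OF refl])
        fix i assume "i \<in> {..<dout z}"
        hence "(z, i) \<in> tails" using z by (simp add: in_tails)
        hence "\<sigma> (z, i) = \<sigma> e \<longleftrightarrow> (z, i) = e" using inj_on_eq_iff[OF S_inj[OF \<sigma>]] e by blast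
        thus "(if \<sigma> (z, i) \<in> {\<sigma> e} then 1 else 0) = (if i = snd e \<and> z = fst e then 1 else (0::real))"
          by (auto simp: prod_eq_iff)
      qed
      also have "\<dots> = ind (fst e) z" using e by (cases "z = fst e") (auto simp: half_edges_def)
      finally show "use_heads \<sigma> {\<sigma> e} z = 1 / real (dout (fst e)) * ind (fst e) z"
        by (simp add: use_heads_def)
    qed
    thus ?thesis unfolding walk_cmult by simp
  qed
  have "(\<Sum>f\<in>heads. flow \<sigma> t a f * flow \<sigma> t b f) = (\<Sum>e\<in>tails. flow \<sigma> t a (\<sigma> e) * flow \<sigma> t b (\<sigma> e))"
    by (rule sum.reindex_bij_betw[OF S_bij[OF \<sigma>], symmetric])
  also have "\<dots> = (\<Sum>e\<in>tails. ?p (fst e) a * ?p (fst e) b / (real (dout (fst e)) * real (dout (fst e))))"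
    using fl a b by (intro sum.cong) auto
  also have "\<dots> = (\<Sum>x\<in>V. 1 / real (dout x) * ?p x a * ?p x b)"
    unfolding sum_tails
  proof (rule sum.cong[OF refl])
    fix x assume "x \<in> V"
    hence "0 < real (dout x)" by (rule dout_pos)
    thus "(\<Sum>i<dout x. ?p (fst (x, i)) a * ?p (fst (x, i)) b / (real (dout (fst (x, i))) * real (dout (fst (x, i)))))
      = 1 / real (dout x) * ?p x a * ?p x b" by simp
  qed
  also have "\<dots> = meet \<sigma> (\<lambda>x. 1 / real (dout x)) t a b" by (rule meet_eq_sum[OF \<sigma> a b, symmetric])
  finally show ?thesis .
qed

definition heads_of :: "nat \<Rightarrow> (nat \<times> nat) set" where
  "heads_of v = {f \<in> heads. fst f = v}"

text \<open>An upper bound for the probability that the walk uses \<open>R\<close> in step \<open>t + 1\<close> after having used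
  \<open>R \<union> heads_of v\<close> before.\<close>

fun lost :: "(nat \<times> nat \<Rightarrow> nat \<times> nat) \<Rightarrow> nat \<Rightarrow> (nat \<times> nat) set \<Rightarrow> nat \<Rightarrow> nat \<Rightarrow> real" where
  "lost \<sigma> v R 0 y = 0"
| "lost \<sigma> v R (Suc t) y =
    (\<Sum>i<dout y. if \<sigma> (y, i) \<in> R \<union> heads_of v then walk \<sigma> t (use_heads \<sigma> R) (fst (\<sigma> (y, i))) else 0) / real (dout y)
     + step \<sigma> UNIV (lost \<sigma> v R t) y"

lemma lost_nonneg: "\<sigma> \<in> S \<Longrightarrow> y \<in> V \<Longrightarrow> 0 \<le> lost \<sigma> v R t y"
proof (induction t arbitrary: y)
  case (Suc t)
  have "0 \<le> walk \<sigma> t (use_heads \<sigma> R) (fst (\<sigma> (y, i)))" if "i < dout y" for i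
    using Suc.prems that by (intro walk_nonneg S_fst use_heads_nonneg)
  thus ?case using Suc
    by (auto intro!: add_nonneg_nonneg divide_nonneg_nonneg sum_nonneg step_nonneg)
qed simp

text \<open>\<open>R\<close> and the heads of \<open>v\<close> have the same size but may overlap.
  The overlap stays in place, and the two differences, again of equal size, are exchanged by an
  involution.\<close>

lemma exists_swap:
  assumes v: "v \<in> V" "din v = D" and R: "R \<subseteq> heads" "card R = D"
  obtains \<alpha> where "bij_betw \<alpha> heads heads" "\<And>f. f \<in> heads \<Longrightarrow> fst (\<alpha> f) = v \<longleftrightarrow> f \<in> R"
    "\<And>f. f \<in> heads \<Longrightarrow> f \<notin> R \<union> heads_of v \<Longrightarrow> \<alpha> f = f"
proof -
  let ?H = "heads_of v"
  have fin: "finite R" "finite ?H"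
    using finite_subset[OF R(1) finite_heads] by (simp_all add: heads_of_def)
  have "heads_of v = Pair v ` {..<din v}"
    using v(1) unfolding heads_of_def half_edges_def V_def[symmetric] by (auto simp: image_def)
  hence cH: "card ?H = D" using v by (simp add: card_image inj_on_def)
  have "card (R - ?H) = card (?H - R)"
    using fin cH R card_Diff_subset_Int[of R ?H] card_Diff_subset_Int[of ?H R] by (simp add: Int_commute)
  then obtain g where g: "bij_betw g (R - ?H) (?H - R)"
    using finite_same_card_bij[OF finite_Diff[OF fin(1)] finite_Diff[OF fin(2)]] by blast
  define h where "h = inv_into (R - ?H) g"
  have h: "bij_betw h (?H - R) (R - ?H)" unfolding h_def by (rule bij_betw_inv_into[OF g])
  have gh: "g (h f) = f" if "f \<in> ?H - R" for f
    unfolding h_def using g that by (metis bij_betw_def f_inv_into_f)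
  have hg: "h (g f) = f" if "f \<in> R - ?H" for f
    unfolding h_def using g that by (simp add: bij_betw_def)
  have gm: "g f \<in> ?H - R" if "f \<in> R - ?H" for f using g that by (rule bij_betw_apply)
  have hm: "h f \<in> R - ?H" if "f \<in> ?H - R" for f using h that by (rule bij_betw_apply)
  define \<alpha> where "\<alpha> f = (if f \<in> R - ?H then g f else if f \<in> ?H - R then h f else f)" for f
  have inv: "\<alpha> (\<alpha> f) = f" for f
  proof (cases "f \<in> R - ?H")
    case True
    hence "\<alpha> f = g f" by (simp add: \<alpha>_def)
    thus ?thesis using gm[OF True] hg[OF True] by (simp add: \<alpha>_def)
  next
    case False
    show ?thesis
    proof (cases "f \<in> ?H - R")
      case True
      hence "\<alpha> f = h f" using False by (simp add: \<alpha>_def)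
      thus ?thesis using hm[OF True] gh[OF True] by (simp add: \<alpha>_def)
    qed (use False in \<open>auto simp: \<alpha>_def\<close>)
  qed
  have Hh: "?H \<subseteq> heads" by (auto simp: heads_of_def)
  have im: "\<alpha> f \<in> heads" if "f \<in> heads" for f
    using that gm[of f] hm[of f] R Hh unfolding \<alpha>_def by (auto split: if_splits)
  show thesis
  proof (rule that)
    show "bij_betw \<alpha> heads heads"
      by (rule bij_betw_byWitness[where f'=\<alpha>]) (use inv im in auto)
    show "\<alpha> f = f" if "f \<in> heads" "f \<notin> R \<union> ?H" for f using that by (simp add: \<alpha>_def)
    show "fst (\<alpha> f) = v \<longleftrightarrow> f \<in> R" if f: "f \<in> heads" for f
    proof -
      have "\<alpha> f \<in> ?H \<longleftrightarrow> f \<in> R"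
        using gm[of f] hm[of f] unfolding \<alpha>_def by auto
      moreover have "\<alpha> f \<in> ?H \<longleftrightarrow> fst (\<alpha> f) = v" using im[OF f] by (simp add: heads_of_def)
      ultimately show ?thesis by simp
    qed
  qed
qed

text \<open>Until a head in \<open>R\<close> or at \<open>v\<close> is used, the walks in both
  matchings coincide, and the exchanged walk enters \<open>v\<close> in its last step exactly when
  the old matching leads that step to \<open>R\<close>. Walks that use such a head earlier are
  written off as \<open>lost\<close>.\<close>

lemma walk_swapped_ge:
  assumes \<sigma>: "\<sigma> \<in> S" and \<alpha>: "bij_betw \<alpha> heads heads"
    "\<And>f. f \<in> heads \<Longrightarrow> fst (\<alpha> f) = v \<longleftrightarrow> f \<in> R" "\<And>f. f \<in> heads \<Longrightarrow> f \<notin> R \<union> heads_of v \<Longrightarrow> \<alpha> f = f"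
    and \<sigma>': "\<sigma>' = restrict (\<alpha> \<circ> \<sigma>) tails"
  shows "y \<in> V \<Longrightarrow> walk \<sigma> t (use_heads \<sigma> R) y - lost \<sigma> v R t y \<le> walk \<sigma>' (Suc t) (ind v) y"
proof -
  have \<sigma>'S: "\<sigma>' \<in> S" unfolding \<sigma>' by (rule S_post[OF \<sigma> \<alpha>(1)])
  have app: "\<sigma>' (x, i) = \<alpha> (\<sigma> (x, i))" "\<sigma> (x, i) \<in> heads" if "x \<in> V" "i < dout x" for x i
    using that S_heads[OF \<sigma>] by (auto simp: \<sigma>' in_tails)
  have base: "step \<sigma>' UNIV (ind v) x = use_heads \<sigma> R x" if "x \<in> V" for x
    unfolding step_def use_heads_def using app \<alpha>(2) that by (auto intro!: arg_cong2[of _ _ _ _ "(/)"] sum.cong)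
  have main: "walk \<sigma> t (use_heads \<sigma> R) y - lost \<sigma> v R t y \<le> walk \<sigma>' t (use_heads \<sigma> R) y" if "y \<in> V" for t y
    using that
  proof (induction t arbitrary: y)
    case (Suc t)
    let ?u = "walk \<sigma> t (use_heads \<sigma> R)" and ?u' = "walk \<sigma>' t (use_heads \<sigma> R)" and ?l = "lost \<sigma> v R t"
    have "(\<Sum>i<dout y. ?u (fst (\<sigma> (y, i)))) - (\<Sum>i<dout y. if \<sigma> (y, i) \<in> R \<union> heads_of v then ?u (fst (\<sigma> (y, i))) else 0)
        - (\<Sum>i<dout y. ?l (fst (\<sigma> (y, i)))) \<le> (\<Sum>i<dout y. ?u' (fst (\<sigma>' (y, i))))"
      unfolding sum_subtractf[symmetric]
    proof (rule sum_mono)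
      fix i assume "i \<in> {..<dout y}"
      hence i: "i < dout y" by simp
      have z: "fst (\<sigma> (y, i)) \<in> V" "fst (\<sigma>' (y, i)) \<in> V" using S_fst \<sigma> \<sigma>'S Suc.prems i by auto
      show "?u (fst (\<sigma> (y, i))) - (if \<sigma> (y, i) \<in> R \<union> heads_of v then ?u (fst (\<sigma> (y, i))) else 0) - ?l (fst (\<sigma> (y, i)))
          \<le> ?u' (fst (\<sigma>' (y, i)))"
      proof (cases "\<sigma> (y, i) \<in> R \<union> heads_of v")
        case True
        have "0 \<le> ?l (fst (\<sigma> (y, i)))" using lost_nonneg[OF \<sigma> z(1)] .
        moreover have "0 \<le> ?u' (fst (\<sigma>' (y, i)))" by (rule walk_nonneg[OF \<sigma>'S z(2)]) (rule use_heads_nonneg)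
        ultimately show ?thesis using True by simp
      next
        case False
        hence "\<sigma>' (y, i) = \<sigma> (y, i)" using app[OF Suc.prems i] \<alpha>(3) by simp
        thus ?thesis using False Suc.IH[OF z(1)] by simp
      qed
    qed
    hence "((\<Sum>i<dout y. ?u (fst (\<sigma> (y, i)))) - (\<Sum>i<dout y. if \<sigma> (y, i) \<in> R \<union> heads_of v then ?u (fst (\<sigma> (y, i))) else 0)
        - (\<Sum>i<dout y. ?l (fst (\<sigma> (y, i))))) / real (dout y) \<le> (\<Sum>i<dout y. ?u' (fst (\<sigma>' (y, i)))) / real (dout y)"
      by (rule divide_right_mono) simp
    thus ?case by (simp add: walk_Suc step_def diff_divide_distrib)
  qed simp
  assume y: "y \<in> V"
  have "walk \<sigma>' (Suc t) (ind v) y = walk \<sigma>' t (use_heads \<sigma> R) y"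
    unfolding walk_Suc2 by (rule walk_cong[OF \<sigma>'S y base])
  thus ?thesis using main[OF y] by simp
qed

text \<open>The base point of the loop of length \<open>j\<close> is the position after
  \<open>r\<close> free steps.\<close>

fun return :: "(nat \<times> nat \<Rightarrow> nat \<times> nat) \<Rightarrow> nat \<Rightarrow> nat \<Rightarrow> nat \<Rightarrow> real" where
  "return \<sigma> 0 j y = walk \<sigma> j (ind y) y"
| "return \<sigma> (Suc r) j y = step \<sigma> UNIV (return \<sigma> r j) y"

lemma walk_le_1: "\<sigma> \<in> S \<Longrightarrow> x \<in> V \<Longrightarrow> (\<And>z. z \<in> V \<Longrightarrow> \<phi> z \<le> 1) \<Longrightarrow> walk \<sigma> t \<phi> x \<le> 1"
  by (induction t arbitrary: x) (auto simp: walk_Suc intro!: step_le_const)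

lemma return_le_1: "\<sigma> \<in> S \<Longrightarrow> x \<in> V \<Longrightarrow> return \<sigma> r j x \<le> 1"
  by (induction r arbitrary: x) (auto intro!: step_le_const walk_le_1)

text \<open>The walk uses a head \<open>f\<close> at step \<open>r + 1\<close> and a head
  \<open>g\<close> in \<open>R\<close> at the end. If \<open>f\<close> is a head of
  \<open>v\<close>, then \<open>g\<close> costs \<open>\<delta>\<close>; if
  \<open>f \<noteq> g\<close> both lie in \<open>R\<close>, this costs at most
  \<open>\<delta>^2\<close>; if \<open>f = g\<close>, the cost is a single \<open>\<delta>\<close>,
  but the walk has to come back to the vertex from which it used \<open>f\<close>.\<close>

lemma subset_avg_lost_le:
  assumes \<sigma>: "\<sigma> \<in> S"
  shows "y \<in> V \<Longrightarrow> subset_avg heads D (\<lambda>R. lost \<sigma> v R t y) \<le>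
     (\<Sum>r<t. \<delta> * walk \<sigma> (Suc r) (ind v) y + \<delta>\<^sup>2 + \<delta> * return \<sigma> r (t - r) y)"
proof (induction t arbitrary: y)
  case 0
  show ?case using subset_avg_const[OF finite_heads, of D 0] D_le_m card_heads by simp
next
  case (Suc t)
  let ?av = "subset_avg heads D"
  have Dm: "0 < D" "D \<le> card heads" using D_pos D_le_m card_heads by auto
  have d0: "0 \<le> \<delta>" by simp
  have mem: "?av (\<lambda>R. if f \<in> R then 1 else 0) = \<delta>" if "f \<in> heads" for f
    using subset_avg_member[OF finite_heads that Dm] card_heads by simp
  have two: "?av (\<lambda>R. if f \<in> R \<and> g \<in> R then 1 else 0) \<le> \<delta>\<^sup>2" if "f \<in> heads" "g \<in> heads" "f \<noteq> g" for f g
    using subset_avg_two_members[OF finite_heads that Dm] two_members_le(1)[of D "card heads"] Dm card_heads by simp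
  have first: "?av (\<lambda>R. if \<sigma> (y, i) \<in> R \<union> heads_of v then walk \<sigma> t (use_heads \<sigma> R) (fst (\<sigma> (y, i))) else 0)
     \<le> \<delta> * ind v (fst (\<sigma> (y, i))) + \<delta>\<^sup>2 + \<delta> * walk \<sigma> t (ind y) (fst (\<sigma> (y, i)))" if i: "i < dout y" for i
  proof -
    let ?f = "\<sigma> (y, i)"
    let ?z = "fst ?f"
    have fh: "?f \<in> heads" using S_heads[OF \<sigma>] Suc.prems i by (simp add: in_tails)
    have z: "?z \<in> V" by (rule head_fst[OF fh])
    have fl0: "0 \<le> flow \<sigma> t ?z g" for g by (rule flow_nonneg[OF \<sigma> z])
    \<comment> \<open>Only one tail is matched to \<open>?f\<close>, and it sits at
      \<open>y\<close>: using this head again means being at \<open>y\<close> again.\<close>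
    have flf: "flow \<sigma> t ?z ?f \<le> walk \<sigma> t (ind y) ?z"
      unfolding flow_def
    proof (rule walk_mono[OF \<sigma> z])
      fix x assume x: "x \<in> V"
      show "use_heads \<sigma> {?f} x \<le> ind y x"
      proof (cases "x = y")
        case True
        have "(\<Sum>i'<dout x. if \<sigma> (x, i') \<in> {?f} then 1 else 0) \<le> (\<Sum>i'<dout x. (1::real))"
          by (intro sum_mono) auto
        hence "use_heads \<sigma> {?f} x \<le> real (dout x) / real (dout x)"
          unfolding use_heads_def by (intro divide_right_mono) auto
        thus ?thesis using dout_pos[OF x] True by simp
      next
        case False
        have "\<sigma> (x, i') \<noteq> ?f" if "i' < dout x" for i'
          using inj_onD[OF S_inj[OF \<sigma>], of "(x, i')" "(y, i)"] that i x Suc.prems False by (auto simp: in_tails)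
        thus ?thesis using False by (simp add: use_heads_def)
      qed
    qed
    have "?av (\<lambda>R. if ?f \<in> R \<union> heads_of v then walk \<sigma> t (use_heads \<sigma> R) ?z else 0)
       \<le> ?av (\<lambda>R. \<Sum>g\<in>heads. flow \<sigma> t ?z g * (if ?f \<in> R \<and> g \<in> R then 1 else 0)
            + ind v ?z * (flow \<sigma> t ?z g * (if g \<in> R then 1 else 0)))"
    proof (rule subset_avg_mono)
      fix R assume R: "R \<subseteq> heads"
      have "walk \<sigma> t (use_heads \<sigma> R) ?z = (\<Sum>g\<in>R. flow \<sigma> t ?z g)"
        using R finite_subset by (intro walk_use_heads) blast
      also have "\<dots> = (\<Sum>g\<in>heads. if g \<in> R then flow \<sigma> t ?z g else 0)"
        using R by (simp add: sum.inter_restrict[symmetric] Int_absorb1)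
      finally have w: "walk \<sigma> t (use_heads \<sigma> R) ?z = (\<Sum>g\<in>heads. if g \<in> R then flow \<sigma> t ?z g else 0)" .
      show "(if ?f \<in> R \<union> heads_of v then walk \<sigma> t (use_heads \<sigma> R) ?z else 0)
        \<le> (\<Sum>g\<in>heads. flow \<sigma> t ?z g * (if ?f \<in> R \<and> g \<in> R then 1 else 0) + ind v ?z * (flow \<sigma> t ?z g * (if g \<in> R then 1 else 0)))"
      proof (cases "?f \<in> R \<union> heads_of v")
        case True
        hence "?f \<in> R \<or> ?z = v" by (auto simp: heads_of_def)
        thus ?thesis unfolding w using True fl0 by (auto intro!: sum_mono)
      next
        case False thus ?thesis using fl0 by (auto intro!: sum_nonneg add_nonneg_nonneg)
      qed
    qed
    also have "\<dots> = (\<Sum>g\<in>heads. flow \<sigma> t ?z g * ?av (\<lambda>R. if ?f \<in> R \<and> g \<in> R then 1 else 0)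
        + ind v ?z * (flow \<sigma> t ?z g * ?av (\<lambda>R. if g \<in> R then 1 else 0)))"
      by (simp only: subset_avg_sum subset_avg_add subset_avg_mult)
    also have "\<dots> \<le> (\<Sum>g\<in>heads. (flow \<sigma> t ?z g * \<delta>\<^sup>2 + (if g = ?f then flow \<sigma> t ?z ?f * \<delta> else 0)) + ind v ?z * (flow \<sigma> t ?z g * \<delta>))"
    proof (rule sum_mono, rule add_mono)
      fix g assume g: "g \<in> heads"
      show "flow \<sigma> t ?z g * ?av (\<lambda>R. if ?f \<in> R \<and> g \<in> R then 1 else 0) \<le> flow \<sigma> t ?z g * \<delta>\<^sup>2 + (if g = ?f then flow \<sigma> t ?z ?f * \<delta> else 0)"
      proof (cases "g = ?f")
        case True thus ?thesis using mem[OF fh] fl0 by (simp add: mult_nonneg_nonneg)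
      next
        case False
        hence "flow \<sigma> t ?z g * ?av (\<lambda>R. if ?f \<in> R \<and> g \<in> R then 1 else 0) \<le> flow \<sigma> t ?z g * \<delta>\<^sup>2"
          by (intro mult_left_mono two fh g fl0) auto
        thus ?thesis using False by simp
      qed
      show "ind v ?z * (flow \<sigma> t ?z g * ?av (\<lambda>R. if g \<in> R then 1 else 0)) \<le> ind v ?z * (flow \<sigma> t ?z g * \<delta>)"
        by (simp only: mem[OF g])
    qed
    also have "\<dots> = \<delta>\<^sup>2 + flow \<sigma> t ?z ?f * \<delta> + ind v ?z * \<delta>"
    proof -
      have "(\<Sum>g\<in>heads. flow \<sigma> t ?z g * c) = c" for c
        using sum_flow[OF \<sigma> z, of t] by (simp only: sum_distrib_right[symmetric] mult_1)
      moreover have "(\<Sum>g\<in>heads. ind v ?z * (flow \<sigma> t ?z g * \<delta>)) = ind v ?z * (\<Sum>g\<in>heads. flow \<sigma> t ?z g * \<delta>)"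
        by (simp only: sum_distrib_left)
      moreover have "(\<Sum>g\<in>heads. if g = ?f then flow \<sigma> t ?z ?f * \<delta> else 0) = flow \<sigma> t ?z ?f * \<delta>"
        using fh by simp
      ultimately show ?thesis by (simp only: sum.distrib)
    qed
    also have "\<dots> \<le> \<delta> * ind v ?z + \<delta>\<^sup>2 + \<delta> * walk \<sigma> t (ind y) ?z"
      using mult_left_mono[OF flf d0] by (simp only: mult.commute[of \<delta>])
    finally show ?thesis .
  qed
  have "?av (\<lambda>R. lost \<sigma> v R (Suc t) y) =
      (\<Sum>i<dout y. ?av (\<lambda>R. if \<sigma> (y, i) \<in> R \<union> heads_of v then walk \<sigma> t (use_heads \<sigma> R) (fst (\<sigma> (y, i))) else 0)) / real (dout y)
      + step \<sigma> UNIV (\<lambda>z. ?av (\<lambda>R. lost \<sigma> v R t z)) y"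
  proof -
    have dv: "?av (\<lambda>R. F R / c) = ?av F / c" for F c
      by (simp add: subset_avg_def sum_divide_distrib mult.commute)
    show ?thesis by (simp add: subset_avg_add dv subset_avg_sum step_def)
  qed
  also have "\<dots> \<le> (\<Sum>i<dout y. \<delta> * ind v (fst (\<sigma> (y, i))) + \<delta>\<^sup>2 + \<delta> * walk \<sigma> t (ind y) (fst (\<sigma> (y, i)))) / real (dout y)
      + step \<sigma> UNIV (\<lambda>z. \<Sum>r<t. \<delta> * walk \<sigma> (Suc r) (ind v) z + \<delta>\<^sup>2 + \<delta> * return \<sigma> r (t - r) z) y"
    using Suc by (intro add_mono divide_right_mono sum_mono first step_mono[OF \<sigma>]) auto
  also have "(\<Sum>i<dout y. \<delta> * ind v (fst (\<sigma> (y, i))) + \<delta>\<^sup>2 + \<delta> * walk \<sigma> t (ind y) (fst (\<sigma> (y, i)))) / real (dout y)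
     = step \<sigma> UNIV (\<lambda>z. \<delta> * ind v z + \<delta>\<^sup>2 + \<delta> * walk \<sigma> t (ind y) z) y"
    by (simp add: step_def)
  also have "\<dots> = \<delta> * walk \<sigma> (Suc 0) (ind v) y + \<delta>\<^sup>2 + \<delta> * return \<sigma> 0 (Suc t) y"
    by (simp only: step_add step_cmult step_const[OF Suc.prems] walk_Suc walk_0 return.simps)
  also have "step \<sigma> UNIV (\<lambda>z. \<Sum>r<t. \<delta> * walk \<sigma> (Suc r) (ind v) z + \<delta>\<^sup>2 + \<delta> * return \<sigma> r (t - r) z) y
     = (\<Sum>r<t. \<delta> * walk \<sigma> (Suc (Suc r)) (ind v) y + \<delta>\<^sup>2 + \<delta> * return \<sigma> (Suc r) (t - r) y)"
    by (simp only: step_sum step_add step_cmult step_const[OF Suc.prems] walk_Suc return.simps)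
  finally show ?case by (simp only: sum.lessThan_Suc_shift) simp
qed

end

context weighted_dcm
begin

lemma cexp_step_fresh:
  assumes \<sigma>: "\<sigma> \<in> S" and E: "E \<subseteq> tails" "card E \<le> s" and x: "x \<in> V" "x \<notin> fst ` E" and b0: "0 \<le> b0"
    and \<phi>: "\<And>\<tau> z. \<tau> \<in> S \<Longrightarrow> z \<in> V \<Longrightarrow> \<phi> \<tau> z \<le> 1"
    and good: "\<And>\<tau> i z. \<tau> \<in> S \<Longrightarrow> i < dout x \<Longrightarrow> z \<in> V \<Longrightarrow> z \<notin> insert x (fst ` E) \<Longrightarrow>
        cexp \<tau> (insert (x, i) E) (\<lambda>\<upsilon>. \<phi> \<upsilon> z) \<le> b0"
  shows "cexp \<sigma> E (\<lambda>\<tau>. step \<tau> UNIV (\<phi> \<tau>) x) \<le> b0 + q"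
proof -
  have "cexp \<sigma> E (\<lambda>\<tau>. 1 * step \<tau> UNIV (\<phi> \<tau>) x) \<le> b0 + 1 * q"
  proof (rule cexp_step[OF x(1)])
    fix i assume i: "i < dout x"
    show "cexp \<sigma> E (\<lambda>\<tau>. 1 * \<phi> \<tau> (fst (\<tau> (x, i)))) \<le> b0 + 1 * q"
    proof (rule reveal_landing[OF \<sigma> E(1) fresh_tail[OF x i] E(2) s_less, where A="fst ` E \<union> {x}" and \<psi>="\<lambda>\<tau> z. 1 * \<phi> \<tau> z"])
      show "finite (fst ` E \<union> {x})" "card (fst ` E \<union> {x}) \<le> s + 5"
        using card_dirty_le[OF E(1), of "{x}"] E by auto
      fix \<tau> assume \<tau>: "\<tau> \<in> ext \<sigma> E" and z: "fst (\<tau> (x, i)) \<in> V"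
      show "cexp \<tau> (insert (x, i) E) (\<lambda>\<upsilon>. 1 * \<phi> \<upsilon> (fst (\<tau> (x, i)))) \<le> b0" if "fst (\<tau> (x, i)) \<notin> fst ` E \<union> {x}"
        using good[OF ext_in_S[OF \<tau>] i z] that by simp
      have "cexp \<tau> (insert (x, i) E) (\<lambda>\<upsilon>. 1 * \<phi> \<upsilon> (fst (\<tau> (x, i)))) \<le> 1"
        by (rule cexp_le[OF ext_in_S[OF \<tau>]]) (use \<phi> z ext_in_S in auto)
      thus "cexp \<tau> (insert (x, i) E) (\<lambda>\<upsilon>. 1 * \<phi> \<upsilon> (fst (\<tau> (x, i)))) \<le> b0 + 1" using b0 by simp
    qed simp
  qed
  thus ?thesis by simp
qed

lemma walk_ind_le_hit: "\<sigma> \<in> S \<Longrightarrow> x \<in> V \<Longrightarrow> walk \<sigma> t (ind v) x \<le> hit \<sigma> {v} t x"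
proof (induction t arbitrary: x)
  case (Suc t)
  show ?case
  proof (cases "x = v")
    case True
    have "walk \<sigma> (Suc t) (ind v) x \<le> 1" by (rule walk_le_1) (use Suc in auto)
    thus ?thesis using True by simp
  next
    case False
    have "step \<sigma> UNIV (walk \<sigma> t (ind v)) x \<le> step \<sigma> UNIV (hit \<sigma> {v} t) x"
      by (rule step_mono) (use Suc in auto)
    thus ?thesis using False by (simp add: walk_Suc)
  qed
qed simp

lemma cexp_walk_ind_le:
  assumes "\<sigma> \<in> S" "E \<subseteq> tails" "card E + t \<le> s" "x \<in> V" "x \<notin> fst ` E" "x \<noteq> v"
  shows "cexp \<sigma> E (\<lambda>\<tau>. walk \<tau> t (ind v) x) \<le> real t * q"
proof -
  have "cexp \<sigma> E (\<lambda>\<tau>. walk \<tau> t (ind v) x) \<le> cexp \<sigma> E (\<lambda>\<tau>. hit \<tau> {v} t x)"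
    by (rule cexp_mono, rule walk_ind_le_hit) (use assms ext_in_S in auto)
  also have "\<dots> \<le> real t * q" by (rule cexp_hit_fresh) (use assms in auto)
  finally show ?thesis .
qed

lemma cexp_return_le:
  "\<lbrakk>0 < j; \<sigma> \<in> S; E \<subseteq> tails; card E + (r + j) \<le> s; x \<in> V; x \<notin> fst ` E\<rbrakk> \<Longrightarrow>
    cexp \<sigma> E (\<lambda>\<tau>. return \<tau> r j x) \<le> real (r + j) * q"
proof (induction r arbitrary: \<sigma> E x)
  case 0
  then obtain j' where j: "j = Suc j'" by (cases j) auto
  have "cexp \<sigma> E (\<lambda>\<tau>. step \<tau> UNIV (walk \<tau> j' (ind x)) x) \<le> real j' * q + q"
  proof (rule cexp_step_fresh)
    fix \<tau> i z assume a: "\<tau> \<in> S" "i < dout x" "z \<in> V" "z \<notin> insert x (fst ` E)"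
    note ins = card_insert_E[OF 0(3) fresh_tail[OF 0(5,6) a(2)]]
    show "cexp \<tau> (insert (x, i) E) (\<lambda>\<upsilon>. walk \<upsilon> j' (ind x) z) \<le> real j' * q"
      by (rule cexp_walk_ind_le) (use a ins 0 j in auto)
  qed (use 0 q_nonneg walk_le_1 in auto)
  thus ?case by (simp add: j walk_Suc algebra_simps)
next
  case (Suc r)
  have "cexp \<sigma> E (\<lambda>\<tau>. step \<tau> UNIV (return \<tau> r j) x) \<le> real (r + j) * q + q"
  proof (rule cexp_step_fresh)
    fix \<tau> i z assume a: "\<tau> \<in> S" "i < dout x" "z \<in> V" "z \<notin> insert x (fst ` E)"
    note ins = card_insert_E[OF Suc(4) fresh_tail[OF Suc(6,7) a(2)]]
    show "cexp \<tau> (insert (x, i) E) (\<lambda>\<upsilon>. return \<upsilon> r j z) \<le> real (r + j) * q"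
      by (rule Suc.IH) (use a ins Suc.prems in auto)
  qed (use Suc.prems q_nonneg return_le_1 in auto)
  thus ?case by (simp add: algebra_simps)
qed

text \<open>The start \<open>y = v\<close> gets the trivial bound 1 for being at \<open>v\<close>,
  recorded as \<open>ind v y\<close>, which contributes only once when summed over
  \<open>y\<close>.\<close>

lemma avg_lost_le:
  assumes t: "t \<le> s" and y: "y \<in> V"
  shows "avg (\<lambda>\<sigma>. subset_avg heads D (\<lambda>R. lost \<sigma> v R t y))
    \<le> real t * (\<delta> * (2 * real t * q + ind v y) + \<delta>\<^sup>2)"
proof -
  obtain \<sigma>0 where \<sigma>0: "\<sigma>0 \<in> S" using S_nonempty by blast
  have w: "avg (\<lambda>\<sigma>. walk \<sigma> (Suc r) (ind v) y) \<le> real t * q + ind v y" if r: "r < t" for r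
  proof (cases "y = v")
    case True
    have "avg (\<lambda>\<sigma>. walk \<sigma> (Suc r) (ind v) y) \<le> avg (\<lambda>_. 1)"
      by (rule avg_mono, rule walk_le_1) (use y in auto)
    thus ?thesis using True q_nonneg by (simp add: avg_const add_increasing)
  next
    case False
    have "avg (\<lambda>\<sigma>. walk \<sigma> (Suc r) (ind v) y) \<le> real (Suc r) * q"
      using cexp_walk_ind_le[OF \<sigma>0, of "{}" "Suc r" y v] t r y False by (simp add: cexp_empty)
    also have "\<dots> \<le> real t * q" using r q_nonneg by (intro mult_right_mono) auto
    finally show ?thesis using False by simp
  qed
  have re: "avg (\<lambda>\<sigma>. return \<sigma> r (t - r) y) \<le> real t * q" if r: "r < t" for r
    using cexp_return_le[of "t - r" \<sigma>0 "{}" r y] r t y \<sigma>0 by (simp add: cexp_empty)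
  have "avg (\<lambda>\<sigma>. subset_avg heads D (\<lambda>R. lost \<sigma> v R t y))
     \<le> avg (\<lambda>\<sigma>. \<Sum>r<t. \<delta> * walk \<sigma> (Suc r) (ind v) y + \<delta>\<^sup>2 + \<delta> * return \<sigma> r (t - r) y)"
    by (rule avg_mono, rule subset_avg_lost_le) (use y in auto)
  also have "\<dots> = (\<Sum>r<t. \<delta> * avg (\<lambda>\<sigma>. walk \<sigma> (Suc r) (ind v) y) + \<delta>\<^sup>2 + \<delta> * avg (\<lambda>\<sigma>. return \<sigma> r (t - r) y))"
    by (simp only: avg_sum avg_add avg_mult avg_const)
  also have "\<dots> \<le> (\<Sum>r<t. \<delta> * (real t * q + ind v y) + \<delta>\<^sup>2 + \<delta> * (real t * q))"
    using w re by (intro sum_mono add_mono mult_left_mono order_refl) auto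
  also have "\<dots> = real t * (\<delta> * (2 * real t * q + ind v y) + \<delta>\<^sup>2)" by (simp add: algebra_simps)
  finally show ?thesis .
qed

text \<open>A Markov inequality: on the bad event one of the three terms is at least 1. The
  distribution \<open>p\<close> is stationary for the exchanged matching and may be correlated with
  \<open>walk \<sigma> t (use_heads \<sigma> R)\<close>; averages under \<open>p\<close> are
  therefore replaced by \<open>X\<close> times a sum over all vertices.\<close>

lemma stationary_swapped_ge:
  assumes \<sigma>: "\<sigma> \<in> S" and v: "v \<in> V" and R: "R \<subseteq> heads" "card R = D"
    and \<alpha>: "bij_betw \<alpha> heads heads"
      "\<And>f. f \<in> heads \<Longrightarrow> fst (\<alpha> f) = v \<longleftrightarrow> f \<in> R" "\<And>f. f \<in> heads \<Longrightarrow> f \<notin> R \<union> heads_of v \<Longrightarrow> \<alpha> f = f"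
    and y0: "y0 \<in> V" and X: "0 \<le> X" and \<eta>: "0 < \<eta>"
  shows "(if \<exists>p. stationary n dout (graph_of_matching n dout (restrict (\<alpha> \<circ> \<sigma>) tails)) p \<and> max_mass n p \<le> X
        \<and> pmf p v < (1 - 4 * \<eta>) * \<delta> then 1 else 0) \<le>
     (walk \<sigma> t (use_heads \<sigma> R) y0 - \<delta>)\<^sup>2 / (\<eta> * \<delta>)\<^sup>2
     + X / (\<eta> * \<delta>)\<^sup>2 * (\<Sum>y\<in>V. (walk \<sigma> t (use_heads \<sigma> R) y - walk \<sigma> t (use_heads \<sigma> R) y0)\<^sup>2)
     + X / (\<eta> * \<delta>) * (\<Sum>y\<in>V. lost \<sigma> v R t y)"
    (is "_ \<le> ?A + ?B + ?C")
proof -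
  let ?\<psi> = "walk \<sigma> t (use_heads \<sigma> R)"
  let ?\<sigma>' = "restrict (\<alpha> \<circ> \<sigma>) tails"
  define h where "h = \<eta> * \<delta>"
  have h0: "0 < h" using \<eta> D_pos m_pos by (simp add: h_def)
  have lost0: "0 \<le> lost \<sigma> v R t y" if "y \<in> V" for y by (rule lost_nonneg[OF \<sigma> that])
  have A0: "0 \<le> ?A" by simp
  have B0: "0 \<le> ?B" using X by (intro mult_nonneg_nonneg sum_nonneg divide_nonneg_nonneg) auto
  have C0: "0 \<le> ?C" using X lost0 h0 by (intro mult_nonneg_nonneg sum_nonneg divide_nonneg_nonneg) (use \<eta> in auto)
  show ?thesis
  proof (cases "\<exists>p. stationary n dout (graph_of_matching n dout ?\<sigma>') p \<and> max_mass n p \<le> X \<and> pmf p v < (1 - 4 * \<eta>) * \<delta>")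
    case False
    have "0 \<le> ?A + ?B + ?C" using A0 B0 C0 by (intro add_nonneg_nonneg)
    thus ?thesis unfolding if_not_P[OF False] .
  next
    case True
    then obtain p where p: "stationary n dout (graph_of_matching n dout ?\<sigma>') p" "max_mass n p \<le> X"
      "pmf p v < (1 - 4 * \<eta>) * \<delta>" by blast
    have pX: "pmf p y \<le> X" if "y \<in> V" for y using pmf_le_max_mass[OF that, of p] p(2) by simp
    have \<sigma>'S: "?\<sigma>' \<in> S" by (rule S_post[OF \<sigma> \<alpha>(1)])
    have "1 \<le> ?A + ?B + ?C"
    proof (rule ccontr)
      assume "\<not> 1 \<le> ?A + ?B + ?C"
      moreover have "x < 1 \<and> y < 1 \<and> z < 1"
        if "\<not> 1 \<le> x + y + z" "0 \<le> x" "0 \<le> y" "0 \<le> z" for x y z :: real using that by linarith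
      ultimately have "?A < 1 \<and> ?B < 1 \<and> ?C < 1" using A0 B0 C0 by blast
      hence lt: "?A < 1" "?B < 1" "?C < 1" by blast+
      have a: "\<delta> - h < ?\<psi> y0"
      proof -
        have "(?\<psi> y0 - \<delta>)\<^sup>2 < h\<^sup>2" using lt(1) h0 unfolding h_def[symmetric] by simp
        hence "\<bar>?\<psi> y0 - \<delta>\<bar> < h" using h0 by (simp add: abs_le_square_iff power2_less_imp_less[of "\<bar>?\<psi> y0 - \<delta>\<bar>" h])
        thus ?thesis by linarith
      qed
      have b: "X * (\<Sum>y\<in>V. (?\<psi> y - ?\<psi> y0)\<^sup>2) / h < h"
        using lt(2) h0 unfolding h_def[symmetric] by (simp add: field_simps power2_eq_square)
      have c': "X * (\<Sum>y\<in>V. lost \<sigma> v R t y) < h"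
        using lt(3) h0 unfolding h_def[symmetric] by (simp add: field_simps)
      \<comment> \<open>A shortfall \<open>z\<close> is at most \<open>h + z^2 / h\<close>. This
        trades a mean under \<open>p\<close> for a sum of squares, which can be estimated with the
        uniform weight \<open>X\<close>.\<close>
      have z: "?\<psi> y0 - (h + (?\<psi> y - ?\<psi> y0)\<^sup>2 / h) \<le> ?\<psi> y" for y
      proof -
        let ?z = "?\<psi> y0 - ?\<psi> y"
        have "h * h + ?z\<^sup>2 - ?z * h = (?z - h / 2)\<^sup>2 + 3 / 4 * h\<^sup>2"
          by (simp add: power2_eq_square field_simps)
        moreover have "0 \<le> (?z - h / 2)\<^sup>2 + 3 / 4 * h\<^sup>2" by simp
        ultimately have "?z * h \<le> h * h + ?z\<^sup>2" by linarith
        hence "?z \<le> h + ?z\<^sup>2 / h" using h0 by (simp add: field_simps power2_eq_square)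
        moreover have "?z\<^sup>2 = (?\<psi> y - ?\<psi> y0)\<^sup>2" by (simp add: power2_commute)
        ultimately have "?z \<le> h + (?\<psi> y - ?\<psi> y0)\<^sup>2 / h" by (simp only:)
        moreover have "a - u \<le> b" if "a - b \<le> u" for a b u :: real using that by linarith
        ultimately show ?thesis by blast
      qed
      have "?\<psi> y0 - h - X * (\<Sum>y\<in>V. (?\<psi> y - ?\<psi> y0)\<^sup>2) / h - X * (\<Sum>y\<in>V. lost \<sigma> v R t y)
          \<le> (\<Sum>y\<in>V. pmf p y * (?\<psi> y0 - h)) - (\<Sum>y\<in>V. pmf p y * ((?\<psi> y - ?\<psi> y0)\<^sup>2 / h)) - (\<Sum>y\<in>V. pmf p y * lost \<sigma> v R t y)"
      proof -
        have "(\<Sum>y\<in>V. pmf p y * (?\<psi> y0 - h)) = ?\<psi> y0 - h"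
          using stationary_sum_1[OF p(1)] by (simp only: sum_distrib_right[symmetric]) simp
        moreover have "(\<Sum>y\<in>V. pmf p y * ((?\<psi> y - ?\<psi> y0)\<^sup>2 / h)) \<le> X * (\<Sum>y\<in>V. (?\<psi> y - ?\<psi> y0)\<^sup>2) / h"
          unfolding sum_distrib_left sum_divide_distrib times_divide_eq_right
          using pX h0 by (intro sum_mono divide_right_mono mult_right_mono) auto
        moreover have "(\<Sum>y\<in>V. pmf p y * lost \<sigma> v R t y) \<le> X * (\<Sum>y\<in>V. lost \<sigma> v R t y)"
          unfolding sum_distrib_left using pX lost0 by (intro sum_mono mult_right_mono) auto
        ultimately show ?thesis by linarith
      qed
      also have "\<dots> = (\<Sum>y\<in>V. pmf p y * (?\<psi> y0 - (h + (?\<psi> y - ?\<psi> y0)\<^sup>2 / h) - lost \<sigma> v R t y))"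
        by (simp add: sum_subtractf[symmetric] algebra_simps)
      also have "\<dots> \<le> (\<Sum>y\<in>V. pmf p y * walk ?\<sigma>' (Suc t) (ind v) y)"
      proof (intro sum_mono mult_left_mono)
        fix y assume y: "y \<in> V"
        show "?\<psi> y0 - (h + (?\<psi> y - ?\<psi> y0)\<^sup>2 / h) - lost \<sigma> v R t y \<le> walk ?\<sigma>' (Suc t) (ind v) y"
          using walk_swapped_ge[OF \<sigma> \<alpha> refl y, of t] z[of y] by linarith
      qed simp
      also have "\<dots> = (\<Sum>y\<in>V. pmf p y * ind v y)" by (rule stationary_walk[OF \<sigma>'S p(1)])
      also have "\<dots> = (\<Sum>y\<in>V. if y = v then pmf p y else 0)" by (rule sum.cong) auto
      also have "\<dots> = pmf p v" using v by simp
      \<comment> \<open>The four losses of \<open>h\<close>: the deviation at \<open>y0\<close>, the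
        \<open>h\<close> in the shortfall, the sum of squares and the lost walks.\<close>
      finally have "\<delta> - 4 * h < pmf p v" using a b c' by linarith
      moreover have "(1 - 4 * \<eta>) * \<delta> = \<delta> - 4 * h" unfolding h_def left_diff_distrib by (simp only: mult_1 mult.assoc)
      ultimately show False using p(3) by simp
    qed
    thus ?thesis unfolding if_P[OF True] .
  qed
qed

text \<open>The reference vertex \<open>y0\<close> is \<open>v\<close> itself. Sampling turns the
  deviation from \<open>\<delta>\<close> at \<open>v\<close> into a meeting probability from
  \<open>v\<close>, and the dependence on the starting point into the combination of meetings
  controlled by \<open>gap\<close>.\<close>

theorem lower_tail:
  assumes c: "c = (\<lambda>x. 1 / real (dout x))" and s: "2 + 2 * N \<le> s" and v: "v \<in> V" "din v = D"
    and X: "0 \<le> X" and \<eta>: "0 < \<eta>"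
  shows "avg (\<lambda>\<sigma>. if \<exists>p. stationary n dout (graph_of_matching n dout \<sigma>) p \<and> max_mass n p \<le> X
        \<and> pmf p v < (1 - 4 * \<eta>) * \<delta> then 1 else 0) \<le>
     (2 * \<kappa> + (real N + 1) * err N + gap N + 2 * real n * X * gap N) / (\<eta>\<^sup>2 * \<delta>)
     + X / \<eta> * ((real N + 1) * (real n * (2 * (real N + 1) * q + \<delta>) + 1))"
proof -
  let ?bad = "\<lambda>\<sigma>. if \<exists>p. stationary n dout (graph_of_matching n dout \<sigma>) p \<and> max_mass n p \<le> X
        \<and> pmf p v < (1 - 4 * \<eta>) * \<delta> then 1 else (0::real)"
  let ?t = "Suc N" and ?av = "subset_avg heads D"
  let ?\<psi> = "\<lambda>\<sigma> R. walk \<sigma> ?t (use_heads \<sigma> R)"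
  let ?G = "\<lambda>\<sigma> R. 1 / (\<eta> * \<delta>)\<^sup>2 * (?\<psi> \<sigma> R v - \<delta>)\<^sup>2
     + X / (\<eta> * \<delta>)\<^sup>2 * (\<Sum>y\<in>V. (?\<psi> \<sigma> R y - ?\<psi> \<sigma> R v)\<^sup>2) + X / (\<eta> * \<delta>) * (\<Sum>y\<in>V. lost \<sigma> v R ?t y)"
  define h where "h = \<eta> * \<delta>"
  have \<delta>0: "0 < \<delta>" using D_pos m_pos by simp
  have h0: "0 < h" unfolding h_def using \<eta> \<delta>0 by (rule mult_pos_pos)
  have Dm: "0 < D" "D \<le> card heads" using D_pos D_le_m card_heads by auto
  obtain g where g: "0 \<le> g" "g \<le> 2 * \<kappa> + (real N + 1) * err N"
    "\<And>a. a \<in> V \<Longrightarrow> avg (\<lambda>\<sigma>. meet \<sigma> c ?t a a) \<le> g + gap N / 2"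
    "\<And>a b. a \<in> V \<Longrightarrow> b \<in> V \<Longrightarrow> a \<noteq> b \<Longrightarrow> g - gap N / 2 \<le> avg (\<lambda>\<sigma>. meet \<sigma> c ?t a b)" "0 \<le> gap N"
    using avg_meet_bounds[OF s] by blast
  have perR: "avg ?bad \<le> avg (\<lambda>\<sigma>. ?G \<sigma> R)" if R: "R \<subseteq> heads" "card R = D" for R
  proof -
    obtain \<alpha> where \<alpha>: "bij_betw \<alpha> heads heads" "\<And>f. f \<in> heads \<Longrightarrow> fst (\<alpha> f) = v \<longleftrightarrow> f \<in> R"
      "\<And>f. f \<in> heads \<Longrightarrow> f \<notin> R \<union> heads_of v \<Longrightarrow> \<alpha> f = f"
      using exists_swap[OF v R] by metis
    have "avg ?bad = avg (\<lambda>\<sigma>. ?bad (restrict (\<alpha> \<circ> \<sigma>) tails))" by (rule avg_postcompose[OF \<alpha>(1), symmetric])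
    also have "\<dots> \<le> avg (\<lambda>\<sigma>. ?G \<sigma> R)"
    proof (rule avg_mono)
      fix \<sigma> assume \<sigma>: "\<sigma> \<in> S"
      have "?bad (restrict (\<alpha> \<circ> \<sigma>) tails) \<le> (?\<psi> \<sigma> R v - \<delta>)\<^sup>2 / (\<eta> * \<delta>)\<^sup>2
         + X / (\<eta> * \<delta>)\<^sup>2 * (\<Sum>y\<in>V. (?\<psi> \<sigma> R y - ?\<psi> \<sigma> R v)\<^sup>2) + X / (\<eta> * \<delta>) * (\<Sum>y\<in>V. lost \<sigma> v R ?t y)"
        by (rule stationary_swapped_ge[OF \<sigma> v(1) R \<alpha> v(1) X \<eta>])
      thus "?bad (restrict (\<alpha> \<circ> \<sigma>) tails) \<le> ?G \<sigma> R" by simp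
    qed
    finally show ?thesis .
  qed
  \<comment> \<open>For each fixed \<open>R\<close> the exchange preserves the law, so the left side
    is free of \<open>R\<close>; in the average \<open>R\<close> becomes a uniform sample
    independent of the matching.\<close>
  have "avg ?bad = ?av (\<lambda>_. avg ?bad)" using subset_avg_const[OF finite_heads Dm(2)] by simp
  also have "\<dots> \<le> ?av (\<lambda>R. avg (\<lambda>\<sigma>. ?G \<sigma> R))" by (rule subset_avg_mono) (rule perR)
  also have "\<dots> = avg (\<lambda>\<sigma>. ?av (\<lambda>R. ?G \<sigma> R))"
  proof -
    have "?av (\<lambda>R. avg (\<lambda>\<sigma>. F \<sigma> R)) = avg (\<lambda>\<sigma>. ?av (F \<sigma>))" for F
      unfolding avg_def subset_avg_def
      by (simp add: sum_divide_distrib[symmetric], subst sum.swap) (simp add: mult.commute)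
    thus ?thesis .
  qed
  also have "\<dots> = avg (\<lambda>\<sigma>. 1 / h\<^sup>2 * ?av (\<lambda>R. (?\<psi> \<sigma> R v - \<delta>)\<^sup>2)
     + X / h\<^sup>2 * (\<Sum>y\<in>V. ?av (\<lambda>R. (?\<psi> \<sigma> R y - ?\<psi> \<sigma> R v)\<^sup>2)) + X / h * (\<Sum>y\<in>V. ?av (\<lambda>R. lost \<sigma> v R ?t y)))"
    by (simp only: subset_avg_add subset_avg_mult subset_avg_sum h_def)
  also have "\<dots> \<le> avg (\<lambda>\<sigma>. 1 / h\<^sup>2 * (\<delta> * meet \<sigma> c ?t v v)
     + X / h\<^sup>2 * (\<Sum>y\<in>V. \<delta> * (meet \<sigma> c ?t y y + meet \<sigma> c ?t v v - 2 * meet \<sigma> c ?t y v))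
     + X / h * (\<Sum>y\<in>V. ?av (\<lambda>R. lost \<sigma> v R ?t y)))"
  proof (rule avg_mono, intro add_mono mult_left_mono sum_mono order_refl)
    fix \<sigma> assume \<sigma>: "\<sigma> \<in> S"
    have prod: "(\<Sum>f\<in>heads. flow \<sigma> ?t a f * flow \<sigma> ?t b f) = meet \<sigma> c ?t a b" if "a \<in> V" "b \<in> V" for a b
      using sum_flow_product[OF \<sigma> that] c by simp
    have psi: "?\<psi> \<sigma> R y = (\<Sum>f\<in>R. flow \<sigma> ?t y f)" if "R \<subseteq> heads" for R y
      by (rule walk_use_heads) (rule finite_subset[OF that finite_heads])
    have "?av (\<lambda>R. (?\<psi> \<sigma> R v - \<delta>)\<^sup>2) = ?av (\<lambda>R. (\<Sum>f\<in>R. flow \<sigma> ?t v f - 1 / real m)\<^sup>2)"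
      by (rule subset_avg_cong) (simp add: psi sum_subtractf)
    also have "\<dots> \<le> real D / real (card heads) * (\<Sum>f\<in>heads. (flow \<sigma> ?t v f - 1 / real m)\<^sup>2)"
      by (rule subset_avg_square_le[OF finite_heads Dm])
        (use sum_flow[OF \<sigma> v(1)] m_pos in \<open>simp add: sum_subtractf card_heads\<close>)
    also have "\<dots> \<le> \<delta> * meet \<sigma> c ?t v v"
    proof -
      have "(\<Sum>f\<in>heads. (flow \<sigma> ?t v f - 1 / real m)\<^sup>2)
         = (\<Sum>f\<in>heads. flow \<sigma> ?t v f * flow \<sigma> ?t v f - 2 / real m * flow \<sigma> ?t v f + (1 / real m)\<^sup>2)"
        by (intro sum.cong refl) (simp add: power2_eq_square algebra_simps)
      also have "\<dots> = meet \<sigma> c ?t v v - 2 / real m * 1 + real m * (1 / real m)\<^sup>2"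
        using sum_flow[OF \<sigma> v(1), of ?t] prod[OF v(1) v(1)]
        by (simp only: sum.distrib sum_subtractf sum_distrib_left[symmetric] sum_constant card_heads)
      also have "\<dots> \<le> meet \<sigma> c ?t v v" using m_pos by (simp add: power2_eq_square field_simps)
      finally show ?thesis using \<delta>0 by (simp only: card_heads) (intro mult_left_mono, auto)
    qed
    finally show "?av (\<lambda>R. (?\<psi> \<sigma> R v - \<delta>)\<^sup>2) \<le> \<delta> * meet \<sigma> c ?t v v" .
    fix y assume y: "y \<in> V"
    have "?av (\<lambda>R. (?\<psi> \<sigma> R y - ?\<psi> \<sigma> R v)\<^sup>2) = ?av (\<lambda>R. (\<Sum>f\<in>R. flow \<sigma> ?t y f - flow \<sigma> ?t v f)\<^sup>2)"
      by (rule subset_avg_cong) (simp add: psi sum_subtractf)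
    also have "\<dots> \<le> real D / real (card heads) * (\<Sum>f\<in>heads. (flow \<sigma> ?t y f - flow \<sigma> ?t v f)\<^sup>2)"
      by (rule subset_avg_square_le[OF finite_heads Dm])
        (use sum_flow[OF \<sigma>] v y in \<open>simp add: sum_subtractf\<close>)
    also have "(\<Sum>f\<in>heads. (flow \<sigma> ?t y f - flow \<sigma> ?t v f)\<^sup>2)
       = (\<Sum>f\<in>heads. flow \<sigma> ?t y f * flow \<sigma> ?t y f + flow \<sigma> ?t v f * flow \<sigma> ?t v f - 2 * (flow \<sigma> ?t y f * flow \<sigma> ?t v f))"
      by (intro sum.cong refl) (simp add: power2_eq_square algebra_simps)
    also have "\<dots> = meet \<sigma> c ?t y y + meet \<sigma> c ?t v v - 2 * meet \<sigma> c ?t y v"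
      using prod v y by (simp only: sum.distrib sum_subtractf sum_distrib_left[symmetric])
    finally show "?av (\<lambda>R. (?\<psi> \<sigma> R y - ?\<psi> \<sigma> R v)\<^sup>2) \<le> \<delta> * (meet \<sigma> c ?t y y + meet \<sigma> c ?t v v - 2 * meet \<sigma> c ?t y v)"
      by (simp only: card_heads)
  qed (use X h0 in auto)
  also have "\<dots> = 1 / h\<^sup>2 * (\<delta> * avg (\<lambda>\<sigma>. meet \<sigma> c ?t v v))
     + X / h\<^sup>2 * (\<Sum>y\<in>V. \<delta> * (avg (\<lambda>\<sigma>. meet \<sigma> c ?t y y) + avg (\<lambda>\<sigma>. meet \<sigma> c ?t v v) - 2 * avg (\<lambda>\<sigma>. meet \<sigma> c ?t y v)))
     + X / h * (\<Sum>y\<in>V. avg (\<lambda>\<sigma>. ?av (\<lambda>R. lost \<sigma> v R ?t y)))"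
    by (simp only: avg_add avg_diff avg_mult avg_sum)
  also have "\<dots> \<le> 1 / h\<^sup>2 * (\<delta> * (2 * \<kappa> + (real N + 1) * err N + gap N))
     + X / h\<^sup>2 * (\<Sum>y\<in>V. \<delta> * (2 * gap N))
     + X / h * (\<Sum>y\<in>V. real ?t * (\<delta> * (2 * real ?t * q + ind v y) + \<delta>\<^sup>2))"
  proof (intro add_mono mult_left_mono sum_mono)
    show "avg (\<lambda>\<sigma>. meet \<sigma> c ?t v v) \<le> 2 * \<kappa> + (real N + 1) * err N + gap N"
      by (rule order_trans[OF g(3)[OF v(1)]]) (use g(2,5) in linarith)
    fix y assume y: "y \<in> V"
    show "avg (\<lambda>\<sigma>. meet \<sigma> c ?t y y) + avg (\<lambda>\<sigma>. meet \<sigma> c ?t v v) - 2 * avg (\<lambda>\<sigma>. meet \<sigma> c ?t y v) \<le> 2 * gap N"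
    proof (cases "y = v")
      case True thus ?thesis using g(5) by simp
    next
      case False
      have "A + B - 2 * C \<le> 2 * G" if "A \<le> g + G / 2" "B \<le> g + G / 2" "g - G / 2 \<le> C" for A B C G :: real
        using that by linarith
      thus ?thesis using g(3)[OF y] g(3)[OF v(1)] g(4)[OF y v(1) False] by blast
    qed
    show "avg (\<lambda>\<sigma>. ?av (\<lambda>R. lost \<sigma> v R ?t y)) \<le> real ?t * (\<delta> * (2 * real ?t * q + ind v y) + \<delta>\<^sup>2)"
      by (rule avg_lost_le) (use s y in auto)
  qed (use X h0 \<delta>0 in auto)
  also have "\<dots> = (2 * \<kappa> + (real N + 1) * err N + gap N + 2 * real n * X * gap N) / (\<eta>\<^sup>2 * \<delta>)
     + X / \<eta> * ((real N + 1) * (real n * (2 * (real N + 1) * q + \<delta>) + 1))"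
  proof -
    have cV: "(\<Sum>y\<in>V. x) = real n * x" for x by (simp add: V_def)
    have "(\<Sum>y\<in>V. real ?t * (\<delta> * (2 * real ?t * q + ind v y) + \<delta>\<^sup>2)) =
        (\<Sum>y\<in>V. real ?t * (\<delta> * (2 * real ?t * q) + \<delta>\<^sup>2)) + (\<Sum>y\<in>V. if y = v then real ?t * \<delta> else 0)"
      unfolding sum.distrib[symmetric] by (intro sum.cong refl) (auto simp: algebra_simps)
    also have "\<dots> = \<delta> * (real ?t * (real n * (2 * real ?t * q + \<delta>) + 1))"
    proof -
      have "(\<Sum>y\<in>V. if y = v then real ?t * \<delta> else 0) = real ?t * \<delta>" using v by simp
      moreover have "a * (k * (d * b + d\<^sup>2)) + k * d = d * (k * (a * (b + d) + 1))" for a b d k :: real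
        by (simp add: algebra_simps power2_eq_square)
      ultimately show ?thesis unfolding cV by (simp only:)
    qed
    finally have e: "(\<Sum>y\<in>V. real ?t * (\<delta> * (2 * real ?t * q + ind v y) + \<delta>\<^sup>2))
        = \<delta> * (real ?t * (real n * (2 * real ?t * q + \<delta>) + 1))" .
    have i: "1 / h\<^sup>2 * (d * a) + X / h\<^sup>2 * (real n * (d * (2 * b))) + X / h * (d * u) = (a + 2 * real n * X * b) / (\<eta>\<^sup>2 * d) + X / \<eta> * u"
      if "h = \<eta> * d" "0 < d" for a b u d
      using that \<eta> by (simp add: field_simps power2_eq_square)
    show ?thesis unfolding e cV using i[OF h_def \<delta>0] by (simp add: add.commute[of 1])
  qed
  finally show ?thesis .
qed

end

context dcm_model
begin

section \<open>Asymptotics\<close>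

lemma prob_dcm:
  "measure_pmf.prob (dcm n din dout) {G. P G} = avg (\<lambda>\<sigma>. if P (graph_of_matching n dout \<sigma>) then 1 else 0)"
proof -
  have "measure_pmf.prob (dcm n din dout) {G. P G}
     = measure_pmf.prob (pmf_of_set S) {\<sigma>. P (graph_of_matching n dout \<sigma>)}"
    unfolding dcm_def by (simp add: measure_map_pmf vimage_def)
  also have "\<dots> = real (card (S \<inter> {\<sigma>. P (graph_of_matching n dout \<sigma>)})) / real (card S)"
    by (rule measure_pmf_of_set[OF S_nonempty finite_S])
  also have "\<dots> = avg (\<lambda>\<sigma>. if P (graph_of_matching n dout \<sigma>) then 1 else 0)"
    by (simp add: avg_def sum.If_cases)
  finally show ?thesis .
qed

lemma graph_in_dcm: "\<sigma> \<in> S \<Longrightarrow> graph_of_matching n dout \<sigma> \<in> set_pmf (dcm n din dout)"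
  unfolding dcm_def by (simp add: set_pmf_of_set[OF S_nonempty finite_S])

text \<open>Up to constants this is \<open>n \<delta>^2\<close>: a union bound over \<open>n\<close>
  vertices of an event with two coincidences.\<close>

definition density :: real where "density = (real D)\<^sup>2 / real n"

lemma n_real: "1 \<le> real n" using n_pos by simp
lemma D_real: "1 \<le> real D" using D_pos by simp

lemma density_ge: "1 / real n \<le> density" "real D / real n \<le> density"
proof -
  have "1 \<le> (real D)\<^sup>2" "real D \<le> (real D)\<^sup>2"
    using D_real one_le_power[OF D_real, of 2] power_increasing[OF _ D_real, of 1 2] by auto
  thus "1 / real n \<le> density" "real D / real n \<le> density"
    unfolding density_def by (auto intro: divide_right_mono)
qed

lemma density_pos: "0 < density" using density_ge(1) n_real by (smt (verit) divide_pos_pos)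

text \<open>The degree moment condition makes \<open>density\<close> a negative power of \<open>n\<close>; with \<open>k\<close> of order
  \<open>ln n\<close>, every error term below is a constant times \<open>k ^ 16 * density\<close>.\<close>

lemma window:
  assumes k: "1 \<le> k" and small: "49200 * real k ^ 16 * density \<le> 1"
  defines "s \<equiv> 200 * k ^ 3"
  shows "real n \<le> real m - real s" "real m / 2 \<le> real m - real s" "s < m"
    "rate s \<le> 205 * real k ^ 3 * (real D / real n)"
proof -
  have k1: "1 \<le> real k" using k by simp
  have "200 * real k ^ 3 * (1 / real n) \<le> 49200 * real k ^ 16 * density"
    using k1 density_ge(1) n_real power_increasing[of 3 16 "real k"] by (intro mult_mono) auto
  also note small
  finally have "200 * real k ^ 3 \<le> real n" using n_real by (simp add: field_simps)
  hence s: "real s \<le> real n" by (simp add: s_def)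
  have m: "2 * real n \<le> real m" using of_nat_mono[OF m_ge, where ?'a=real] by simp
  show 1: "real n \<le> real m - real s" "real m / 2 \<le> real m - real s" using s m by auto
  show "s < m" using 1(1) n_real by linarith
  \<comment> \<open>From \<open>s + 5 \<le> 205 k^3\<close> and \<open>m - s \<ge> n\<close>; the
    latter holds since \<open>m \<ge> 2 n\<close>.\<close>
  have "rate s \<le> (205 * real k ^ 3 * real D) / real n"
    unfolding rate_def using 1 n_real k1 one_le_power[OF k1, of 3]
    by (intro frac_le mult_right_mono) (auto simp: s_def)
  thus "rate s \<le> 205 * real k ^ 3 * (real D / real n)" by simp
qed

lemma exp_neg_ln:
  assumes "ln (real n) \<le> real k" shows "exp (- real k) \<le> 1 / real n"
proof -
  have "exp (- real k) \<le> exp (- ln (real n))" using assms by simp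
  thus ?thesis using n_real by (simp add: exp_minus inverse_eq_divide)
qed

lemma two_powers_le:
  assumes "ln (real n) \<le> real k" shows "1 / 2 ^ (4 * k) \<le> 1 / (real n)\<^sup>2"
proof -
  have "exp 1 \<le> (2::real) ^ 2" using exp_le by simp
  hence "exp 1 ^ (2 * k) \<le> ((2::real) ^ 2) ^ (2 * k)" by (intro power_mono) auto
  moreover have "((2::real) ^ 2) ^ (2 * k) = 2 ^ (4 * k)" by (simp only: power_mult[symmetric]) simp
  moreover have "exp 1 ^ (2 * k) = exp (real k) ^ 2" by (simp add: exp_of_nat_mult[symmetric] mult.commute)
  ultimately have "exp (real k) ^ 2 \<le> (2::real) ^ (4 * k)" by simp
  moreover have "real n \<le> exp (real k)" using assms n_real by (metis exp_le_cancel_iff exp_ln less_le_trans zero_less_one)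
  hence "(real n)\<^sup>2 \<le> exp (real k) ^ 2" by (intro power_mono) auto
  ultimately have "(real n)\<^sup>2 \<le> 2 ^ (4 * k)" by (rule order_trans[rotated])
  thus ?thesis using n_real by (intro divide_left_mono) auto
qed

lemma max_mass_tail_density:
  assumes k: "1 \<le> k" and ln: "ln (real n) \<le> real k" and small: "49200 * real k ^ 16 * density \<le> 1"
    and K: "\<And>y. y \<in> V \<Longrightarrow> dout y \<le> K"
  shows "avg (\<lambda>\<sigma>. if \<exists>p. stationary n dout (graph_of_matching n dout \<sigma>) p
        \<and> max_mass n p > exp 4 * real k * ((5 / 8) ^ (10 * k) + 192 * \<delta>) then 1 else 0)
    \<le> (10 ^ 14 * (real K)\<^sup>2 + 1) * (real k ^ 16 * density)"
proof -
  define s where "s = 200 * k ^ 3"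
  \<comment> \<open>The value of \<open>h\<close> makes the square of \<open>1 / 2 ^ h\<close> at
    most \<open>n^-2\<close>, and that of \<open>r\<close> makes \<open>(5/8) ^ r\<close> at most
    \<open>n^-4\<close>. Then \<open>N \<le> 80 k^2\<close>, and \<open>k\<close> walks reveal at
    most \<open>80 k^3\<close> tails, within the budget \<open>s\<close>.\<close>
  define h where "h = 2 * k"
  define r where "r = 10 * k"
  define H where "H = r * (h + 2)"
  define N where "N = 2 * H"
  define u where "u = real D / real n"
  define w where "w = density"
  obtain \<sigma>0 where \<sigma>0: "\<sigma>0 \<in> S" using S_nonempty by blast
  note win = window[OF k small, folded s_def u_def]
  have k1: "1 \<le> real k" using k by simp
  have kp: "real k ^ i \<le> real k ^ j" if "i \<le> j" for i j using that k1 by (rule power_increasing)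
  have u0: "0 \<le> u" by (simp add: u_def)
  have uw: "u \<le> w" "1 / real n \<le> w" unfolding u_def w_def by (rule density_ge)+
  have nuu: "real n * u\<^sup>2 = w" using n_real by (simp add: u_def w_def density_def power2_eq_square)
  have w0: "0 < w" using density_pos by (simp add: w_def)
  have kk: "k \<le> k ^ 2" "k \<le> k ^ 3" "k ^ 2 \<le> k ^ 3" "1 \<le> k ^ 3" "1 \<le> k ^ 2"
    using k power_increasing[of 1 2 k] power_increasing[of 1 3 k] power_increasing[of 2 3 k] by auto
  have Heq: "H = 20 * k ^ 2 + 20 * k" by (simp add: H_def r_def h_def power2_eq_square algebra_simps)
  have Nle: "N \<le> 80 * k ^ 2" using kk by (simp add: N_def Heq)
  have kN: "k * N \<le> s" using mult_le_mono2[OF Nle, of k] kk by (simp add: s_def power2_eq_square power3_eq_cube)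
  have c: "2 + 2 * N \<le> s" "2 + 4 * h \<le> s" using Nle kk by (auto simp: s_def h_def)
  have q0: "0 \<le> rate s" by (rule rate_nonneg[OF win(3)])
  have Nr: "real N \<le> 80 * real k ^ 2" using of_nat_mono[OF Nle, where ?'a=real] by simp
  have "0 < H" unfolding H_def r_def h_def using k by (intro mult_pos_pos) auto
  hence H0: "0 < real H" by (rule of_nat_0_less_iff[THEN iffD2])
  have sm: "rate s * (2 + real k) * real N \<le> 1"
  proof -
    \<comment> \<open>Here the constant in \<open>small\<close> is fixed:
      \<open>205 * 3 * 80 = 49200\<close>.\<close>
    have "rate s * (2 + real k) * real N \<le> (205 * real k ^ 3 * u) * (3 * real k) * (80 * real k ^ 2)"
      using win(4) Nr k1 q0 u0 by (intro mult_mono) auto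
    also have "\<dots> = 49200 * real k ^ 6 * u" by (simp add: eval_nat_numeral)
    also have "\<dots> \<le> 49200 * real k ^ 16 * w" using kp[of 6 16] uw u0 by (intro mult_mono) auto
    finally show ?thesis using small by (simp add: w_def)
  qed
  have thr: "exp 4 * (real H * (5 / 8) ^ r + 48 * real N * real D / (real m - real s)) * real k / real H
     \<le> exp 4 * real k * ((5 / 8) ^ (10 * k) + 192 * \<delta>)"
  proof -
    have "exp 4 * (real H * (5 / 8) ^ r + 48 * real N * real D / (real m - real s)) * real k / real H
       = exp 4 * real k * ((5 / 8) ^ r + 96 * (real D / (real m - real s)))"
      using H0 by (simp add: N_def field_simps)
    also have "\<dots> \<le> exp 4 * real k * ((5 / 8) ^ r + 96 * (real D / (real m / 2)))"
      using win(2) m_pos k1 by (intro mult_left_mono add_left_mono divide_left_mono) auto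
    finally show ?thesis by (simp add: r_def)
  qed
  have "avg (\<lambda>\<sigma>. if \<exists>p. stationary n dout (graph_of_matching n dout \<sigma>) p
        \<and> max_mass n p > exp 4 * real k * ((5 / 8) ^ (10 * k) + 192 * \<delta>) then 1 else 0)
     \<le> avg (\<lambda>\<sigma>. if \<exists>p. stationary n dout (graph_of_matching n dout \<sigma>) p
        \<and> max_mass n p > exp 4 * (real H * (5 / 8) ^ r + 48 * real N * real D / (real m - real s)) * real k / real H then 1 else 0)"
    by (rule avg_mono) (use thr in \<open>auto intro: le_less_trans\<close>)
  also have "\<dots> \<le> 4 * real n * (real K)\<^sup>2 * ((real N + 1) * rate s)\<^sup>2
      + 256 * (real s)\<^sup>2 * real n * (real K)\<^sup>2 * (1 / 2 ^ h + (2 * real h + 1) * rate s)\<^sup>2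
      + (real n)\<^sup>2 * exp (- 4 * real k)"
    using max_mass_tail[of r k h s K \<sigma>0, folded H_def, folded N_def, OF _ _ kN c win(3) sm K \<sigma>0] k
    by (simp only: cexp_empty r_def)
  also have "4 * real n * (real K)\<^sup>2 * ((real N + 1) * rate s)\<^sup>2 \<le> 4 * (real K)\<^sup>2 * (16605\<^sup>2 * (real k ^ 16 * w))"
  proof -
    have "(real N + 1) * rate s \<le> (81 * real k ^ 2) * (205 * real k ^ 3 * u)"
      using Nr kp[of 0 2] win(4) q0 u0 by (intro mult_mono) auto
    also have "\<dots> = 16605 * real k ^ 5 * u" by (simp add: eval_nat_numeral)
    finally have "((real N + 1) * rate s)\<^sup>2 \<le> (16605 * real k ^ 5 * u)\<^sup>2" using q0 by (intro power_mono) auto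
    hence "real n * ((real N + 1) * rate s)\<^sup>2 \<le> real n * (16605 * real k ^ 5 * u)\<^sup>2" by (intro mult_left_mono) auto
    also have "\<dots> = 16605\<^sup>2 * (real k ^ 10 * (real n * u\<^sup>2))" by (simp add: power_mult_distrib power_mult[symmetric])
    also have "\<dots> \<le> 16605\<^sup>2 * (real k ^ 16 * w)" unfolding nuu using w0 kp[of 10 16] by (intro mult_left_mono mult_right_mono) auto
    finally have "4 * (real K)\<^sup>2 * (real n * ((real N + 1) * rate s)\<^sup>2) \<le> 4 * (real K)\<^sup>2 * (16605\<^sup>2 * (real k ^ 16 * w))"
      by (intro mult_left_mono) auto
    thus ?thesis by (simp add: mult_ac)
  qed
  also have "256 * (real s)\<^sup>2 * real n * (real K)\<^sup>2 * (1 / 2 ^ h + (2 * real h + 1) * rate s)\<^sup>2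
     \<le> 256 * 40000 * (real K)\<^sup>2 * (2 * (1 + 1025\<^sup>2) * (real k ^ 16 * w))"
  proof -
    have "(2 * real h + 1) * rate s \<le> (5 * real k) * (205 * real k ^ 3 * u)"
      using k1 win(4) q0 u0 by (intro mult_mono) (auto simp: h_def)
    also have "\<dots> = 1025 * real k ^ 4 * u" by (simp add: eval_nat_numeral)
    finally have 1: "((2 * real h + 1) * rate s)\<^sup>2 \<le> (1025 * real k ^ 4 * u)\<^sup>2" using q0 by (intro power_mono) auto
    have "real n * (1025 * real k ^ 4 * u)\<^sup>2 = 1025\<^sup>2 * (real k ^ 8 * (real n * u\<^sup>2))"
      by (simp add: power_mult_distrib power_mult[symmetric])
    hence 2: "real n * (1025 * real k ^ 4 * u)\<^sup>2 = 1025\<^sup>2 * (real k ^ 8 * w)" unfolding nuu .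
    have "((1::real) / 2 ^ h)\<^sup>2 = 1 / 2 ^ (4 * k)" by (simp add: h_def power_mult[symmetric] power_divide mult.commute)
    hence "real n * (1 / 2 ^ h)\<^sup>2 \<le> real n * (1 / (real n)\<^sup>2)" using two_powers_le[OF ln] by (intro mult_left_mono) auto
    also have "\<dots> = 1 / real n" using n_real by (simp add: power2_eq_square)
    finally have 3: "real n * (1 / 2 ^ h)\<^sup>2 \<le> w" using uw(2) by (rule order_trans)
    have "real n * (1 / 2 ^ h + (2 * real h + 1) * rate s)\<^sup>2 \<le> real n * (2 * (1 / 2 ^ h)\<^sup>2 + 2 * ((2 * real h + 1) * rate s)\<^sup>2)"
    proof (rule mult_left_mono)
      have "(a + b)\<^sup>2 \<le> 2 * a\<^sup>2 + 2 * b\<^sup>2" for a b :: real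
        using sum_squares_bound[of a b] by (simp add: power2_sum)
      thus "(1 / 2 ^ h + (2 * real h + 1) * rate s)\<^sup>2 \<le> 2 * (1 / 2 ^ h)\<^sup>2 + 2 * ((2 * real h + 1) * rate s)\<^sup>2" .
    qed simp
    also have "\<dots> = 2 * (real n * (1 / 2 ^ h)\<^sup>2) + 2 * (real n * ((2 * real h + 1) * rate s)\<^sup>2)" by (simp only: algebra_simps)
    also have "\<dots> \<le> 2 * w + 2 * (real n * (1025 * real k ^ 4 * u)\<^sup>2)"
      using 1 3 by (intro add_mono mult_left_mono) auto
    also have "\<dots> \<le> 2 * (real k ^ 8 * w) + 2 * (1025\<^sup>2 * (real k ^ 8 * w))"
      unfolding 2 using kp[of 0 8] w0 by (intro add_mono order_refl mult_left_mono) auto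
    finally have 4: "real n * (1 / 2 ^ h + (2 * real h + 1) * rate s)\<^sup>2 \<le> 2 * (1 + 1025\<^sup>2) * (real k ^ 8 * w)"
      by (simp add: algebra_simps)
    have s2: "(real s)\<^sup>2 = 40000 * real k ^ 6" by (simp add: s_def power_mult_distrib power_mult[symmetric])
    have "256 * (real s)\<^sup>2 * (real K)\<^sup>2 * (real n * (1 / 2 ^ h + (2 * real h + 1) * rate s)\<^sup>2)
       \<le> 256 * (real s)\<^sup>2 * (real K)\<^sup>2 * (2 * (1 + 1025\<^sup>2) * (real k ^ 8 * w))"
      using 4 by (intro mult_left_mono) auto
    \<comment> \<open>\<open>k^6\<close> from \<open>s^2\<close> and \<open>k^8\<close> from the
      squared rate: \<open>k^14\<close> is the largest power among the error terms, all of which are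
      rounded up to \<open>k^16\<close>.\<close>
    also have "\<dots> = 256 * 40000 * (real K)\<^sup>2 * (2 * (1 + 1025\<^sup>2) * (real k ^ 14 * w))"
      unfolding s2 by (simp add: power_add[of "real k" 6 8, simplified])
    also have "\<dots> \<le> 256 * 40000 * (real K)\<^sup>2 * (2 * (1 + 1025\<^sup>2) * (real k ^ 16 * w))"
      using w0 kp[of 14 16] by (intro mult_left_mono mult_right_mono) auto
    finally show ?thesis by (simp add: mult_ac)
  qed
  also have "(real n)\<^sup>2 * exp (- 4 * real k) \<le> real k ^ 16 * w"
  proof -
    have "exp (- 4 * real k) = exp (- real k) ^ 4" by (simp add: exp_of_nat_mult[symmetric])
    also have "\<dots> \<le> (1 / real n) ^ 4" using exp_neg_ln[OF ln] by (intro power_mono) auto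
    finally have "(real n)\<^sup>2 * exp (- 4 * real k) \<le> (real n)\<^sup>2 * (1 / real n) ^ 4" by (intro mult_left_mono) auto
    also have "\<dots> = 1 / real n * (1 / real n)" using n_real by (simp add: eval_nat_numeral)
    also have "\<dots> \<le> 1 * (1 / real n)" using n_real by (intro mult_right_mono) auto
    also have "\<dots> \<le> 1 * w" using uw by simp
    also have "\<dots> \<le> real k ^ 16 * w" using kp[of 0 16] w0 by (intro mult_right_mono) auto
    finally show ?thesis .
  qed
  also have "4 * (real K)\<^sup>2 * (16605\<^sup>2 * (real k ^ 16 * w)) + 256 * 40000 * (real K)\<^sup>2 * (2 * (1 + 1025\<^sup>2) * (real k ^ 16 * w)) + real k ^ 16 * w
     \<le> (10 ^ 14 * (real K)\<^sup>2 + 1) * (real k ^ 16 * density)"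
  proof -
    have "0 \<le> (real K)\<^sup>2 * (real k ^ 16 * w)" using w0 by simp
    thus ?thesis unfolding w_def[symmetric] by (simp add: algebra_simps)
  qed
  finally show ?thesis by simp
qed

text \<open>The term with \<open>1 / D\<close> is the relative variance of a sample of
  \<open>D\<close> heads, and the one place where large in-degrees are called for; the rest is
  governed by \<open>density\<close>.\<close>

lemma lower_tail_density:
  assumes k: "1 \<le> k" and ln: "ln (real n) \<le> real k" and small: "49200 * real k ^ 16 * density \<le> 1"
    and K: "real m \<le> K * real n" and C0: "(\<Sum>v\<in>V. (real (din v))\<^sup>2) \<le> C0 * real n"
    and v: "v \<in> V" "din v = D" and \<eta>: "0 < \<eta>" and C1: "0 \<le> C1"
  defines "e0 \<equiv> 8200 * C0 + 1891125"
  defines "g0 \<equiv> 12 * e0 + 2689600 + 4 * C0\<^sup>2 + 2 * C0 * e0 + 5126"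
  shows "avg (\<lambda>\<sigma>. if \<exists>p. stationary n dout (graph_of_matching n dout \<sigma>) p \<and> max_mass n p \<le> C1 * ln (real n) * \<delta>
        \<and> pmf p v < (1 - 4 * \<eta>) * \<delta> then 1 else 0)
     \<le> 2 * C0 * K / \<eta>\<^sup>2 / real D
       + (((e0 + g0) * K + 2 * C1 * g0) / \<eta>\<^sup>2 + 10260 * C1 / \<eta>) * (real k ^ 16 * density)"
proof -
  define s where "s = 200 * k ^ 3"
  \<comment> \<open>Chosen so that the mixing term \<open>1 / 2 ^ N\<close> in \<open>gap\<close> is
    at most \<open>n^-2\<close>, and hence at most \<open>u^2\<close>.\<close>
  define N where "N = 4 * k"
  define u where "u = real D / real n"
  define w where "w = density"
  note win = window[OF k small, folded s_def u_def]
  interpret weighted_dcm n din dout "\<lambda>x. 1 / real (dout x)" s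
  proof unfold_locales
    show "1 / real (dout x) \<le> 1" if "x \<in> V" for x using inverse_dout[OF that] by simp
  qed (use win in auto)
  let ?E = "(real N + 1) * err N"
  have k1: "1 \<le> real k" using k by simp
  have kp: "real k ^ i \<le> real k ^ j" if "i \<le> j" for i j using that k1 by (rule power_increasing)
  have k0: "0 \<le> real k ^ i" for i by simp
  have u0: "0 \<le> u" by (simp add: u_def)
  have uw: "u \<le> w" unfolding u_def w_def by (rule density_ge)
  have w0: "0 < w" using density_pos by (simp add: w_def)
  have w1: "w \<le> 1"
  proof -
    have "1 * w \<le> (49200 * real k ^ 16) * w" using kp[of 0 16] w0 by (intro mult_right_mono) auto
    thus ?thesis using small by (simp add: w_def)
  qed
  have u1: "u \<le> 1" using uw w1 by simp
  have nuu: "real n * u\<^sup>2 = w" using n_real by (simp add: u_def w_def density_def power2_eq_square)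
  have inu: "1 / real n \<le> u" using D_real n_real by (simp add: u_def divide_right_mono)
  have inn: "1 / (real n)\<^sup>2 \<le> u\<^sup>2"
    using power_mono[OF inu, of 2] n_real by (simp add: power_divide)
  have C00: "0 \<le> C0"
  proof -
    have "0 \<le> (\<Sum>v\<in>V. (real (din v))\<^sup>2)" by (intro sum_nonneg) auto
    hence "0 \<le> C0 * real n" using C0 by (rule order_trans)
    thus ?thesis using n_real by (simp add: zero_le_mult_iff)
  qed
  have K0: "0 \<le> K"
  proof -
    have "0 \<le> K * real n" using K by (rule order_trans[rotated]) simp
    thus ?thesis using n_real by (simp add: zero_le_mult_iff)
  qed
  have e00: "0 \<le> e0" using C00 by (simp add: e0_def)
  have g00: "0 \<le> g0" using C00 e00 by (simp add: g0_def)
  have \<kappa>: "\<kappa> \<le> C0 * (1 / real n)"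
  proof -
    have "\<kappa> \<le> C0 * real n / (real n)\<^sup>2"
      unfolding pair_rate_def using C0 C00 win(1) n_real by (intro frac_le power_mono mult_nonneg_nonneg) auto
    thus ?thesis using n_real by (simp add: power2_eq_square)
  qed
  have \<kappa>0: "0 \<le> \<kappa>" by (rule pair_rate_nonneg)
  have \<kappa>u: "\<kappa> \<le> C0 * u" using \<kappa> mult_left_mono[OF inu C00] by (rule order_trans)
  have \<kappa>C: "\<kappa> \<le> C0" using \<kappa>u mult_left_mono[OF u1 C00] by simp
  have qq: "q\<^sup>2 \<le> 42025 * real k ^ 6 * u\<^sup>2"
  proof -
    have "q\<^sup>2 \<le> (205 * real k ^ 3 * u)\<^sup>2" using win(4) q_nonneg by (intro power_mono)
    thus ?thesis by (simp add: power_mult_distrib power_mult[symmetric])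
  qed
  have err: "err N \<le> (1640 * C0 + 378225) * (real k ^ 7 * u\<^sup>2)"
  proof -
    have "\<kappa> * (2 * real N * q) \<le> (C0 * u) * (2 * real N * (205 * real k ^ 3 * u))"
      using \<kappa>u win(4) \<kappa>0 q_nonneg C00 u0 by (intro mult_mono mult_left_mono) auto
    also have "\<dots> = 1640 * C0 * (real k ^ 4 * u\<^sup>2)" by (simp add: N_def eval_nat_numeral)
    also have "\<dots> \<le> 1640 * C0 * (real k ^ 7 * u\<^sup>2)" using C00 kp[of 4 7] by (intro mult_left_mono mult_right_mono) auto
    finally have a: "\<kappa> * (2 * real N * q) \<le> 1640 * C0 * (real k ^ 7 * u\<^sup>2)" .
    have "2 * q * (real N * q) = 8 * real k * q\<^sup>2" by (simp add: N_def power2_eq_square)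
    also have "\<dots> \<le> 8 * real k * (42025 * real k ^ 6 * u\<^sup>2)" using qq by (intro mult_left_mono) auto
    also have "\<dots> = 336200 * (real k ^ 7 * u\<^sup>2)" by (simp add: eval_nat_numeral)
    finally have b: "2 * q * (real N * q) \<le> 336200 * (real k ^ 7 * u\<^sup>2)" .
    have "q\<^sup>2 \<le> 42025 * (real k ^ 7 * u\<^sup>2)"
      unfolding mult.assoc[symmetric]
      by (rule order_trans[OF qq]) (use kp[of 6 7] in \<open>intro mult_right_mono mult_left_mono, auto\<close>)
    thus ?thesis using a b by (simp add: err_def algebra_simps)
  qed
  have E: "?E \<le> e0 * (real k ^ 8 * u\<^sup>2)"
  proof -
    have "?E \<le> (5 * real k) * ((1640 * C0 + 378225) * (real k ^ 7 * u\<^sup>2))"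
      using err err_nonneg k1 by (intro mult_mono) (auto simp: N_def)
    also have "\<dots> = e0 * (real k ^ 8 * u\<^sup>2)" by (simp add: e0_def eval_nat_numeral algebra_simps)
    finally show ?thesis .
  qed
  have E0: "0 \<le> ?E" using err_nonneg by simp
  have gap: "gap N \<le> g0 * (real k ^ 8 * u\<^sup>2)"
  proof -
    let ?y = "real k ^ 8 * u\<^sup>2"
    have y0: "0 \<le> ?y" by simp
    have uy: "u\<^sup>2 \<le> ?y" using kp[of 0 8] mult_right_mono[of 1 "real k ^ 8" "u\<^sup>2"] by simp
    have a: "12 * ?E \<le> 12 * (e0 * ?y)" using E by simp
    have "16 * real N * q\<^sup>2 \<le> 64 * real k * (42025 * real k ^ 6 * u\<^sup>2)"
      using qq by (rule mult_mono[rotated]) (auto simp: N_def)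
    also have "\<dots> = 2689600 * (real k ^ 7 * u\<^sup>2)" by (simp add: eval_nat_numeral)
    also have "\<dots> \<le> 2689600 * ?y" using kp[of 7 8] by (intro mult_left_mono mult_right_mono) auto
    finally have b: "16 * real N * q\<^sup>2 \<le> 2689600 * ?y" .
    have "2 * \<kappa> * (2 * \<kappa>) \<le> 2 * (C0 * u) * (2 * (C0 * u))"
      using \<kappa>u \<kappa>0 C00 u0 by (intro mult_mono) auto
    also have "\<dots> = 4 * C0\<^sup>2 * u\<^sup>2" by (simp add: power2_eq_square)
    also have "\<dots> \<le> 4 * C0\<^sup>2 * ?y" using uy by (intro mult_left_mono) auto
    finally have c1: "2 * \<kappa> * (2 * \<kappa>) \<le> 4 * C0\<^sup>2 * ?y" .
    have c2: "2 * \<kappa> * ?E \<le> 2 * C0 * (e0 * ?y)"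
      by (rule mult_mono[OF _ E _ E0]) (use \<kappa>C C00 in auto)
    have "(real N + 1)\<^sup>2 * q \<le> (5 * real k)\<^sup>2 * (205 * real k ^ 3 * u)"
      using win(4) q_nonneg k1 by (intro mult_mono power_mono) (auto simp: N_def)
    also have "\<dots> = 5125 * real k ^ 5 * u" by (simp add: eval_nat_numeral)
    also have "\<dots> \<le> 5125 * real k ^ 5 * 1" using u1 by (intro mult_left_mono) auto
    finally have "1 + (real N + 1)\<^sup>2 * q \<le> 5126 * real k ^ 5" using kp[of 0 5] by simp
    hence "(1 + (real N + 1)\<^sup>2 * q) / 2 ^ N \<le> 5126 * real k ^ 5 * (1 / 2 ^ N)"
      using divide_right_mono[of "1 + (real N + 1)\<^sup>2 * q" "5126 * real k ^ 5" "2 ^ N"] by simp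
    also have "\<dots> \<le> 5126 * real k ^ 8 * u\<^sup>2"
      using two_powers_le[OF ln] inn kp[of 5 8] unfolding N_def by (intro mult_mono) auto
    finally have d: "(1 + (real N + 1)\<^sup>2 * q) / 2 ^ N \<le> 5126 * ?y" by simp
    have "gap N = 12 * ?E + 16 * real N * q\<^sup>2 + (2 * \<kappa> * (2 * \<kappa>) + 2 * \<kappa> * ?E) + (1 + (real N + 1)\<^sup>2 * q) / 2 ^ N"
      by (simp only: gap_def distrib_left)
    also have "\<dots> \<le> 12 * (e0 * ?y) + 2689600 * ?y + (4 * C0\<^sup>2 * ?y + 2 * C0 * (e0 * ?y)) + 5126 * ?y"
      by (intro add_mono a b c1 c2 d)
    also have "\<dots> = g0 * ?y" by (simp add: g0_def algebra_simps)
    finally show ?thesis .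
  qed
  have gap0: "0 \<le> gap N"
    unfolding gap_def using err_nonneg \<kappa>0 q_nonneg by (intro add_nonneg_nonneg mult_nonneg_nonneg divide_nonneg_nonneg) auto
  have D0: "0 < real D" using D_real by simp
  have m0: "0 < real m" using m_pos by simp
  have \<delta>0: "0 < \<delta>" using D0 m0 by simp
  have \<delta>u: "\<delta> \<le> u" unfolding u_def using win(1) n_real D0 by (intro divide_left_mono) (auto simp: mult_pos_pos)
  have inv\<delta>: "1 / \<delta> \<le> K * real n / real D" using K D0 m0 by (simp add: divide_right_mono)
  define X where "X = C1 * ln (real n) * \<delta>"
  have ln0: "0 \<le> ln (real n)" using n_real by simp
  have X0: "0 \<le> X" using C1 ln0 \<delta>0 by (simp add: X_def)
  have Xu: "X \<le> C1 * real k * u" unfolding X_def using C1 ln ln0 \<delta>u \<delta>0 by (intro mult_mono mult_left_mono) auto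
  \<comment> \<open>\<open>\<kappa>\<close> is of order \<open>1 / n\<close> and
    \<open>\<delta>\<close> of order \<open>D / n\<close>, so the quotient leaves
    \<open>1 / D\<close>; the terms in \<open>err\<close> and \<open>gap\<close> carry
    \<open>u^2\<close> and keep one factor \<open>u\<close> after the division.\<close>
  have T1: "(2 * \<kappa> + ?E + gap N) / \<delta> \<le> 2 * C0 * K / real D + (e0 + g0) * K * (real k ^ 16 * w)"
  proof -
    have "(2 * \<kappa> + ?E + gap N) / \<delta> = (2 * \<kappa> + ?E + gap N) * (1 / \<delta>)" by simp
    also have "\<dots> \<le> (2 * (C0 * (1 / real n)) + e0 * (real k ^ 8 * u\<^sup>2) + g0 * (real k ^ 8 * u\<^sup>2)) * (K * real n / real D)"
      using C00 e00 g00 \<delta>0 n_real by (intro mult_mono inv\<delta> add_mono mult_left_mono \<kappa> E gap) auto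
    also have "\<dots> = 2 * C0 * K / real D + (e0 + g0) * K * (real k ^ 8 * u)"
      using D0 n_real by (simp add: u_def field_simps power2_eq_square)
    also have "\<dots> \<le> 2 * C0 * K / real D + (e0 + g0) * K * (real k ^ 16 * w)"
      using e00 g00 K0 kp[of 8 16] uw u0 by (intro add_left_mono mult_left_mono mult_mono) auto
    finally show ?thesis .
  qed
  have T2: "2 * real n * X * gap N / \<delta> \<le> 2 * C1 * g0 * (real k ^ 16 * w)"
  proof -
    have "2 * real n * X * gap N / \<delta> = 2 * C1 * (ln (real n) * (real n * gap N))"
    proof -
      have "2 * a * (C1 * l * d) * b / d = 2 * C1 * (l * (a * b))" if "0 < d" for a l d b :: real
        using that by simp
      thus ?thesis unfolding X_def using \<delta>0 by blast
    qed
    also have "\<dots> \<le> 2 * C1 * (real k * (real n * (g0 * (real k ^ 8 * u\<^sup>2))))"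
      using C1 ln ln0 gap gap0 g00
      by (intro mult_left_mono mult_mono[of "ln (real n)" "real k" "real n * gap N"])
        (auto intro!: mult_left_mono mult_nonneg_nonneg)
    also have "\<dots> = 2 * C1 * g0 * (real k ^ 9 * (real n * u\<^sup>2))" by (simp add: eval_nat_numeral)
    also have "\<dots> \<le> 2 * C1 * g0 * (real k ^ 16 * w)"
      unfolding nuu using C1 g00 w0 kp[of 9 16] by (intro mult_left_mono mult_right_mono) auto
    finally show ?thesis .
  qed
  have T3: "X * ((real N + 1) * (real n * (2 * (real N + 1) * q + \<delta>) + 1)) \<le> 10260 * C1 * (real k ^ 16 * w)"
  proof -
    have "2 * (real N + 1) * q \<le> 2 * (5 * real k) * (205 * real k ^ 3 * u)"
      using win(4) q_nonneg k1 by (intro mult_mono) (auto simp: N_def)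
    also have "\<dots> = 2050 * real k ^ 4 * u" by (simp add: eval_nat_numeral)
    finally have a: "2 * (real N + 1) * q + \<delta> \<le> 2050 * real k ^ 4 * u + real k ^ 4 * u"
      using \<delta>u mult_right_mono[OF kp[of 0 4], of u] u0 by (intro add_mono) auto
    have "real n * (2 * (real N + 1) * q + \<delta>) \<le> real n * (2051 * real k ^ 4 * u)"
      using a by (intro mult_left_mono) (auto simp: algebra_simps)
    also have "\<dots> = 2051 * real k ^ 4 * real D" using n_real by (simp add: u_def)
    finally have "real n * (2 * (real N + 1) * q + \<delta>) \<le> 2051 * real k ^ 4 * real D" .
    moreover have "1 \<le> real k ^ 4 * real D" using kp[of 0 4] D_real mult_mono[of 1 "real k ^ 4" 1 "real D"] by simp
    ultimately have b: "real n * (2 * (real N + 1) * q + \<delta>) + 1 \<le> 2052 * real k ^ 4 * real D" by simp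
    have "0 \<le> real n * (2 * (real N + 1) * q + \<delta>) + 1"
      using q_nonneg \<delta>0 by (intro add_nonneg_nonneg mult_nonneg_nonneg) auto
    hence "X * ((real N + 1) * (real n * (2 * (real N + 1) * q + \<delta>) + 1))
      \<le> (C1 * real k * u) * ((5 * real k) * (2052 * real k ^ 4 * real D))"
      using Xu X0 b k1 by (intro mult_mono) (auto simp: N_def)
    also have "\<dots> = 10260 * C1 * (real k ^ 6 * w)"
      by (simp add: u_def w_def density_def eval_nat_numeral)
    also have "\<dots> \<le> 10260 * C1 * (real k ^ 16 * w)"
      using C1 w0 kp[of 6 16] by (intro mult_left_mono mult_right_mono) auto
    finally show ?thesis .
  qed
  have c: "2 + 2 * N \<le> s"
    using k power_increasing[of 1 3 k] one_le_power[of k 3] by (simp add: N_def s_def)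
  have "avg (\<lambda>\<sigma>. if \<exists>p. stationary n dout (graph_of_matching n dout \<sigma>) p \<and> max_mass n p \<le> X
        \<and> pmf p v < (1 - 4 * \<eta>) * \<delta> then 1 else 0) \<le>
     (2 * \<kappa> + ?E + gap N + 2 * real n * X * gap N) / (\<eta>\<^sup>2 * \<delta>)
     + X / \<eta> * ((real N + 1) * (real n * (2 * (real N + 1) * q + \<delta>) + 1))"
    by (rule lower_tail[OF refl c v X0 \<eta>])
  also have "\<dots> = ((2 * \<kappa> + ?E + gap N) / \<delta> + 2 * real n * X * gap N / \<delta>) / \<eta>\<^sup>2
     + X * ((real N + 1) * (real n * (2 * (real N + 1) * q + \<delta>) + 1)) / \<eta>"
    by (simp only: add_divide_distrib[symmetric] divide_divide_eq_left mult.commute[of _ "\<eta>\<^sup>2"] times_divide_eq_left mult.commute[of \<delta>])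
  also have "\<dots> \<le> ((2 * C0 * K / real D + (e0 + g0) * K * (real k ^ 16 * w)) + 2 * C1 * g0 * (real k ^ 16 * w)) / \<eta>\<^sup>2
     + 10260 * C1 * (real k ^ 16 * w) / \<eta>"
    using \<eta> by (intro add_mono divide_right_mono T1 T2 T3) auto
  also have "\<dots> = 2 * C0 * K / \<eta>\<^sup>2 / real D
       + (((e0 + g0) * K + 2 * C1 * g0) / \<eta>\<^sup>2 + 10260 * C1 / \<eta>) * (real k ^ 16 * density)"
    by (simp add: w_def add_divide_distrib distrib_right)
  finally show ?thesis by (simp add: X_def)
qed

lemma upper_tail:
  assumes k: "1 \<le> k" and ln: "ln (real n) \<le> real k" "real k \<le> 2 * ln (real n)"
    and small: "49200 * real k ^ 16 * density \<le> 1"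
    and K: "\<And>y. y \<in> V \<Longrightarrow> dout y \<le> K" and nK: "real K \<le> real n ^ 3"
  shows "avg (\<lambda>\<sigma>. if \<exists>p. stationary n dout (graph_of_matching n dout \<sigma>) p
        \<and> max_mass n p > 386 * exp 4 * ln (real n) * \<delta> then 1 else 0)
    \<le> (10 ^ 14 * (real K)\<^sup>2 + 1) * (real k ^ 16 * density)"
proof -
  \<comment> \<open>The exponent 10 works because \<open>(5/8)^10 * 3^4 \<le> 1\<close> and
    \<open>e \<le> 3\<close>; this gives \<open>n^-4\<close>, and
    \<open>m \<le> n K \<le> n^4\<close> compares it with \<open>1 / m\<close>.\<close>
  have "(5 / 8) ^ (10 * k) \<le> \<delta>"
  proof -
    have "exp 4 = exp (1::real) ^ 4" by (simp add: exp_of_nat_mult[symmetric])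
    also have "\<dots> \<le> 3 ^ 4" by (intro power_mono exp_le) auto
    finally have "(5 / 8) ^ 10 * exp 4 \<le> (5 / 8) ^ 10 * (3 ^ 4 :: real)" by (intro mult_left_mono) auto
    also have "\<dots> \<le> 1" by (simp add: power_divide)
    finally have "(5 / 8) ^ 10 \<le> exp (- 4 :: real)" by (simp add: exp_minus field_simps)
    hence "((5 / 8) ^ 10) ^ k \<le> exp (- 4 :: real) ^ k" by (intro power_mono) auto
    also have "exp (- 4 :: real) ^ k = exp (- real k) ^ 4" by (simp add: exp_of_nat_mult[symmetric])
    also have "\<dots> \<le> (1 / real n) ^ 4" using exp_neg_ln[OF ln(1)] by (intro power_mono) auto
    also have "\<dots> = 1 / (real n ^ 3 * real n)" by (simp add: power_divide eval_nat_numeral mult_ac)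
    also have "\<dots> \<le> 1 / real m"
    proof (rule divide_left_mono)
      have "m \<le> (\<Sum>v\<in>V. K)" unfolding num_edges_def V_def[symmetric] by (rule sum_mono) (rule K)
      hence "m \<le> n * K" by (simp add: V_def)
      hence "real m \<le> real n * real K" using of_nat_mono[of m "n * K", where ?'a=real] by simp
      also have "\<dots> \<le> real n * real n ^ 3" using nK by (intro mult_left_mono) auto
      finally show "real m \<le> real n ^ 3 * real n" by (simp add: mult.commute)
    qed (use m_pos n_real in auto)
    also have "\<dots> \<le> \<delta>" using D_real by (intro divide_right_mono) auto
    finally show ?thesis by (simp only: power_mult)
  qed
  hence "exp 4 * real k * ((5 / 8) ^ (10 * k) + 192 * \<delta>) \<le> exp 4 * (2 * ln (real n)) * (\<delta> + 192 * \<delta>)"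
    using ln k by (intro mult_mono mult_left_mono add_mono) auto
  \<comment> \<open>\<open>386 = 2 * (1 + 192)\<close>, where the 2 comes from
    \<open>k \<le> 2 ln n\<close>.\<close>
  also have "\<dots> = 386 * exp 4 * ln (real n) * \<delta>"
  proof -
    have "a * (2 * l) * (d + 192 * d) = 386 * a * l * d" for a l d :: real by (simp add: algebra_simps)
    thus ?thesis by blast
  qed
  finally have thr: "exp 4 * real k * ((5 / 8) ^ (10 * k) + 192 * \<delta>) \<le> 386 * exp 4 * ln (real n) * \<delta>" .
  have "avg (\<lambda>\<sigma>. if \<exists>p. stationary n dout (graph_of_matching n dout \<sigma>) p
        \<and> max_mass n p > 386 * exp 4 * ln (real n) * \<delta> then 1 else 0)
     \<le> avg (\<lambda>\<sigma>. if \<exists>p. stationary n dout (graph_of_matching n dout \<sigma>) p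
        \<and> max_mass n p > exp 4 * real k * ((5 / 8) ^ (10 * k) + 192 * \<delta>) then 1 else 0)"
  proof (rule avg_mono)
    fix \<sigma>
    let ?P = "\<lambda>b. \<exists>p. stationary n dout (graph_of_matching n dout \<sigma>) p \<and> max_mass n p > b"
    have "?P (386 * exp 4 * ln (real n) * \<delta>) \<Longrightarrow> ?P (exp 4 * real k * ((5 / 8) ^ (10 * k) + 192 * \<delta>))"
      using le_less_trans[OF thr] by blast
    thus "(if ?P (386 * exp 4 * ln (real n) * \<delta>) then 1 else 0) \<le>
       (if ?P (exp 4 * real k * ((5 / 8) ^ (10 * k) + 192 * \<delta>)) then 1 else (0::real))"
      by (simp only: if_split) auto
  qed
  also have "\<dots> \<le> (10 ^ 14 * (real K)\<^sup>2 + 1) * (real k ^ 16 * density)"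
    by (rule max_mass_tail_density[OF k ln(1) small K])
  finally show ?thesis .
qed

lemma prob_dcm_ge:
  assumes "avg (\<lambda>\<sigma>. if P (graph_of_matching n dout \<sigma>) then 0 else 1) \<le> b"
  shows "1 - b \<le> measure_pmf.prob (dcm n din dout) {G. P G}"
proof -
  have "avg (\<lambda>\<sigma>. if P (graph_of_matching n dout \<sigma>) then 1 else 0)
     = avg (\<lambda>\<sigma>. 1 - (if P (graph_of_matching n dout \<sigma>) then 0 else 1))"
    by (rule avg_cong) auto
  also have "\<dots> = 1 - avg (\<lambda>\<sigma>. if P (graph_of_matching n dout \<sigma>) then 0 else 1)"
    by (simp only: avg_diff avg_const)
  finally show ?thesis using assms by (simp add: prob_dcm)
qed

end

section \<open>Choice of the logarithmic scale and passage to the limit\<close>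

definition log_scale :: "nat \<Rightarrow> nat" where
  "log_scale n = nat \<lceil>ln (real n)\<rceil> + 1"

lemma log_scale_bounds:
  assumes "1 \<le> n"
  shows "1 \<le> log_scale n" "ln (real n) \<le> real (log_scale n)" "real (log_scale n) \<le> ln (real n) + 2"
proof -
  have "0 \<le> ln (real n)" using assms by simp
  hence "real (log_scale n) = of_int \<lceil>ln (real n)\<rceil> + 1" by (simp add: log_scale_def)
  thus "ln (real n) \<le> real (log_scale n)" "real (log_scale n) \<le> ln (real n) + 2" by linarith+
qed (simp add: log_scale_def)

context
  fixes \<eta> C\<^sub>0 K :: real and din dout :: "nat \<Rightarrow> nat \<Rightarrow> nat"
  assumes \<eta>: "0 < \<eta>" and C0: "0 < C\<^sub>0" and K: "2 \<le> K" and deg: "degree_assumption \<eta> C\<^sub>0 K din dout"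
begin

lemma deg_model: "1 \<le> n \<Longrightarrow> dcm_model n (din n) (dout n)"
  using deg by unfold_locales (auto simp: degree_assumption_def)

lemma deg_dout_le: "1 \<le> n \<Longrightarrow> v \<in> {1..n} \<Longrightarrow> dout n v \<le> nat \<lfloor>K\<rfloor>"
  using deg unfolding degree_assumption_def by (auto intro: le_nat_floor)

lemma deg_edges_le: "1 \<le> n \<Longrightarrow> real (num_edges n (dout n)) \<le> K * real n"
proof -
  assume n: "1 \<le> n"
  have "(\<Sum>v\<in>{1..n}. real (dout n v)) \<le> (\<Sum>v\<in>{1..n}. K)"
    using deg n unfolding degree_assumption_def by (intro sum_mono) auto
  thus ?thesis by (simp add: num_edges_def mult.commute)
qed

lemma square_le_powr: "(real d)\<^sup>2 \<le> real d powr (2 + \<eta>)"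
proof (cases "d = 0")
  case False
  hence "real d powr 2 \<le> real d powr (2 + \<eta>)" using \<eta> by (intro powr_mono) auto
  thus ?thesis using False by simp
qed simp

lemma deg_squares_le: "1 \<le> n \<Longrightarrow> (\<Sum>v\<in>{1..n}. (real (din n v))\<^sup>2) \<le> C\<^sub>0 * real n"
  using sum_mono[of "{1..n}" "\<lambda>v. (real (din n v))\<^sup>2" "\<lambda>v. real (din n v) powr (2 + \<eta>)"] square_le_powr deg
  by (force simp: degree_assumption_def)

text \<open>One term of the moment sum is at most the whole sum. The exponent
  \<open>2 / (2 + \<eta>) < 1\<close> is the source of all polynomial decay.\<close>

lemma deg_max_le:
  assumes n: "1 \<le> n"
  shows "(real (max_degree n (din n)))\<^sup>2 \<le> C\<^sub>0 powr (2 / (2 + \<eta>)) * real n powr (2 / (2 + \<eta>))"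
proof -
  interpret dcm_model n "din n" "dout n" by (rule deg_model[OF n])
  obtain v where v: "v \<in> V" "din n v = D" by (rule max_degree_attained)
  have "real D powr (2 + \<eta>) \<le> (\<Sum>v\<in>V. real (din n v) powr (2 + \<eta>))"
    using v member_le_sum[of v V "\<lambda>v. real (din n v) powr (2 + \<eta>)"] by simp
  also have "\<dots> \<le> C\<^sub>0 * real n" using deg n by (simp add: degree_assumption_def V_def)
  finally have "(real D powr (2 + \<eta>)) powr (2 / (2 + \<eta>)) \<le> (C\<^sub>0 * real n) powr (2 / (2 + \<eta>))"
    using \<eta> by (intro powr_mono2) auto
  moreover have "(real D powr (2 + \<eta>)) powr (2 / (2 + \<eta>)) = (real D)\<^sup>2"
  proof -
    have "2 + \<eta> \<noteq> 0" using \<eta> by simp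
    hence "(2 + \<eta>) * (2 / (2 + \<eta>)) = 2" unfolding times_divide_eq_right by (rule nonzero_mult_div_cancel_left)
    thus ?thesis using D_pos by (simp only: powr_powr) simp
  qed
  ultimately show ?thesis using C0 by (simp add: powr_mult)
qed

definition error :: "nat \<Rightarrow> real" where
  "error n = real (log_scale n) ^ 16 * ((real (max_degree n (din n)))\<^sup>2 / real n)"

lemma error_tendsto: "error \<longlonglongrightarrow> 0"
proof (rule tendsto_sandwich)
  define b where "b = 2 / (2 + \<eta>)"
  have b: "b < 1" using \<eta> by (simp add: b_def)
  show "\<forall>\<^sub>F n in sequentially. 0 \<le> error n" by (simp add: error_def)
  show "\<forall>\<^sub>F n in sequentially. error n \<le> C\<^sub>0 powr b * ((ln (real n) + 2) ^ 16 * (real n powr b / real n))"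
  proof (rule eventually_sequentiallyI)
    fix n :: nat assume n: "1 \<le> n"
    have "error n \<le> (ln (real n) + 2) ^ 16 * ((C\<^sub>0 powr b * real n powr b) / real n)"
      unfolding error_def using log_scale_bounds[OF n] deg_max_le[OF n] n
      by (intro mult_mono power_mono divide_right_mono) (auto simp: b_def)
    thus "error n \<le> C\<^sub>0 powr b * ((ln (real n) + 2) ^ 16 * (real n powr b / real n))" by (simp add: mult_ac)
  qed
  have "(\<lambda>n. (ln (real n) + 2) ^ 16 * (real n powr b / real n)) \<longlonglongrightarrow> 0" using b by real_asymp
  from tendsto_mult_left[OF this, of "C\<^sub>0 powr b"]
  show "(\<lambda>n. C\<^sub>0 powr b * ((ln (real n) + 2) ^ 16 * (real n powr b / real n))) \<longlonglongrightarrow> 0" by simp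
qed simp

lemma whp_of_error:
  assumes b: "b \<longlonglongrightarrow> 0"
    and ev: "\<forall>\<^sub>F n in sequentially. 1 - b n \<le> measure_pmf.prob (dcm n (din n) (dout n)) {G. E n G}"
  shows "whp din dout E"
  unfolding whp_def
proof (rule tendsto_sandwich[OF ev])
  show "\<forall>\<^sub>F n in sequentially. measure_pmf.prob (dcm n (din n) (dout n)) {G. E n G} \<le> 1" by simp
  show "(\<lambda>n. 1 - b n) \<longlonglongrightarrow> 1" using tendsto_diff[OF tendsto_const b, of 1] by simp
qed simp

lemma eventually_window:
  "\<forall>\<^sub>F n in sequentially. 1 \<le> n \<and> 2 \<le> ln (real n) \<and> K \<le> real n ^ 3 \<and> 49200 * error n \<le> 1"
proof (intro eventually_conj)
  show "\<forall>\<^sub>F n in sequentially. 1 \<le> (n::nat)" by (rule eventually_ge_at_top)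
  show "\<forall>\<^sub>F n in sequentially. 2 \<le> ln (real n)" by real_asymp
  show "\<forall>\<^sub>F n in sequentially. K \<le> real n ^ 3" by real_asymp
  have "\<forall>\<^sub>F n in sequentially. error n < 1 / 49200" by (rule order_tendstoD(2)[OF error_tendsto]) simp
  thus "\<forall>\<^sub>F n in sequentially. 49200 * error n \<le> 1" by (rule eventually_mono) simp
qed

lemma max_mass_upper_n:
  assumes n: "1 \<le> n" "2 \<le> ln (real n)" "K \<le> real n ^ 3" "49200 * error n \<le> 1"
  shows "dcm_model.avg n (din n) (dout n) (\<lambda>\<sigma>. if \<exists>p. stationary n (dout n) (graph_of_matching n (dout n) \<sigma>) p
        \<and> max_mass n p > 386 * exp 4 * ln (real n) * (real (max_degree n (din n)) / real (num_edges n (dout n))) then 1 else 0)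
    \<le> (10 ^ 14 * (real (nat \<lfloor>K\<rfloor>))\<^sup>2 + 1) * error n"
proof -
  interpret dcm_model n "din n" "dout n" by (rule deg_model[OF n(1)])
  have e: "error n = real (log_scale n) ^ 16 * density" by (simp add: error_def density_def)
  note l = log_scale_bounds[OF n(1)]
  show ?thesis unfolding e
  proof (rule upper_tail[OF l(1,2)])
    show "real (log_scale n) \<le> 2 * ln (real n)" using l(3) n(2) by simp
    show "49200 * real (log_scale n) ^ 16 * density \<le> 1" using n(4) by (simp add: e mult.assoc)
    show "dout n y \<le> nat \<lfloor>K\<rfloor>" if "y \<in> V" for y using deg_dout_le[OF n(1)] that by (simp add: V_def)
    have "real (nat \<lfloor>K\<rfloor>) \<le> K" using K by linarith
    thus "real (nat \<lfloor>K\<rfloor>) \<le> real n ^ 3" using n(3) by simp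
  qed
qed

text \<open>The constant is absolute: \<open>\<eta>\<close>, \<open>C\<^sub>0\<close> and
  \<open>K\<close> influence only the failure probability and the size of \<open>n\<close> from
  which the estimates apply.\<close>

theorem whp_max_mass_upper:
  assumes \<pi>: "stationary_choice din dout \<pi>"
  shows "whp din dout (\<lambda>n G. max_mass n (\<pi> n G)
     \<le> 386 * exp 4 * ln (real n) * (real (max_degree n (din n)) / real (num_edges n (dout n))))"
proof (rule whp_of_error)
  let ?b = "\<lambda>n. (10 ^ 14 * (real (nat \<lfloor>K\<rfloor>))\<^sup>2 + 1) * error n"
  show "?b \<longlonglongrightarrow> 0" using tendsto_mult_left[OF error_tendsto] by simp
  show "\<forall>\<^sub>F n in sequentially. 1 - ?b n \<le> measure_pmf.prob (dcm n (din n) (dout n)) {G. max_mass n (\<pi> n G)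
     \<le> 386 * exp 4 * ln (real n) * (real (max_degree n (din n)) / real (num_edges n (dout n)))}"
    using eventually_window
  proof (rule eventually_mono)
    fix n assume n: "1 \<le> n \<and> 2 \<le> ln (real n) \<and> K \<le> real n ^ 3 \<and> 49200 * error n \<le> 1"
    interpret dcm_model n "din n" "dout n" by (rule deg_model) (use n in simp)
    show "1 - ?b n \<le> measure_pmf.prob (dcm n (din n) (dout n)) {G. max_mass n (\<pi> n G)
       \<le> 386 * exp 4 * ln (real n) * (real (max_degree n (din n)) / real (num_edges n (dout n)))}"
    proof (rule prob_dcm_ge, rule order_trans[OF _ max_mass_upper_n], rule avg_mono)
      fix \<sigma> assume \<sigma>: "\<sigma> \<in> S"
      have "stationary n (dout n) (graph_of_matching n (dout n) \<sigma>) (\<pi> n (graph_of_matching n (dout n) \<sigma>))"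
        using \<pi> n graph_in_dcm[OF \<sigma>] by (auto simp: stationary_choice_def)
      thus "(if max_mass n (\<pi> n (graph_of_matching n (dout n) \<sigma>)) \<le> 386 * exp 4 * ln (real n) * \<delta> then 0 else 1) \<le>
        (if \<exists>p. stationary n (dout n) (graph_of_matching n (dout n) \<sigma>) p \<and> max_mass n p > 386 * exp 4 * ln (real n) * \<delta> then 1 else (0::real))"
        by (auto simp: not_le)
    qed (use n in auto)
  qed
qed

theorem whp_max_mass_lower:
  assumes \<pi>: "stationary_choice din dout \<pi>"
    and \<Delta>: "filterlim (\<lambda>n. max_degree n (din n)) at_top sequentially" and \<epsilon>: "0 < \<epsilon>"
  shows "whp din dout (\<lambda>n G. max_mass n (\<pi> n G)
     \<ge> (1 - \<epsilon>) * (real (max_degree n (din n)) / real (num_edges n (dout n))))"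
proof -
  \<comment> \<open>The division by 4 accounts for the factor \<open>1 - 4 * \<zeta>\<close> in the
    lower tail.\<close>
  define \<zeta> where "\<zeta> = \<epsilon> / 4"
  have \<zeta>: "0 < \<zeta>" using \<epsilon> by (simp add: \<zeta>_def)
  define C where "C = 386 * exp (4::real)"
  define e0 where "e0 = 8200 * C\<^sub>0 + 1891125"
  define g0 where "g0 = 12 * e0 + 2689600 + 4 * C\<^sub>0\<^sup>2 + 2 * C\<^sub>0 * e0 + 5126"
  define c where "c = 2 * C\<^sub>0 * K / \<zeta>\<^sup>2"
  define d where "d = ((e0 + g0) * K + 2 * C * g0) / \<zeta>\<^sup>2 + 10260 * C / \<zeta>"
  define b where "b n = (10 ^ 14 * (real (nat \<lfloor>K\<rfloor>))\<^sup>2 + 1) * error n + (c / real (max_degree n (din n)) + d * error n)" for n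
  show ?thesis
  proof (rule whp_of_error)
    have "filterlim (\<lambda>n. real (max_degree n (din n))) at_top sequentially"
      using filterlim_real_sequentially \<Delta> by (rule filterlim_compose)
    hence "(\<lambda>n. c / real (max_degree n (din n))) \<longlonglongrightarrow> 0"
      by (rule real_tendsto_divide_at_top[OF tendsto_const])
    hence "b \<longlonglongrightarrow> a * 0 + (0 + d * 0)" if "a = 10 ^ 14 * (real (nat \<lfloor>K\<rfloor>))\<^sup>2 + 1" for a
      unfolding b_def that by (intro tendsto_add tendsto_mult_left error_tendsto)
    thus "b \<longlonglongrightarrow> 0" by simp
    show "\<forall>\<^sub>F n in sequentially. 1 - b n \<le> measure_pmf.prob (dcm n (din n) (dout n)) {G. max_mass n (\<pi> n G)
       \<ge> (1 - \<epsilon>) * (real (max_degree n (din n)) / real (num_edges n (dout n)))}"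
      using eventually_window
    proof (rule eventually_mono)
      fix n assume n: "1 \<le> n \<and> 2 \<le> ln (real n) \<and> K \<le> real n ^ 3 \<and> 49200 * error n \<le> 1"
      hence n1: "1 \<le> n" by simp
      interpret dcm_model n "din n" "dout n" by (rule deg_model[OF n1])
      obtain v where v: "v \<in> V" "din n v = D" by (rule max_degree_attained)
      have e: "error n = real (log_scale n) ^ 16 * density" by (simp add: error_def density_def)
      let ?g = "graph_of_matching n (dout n)"
      let ?X = "C * ln (real n) * \<delta>"
      let ?up = "\<lambda>\<sigma>. if \<exists>p. stationary n (dout n) (?g \<sigma>) p \<and> max_mass n p > ?X then 1 else (0::real)"
      let ?lo = "\<lambda>\<sigma>. if \<exists>p. stationary n (dout n) (?g \<sigma>) p \<and> max_mass n p \<le> ?X \<and> pmf p v < (1 - 4 * \<zeta>) * \<delta> then 1 else (0::real)"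
      have up: "avg ?up \<le> (10 ^ 14 * (real (nat \<lfloor>K\<rfloor>))\<^sup>2 + 1) * error n"
        unfolding C_def by (rule max_mass_upper_n) (use n in auto)
      have lo: "avg ?lo \<le> c / real D + d * error n"
        unfolding c_def d_def e e0_def g0_def
      proof (rule lower_tail_density[OF log_scale_bounds(1,2)[OF n1] _ _ _ v \<zeta>])
        show "49200 * real (log_scale n) ^ 16 * density \<le> 1" using n by (simp add: e mult.assoc)
        show "real m \<le> K * real n" by (rule deg_edges_le[OF n1])
        show "(\<Sum>v\<in>V. (real (din n v))\<^sup>2) \<le> C\<^sub>0 * real n" using deg_squares_le[OF n1] by (simp add: V_def)
        show "0 \<le> C" by (simp add: C_def)
      qed
      show "1 - b n \<le> measure_pmf.prob (dcm n (din n) (dout n)) {G. max_mass n (\<pi> n G) \<ge> (1 - \<epsilon>) * \<delta>}"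
      proof (rule prob_dcm_ge)
        have "avg (\<lambda>\<sigma>. if max_mass n (\<pi> n (?g \<sigma>)) \<ge> (1 - \<epsilon>) * \<delta> then 0 else 1) \<le> avg (\<lambda>\<sigma>. ?up \<sigma> + ?lo \<sigma>)"
        proof (rule avg_mono)
          fix \<sigma> assume \<sigma>: "\<sigma> \<in> S"
          let ?p = "\<pi> n (?g \<sigma>)"
          have st: "stationary n (dout n) (?g \<sigma>) ?p"
            using \<pi> n graph_in_dcm[OF \<sigma>] by (auto simp: stationary_choice_def)
          show "(if max_mass n ?p \<ge> (1 - \<epsilon>) * \<delta> then 0 else 1) \<le> ?up \<sigma> + ?lo \<sigma>"
          proof (cases "max_mass n ?p \<ge> (1 - \<epsilon>) * \<delta>")
            case False
            hence lt: "pmf ?p v < (1 - 4 * \<zeta>) * \<delta>" using pmf_le_max_mass[OF v(1), of ?p] by (simp add: \<zeta>_def)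
            \<comment> \<open>Either the upper bound of the first part fails, which is unlikely, or
              it supplies the maximal mass \<open>?X\<close> required by the lower tail.\<close>
            show ?thesis
            proof (cases "max_mass n ?p \<le> ?X")
              case True
              hence "?lo \<sigma> = 1" using st lt by (intro if_P) blast
              thus ?thesis by simp
            next
              case False
              hence "?up \<sigma> = 1" using st by (intro if_P) (blast intro: not_le_imp_less)
              thus ?thesis by simp
            qed
          qed simp
        qed
        also have "\<dots> \<le> b n" unfolding avg_add b_def by (intro add_mono up lo)
        finally show "avg (\<lambda>\<sigma>. if max_mass n (\<pi> n (?g \<sigma>)) \<ge> (1 - \<epsilon>) * \<delta> then 0 else 1) \<le> b n" .
      qed
    qed
  qed
qed

end

theorem theorem1p4:
  shows "(\<exists>C::real. C > 0 \<and>
           (\<forall>din dout \<pi>.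
              (\<exists>\<eta> C\<^sub>0 K. \<eta> > 0 \<and> C\<^sub>0 > 0 \<and> K \<ge> 2 \<and> degree_assumption \<eta> C\<^sub>0 K din dout) \<longrightarrow>
              stationary_choice din dout \<pi> \<longrightarrow>
              whp din dout (\<lambda>n G. max_mass n (\<pi> n G)
                 \<le> C * ln (real n) * (real (max_degree n (din n)) / real (num_edges n (dout n))))))
       \<and> (\<forall>din dout \<pi>.
            (\<exists>\<eta> C\<^sub>0 K. \<eta> > 0 \<and> C\<^sub>0 > 0 \<and> K \<ge> 2 \<and> degree_assumption \<eta> C\<^sub>0 K din dout) \<longrightarrow>
            stationary_choice din dout \<pi> \<longrightarrow>
            filterlim (\<lambda>n. max_degree n (din n)) at_top sequentially \<longrightarrow>
            (\<forall>\<epsilon>::real. \<epsilon> > 0 \<longrightarrow>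
              whp din dout (\<lambda>n G. max_mass n (\<pi> n G)
                 \<ge> (1 - \<epsilon>) * (real (max_degree n (din n)) / real (num_edges n (dout n))))))"
proof (rule conjI)
  show "\<exists>C::real. C > 0 \<and>
           (\<forall>din dout \<pi>.
              (\<exists>\<eta> C\<^sub>0 K. \<eta> > 0 \<and> C\<^sub>0 > 0 \<and> K \<ge> 2 \<and> degree_assumption \<eta> C\<^sub>0 K din dout) \<longrightarrow>
              stationary_choice din dout \<pi> \<longrightarrow>
              whp din dout (\<lambda>n G. max_mass n (\<pi> n G)
                 \<le> C * ln (real n) * (real (max_degree n (din n)) / real (num_edges n (dout n)))))"
    by (intro exI[of _ "386 * exp 4"] conjI allI impI) (use whp_max_mass_upper in auto)
qed (use whp_max_mass_lower in blast)

end
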